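(* Assume that $0<\rho_1\le\rho_0\le\rho_2$ a.e. in $\Omega$, that $\mathbf{u}_0\in\mathbf{H}^1_0(\Omega)$ and that $\operatorname{div}\mathbf{u}_0=0$. Let $(\mathbf{u},\rho,p,\boldsymbol\Sigma)$ be a solution on $(0,T)\times\Omega$ of the continuous Bingham model (given in the context) with $$\begin{aligned}&\mathbf{u}\in L^\infty(0,T;\mathbf{L}^\infty(\Omega)),\quad \nabla\mathbf{u}\in L^\infty(0,T;\mathbf{L}^\infty(\Omega)),\quad \partial_t\mathbf{u}\in L^\infty(0,T;\mathbf{L}^3(\Omega)),\\ &\partial_{tt}\mathbf{u}\in L^2(0,T;\mathbf{L}^{6/5}(\Omega)),\quad \nabla\rho\in L^\infty(0,T;\mathbf{L}^\infty(\Omega)),\quad \partial_{tt}\rho\in L^2(0,T;L^2(\Omega)),\\ &\partial_tp\in L^2(0,T;H^1(\Omega)),\quad \partial_t\boldsymbol\Sigma\in L^2(0,T;\mathbf{L}^2(\Omega)).\end{aligned}$$ Let $(\rho^n,\mathbf{u}^n,\hat{\mathbf{u}}^n,q^n,p^n,\boldsymbol\Sigma^n)_{0\le n\le N}$ be produced by the bi-projection scheme (described in the context), with $\delta t=T/N<1/6$. Then there is a constant $C$ independent of the time step $\delta t$ such that, for all $n$ with $0\le n\le N-1$, $$\delta t\sum_{k=0}^n\|\rho(t_{k+1})-\rho^{k+1}\|^2\le C\,\delta t^2+C\,\delta t\sum_{k=0}^n\|\mathbf{u}(t_{k+1})-\mathbf{u}^{k+1}\|^2.$$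
   Context: Setting: $T>0$, $\Omega$ is a bounded domain of $\mathbb{R}^3$ with boundary $\Gamma$ and unit outward normal $\mathbf{n}$. Bold function spaces are vector- or tensor-valued. $\|\cdot\|$ is the $L^2(\Omega)$ norm. $\mathbf{D}\mathbf{u}=\frac12(\nabla\mathbf{u}+{}^T\nabla\mathbf{u})$. Tensor conventions: for $\boldsymbol\lambda\in\mathbb{R}^{3\times3}$, $|\boldsymbol\lambda|^2=\frac12\operatorname{tr}({}^T\boldsymbol\lambda\boldsymbol\lambda)$. $\Lambda=\{\boldsymbol\lambda\in\mathbb{R}^{3\times3}:|\boldsymbol\lambda|\le1,\ {}^T\boldsymbol\lambda=\boldsymbol\lambda,\ \operatorname{tr}\boldsymbol\lambda=0\}$ and $\mathbb{P}$ is the projection onto the closed convex set $\Lambda$, applied pointwise a.e. to tensor fields. $\boldsymbol\Lambda=\{\boldsymbol f\in L^2(\Omega)^{3\times3}: \boldsymbol f(x)\in\Lambda\text{ a.e.}\}$. Coefficients: the plastic viscosity $\mu$ and yield stress $\alpha$ are $\mathcal{C}^1$ functions of the density, $\mu$ positive and $\alpha$ non-negative; there are constants $\mu_1,\mu_2>0$, $\alpha_1,\alpha_2\ge0$ with $\mu_1\le\mu(s)\le\mu_2$ and $\alpha_1\le\alpha(s)\le\alpha_2$ for $s\in[\rho_1,\rho_2]$. Continuous model: in $(0,T)\times\Omega$, $$\partial_t\rho+\mathbf{u}\cdot\nabla\rho=0,\qquad \rho(\partial_t\mathbf{u}+\mathbf{u}\cdot\nabla\mathbf{u})+\nabla p-2\operatorname{div}(\mu(\rho)\mathbf{D}\mathbf{u})=\operatorname{div}(\alpha(\rho)\boldsymbol\Sigma),$$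 $$\boldsymbol\Sigma=\mathbb{P}(\boldsymbol\Sigma+\ell\,\mathbf{D}\mathbf{u})\ \text{ for any }\ell>0,\qquad \operatorname{div}\mathbf{u}=0,$$ with $\rho|_{t=0}=\rho_0$, $\mathbf{u}|_{t=0}=\mathbf{u}_0$, $\mathbf{u}|_\Gamma=0$. Under the stated regularity, $\rho_1\le\rho\le\rho_2$ a.e. in $(0,T)\times\Omega$. Notation: $\tilde B(\mathbf{u},\mathbf{v})=(\mathbf{u}\cdot\nabla)\mathbf{v}+\frac{\mathbf{v}}2\operatorname{div}\mathbf{u}$. Bi-projection scheme: $N>0$ integer, $\delta t=T/N$, $t_n=n\,\delta t$, numerical parameters $r>0$, $\theta>0$. Initialization: $\rho^0=\rho_0$, $\mathbf{u}^0=\hat{\mathbf{u}}^0=\mathbf{u}_0$, $q^0=0$, with $p^0$ and $\boldsymbol\Sigma^0$ arbitrary (in the relevant spaces). For $0\le n\le N-1$: (1) $\rho^{n+1}$ is the viscosity solution of $\frac{\rho^{n+1}-\rho^n}{\delta t}+\hat{\mathbf{u}}^n\cdot\nabla\rho^{n+1}=0$, i.e. the limit as $\epsilon\to0$ (weak-$*$ in $L^\infty(\Omega)$) of the solutions $\rho_\epsilon^{n+1}\in H^1(\Omega)$ of $\frac{\rho_\epsilon^{n+1}-\rho^n}{\delta t}+\hat{\mathbf{u}}^n\cdot\nabla\rho_\epsilon^{n+1}-\epsilon\Delta\rho_\epsilon^{n+1}=0$, $\nabla\rho_\epsilon^{n+1}\cdot\mathbf{n}|_\Gamma=0$. Set $\mu^{n+1}=\mu(\rho^{n+1})$,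 $\alpha^{n+1}=\alpha(\rho^{n+1})$. (2) $(\mathbf{u}^{n+1},\boldsymbol\Sigma^{n+1})\in\mathbf{H}^1_0(\Omega)\times\boldsymbol\Lambda$ solves $$\tfrac1{\delta t}\big[\tfrac12(\rho^{n+1}+\rho^n)\mathbf{u}^{n+1}-\rho^n\mathbf{u}^n\big]+\tilde B(\rho^{n+1}\hat{\mathbf{u}}^n,\mathbf{u}^{n+1})-\operatorname{div}(2\mu^{n+1}\mathbf{D}\mathbf{u}^{n+1})+\nabla(p^n+q^n)=\operatorname{div}(\alpha^{n+1}\boldsymbol\Sigma^{n+1}),$$ $$\boldsymbol\Sigma^{n+1}=\mathbb{P}\big(\boldsymbol\Sigma^{n+1}+r\alpha^{n+1}\mathbf{D}\mathbf{u}^{n+1}+\theta(\boldsymbol\Sigma^n-\boldsymbol\Sigma^{n+1})\big),\qquad \mathbf{u}^{n+1}|_\Gamma=0.$$ (3) $q^{n+1}$ solves $\Delta q^{n+1}=\frac{\rho_1}{\delta t}\operatorname{div}\mathbf{u}^{n+1}$, $\partial_{\mathbf{n}}q^{n+1}|_\Gamma=0$ (up to an irrelevant additive constant). (4) $p^{n+1}=p^n+q^{n+1}$ and $\hat{\mathbf{u}}^{n+1}=\mathbf{u}^{n+1}-\frac{\delta t}{\rho_1}\nabla q^{n+1}$. *)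

theory Defs
  imports "HOL-Analysis.Analysis"
begin

text \<open>The spaces consist of functions, not of classes of functions; equality in them is
  therefore always stated almost everywhere.\<close>

definition Lp_space :: "ennreal \<Rightarrow> 'a measure \<Rightarrow> ('a \<Rightarrow> 'b::real_normed_vector) set" where
  "Lp_space p M = {f \<in> borel_measurable M.
     if p = \<infinity> then (\<exists>C. AE x in M. norm (f x) \<le> C)
     else integrable M (\<lambda>x. norm (f x) powr enn2real p)}"

definition Lp_norm :: "ennreal \<Rightarrow> 'a measure \<Rightarrow> ('a \<Rightarrow> 'b::real_normed_vector) \<Rightarrow> real" where
  "Lp_norm p M f =
     (if p = \<infinity> then Inf {C. 0 \<le> C \<and> (AE x in M. norm (f x) \<le> C)}
      else (integral\<^sup>L M (\<lambda>x. norm (f x) powr enn2real p)) powr (1 / enn2real p))"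

abbreviation L2_norm :: "'a::euclidean_space set \<Rightarrow> ('a \<Rightarrow> 'b::real_normed_vector) \<Rightarrow> real" where
  "L2_norm \<Omega> f \<equiv> Lp_norm 2 (lebesgue_on \<Omega>) f"

definition weakstar_Linf ::
    "'a measure \<Rightarrow> ('e \<Rightarrow> 'a \<Rightarrow> real) \<Rightarrow> ('a \<Rightarrow> real) \<Rightarrow> 'e filter \<Rightarrow> bool" where
  "weakstar_Linf M R f F \<longleftrightarrow>
     (\<forall>\<^sub>F e in F. R e \<in> Lp_space \<infinity> M) \<and> f \<in> Lp_space \<infinity> M \<and>
     (\<forall>g \<in> Lp_space 1 M.
        ((\<lambda>e. integral\<^sup>L M (\<lambda>x. R e x * g x)) \<longlongrightarrow> integral\<^sup>L M (\<lambda>x. f x * g x)) F)"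


primrec Ck :: "nat \<Rightarrow> ('a::euclidean_space \<Rightarrow> 'b::real_normed_vector) \<Rightarrow> bool" where
  "Ck 0 f \<longleftrightarrow> continuous_on UNIV f"
| "Ck (Suc k) f \<longleftrightarrow> (\<forall>x. f differentiable (at x)) \<and>
     (\<forall>b\<in>Basis. Ck k (\<lambda>x. frechet_derivative f (at x) b))"

definition test_functions :: "'a::euclidean_space set \<Rightarrow> ('a \<Rightarrow> 'b::real_normed_vector) set" where
  "test_functions U = {\<phi>. (\<forall>k. Ck k \<phi>) \<and>
     compact (closure {x. \<phi> x \<noteq> 0}) \<and> closure {x. \<phi> x \<noteq> 0} \<subseteq> U}"

definition locally_integrable ::
    "'a::euclidean_space set \<Rightarrow> ('a \<Rightarrow> 'b::euclidean_space) \<Rightarrow> bool" where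
  "locally_integrable U f \<longleftrightarrow> (\<forall>K. compact K \<and> K \<subseteq> U \<longrightarrow> integrable (lebesgue_on K) f)"

definition has_weak_deriv ::
    "'a::euclidean_space set \<Rightarrow> 'a \<Rightarrow> ('a \<Rightarrow> 'b::euclidean_space) \<Rightarrow> ('a \<Rightarrow> 'b) \<Rightarrow> bool" where
  "has_weak_deriv U v f g \<longleftrightarrow> locally_integrable U f \<and> locally_integrable U g \<and>
     (\<forall>\<phi> \<in> test_functions U.
        integral\<^sup>L (lebesgue_on U) (\<lambda>x. frechet_derivative \<phi> (at x) v *\<^sub>R f x)
        = - integral\<^sup>L (lebesgue_on U) (\<lambda>x. (\<phi> x :: real) *\<^sub>R g x))"

definition weakly_differentiable ::
    "'a::euclidean_space set \<Rightarrow> 'a \<Rightarrow> ('a \<Rightarrow> 'b::euclidean_space) \<Rightarrow> bool" where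
  "weakly_differentiable U v f \<longleftrightarrow> (\<exists>g. has_weak_deriv U v f g)"

text \<open>A representative of the weak derivative in direction \<open>v\<close>; it is meaningful, and determined
  up to a null set, only if \<open>f\<close> is weakly differentiable in that direction.\<close>

definition weak_deriv ::
    "'a::euclidean_space set \<Rightarrow> 'a \<Rightarrow> ('a \<Rightarrow> 'b::euclidean_space) \<Rightarrow> 'a \<Rightarrow> 'b" where
  "weak_deriv U v f = (SOME g. has_weak_deriv U v f g)"

definition weak_grad :: "(real^3) set \<Rightarrow> (real^3 \<Rightarrow> real) \<Rightarrow> real^3 \<Rightarrow> real^3" where
  "weak_grad \<Omega> f x = (\<chi> j. weak_deriv \<Omega> (axis j 1) f x)"

text \<open>The entry in row \<open>i\<close> and column \<open>j\<close> is the derivative of the \<open>i\<close>-th component in direction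
  \<open>j\<close>, as for the library's \<^const>\<open>jacobian\<close>.\<close>

definition weak_jac :: "(real^3) set \<Rightarrow> (real^3 \<Rightarrow> real^3) \<Rightarrow> real^3 \<Rightarrow> real^3^3" where
  "weak_jac \<Omega> u x = (\<chi> i j. weak_deriv \<Omega> (axis j 1) u x $ i)"

definition weak_div :: "(real^3) set \<Rightarrow> (real^3 \<Rightarrow> real^3) \<Rightarrow> real^3 \<Rightarrow> real" where
  "weak_div \<Omega> u x = trace (weak_jac \<Omega> u x)"

definition sym_part :: "real^3^3 \<Rightarrow> real^3^3" where
  "sym_part A = (1/2) *\<^sub>R (A + transpose A)"


definition H1 :: "'a::euclidean_space set \<Rightarrow> ('a \<Rightarrow> 'b::euclidean_space) set" where
  "H1 \<Omega> = {f \<in> Lp_space 2 (lebesgue_on \<Omega>). \<forall>b\<in>Basis.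
     weakly_differentiable \<Omega> b f \<and> weak_deriv \<Omega> b f \<in> Lp_space 2 (lebesgue_on \<Omega>)}"

definition H10 :: "'a::euclidean_space set \<Rightarrow> ('a \<Rightarrow> 'b::euclidean_space) set" where
  "H10 \<Omega> = {f \<in> H1 \<Omega>. \<exists>\<phi> :: nat \<Rightarrow> 'a \<Rightarrow> 'b. (\<forall>m. \<phi> m \<in> test_functions \<Omega>) \<and>
     (\<lambda>m. L2_norm \<Omega> (\<lambda>x. f x - \<phi> m x)) \<longlonglongrightarrow> 0 \<and>
     (\<forall>b\<in>Basis. (\<lambda>m. L2_norm \<Omega>
        (\<lambda>x. weak_deriv \<Omega> b f x - frechet_derivative (\<phi> m) (at x) b)) \<longlonglongrightarrow> 0)}"


text \<open>A time-dependent field is a function of \<open>(t, x)\<close>, its value at time \<open>t\<close> being \<open>curry f t\<close>.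
  Its derivatives in time and in space are weak derivatives on \<open>(0,T) \<times> \<Omega>\<close>.\<close>

definition cyl :: "real \<Rightarrow> (real^3) set \<Rightarrow> (real \<times> (real^3)) set" where
  "cyl T \<Omega> = {0<..<T} \<times> \<Omega>"

definition t_differentiable ::
    "real \<Rightarrow> (real^3) set \<Rightarrow> (real \<times> (real^3) \<Rightarrow> 'b::euclidean_space) \<Rightarrow> bool" where
  "t_differentiable T \<Omega> f \<longleftrightarrow> weakly_differentiable (cyl T \<Omega>) (1, 0) f"

definition x_differentiable ::
    "real \<Rightarrow> (real^3) set \<Rightarrow> (real \<times> (real^3) \<Rightarrow> 'b::euclidean_space) \<Rightarrow> bool" where
  "x_differentiable T \<Omega> f \<longleftrightarrow> (\<forall>j. weakly_differentiable (cyl T \<Omega>) (0, axis j 1) f)"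

definition dt ::
    "real \<Rightarrow> (real^3) set \<Rightarrow> (real \<times> (real^3) \<Rightarrow> 'b::euclidean_space) \<Rightarrow> real \<times> (real^3) \<Rightarrow> 'b" where
  "dt T \<Omega> f = weak_deriv (cyl T \<Omega>) (1, 0) f"

definition x_grad ::
    "real \<Rightarrow> (real^3) set \<Rightarrow> (real \<times> (real^3) \<Rightarrow> real) \<Rightarrow> real \<times> (real^3) \<Rightarrow> real^3" where
  "x_grad T \<Omega> f z = (\<chi> j. weak_deriv (cyl T \<Omega>) (0, axis j 1) f z)"

definition x_jac ::
    "real \<Rightarrow> (real^3) set \<Rightarrow> (real \<times> (real^3) \<Rightarrow> real^3) \<Rightarrow> real \<times> (real^3) \<Rightarrow> real^3^3" where
  "x_jac T \<Omega> u z = (\<chi> i j. weak_deriv (cyl T \<Omega>) (0, axis j 1) u z $ i)"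

text \<open>The mixed-norm form of \<open>L\<^sup>p(0,T; L\<^sup>q(\<Omega>))\<close>: only joint measurability is required, which
  for \<open>q = \<infinity>\<close> is weaker than Bochner measurability into \<open>L\<^sup>\<infinity>(\<Omega>)\<close>.\<close>

definition Lp_Lq :: "ennreal \<Rightarrow> ennreal \<Rightarrow> real \<Rightarrow> (real^3) set \<Rightarrow>
    (real \<times> (real^3) \<Rightarrow> 'b::real_normed_vector) set" where
  "Lp_Lq p q T \<Omega> = {f \<in> borel_measurable (lebesgue_on (cyl T \<Omega>)).
     (AE t in lebesgue_on {0<..<T}. curry f t \<in> Lp_space q (lebesgue_on \<Omega>)) \<and>
     (\<lambda>t. Lp_norm q (lebesgue_on \<Omega>) (curry f t)) \<in> Lp_space p (lebesgue_on {0<..<T})}"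

definition C_L2 :: "real \<Rightarrow> (real^3) set \<Rightarrow> (real \<times> (real^3) \<Rightarrow> 'b::real_normed_vector) set" where
  "C_L2 T \<Omega> = {f. \<forall>t\<in>{0..T}. curry f t \<in> Lp_space 2 (lebesgue_on \<Omega>) \<and>
     ((\<lambda>s. L2_norm \<Omega> (\<lambda>x. f (s, x) - f (t, x))) \<longlongrightarrow> 0) (at t within {0..T})}"


definition tensor_norm :: "real^3^3 \<Rightarrow> real" where
  "tensor_norm A = sqrt (1/2 * trace (transpose A ** A))"

definition Lam :: "(real^3^3) set" where
  "Lam = {A. tensor_norm A \<le> 1 \<and> transpose A = A \<and> trace A = 0}"

text \<open>The library's norm on matrices is \<open>sqrt 2\<close> times \<^const>\<open>tensor_norm\<close>, so both norms give
  the same projection.\<close>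

definition proj_Lam :: "real^3^3 \<Rightarrow> real^3^3" where
  "proj_Lam A = closest_point Lam A"

definition Lam_fields :: "(real^3) set \<Rightarrow> (real^3 \<Rightarrow> real^3^3) set" where
  "Lam_fields \<Omega> = {S \<in> Lp_space 2 (lebesgue_on \<Omega>). AE x in lebesgue_on \<Omega>. S x \<in> Lam}"

text \<open>The momentum equation is understood in the sense of distributions on \<open>(0,T) \<times> \<Omega>\<close>. The
  initial values and the values at the times \<open>t\<^sub>n\<close> are those of the representatives of \<open>\<rho>\<close> and \<open>u\<close>
  that are continuous in time, which are the ones fixed here; under the regularity below such
  representatives exist.\<close>

definition bingham_solution ::
    "real \<Rightarrow> (real^3) set \<Rightarrow> (real \<Rightarrow> real) \<Rightarrow> (real \<Rightarrow> real) \<Rightarrow>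
     (real^3 \<Rightarrow> real) \<Rightarrow> (real^3 \<Rightarrow> real^3) \<Rightarrow>
     (real \<times> (real^3) \<Rightarrow> real^3) \<Rightarrow> (real \<times> (real^3) \<Rightarrow> real) \<Rightarrow> (real \<times> (real^3) \<Rightarrow> real) \<Rightarrow>
     (real \<times> (real^3) \<Rightarrow> real^3^3) \<Rightarrow> bool" where
  "bingham_solution T \<Omega> \<mu> \<alpha> \<rho>0 u0 u \<rho> p S \<longleftrightarrow>
     \<rho> \<in> C_L2 T \<Omega> \<and> u \<in> C_L2 T \<Omega> \<and>
     t_differentiable T \<Omega> \<rho> \<and> x_differentiable T \<Omega> \<rho> \<and>
     t_differentiable T \<Omega> u \<and> x_differentiable T \<Omega> u \<and>
     locally_integrable (cyl T \<Omega>) p \<and> locally_integrable (cyl T \<Omega>) S \<and>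
     (AE z in lebesgue_on (cyl T \<Omega>). dt T \<Omega> \<rho> z + u z \<bullet> x_grad T \<Omega> \<rho> z = 0) \<and>
     (\<forall>\<phi> \<in> test_functions (cyl T \<Omega>).
        integral\<^sup>L (lebesgue_on (cyl T \<Omega>)) (\<lambda>(t, x).
            (\<rho> (t, x) *\<^sub>R (dt T \<Omega> u (t, x) + x_jac T \<Omega> u (t, x) *v u (t, x))) \<bullet> \<phi> (t, x)
            - p (t, x) * trace (jacobian (curry \<phi> t) (at x))
            + 2 * \<mu> (\<rho> (t, x)) *
                (sym_part (x_jac T \<Omega> u (t, x)) \<bullet> jacobian (curry \<phi> t) (at x)))
        = - integral\<^sup>L (lebesgue_on (cyl T \<Omega>)) (\<lambda>(t, x).
            \<alpha> (\<rho> (t, x)) * (S (t, x) \<bullet> jacobian (curry \<phi> t) (at x)))) \<and>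
     (\<forall>l>0. AE z in lebesgue_on (cyl T \<Omega>).
        S z = proj_Lam (S z + l *\<^sub>R sym_part (x_jac T \<Omega> u z))) \<and>
     (AE z in lebesgue_on (cyl T \<Omega>). trace (x_jac T \<Omega> u z) = 0) \<and>
     (AE x in lebesgue_on \<Omega>. \<rho> (0, x) = \<rho>0 x) \<and>
     (AE x in lebesgue_on \<Omega>. u (0, x) = u0 x) \<and>
     (AE t in lebesgue_on {0<..<T}. curry u t \<in> H10 \<Omega>)"

definition bingham_regular ::
    "real \<Rightarrow> (real^3) set \<Rightarrow>
     (real \<times> (real^3) \<Rightarrow> real^3) \<Rightarrow> (real \<times> (real^3) \<Rightarrow> real) \<Rightarrow> (real \<times> (real^3) \<Rightarrow> real) \<Rightarrow>
     (real \<times> (real^3) \<Rightarrow> real^3^3) \<Rightarrow> bool" where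
  "bingham_regular T \<Omega> u \<rho> p S \<longleftrightarrow>
     u \<in> Lp_Lq \<infinity> \<infinity> T \<Omega> \<and>
     x_differentiable T \<Omega> u \<and> x_jac T \<Omega> u \<in> Lp_Lq \<infinity> \<infinity> T \<Omega> \<and>
     t_differentiable T \<Omega> u \<and> dt T \<Omega> u \<in> Lp_Lq \<infinity> 3 T \<Omega> \<and>
     t_differentiable T \<Omega> (dt T \<Omega> u) \<and> dt T \<Omega> (dt T \<Omega> u) \<in> Lp_Lq 2 (6/5) T \<Omega> \<and>
     x_differentiable T \<Omega> \<rho> \<and> x_grad T \<Omega> \<rho> \<in> Lp_Lq \<infinity> \<infinity> T \<Omega> \<and>
     t_differentiable T \<Omega> \<rho> \<and>
     t_differentiable T \<Omega> (dt T \<Omega> \<rho>) \<and> dt T \<Omega> (dt T \<Omega> \<rho>) \<in> Lp_Lq 2 2 T \<Omega> \<and>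
     t_differentiable T \<Omega> p \<and> dt T \<Omega> p \<in> Lp_Lq 2 2 T \<Omega> \<and>
     x_differentiable T \<Omega> (dt T \<Omega> p) \<and> x_grad T \<Omega> (dt T \<Omega> p) \<in> Lp_Lq 2 2 T \<Omega> \<and>
     t_differentiable T \<Omega> S \<and> dt T \<Omega> S \<in> Lp_Lq 2 2 T \<Omega>"


text \<open>Weak form of \<open>(\<rho>\<^sub>\<epsilon> - \<rho>) / \<delta> + w \<cdot> \<nabla>\<rho>\<^sub>\<epsilon> - \<epsilon> \<Delta>\<rho>\<^sub>\<epsilon> = 0\<close> with homogeneous Neumann condition.
  The test functions are bounded because \<open>w\<close> is only square integrable.\<close>

definition regularized_transport ::
    "(real^3) set \<Rightarrow> real \<Rightarrow> real \<Rightarrow> (real^3 \<Rightarrow> real^3) \<Rightarrow> (real^3 \<Rightarrow> real) \<Rightarrow> (real^3 \<Rightarrow> real) \<Rightarrow> bool"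
    where
  "regularized_transport \<Omega> \<delta> \<epsilon> w \<rho> \<rho>\<epsilon> \<longleftrightarrow> \<rho>\<epsilon> \<in> H1 \<Omega> \<and>
     (\<forall>\<phi> \<in> H1 \<Omega> \<inter> Lp_space \<infinity> (lebesgue_on \<Omega>).
        integral\<^sup>L (lebesgue_on \<Omega>) (\<lambda>x.
          (\<rho>\<epsilon> x - \<rho> x) / \<delta> * \<phi> x + (w x \<bullet> weak_grad \<Omega> \<rho>\<epsilon> x) * \<phi> x
          + \<epsilon> * (weak_grad \<Omega> \<rho>\<epsilon> x \<bullet> weak_grad \<Omega> \<phi> x)) = 0)"

definition viscosity_solution ::
    "(real^3) set \<Rightarrow> real \<Rightarrow> (real^3 \<Rightarrow> real^3) \<Rightarrow> (real^3 \<Rightarrow> real) \<Rightarrow> (real^3 \<Rightarrow> real) \<Rightarrow> bool" where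
  "viscosity_solution \<Omega> \<delta> w \<rho> \<rho>' \<longleftrightarrow>
     (\<exists>R. (\<forall>\<epsilon>>0. regularized_transport \<Omega> \<delta> \<epsilon> w \<rho> (R \<epsilon>)) \<and>
          weakstar_Linf (lebesgue_on \<Omega>) R \<rho>' (at_right 0))"

text \<open>The distribution \<open>(w \<cdot> \<nabla>) v + (v / 2) div w\<close> applied to a test function \<open>\<phi>\<close>. In the scheme
  \<open>w\<close> is only square integrable, so \<open>div w\<close> is a distribution, which acts on \<open>v \<cdot> \<phi>\<close>.\<close>

definition B_tilde ::
    "(real^3) set \<Rightarrow> (real^3 \<Rightarrow> real^3) \<Rightarrow> (real^3 \<Rightarrow> real^3) \<Rightarrow> (real^3 \<Rightarrow> real^3) \<Rightarrow> real" where
  "B_tilde \<Omega> w v \<phi> =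
     integral\<^sup>L (lebesgue_on \<Omega>) (\<lambda>x. (weak_jac \<Omega> v x *v w x) \<bullet> \<phi> x)
     - 1/2 * integral\<^sup>L (lebesgue_on \<Omega>) (\<lambda>x. w x \<bullet> weak_grad \<Omega> (\<lambda>y. v y \<bullet> \<phi> y) x)"

text \<open>In the following definition \<open>\<rho>, u, S\<close> are the values at step \<open>n\<close>, \<open>w\<close> is the projected
  velocity at step \<open>n\<close>, \<open>\<pi>\<close> is \<open>p\<^sup>n + q\<^sup>n\<close>, and \<open>\<rho>', u', S'\<close> are the values at step \<open>n + 1\<close>.\<close>

definition momentum_step ::
    "(real^3) set \<Rightarrow> (real \<Rightarrow> real) \<Rightarrow> (real \<Rightarrow> real) \<Rightarrow> real \<Rightarrow> real \<Rightarrow> real \<Rightarrow>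
     (real^3 \<Rightarrow> real) \<Rightarrow> (real^3 \<Rightarrow> real^3) \<Rightarrow> (real^3 \<Rightarrow> real^3) \<Rightarrow> (real^3 \<Rightarrow> real) \<Rightarrow>
     (real^3 \<Rightarrow> real^3^3) \<Rightarrow> (real^3 \<Rightarrow> real) \<Rightarrow> (real^3 \<Rightarrow> real^3) \<Rightarrow> (real^3 \<Rightarrow> real^3^3) \<Rightarrow> bool" where
  "momentum_step \<Omega> \<mu> \<alpha> \<delta> r \<theta> \<rho> u w \<pi> S \<rho>' u' S' \<longleftrightarrow>
     u' \<in> H10 \<Omega> \<and> S' \<in> Lam_fields \<Omega> \<and>
     (\<forall>\<phi> \<in> test_functions \<Omega>.
        integral\<^sup>L (lebesgue_on \<Omega>)
          (\<lambda>x. ((1 / \<delta>) *\<^sub>R ((1/2 * (\<rho>' x + \<rho> x)) *\<^sub>R u' x - \<rho> x *\<^sub>R u x)) \<bullet> \<phi> x)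
        + B_tilde \<Omega> (\<lambda>x. \<rho>' x *\<^sub>R w x) u' \<phi>
        + integral\<^sup>L (lebesgue_on \<Omega>)
            (\<lambda>x. 2 * \<mu> (\<rho>' x) * (sym_part (weak_jac \<Omega> u' x) \<bullet> jacobian \<phi> (at x)))
        - integral\<^sup>L (lebesgue_on \<Omega>) (\<lambda>x. \<pi> x * trace (jacobian \<phi> (at x)))
        = - integral\<^sup>L (lebesgue_on \<Omega>) (\<lambda>x. \<alpha> (\<rho>' x) * (S' x \<bullet> jacobian \<phi> (at x)))) \<and>
     (AE x in lebesgue_on \<Omega>. S' x =
        proj_Lam (S' x + (r * \<alpha> (\<rho>' x)) *\<^sub>R sym_part (weak_jac \<Omega> u' x) + \<theta> *\<^sub>R (S x - S' x)))"

text \<open>Weak form of \<open>\<Delta>q = c div u\<close> with homogeneous Neumann condition.\<close>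

definition neumann_poisson ::
    "(real^3) set \<Rightarrow> real \<Rightarrow> (real^3 \<Rightarrow> real^3) \<Rightarrow> (real^3 \<Rightarrow> real) \<Rightarrow> bool" where
  "neumann_poisson \<Omega> c u q \<longleftrightarrow> q \<in> H1 \<Omega> \<and>
     (\<forall>\<phi> \<in> H1 \<Omega>.
        - integral\<^sup>L (lebesgue_on \<Omega>) (\<lambda>x. weak_grad \<Omega> q x \<bullet> weak_grad \<Omega> \<phi> x)
        = c * integral\<^sup>L (lebesgue_on \<Omega>) (\<lambda>x. weak_div \<Omega> u x * \<phi> x))"

definition bi_projection_scheme ::
    "(real^3) set \<Rightarrow> (real \<Rightarrow> real) \<Rightarrow> (real \<Rightarrow> real) \<Rightarrow> real \<Rightarrow> real \<Rightarrow> real \<Rightarrow>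
     (real^3 \<Rightarrow> real) \<Rightarrow> (real^3 \<Rightarrow> real^3) \<Rightarrow> nat \<Rightarrow> real \<Rightarrow>
     (nat \<Rightarrow> real^3 \<Rightarrow> real) \<Rightarrow> (nat \<Rightarrow> real^3 \<Rightarrow> real^3) \<Rightarrow> (nat \<Rightarrow> real^3 \<Rightarrow> real^3) \<Rightarrow>
     (nat \<Rightarrow> real^3 \<Rightarrow> real) \<Rightarrow> (nat \<Rightarrow> real^3 \<Rightarrow> real) \<Rightarrow> (nat \<Rightarrow> real^3 \<Rightarrow> real^3^3) \<Rightarrow> bool" where
  "bi_projection_scheme \<Omega> \<mu> \<alpha> \<rho>1 r \<theta> \<rho>0 u0 N \<delta> \<rho> u uhat q p S \<longleftrightarrow>
     \<rho> 0 = \<rho>0 \<and> u 0 = u0 \<and> uhat 0 = u0 \<and> q 0 = (\<lambda>x. 0) \<and>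
     p 0 \<in> Lp_space 2 (lebesgue_on \<Omega>) \<and> S 0 \<in> Lp_space 2 (lebesgue_on \<Omega>) \<and>
     (\<forall>n<N.
        viscosity_solution \<Omega> \<delta> (uhat n) (\<rho> n) (\<rho> (Suc n)) \<and>
        momentum_step \<Omega> \<mu> \<alpha> \<delta> r \<theta> (\<rho> n) (u n) (uhat n) (\<lambda>x. p n x + q n x) (S n)
          (\<rho> (Suc n)) (u (Suc n)) (S (Suc n)) \<and>
        neumann_poisson \<Omega> (\<rho>1 / \<delta>) (u (Suc n)) (q (Suc n)) \<and>
        (AE x in lebesgue_on \<Omega>. p (Suc n) x = p n x + q (Suc n) x) \<and>
        (AE x in lebesgue_on \<Omega>.
           uhat (Suc n) x = u (Suc n) x - (\<delta> / \<rho>1) *\<^sub>R weak_grad \<Omega> (q (Suc n)) x))"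

end

theory Submission
  imports Defs
begin

text \<open>Let \<open>B\<^sub>k\<close> be the average of \<open>\<rho>\<close> over \<open>(t\<^sub>k, t\<^sub>k\<^sub>+\<^sub>1)\<close>; it is within \<open>O(\<delta>)\<close> of \<open>\<rho>(t\<^sub>k\<^sub>+\<^sub>1)\<close> and has a
  bounded weak gradient. Testing the regularized transport equation with \<open>B\<^sub>k\<close> minus its
  solution, the convective term drops out, as the projected velocity \<open>v\<close> of step \<open>k\<close> is
  orthogonal to gradients. In the limit \<open>\<epsilon> \<rightarrow> 0\<close> this gives
  \<open>\<parallel>B\<^sub>k - \<rho>\<^sup>k\<^sup>+\<^sup>1\<parallel> \<le> \<parallel>B\<^sub>k - \<rho>\<^sup>k + \<delta> v \<bullet> \<nabla>B\<^sub>k\<parallel>\<close>, so each step adds at most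
  \<open>\<parallel>B\<^sub>k - B\<^sub>k\<^sub>-\<^sub>1 + \<delta> v \<bullet> \<nabla>B\<^sub>k\<parallel>\<close> to the error. By \<open>\<partial>\<^sub>t\<rho> = - u \<bullet> \<nabla>\<rho>\<close> this increment is at most
  \<open>\<delta> M \<parallel>v - u(t\<^sub>k)\<parallel>\<close> plus terms in \<open>\<partial>\<^sub>t\<^sub>t\<rho>\<close> and \<open>\<partial>\<^sub>tu\<close> that sum up to \<open>O(\<delta>)\<close>. Finally \<open>u(t\<^sub>k)\<close> is orthogonal
  to gradients as well, whence \<open>\<parallel>v - u(t\<^sub>k)\<parallel> \<le> \<parallel>u\<^sup>k - u(t\<^sub>k)\<parallel>\<close>.\<close>

subsection \<open>Smooth test functions\<close>

text \<open>The obstacle is that neither density has a controlled gradient at the time nodes: that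
  of \<rho> is bounded for almost every time only, and nothing is known about the gradient of the
  discrete density. So the comparison function is an average in time, and the energy estimate puts
  the gradient on it alone. To write the convective term as a pairing with a gradient, the square of
  the tested difference must itself be an admissible potential. This uses that the regularized
  densities are eventually bounded, and it is the purpose of the material on weak derivatives along
  lines. The step estimate has factor one, so errors are added and never amplified. The consistency
  error of a step is \<delta> times the L2 norm of an integral over a time window of length 2
  \<delta>; Cauchy-Schwarz, inside the window and over the steps, leaves O(\<delta>) because the
  number of steps times \<delta> is at most T. The same device turns the sum of velocity errors into
  a sum of squares. The first step is separate, since no average precedes it.\<close>

lemma Ck_SucI:
  assumes "\<And>x. (f has_derivative f' x) (at x)"
    and "\<And>b. b \<in> Basis \<Longrightarrow> Ck k (\<lambda>x. f' x b)"
  shows "Ck (Suc k) f"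
proof -
  have "frechet_derivative f (at x) = f' x" for x
    using frechet_derivative_at[OF assms(1)] by simp
  then show ?thesis
    using assms by (auto simp: differentiable_def)
qed

lemma Ck_Suc_has_derivative:
  "Ck (Suc k) f \<Longrightarrow> (f has_derivative frechet_derivative f (at x)) (at x)"
  by (simp add: frechet_derivative_works)

lemma Ck_Suc_deriv: "Ck (Suc k) f \<Longrightarrow> b \<in> Basis \<Longrightarrow> Ck k (\<lambda>x. frechet_derivative f (at x) b)"
  by simp

text \<open>The product rule needs it: the derivative of a product still contains the factors
  themselves, which are given with one order more than the induction hypothesis takes.\<close>

lemma Ck_Suc_imp_Ck: "Ck (Suc k) f \<Longrightarrow> Ck k f"
proof (induction k arbitrary: f)
  case 0
  then show ?case
    by (auto intro: differentiable_imp_continuous_within simp: continuous_on_eq_continuous_within)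
next
  case (Suc k)
  then show ?case
    by (metis Ck.simps(2))
qed

lemma Ck_const: "Ck k (\<lambda>x. c)"
proof (induction k arbitrary: c)
  case (Suc k)
  show ?case by (rule Ck_SucI[where f'="\<lambda>x h. 0"]) (auto intro: Suc)
qed simp

lemma Ck_add: "Ck k f \<Longrightarrow> Ck k g \<Longrightarrow> Ck k (\<lambda>x. f x + g x)"
proof (induction k arbitrary: f g)
  case 0
  then show ?case by (auto intro: continuous_on_add)
next
  case (Suc k)
  show ?case
    by (rule Ck_SucI[OF has_derivative_add[OF Ck_Suc_has_derivative[OF Suc.prems(1)]
            Ck_Suc_has_derivative[OF Suc.prems(2)]]])
       (intro Suc.IH Ck_Suc_deriv[OF Suc.prems(1)] Ck_Suc_deriv[OF Suc.prems(2)])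
qed

lemma Ck_sum: "(\<And>i. i \<in> I \<Longrightarrow> Ck k (f i)) \<Longrightarrow> Ck k (\<lambda>x. \<Sum>i\<in>I. f i x)"
  by (induction I rule: infinite_finite_induct) (auto intro: Ck_const Ck_add)

lemma Ck_scaleR:
  fixes f :: "'a::euclidean_space \<Rightarrow> real"
  shows "Ck k f \<Longrightarrow> Ck k g \<Longrightarrow> Ck k (\<lambda>x. f x *\<^sub>R g x)"
proof (induction k arbitrary: f g)
  case 0
  then show ?case by (auto intro: continuous_on_scaleR)
next
  case (Suc k)
  show ?case
    by (rule Ck_SucI[OF has_derivative_scaleR[OF Ck_Suc_has_derivative[OF Suc.prems(1)]
            Ck_Suc_has_derivative[OF Suc.prems(2)]]])
       (intro Ck_add Suc.IH Ck_Suc_deriv[OF Suc.prems(1)] Ck_Suc_deriv[OF Suc.prems(2)]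
           Suc.prems[THEN Ck_Suc_imp_Ck])
qed

lemma Ck_mult:
  fixes f g :: "'a::euclidean_space \<Rightarrow> real"
  shows "Ck k f \<Longrightarrow> Ck k g \<Longrightarrow> Ck k (\<lambda>x. f x * g x)"
  using Ck_scaleR[of k f g] by simp

lemma Ck_prod:
  fixes f :: "'i \<Rightarrow> 'a::euclidean_space \<Rightarrow> real"
  shows "(\<And>i. i \<in> I \<Longrightarrow> Ck k (f i)) \<Longrightarrow> Ck k (\<lambda>x. \<Prod>i\<in>I. f i x)"
  by (induction I rule: infinite_finite_induct) (auto intro: Ck_const Ck_mult)

lemma Ck_diff:
  fixes f g :: "'a::euclidean_space \<Rightarrow> 'b::real_normed_vector"
  assumes "Ck k f" "Ck k g" shows "Ck k (\<lambda>x. f x - g x)"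
  using Ck_add[OF assms(1) Ck_scaleR[OF Ck_const[of k "-1"] assms(2)]] by simp

lemma Ck_power:
  fixes f :: "'a::euclidean_space \<Rightarrow> real"
  shows "Ck k f \<Longrightarrow> Ck k (\<lambda>x. f x ^ m)"
  by (induction m) (auto intro: Ck_const Ck_mult)

lemma Ck_linear_compose:
  "bounded_linear L \<Longrightarrow> Ck k f \<Longrightarrow> Ck k (\<lambda>x. L (f x))"
proof (induction k arbitrary: f)
  case 0
  then show ?case by (auto intro: bounded_linear.continuous_on)
next
  case (Suc k)
  show ?case
    by (rule Ck_SucI[OF bounded_linear.has_derivative[OF Suc.prems(1) Ck_Suc_has_derivative[OF Suc.prems(2)]]])
       (intro Suc.IH Suc.prems(1) Ck_Suc_deriv[OF Suc.prems(2)])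
qed

lemma Ck_compose_affine:
  fixes A :: "'a::euclidean_space \<Rightarrow> 'b::euclidean_space"
  assumes A: "bounded_linear A"
  shows "Ck k f \<Longrightarrow> Ck k (\<lambda>x. f (A x + c))"
proof (induction k arbitrary: f)
  case 0
  then show ?case
    using continuous_on_compose2[of UNIV f UNIV "\<lambda>x. A x + c"]
    by (simp add: continuous_on_add linear_continuous_on A)
next
  case (Suc k)
  have der: "((\<lambda>x. f (A x + c)) has_derivative (\<lambda>h. frechet_derivative f (at (A x + c)) (A h))) (at x)" for x
  proof -
    have "((\<lambda>x. A x + c) has_derivative A) (at x)"
      using bounded_linear.has_derivative[OF A has_derivative_ident, of "at x"]
      by (auto intro!: derivative_eq_intros)
    from has_derivative_compose[OF this Ck_Suc_has_derivative[OF Suc.prems]]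
    show ?thesis .
  qed
  \<comment> \<open>\<open>A b\<close> is in general no basis vector, while \<open>Ck\<close> speaks
    of basis directions only; hence the expansion of the derivative in the basis.\<close>
  have "Ck k (\<lambda>x. frechet_derivative f (at (A x + c)) (A b))" for b
  proof -
    have "frechet_derivative f (at y) (A b) = (\<Sum>i\<in>Basis. (A b \<bullet> i) *\<^sub>R frechet_derivative f (at y) i)" for y
    proof -
      have "linear (frechet_derivative f (at y))"
        using Ck_Suc_has_derivative[OF Suc.prems] has_derivative_linear by blast
      then show ?thesis by (subst euclidean_representation[of "A b", symmetric]) (simp add: linear_sum linear_scale del: euclidean_representation)
    qed
    then show ?thesis
      by (simp, intro Ck_sum Ck_scaleR Ck_const Suc.IH Ck_Suc_deriv[OF Suc.prems])
  qed
  then show ?case by (intro Ck_SucI[OF der])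
qed

section \<open>Smooth cutoff functions of boxes\<close>

lemma tendsto_inverse_power_exp: "((\<lambda>x::real. inverse x ^ n * exp (- inverse x)) \<longlongrightarrow> 0) (at_right 0)"
proof -
  have "((\<lambda>y::real. y ^ n / exp y) \<longlongrightarrow> 0) at_top"
    by (rule tendsto_power_div_exp_0)
  from filterlim_compose[OF this filterlim_inverse_at_top_right]
  show ?thesis by (simp add: exp_minus divide_inverse)
qed

text \<open>The derivative of a member of this family is a linear combination of members, so that
  one induction shows that all of them are smooth.\<close>

definition smooth_step :: "nat \<Rightarrow> real \<Rightarrow> real" where
  "smooth_step n x = (if x \<le> 0 then 0 else inverse x ^ n * exp (- inverse x))"

text \<open>Away from 0 this is the product rule for
  \<open>inverse x ^ n * exp (- inverse x)\<close>. At 0 the right difference quotient is the same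
  expression with exponent \<open>Suc n\<close>, which tends to 0 because the exponential beats
  every power.\<close>

lemma smooth_step_has_real_derivative:
  "(smooth_step n has_real_derivative (smooth_step (n + 2) x - real n * smooth_step (Suc n) x)) (at x)"
proof -
  consider "x < 0" | "x > 0" | "x = 0" by linarith
  then show ?thesis
  proof cases
    case 1
    have "((\<lambda>x::real. 0) has_real_derivative 0) (at x)" by simp
    then have "(smooth_step n has_real_derivative 0) (at x)"
      by (rule has_field_derivative_transform_within_open[where S="{..<0}"])
         (use 1 in \<open>auto simp: smooth_step_def\<close>)
    with 1 show ?thesis by (simp add: smooth_step_def)
  next
    case 2
    have "((\<lambda>x::real. inverse x ^ n * exp (- inverse x)) has_real_derivative
       (real n * inverse x ^ (n - 1) * (- (inverse x ^ 2))) * exp (- inverse x)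
        + inverse x ^ n * (exp (- inverse x) * (inverse x ^ 2))) (at x)"
      using 2 by (auto intro!: derivative_eq_intros simp: power2_eq_square)
    also have "(real n * inverse x ^ (n - 1) * (- (inverse x ^ 2))) * exp (- inverse x)
        + inverse x ^ n * (exp (- inverse x) * (inverse x ^ 2)) =
        smooth_step (n + 2) x - real n * smooth_step (Suc n) x"
      \<comment> \<open>For n = 0 the exponent \<open>n - 1\<close> is truncated, harmlessly, as its
        factor \<open>real n\<close> is 0.\<close>
      using 2 by (cases n) (auto simp: smooth_step_def power2_eq_square algebra_simps)
    finally show ?thesis
      by (rule has_field_derivative_transform_within_open[where S="{0<..}"])
         (use 2 in \<open>auto simp: smooth_step_def\<close>)
  next
    case 3
    have "((\<lambda>h. smooth_step n h / h) \<longlongrightarrow> 0) (at_right 0)"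
    proof (rule Lim_transform_eventually[OF tendsto_inverse_power_exp[of "Suc n"]])
      show "\<forall>\<^sub>F h in at_right 0. inverse h ^ Suc n * exp (- inverse h) = smooth_step n h / h"
        by (auto simp: eventually_at_filter smooth_step_def divide_inverse)
    qed
    moreover have "((\<lambda>h. smooth_step n h / h) \<longlongrightarrow> 0) (at_left 0)"
      by (rule Lim_transform_eventually[OF tendsto_const])
         (auto simp: eventually_at_filter smooth_step_def)
    ultimately have "((\<lambda>h. smooth_step n h / h) \<longlongrightarrow> 0) (at 0)"
      by (simp add: filterlim_split_at_real)
    with 3 show ?thesis by (simp add: DERIV_def smooth_step_def)
  qed
qed

lemma Ck_smooth_step: "Ck k (smooth_step n)"
proof (induction k arbitrary: n)
  case 0
  have "isCont (smooth_step n) x" for x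
    using smooth_step_has_real_derivative DERIV_isCont by blast
  then show ?case by (simp add: continuous_at_imp_continuous_on)
next
  case (Suc k)
  let ?g = "\<lambda>x. smooth_step (n + 2) x - real n * smooth_step (Suc n) x"
  have der: "(smooth_step n has_derivative (\<lambda>h. ?g x * h)) (at x)" for x
    using smooth_step_has_real_derivative[of n x] by (simp add: has_field_derivative_def)
  show ?case
    by (rule Ck_SucI[OF der]) (intro Ck_mult Ck_diff Ck_const Suc)
qed

text \<open>Boxes rather than balls: the intersection of two open boxes is an open box, and the open
  boxes generate the Borel sets. The factors are the classical function exp(-1/s) of the distances
  to the faces.\<close>

definition box_bump :: "'a::euclidean_space \<Rightarrow> 'a \<Rightarrow> 'a \<Rightarrow> real" where
  "box_bump a b x = (\<Prod>i\<in>Basis. smooth_step 0 (x \<bullet> i - a \<bullet> i) * smooth_step 0 (b \<bullet> i - x \<bullet> i))"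

lemma smooth_step_0_bounds: "0 \<le> smooth_step 0 x" "smooth_step 0 x \<le> 1" "0 < smooth_step 0 x \<longleftrightarrow> 0 < x"
  by (auto simp: smooth_step_def)

lemma box_bump_bounds: "0 \<le> box_bump a b x" "box_bump a b x \<le> 1"
  unfolding box_bump_def
  by (auto intro!: prod_nonneg prod_le_1 mult_nonneg_nonneg mult_le_one smooth_step_0_bounds)

lemma box_bump_pos_iff: "0 < box_bump a b x \<longleftrightarrow> x \<in> box a b"
proof
  assume "x \<in> box a b"
  then show "0 < box_bump a b x"
    unfolding box_bump_def
    by (auto intro!: prod_pos mult_pos_pos simp: smooth_step_0_bounds(3) mem_box)
next
  assume *: "0 < box_bump a b x"
  show "x \<in> box a b"
  proof (rule ccontr)
    assume "x \<notin> box a b"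
    then obtain i where "i \<in> Basis" "\<not> (a \<bullet> i < x \<bullet> i \<and> x \<bullet> i < b \<bullet> i)"
      by (auto simp: mem_box)
    then have "box_bump a b x = 0"
      unfolding box_bump_def by (intro prod_zero) (auto simp: smooth_step_def intro!: bexI[of _ i])
    with * show False by simp
  qed
qed

lemma Ck_box_bump: "Ck k (box_bump a b)"
proof -
  have 1: "Ck k (\<lambda>x::'a. smooth_step 0 (x \<bullet> i + - (a \<bullet> i)))" for i
    by (intro Ck_compose_affine Ck_smooth_step bounded_linear_inner_left)
  have 2: "Ck k (\<lambda>x::'a. smooth_step 0 (x \<bullet> (- i) + b \<bullet> i))" for i
    by (intro Ck_compose_affine Ck_smooth_step bounded_linear_inner_left)
  show ?thesis
    unfolding box_bump_def[abs_def] using 1 2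
    by (intro Ck_prod Ck_mult) (auto simp: algebra_simps)
qed

text \<open>On the box the bump lies in \<open>{0<..1}\<close> and off the box it is
  \<open>0\<close>, hence these smooth functions tend to the indicator of the box.\<close>

definition box_cutoff :: "nat \<Rightarrow> 'a::euclidean_space \<Rightarrow> 'a \<Rightarrow> 'a \<Rightarrow> real" where
  "box_cutoff m a b x = 1 - (1 - box_bump a b x) ^ m"

lemma box_cutoff_bounds: "0 \<le> box_cutoff m a b x" "box_cutoff m a b x \<le> 1"
  using box_bump_bounds[of a b x] by (auto simp: box_cutoff_def intro: power_le_one)

lemma box_cutoff_outside: "x \<notin> box a b \<Longrightarrow> box_cutoff m a b x = 0"
  using box_bump_pos_iff[of a b x] box_bump_bounds[of a b x] by (simp add: box_cutoff_def)

lemma box_cutoff_tendsto: "(\<lambda>m. box_cutoff m a b x) \<longlonglongrightarrow> indicator (box a b) x"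
proof (cases "x \<in> box a b")
  case True
  then have "(\<lambda>m. (1 - box_bump a b x) ^ m) \<longlonglongrightarrow> 0"
    using box_bump_pos_iff[of a b x] box_bump_bounds[of a b x] by (intro LIMSEQ_power_zero) auto
  from tendsto_diff[OF tendsto_const[of 1] this] True show ?thesis
    by (simp add: box_cutoff_def)
qed (simp add: box_cutoff_outside)

lemma Ck_box_cutoff: "Ck k (box_cutoff m a b)"
  unfolding box_cutoff_def[abs_def] by (intro Ck_diff Ck_power Ck_const Ck_box_bump)

lemma box_cutoff_test: "cbox a b \<subseteq> U \<Longrightarrow> box_cutoff m a b \<in> test_functions U"
proof -
  assume "cbox a b \<subseteq> U"
  have "closure {x. box_cutoff m a b x \<noteq> 0} \<subseteq> cbox a b"
    by (rule closure_minimal) (use box_cutoff_outside box_subset_cbox in fastforce)+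
  moreover from this have "compact (closure {x. box_cutoff m a b x \<noteq> 0})"
    using bounded_subset[OF bounded_cbox] by (simp add: compact_eq_bounded_closed)
  ultimately show ?thesis
    using \<open>cbox a b \<subseteq> U\<close> by (auto simp: test_functions_def Ck_box_cutoff)
qed

text \<open>Any compact set outside of which the function vanishes serves as witness, so that
  constructions of test functions need not determine a closed support.\<close>

lemma test_functions_iff:
  "\<phi> \<in> test_functions U \<longleftrightarrow> (\<forall>k. Ck k \<phi>) \<and> (\<exists>K. compact K \<and> K \<subseteq> U \<and> (\<forall>x. x \<notin> K \<longrightarrow> \<phi> x = 0))"
proof
  assume "\<phi> \<in> test_functions U"
  then show "(\<forall>k. Ck k \<phi>) \<and> (\<exists>K. compact K \<and> K \<subseteq> U \<and> (\<forall>x. x \<notin> K \<longrightarrow> \<phi> x = 0))"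
    using closure_subset[of "{x. \<phi> x \<noteq> 0}"] unfolding test_functions_def by blast
next
  assume *: "(\<forall>k. Ck k \<phi>) \<and> (\<exists>K. compact K \<and> K \<subseteq> U \<and> (\<forall>x. x \<notin> K \<longrightarrow> \<phi> x = 0))"
  then obtain K where K: "compact K" "K \<subseteq> U" "\<And>x. x \<notin> K \<Longrightarrow> \<phi> x = 0" by auto
  have sub: "closure {x. \<phi> x \<noteq> 0} \<subseteq> K"
    by (rule closure_minimal) (use K compact_imp_closed in auto)
  then have "compact (closure {x. \<phi> x \<noteq> 0})"
    by (metis K(1) compact_closure bounded_subset closure_subset compact_imp_bounded order_trans)
  then show "\<phi> \<in> test_functions U"
    using sub * K(2) by (auto simp: test_functions_def)
qed

lemma test_functions_Ck: "\<phi> \<in> test_functions U \<Longrightarrow> Ck k \<phi>"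
  by (simp add: test_functions_def)

lemma test_functions_has_derivative:
  "\<phi> \<in> test_functions U \<Longrightarrow> (\<phi> has_derivative frechet_derivative \<phi> (at x)) (at x)"
  by (rule Ck_Suc_has_derivative, rule test_functions_Ck)

lemma test_functions_continuous: "\<phi> \<in> test_functions U \<Longrightarrow> continuous_on S \<phi>"
  using test_functions_Ck[of \<phi> U 0] continuous_on_subset by auto

lemma test_functions_zero_outside: "\<phi> \<in> test_functions U \<Longrightarrow> x \<notin> U \<Longrightarrow> \<phi> x = 0"
  unfolding test_functions_iff by blast

lemma test_functions_deriv:
  assumes "\<phi> \<in> test_functions U"
  shows "(\<lambda>x. frechet_derivative \<phi> (at x) v) \<in> test_functions U"
proof -
  have lin: "linear (frechet_derivative \<phi> (at x))" for x
    using test_functions_has_derivative[OF assms] has_derivative_linear by blast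
  have eq: "frechet_derivative \<phi> (at x) v = (\<Sum>i\<in>Basis. (v \<bullet> i) *\<^sub>R frechet_derivative \<phi> (at x) i)" for x
    by (subst euclidean_representation[of v, symmetric])
       (simp add: linear_sum[OF lin] linear_scale[OF lin] del: euclidean_representation)
  have "Ck k (\<lambda>x. frechet_derivative \<phi> (at x) v)" for k
    using Ck_Suc_deriv[OF test_functions_Ck[OF assms]]
    by (simp add: eq, intro Ck_sum Ck_scaleR Ck_const)
  moreover obtain K where K: "compact K" "K \<subseteq> U" "\<And>x. x \<notin> K \<Longrightarrow> \<phi> x = 0"
    using assms test_functions_iff by metis
  have "frechet_derivative \<phi> (at x) v = 0" if "x \<notin> K" for x
  proof -
    \<comment> \<open>The complement of K is open, so the function vanishes on a whole neighbourhood
      of x.\<close>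
    have "((\<lambda>x. 0) has_derivative (\<lambda>h. 0)) (at x)" by simp
    then have "(\<phi> has_derivative (\<lambda>h. 0)) (at x)"
      by (rule has_derivative_transform_within_open[where s="- K"])
         (use that K compact_imp_closed in auto)
    from frechet_derivative_at[OF this] show ?thesis by metis
  qed
  ultimately show ?thesis
    using K test_functions_iff by blast
qed

lemma test_functions_bounded:
  assumes "\<phi> \<in> test_functions U"
  obtains B where "0 < B" "\<And>x. norm (\<phi> x) \<le> B"
proof -
  obtain K where K: "compact K" "K \<subseteq> U" "\<And>x. x \<notin> K \<Longrightarrow> \<phi> x = 0"
    using assms test_functions_iff by metis
  have "compact (\<phi> ` K)"
    by (intro compact_continuous_image K test_functions_continuous[OF assms])
  then obtain B where "0 < B" "\<forall>x\<in>\<phi> ` K. norm x \<le> B"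
    using compact_imp_bounded bounded_pos by metis
  with K that[of B] show ?thesis
    by (metis imageI less_imp_le norm_zero)
qed

lemma test_functions_measurable [measurable_dest]:
  "\<phi> \<in> test_functions U \<Longrightarrow> \<phi> \<in> borel_measurable borel"
  using test_functions_continuous borel_measurable_continuous_onI by blast

lemma test_functions_bounded_linear_image:
  "bounded_linear L \<Longrightarrow> \<phi> \<in> test_functions U \<Longrightarrow> (\<lambda>x. L (\<phi> x)) \<in> test_functions U"
  unfolding test_functions_iff
  by (auto intro: Ck_linear_compose) (metis linear_simps(3))

lemma test_functions_translate:
  assumes "\<phi> \<in> test_functions V" "\<And>x. x \<in> V \<Longrightarrow> x + c \<in> U"
  shows "(\<lambda>x. \<phi> (x - c)) \<in> test_functions U"
proof -
  obtain K where K: "compact K" "K \<subseteq> V" "\<And>x. x \<notin> K \<Longrightarrow> \<phi> x = 0"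
    using assms test_functions_iff by metis
  have "Ck k (\<lambda>x. \<phi> (x - c))" for k
    using Ck_compose_affine[OF bounded_linear_ident test_functions_Ck[OF assms(1)], of k "- c"] by simp
  moreover have "compact ((\<lambda>x. x + c) ` K)" 
    by (intro compact_continuous_image continuous_intros K(1))
  moreover have "\<phi> (x - c) = 0" if "x \<notin> (\<lambda>x. x + c) ` K" for x
    using that K(3)[of "x - c"] by (force simp: image_iff)
  ultimately show ?thesis
    unfolding test_functions_iff using K(2) assms(2) by (intro conjI allI exI[of _ "(\<lambda>x. x + c) ` K"]) auto
qed

lemma frechet_derivative_translate:
  assumes "\<phi> \<in> test_functions V"
  shows "frechet_derivative (\<lambda>x. \<phi> (x - c)) (at x) v = frechet_derivative \<phi> (at (x - c)) v"
proof -
  have "((\<lambda>x. x - c) has_derivative (\<lambda>h. h)) (at x)"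
    by (auto intro!: derivative_eq_intros)
  from has_derivative_compose[OF this test_functions_has_derivative[OF assms]]
  show ?thesis using frechet_derivative_at by metis
qed

subsection \<open>The fundamental lemma of the calculus of variations\<close>

lemma AE_lebesgue_on_open_iff:
  fixes U :: "'a::euclidean_space set"
  assumes "open U"
  shows "(AE x in lebesgue_on U. P x) \<longleftrightarrow> (AE x in lborel. x \<in> U \<longrightarrow> P x)"
  using assms by (subst AE_restrict_space_iff) (auto simp: AE_completion_iff)

text \<open>Borel versions, extended by \<open>0\<close>: Fubini's theorem is available for
  \<^const>\<open>lborel\<close>, but the completed measure on a product space is not a product
  measure.\<close>

definition representative ::
    "'a::euclidean_space set \<Rightarrow> ('a \<Rightarrow> 'b::euclidean_space) \<Rightarrow> ('a \<Rightarrow> 'b) \<Rightarrow> bool" where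
  "representative U f f' \<longleftrightarrow> f' \<in> borel_measurable borel \<and> (\<forall>x. x \<notin> U \<longrightarrow> f' x = 0) \<and>
     (AE x in lborel. x \<in> U \<longrightarrow> f' x = f x)"

lemma representative_exists:
  fixes f :: "'a::euclidean_space \<Rightarrow> 'b::euclidean_space"
  assumes U: "open U" and f: "f \<in> borel_measurable (lebesgue_on U)"
  obtains f' where "representative U f f'"
proof -
  have fm: "(\<lambda>x. if x \<in> U then f x else 0) \<in> borel_measurable lebesgue"
    using U f by (intro borel_measurable_if_I) auto
  have "\<exists>g\<in>borel_measurable lborel. AE x in lborel. (if x \<in> U then f x else 0) \<bullet> i = g x" for i
    by (rule completion_ex_borel_measurable_real) (use fm in measurable)
  then obtain g where g[measurable]: "\<And>i. g i \<in> borel_measurable lborel"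
      and ae: "\<And>i. AE x in lborel. (if x \<in> U then f x else 0) \<bullet> i = g i x"
    by metis
  define f' where "f' x = (if x \<in> U then \<Sum>i\<in>Basis. g i x *\<^sub>R i else 0)" for x
  have "f' \<in> borel_measurable borel"
    using borel_open[OF U] unfolding f'_def[abs_def] by measurable
  moreover have "AE x in lborel. \<forall>i\<in>Basis. (if x \<in> U then f x else 0) \<bullet> i = g i x"
    by (rule AE_finite_allI) (use ae in auto)
  then have "AE x in lborel. x \<in> U \<longrightarrow> f' x = f x"
  proof eventually_elim
    case (elim x)
    show ?case
      using elim by (auto simp: f'_def euclidean_representation intro!: trans[OF _ euclidean_representation[of "f x"]] sum.cong)
  qed
  ultimately show thesis
    using that[of f'] by (simp add: representative_def) (simp add: f'_def)
qed

lemma representative_measurable: "representative U f f' \<Longrightarrow> f' \<in> borel_measurable borel"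
  by (simp add: representative_def)

lemma representative_AE: "representative U f f' \<Longrightarrow> AE x in lborel. x \<in> U \<longrightarrow> f' x = f x"
  by (simp add: representative_def)

text \<open>Completion and restriction both disappear, because the version f' is Borel and vanishes
  off U.\<close>

lemma representative_integral:
  fixes f :: "'a::euclidean_space \<Rightarrow> 'b::euclidean_space"
  assumes U: "open U" and r: "representative U f f'" and f: "f \<in> borel_measurable (lebesgue_on U)"
  shows "integral\<^sup>L (lebesgue_on U) f = integral\<^sup>L lborel f'"
    and "integrable (lebesgue_on U) f \<longleftrightarrow> integrable lborel f'"
proof -
  have f'[measurable]: "f' \<in> borel_measurable borel"
    using r by (simp add: representative_def)
  have f'm: "f' \<in> borel_measurable (lebesgue_on U)"
    by (rule measurable_restrict_space1, rule measurable_completion) simp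
  have ae: "AE x in lebesgue_on U. f x = f' x"
    using r by (subst AE_lebesgue_on_open_iff[OF U]) (auto simp: representative_def elim!: eventually_mono)
  have eq: "(\<lambda>x. indicator U x *\<^sub>R f' x) = f'"
    using r by (auto simp: representative_def indicator_def)
  have Us: "U \<inter> space lebesgue \<in> sets lebesgue" using U by simp
  have "integral\<^sup>L (lebesgue_on U) f = integral\<^sup>L (lebesgue_on U) f'"
    by (rule integral_cong_AE[OF f f'm ae])
  also have "\<dots> = integral\<^sup>L lborel f'"
    by (subst integral_restrict_space[OF Us]) (simp add: eq integral_completion)
  finally show "integral\<^sup>L (lebesgue_on U) f = integral\<^sup>L lborel f'" .
  have "integrable (lebesgue_on U) f \<longleftrightarrow> integrable (lebesgue_on U) f'"
    by (rule integrable_cong_AE[OF f f'm ae])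
  also have "\<dots> \<longleftrightarrow> integrable lborel f'"
    by (subst integrable_restrict_space[OF Us]) (simp add: eq integrable_completion)
  finally show "integrable (lebesgue_on U) f \<longleftrightarrow> integrable lborel f'" .
qed

text \<open>The Borel sets over which f integrates to 0 are closed under complements and countable
  disjoint unions, and the open boxes are an intersection-stable generator; so f and 0 are densities
  with the same integral over every Borel set.\<close>

lemma AE_eq_0_if_box_integrals_eq_0:
  fixes f :: "'a::euclidean_space \<Rightarrow> real"
  assumes f: "integrable lborel f" and box0: "\<And>a b. (\<integral>x. indicator (box a b) x * f x \<partial>lborel) = 0"
  shows "AE x in lborel. f x = 0"
proof (rule density_unique_real[OF f])
  have fi: "integrable lborel (\<lambda>x. indicator A x * f x)" if "A \<in> sets borel" for A
    using integrable_mult_indicator[of A lborel f] that f by simp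
  define G where "G = range (\<lambda>(a, b). box a b :: 'a set)"
  have sets: "sets borel = sigma_sets UNIV G"
    unfolding G_def by (subst borel_eq_box) simp
  \<comment> \<open>The whole space is needed for the complements; it is exhausted by the boxes of
    half-width n.\<close>
  have total: "(\<integral>x. f x \<partial>lborel) = 0"
  proof -
    have "(\<lambda>n. \<integral>x. indicator (box (- (real n *\<^sub>R One)) (real n *\<^sub>R One)) x * f x \<partial>lborel) \<longlonglongrightarrow> (\<integral>x. f x \<partial>lborel)"
    proof (rule integral_dominated_convergence[where w="\<lambda>x. norm (f x)"])
      show "AE x in lborel. (\<lambda>n. indicator (box (- (real n *\<^sub>R One)) (real n *\<^sub>R One)) x * f x) \<longlonglongrightarrow> f x"
      proof (rule AE_I2)
        fix x :: 'a
        obtain n0 :: nat where n0: "norm x < real n0" using reals_Archimedean2 by blast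
        have "x \<in> box (- (real n *\<^sub>R One)) (real n *\<^sub>R One)" if "n \<ge> n0" for n
        proof -
          have "\<bar>x \<bullet> i\<bar> < real n" if "i \<in> Basis" for i
            using Basis_le_norm[OF that, of x] n0 \<open>n \<ge> n0\<close> by linarith
          then show ?thesis by (auto simp: mem_box abs_less_iff minus_less_iff)
        qed
        then have "\<forall>\<^sub>F n in sequentially. indicator (box (- (real n *\<^sub>R One)) (real n *\<^sub>R One)) x * f x = f x"
          by (auto simp: eventually_sequentially intro!: exI[of _ n0])
        then show "(\<lambda>n. indicator (box (- (real n *\<^sub>R One)) (real n *\<^sub>R One)) x * f x) \<longlonglongrightarrow> f x"
          by (rule tendsto_eventually)
      qed
    qed (use f in \<open>auto simp: indicator_def\<close>)
    then show ?thesis using box0 LIMSEQ_unique[OF _ tendsto_const] by simp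
  qed
  fix A :: "'a set" assume "A \<in> sets lborel"
  then have "A \<in> sigma_sets UNIV G" using sets by simp
  have "Int_stable G"
    unfolding G_def Int_stable_def by (force simp: box_Int_box)
  moreover have "G \<subseteq> Pow UNIV" by simp
  ultimately have "(\<integral>x. indicator A x * f x \<partial>lborel) = 0"
    using \<open>A \<in> sigma_sets UNIV G\<close>
  proof (induction rule: sigma_sets_induct_disjoint)
    case (basic A)
    then show ?case using box0 by (auto simp: G_def)
  next
    case empty
    then show ?case by simp
  next
    case (compl A)
    then have A: "A \<in> sets borel" using sets by simp
    have "(\<integral>x. indicator (UNIV - A) x * f x \<partial>lborel) = (\<integral>x. f x - indicator A x * f x \<partial>lborel)"
      by (rule Bochner_Integration.integral_cong) (auto simp: indicator_def)
    also have "\<dots> = 0" using compl total f fi[OF A] by simp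
    finally show ?case .
  next
    case (union A)
    then have A[measurable]: "A i \<in> sets borel" for i using sets by auto
    have "(\<lambda>n. \<integral>x. indicator (\<Union>i<n. A i) x * f x \<partial>lborel) \<longlonglongrightarrow> (\<integral>x. indicator (\<Union>i. A i) x * f x \<partial>lborel)"
    proof (rule integral_dominated_convergence[where w="\<lambda>x. norm (f x)"])
      show "AE x in lborel. (\<lambda>n. indicator (\<Union>i<n. A i) x * f x) \<longlonglongrightarrow> indicator (\<Union>i. A i) x * f x"
        by (intro AE_I2 tendsto_mult tendsto_const LIMSEQ_indicator_UN)
    qed (use f in \<open>auto simp: indicator_def\<close>)
    moreover have "(\<integral>x. indicator (\<Union>i<n. A i) x * f x \<partial>lborel) = 0" for n
    proof -
      have "(\<integral>x. indicator (\<Union>i<n. A i) x * f x \<partial>lborel) = (\<integral>x. (\<Sum>i<n. indicator (A i) x * f x) \<partial>lborel)"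
        using union(1)
        by (intro Bochner_Integration.integral_cong)
           (auto simp: indicator_UN_disjoint disjoint_family_on_def sum_distrib_right)
      also have "\<dots> = (\<Sum>i<n. \<integral>x. indicator (A i) x * f x \<partial>lborel)"
        by (rule Bochner_Integration.integral_sum) (use fi A in blast)
      also have "\<dots> = 0" using union(3) by simp
      finally show ?thesis .
    qed
    ultimately show ?case using LIMSEQ_unique[OF _ tendsto_const] by simp
  qed
  then show "(LINT x:A|lborel. f x) = (LINT x:A|lborel. 0)"
    by (simp add: set_lebesgue_integral_def)
qed simp

text \<open>Integrals over sub-boxes are limits of integrals against cutoffs, dominated by the norm
  of f. Only tests vanishing off \<open>box c d\<close> occur in the hypothesis, so that a locally
  integrable function can later be replaced by its restriction to \<open>cbox c d\<close>.\<close>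

lemma AE_eq_0_on_box_if_test_integrals_eq_0:
  fixes f :: "'a::euclidean_space \<Rightarrow> real"
  assumes f: "integrable lborel f" and cd: "cbox c d \<subseteq> U"
    and test0: "\<And>\<phi>. \<phi> \<in> test_functions U \<Longrightarrow> (\<And>x. x \<notin> box c d \<Longrightarrow> \<phi> x = 0) \<Longrightarrow>
      (\<integral>x. \<phi> x * f x \<partial>lborel) = 0"
  shows "AE x in lborel. x \<in> box c d \<longrightarrow> f x = 0"
proof -
  have "AE x in lborel. indicator (box c d) x * f x = 0"
  proof (rule AE_eq_0_if_box_integrals_eq_0)
    show "integrable lborel (\<lambda>x. indicator (box c d) x * f x)"
      using integrable_mult_indicator[of "box c d" lborel f] f by simp
    fix a b :: 'a
    obtain a' b' where ab: "box a b \<inter> box c d = box a' b'" by (rule that[OF box_Int_box[of a b c d]])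
    have "(\<integral>x. indicator (box a b) x * (indicator (box c d) x * f x) \<partial>lborel)
        = (\<integral>x. indicator (box a' b') x * f x \<partial>lborel)"
      by (rule Bochner_Integration.integral_cong) (auto simp: ab[symmetric] indicator_def)
    also have "\<dots> = 0"
    \<comment> \<open>An empty open box may belong to a nonempty, degenerate closed box that leaves
      U, so the closure argument is reserved for a nonempty intersection.\<close>
    proof (cases "box a' b' = {}")
      case False
      then have "cbox a' b' = closure (box a' b')" by simp
      also have "\<dots> \<subseteq> cbox c d" by (rule closure_minimal) (use ab box_subset_cbox in auto)
      finally have sub: "cbox a' b' \<subseteq> U" using cd by auto
      have "(\<lambda>m. \<integral>x. box_cutoff m a' b' x * f x \<partial>lborel) \<longlonglongrightarrow> (\<integral>x. indicator (box a' b') x * f x \<partial>lborel)"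
      proof (rule integral_dominated_convergence[where w="\<lambda>x. norm (f x)"])
        show "AE x in lborel. (\<lambda>m. box_cutoff m a' b' x * f x) \<longlonglongrightarrow> indicator (box a' b') x * f x"
          by (intro AE_I2 tendsto_mult tendsto_const box_cutoff_tendsto)
        show "AE x in lborel. norm (box_cutoff m a' b' x * f x) \<le> norm (f x)" for m
          using box_cutoff_bounds[of m a' b'] by (auto simp: abs_mult intro!: AE_I2 mult_left_le_one_le)
        show "(\<lambda>x. box_cutoff m a' b' x * f x) \<in> borel_measurable lborel" for m
          using f test_functions_measurable[OF box_cutoff_test[OF sub]] by measurable
      qed (use f in auto)
      moreover have "(\<integral>x. box_cutoff m a' b' x * f x \<partial>lborel) = 0" for m
        by (rule test0[OF box_cutoff_test[OF sub]]) (metis IntI Int_iff ab box_cutoff_outside)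
      ultimately show ?thesis using LIMSEQ_unique[OF _ tendsto_const] by simp
    qed simp
    finally show "(\<integral>x. indicator (box a b) x * (indicator (box c d) x * f x) \<partial>lborel) = 0" .
  qed
  then show ?thesis by eventually_elim (auto simp: indicator_def)
qed

text \<open>U is a countable union of compact boxes, and f is integrable, hence measurable, on each
  of them; the complement of U is one more piece.\<close>

lemma locally_integrable_measurable:
  fixes f :: "'a::euclidean_space \<Rightarrow> 'b::euclidean_space"
  assumes U: "open U" and f: "locally_integrable U f"
  shows "f \<in> borel_measurable (lebesgue_on U)"
proof -
  obtain D where D: "countable D" "D \<subseteq> Pow U" "\<And>X. X \<in> D \<Longrightarrow> \<exists>a b. X = cbox a b" "\<Union>D = U"
    using open_countable_Union_open_cbox[OF U] by metis
  have "(\<lambda>x. if x \<in> U then f x else 0) \<in> borel_measurable lebesgue"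
  proof (rule measurable_piecewise_restrict[of "insert (- U) D"])
    fix X assume X: "X \<in> insert (- U) D"
    show "(\<lambda>x. if x \<in> U then f x else 0) \<in> lebesgue_on X \<rightarrow>\<^sub>M borel"
    proof (cases "X = - U")
      case True
      then show ?thesis by (subst measurable_lebesgue_cong[where g="\<lambda>x. 0"]) auto
    next
      case False
      then have "X \<in> D" using X by simp
      then have "integrable (lebesgue_on X) f" "X \<subseteq> U"
        using f D(2) D(3)[of X] by (auto simp: locally_integrable_def)
      then show ?thesis
        by (subst measurable_lebesgue_cong[where g=f]) auto
    qed
  next
    fix X assume "X \<in> insert (- U) D"
    then show "X \<inter> space lebesgue \<in> sets lebesgue"
      using D(3)[of X] U by auto
  qed (use D in auto)
  then show ?thesis by (rule borel_measurable_if_D)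
qed

lemma locally_integrable_diff:
  fixes f :: "'a::euclidean_space \<Rightarrow> 'b::euclidean_space"
  shows "locally_integrable U f \<Longrightarrow> locally_integrable U g \<Longrightarrow> locally_integrable U (\<lambda>x. f x - g x)"
  unfolding locally_integrable_def by auto

lemma test_function_times_locally_integrable:
  fixes f :: "'a::euclidean_space \<Rightarrow> 'b::euclidean_space" and \<phi> :: "'a \<Rightarrow> real"
  assumes U: "open U" and f: "locally_integrable U f" and \<phi>: "\<phi> \<in> test_functions U"
  shows "integrable (lebesgue_on U) (\<lambda>x. \<phi> x *\<^sub>R f x)"
proof -
  obtain K where K: "compact K" "K \<subseteq> U" "\<And>x. x \<notin> K \<Longrightarrow> \<phi> x = 0"
    using \<phi> test_functions_iff by metis
  obtain B where B: "\<And>x. norm (\<phi> x) \<le> B" using test_functions_bounded[OF \<phi>] by metis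
  have Km: "K \<in> sets lebesgue" using K(1) by (simp add: lmeasurable_compact fmeasurableD)
  have "integrable (lebesgue_on K) f" using f K by (simp add: locally_integrable_def)
  then have "integrable (lebesgue_on K) (\<lambda>x. B *\<^sub>R f x)" by simp
  then have "integrable (lebesgue_on K) (\<lambda>x. \<phi> x *\<^sub>R f x)"
  proof (rule Bochner_Integration.integrable_bound)
    have "\<phi> \<in> borel_measurable (lebesgue_on K)"
      by (rule measurable_restrict_space1, rule measurable_completion) (use test_functions_measurable[OF \<phi>] in simp)
    then show "(\<lambda>x. \<phi> x *\<^sub>R f x) \<in> borel_measurable (lebesgue_on K)"
      using \<open>integrable (lebesgue_on K) f\<close> by measurable
    have "norm (\<phi> x *\<^sub>R f x) \<le> norm (B *\<^sub>R f x)" for x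
      unfolding norm_scaleR by (rule mult_right_mono) (use B[of x] in auto)
    then show "AE x in lebesgue_on K. norm (\<phi> x *\<^sub>R f x) \<le> norm (B *\<^sub>R f x)" by simp
  qed
  then have "integrable lebesgue (\<lambda>x. indicator K x *\<^sub>R (\<phi> x *\<^sub>R f x))"
    using Km by (simp add: integrable_restrict_space)
  also have "(\<lambda>x. indicator K x *\<^sub>R (\<phi> x *\<^sub>R f x)) = (\<lambda>x. indicator U x *\<^sub>R (\<phi> x *\<^sub>R f x))"
    using K by (auto simp: indicator_def fun_eq_iff)
  finally show ?thesis using U by (simp add: integrable_restrict_space)
qed

text \<open>The boxes with rational corners whose closed boxes lie in U form a countable cover of U.
  On each of them f is integrable and the result for boxes applies in every coordinate; countably
  many null sets form a null set.\<close>

lemma fundamental_lemma: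
  fixes f :: "'a::euclidean_space \<Rightarrow> 'b::euclidean_space"
  assumes U: "open U" and f: "locally_integrable U f"
    and test0: "\<And>\<phi>::'a \<Rightarrow> real. \<phi> \<in> test_functions U \<Longrightarrow> integral\<^sup>L (lebesgue_on U) (\<lambda>x. \<phi> x *\<^sub>R f x) = 0"
  shows "AE x in lborel. x \<in> U \<longrightarrow> f x = 0"
proof -
  have fm: "f \<in> borel_measurable (lebesgue_on U)"
    by (rule locally_integrable_measurable[OF U f])
  obtain f' where r: "representative U f f'" using representative_exists[OF U fm] .
  note f'[measurable] = representative_measurable[OF r]
  obtain D where D: "countable D" "D \<subseteq> Pow U" "\<And>X. X \<in> D \<Longrightarrow> \<exists>a b. X = box a b \<and> cbox a b \<subseteq> U" "\<Union>D = U"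
  proof -
    have "\<exists>a b. (\<forall>i\<in>Basis. a \<bullet> i \<in> \<rat> \<and> b \<bullet> i \<in> \<rat>) \<and> x \<in> box a b \<and> cbox a b \<subseteq> U" if x: "x \<in> U" for x
    proof -
      obtain e where e: "e > 0" "cball x e \<subseteq> U" using open_contains_cball U x by blast
      then obtain a b where ab: "\<forall>i\<in>Basis. a \<bullet> i \<in> \<rat> \<and> b \<bullet> i \<in> \<rat>" "x \<in> box a b" "box a b \<subseteq> ball x e"
        using rational_boxes[OF e(1)] by blast
      have "cbox a b = closure (box a b)" using ab(2) closure_box[of a b] by blast
      also have "\<dots> \<subseteq> cball x e" by (rule closure_minimal) (use ab(3) in auto)
      finally show ?thesis using ab e by blast
    qed
    then have "U \<subseteq> \<Union>{X. \<exists>a b. (\<forall>i\<in>Basis. a \<bullet> i \<in> \<rat> \<and> b \<bullet> i \<in> \<rat>) \<and> X = box a b \<and> cbox a b \<subseteq> U}"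
      by blast
    moreover have "\<Union>{X. \<exists>a b. (\<forall>i\<in>Basis. a \<bullet> i \<in> \<rat> \<and> b \<bullet> i \<in> \<rat>) \<and> X = box a b \<and> cbox a b \<subseteq> U} \<subseteq> U"
      using box_subset_cbox by blast
    ultimately have cov: "\<Union>{X. \<exists>a b. (\<forall>i\<in>Basis. a \<bullet> i \<in> \<rat> \<and> b \<bullet> i \<in> \<rat>) \<and> X = box a b \<and> cbox a b \<subseteq> U} = U"
      by (rule subset_antisym[rotated])
    have c1: "countable {a::'a. \<forall>i\<in>Basis. a \<bullet> i \<in> \<rat>}"
    proof (rule countable_subset)
      show "countable ((\<lambda>g. \<Sum>i\<in>Basis. g i *\<^sub>R i) ` (Basis \<rightarrow>\<^sub>E \<rat>) :: 'a set)"
        by (intro countable_image countable_PiE countable_rat) auto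
      show "{a::'a. \<forall>i\<in>Basis. a \<bullet> i \<in> \<rat>} \<subseteq> (\<lambda>g. \<Sum>i\<in>Basis. g i *\<^sub>R i) ` (Basis \<rightarrow>\<^sub>E \<rat>)"
      proof
        fix a :: 'a assume a: "a \<in> {a. \<forall>i\<in>Basis. a \<bullet> i \<in> \<rat>}"
        show "a \<in> (\<lambda>g. \<Sum>i\<in>Basis. g i *\<^sub>R i) ` (Basis \<rightarrow>\<^sub>E \<rat>)"
          by (rule image_eqI[of _ _ "restrict ((\<bullet>) a) Basis"]) (use a in \<open>auto simp: euclidean_representation\<close>)
      qed
    qed
    have "countable {X. \<exists>a b. (\<forall>i\<in>Basis. a \<bullet> i \<in> \<rat> \<and> b \<bullet> i \<in> \<rat>) \<and> X = box a b \<and> cbox a b \<subseteq> U}"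
      by (rule countable_subset[of _ "(\<lambda>(a, b). box a b) ` ({a. \<forall>i\<in>Basis. a \<bullet> i \<in> \<rat>} \<times> {a. \<forall>i\<in>Basis. a \<bullet> i \<in> \<rat>})"])
         (use c1 in auto)
    then show thesis
      by (rule that) (use cov in auto)
  qed
  have "AE x in lborel. x \<in> X \<longrightarrow> f' x = 0" if X: "X \<in> D" for X
  proof -
    obtain c d where cd: "X = box c d" "cbox c d \<subseteq> U" using D(3)[OF X] by auto
    \<comment> \<open>Cutting off at \<open>cbox c d\<close> makes a merely locally integrable
      function integrable on the whole space without changing it on the open box.\<close>
    let ?h = "\<lambda>x. indicator (cbox c d) x *\<^sub>R f' x"
    have "integrable (lebesgue_on (cbox c d)) f" using f cd by (simp add: locally_integrable_def)
    then have "integrable lebesgue (\<lambda>x. indicator (cbox c d) x *\<^sub>R f x)"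
      by (simp add: integrable_restrict_space)
    moreover have "AE x in lebesgue. indicator (cbox c d) x *\<^sub>R f x = ?h x"
      using representative_AE[OF r] cd(2)
      by (auto simp: AE_completion_iff indicator_def elim!: eventually_mono)
    ultimately have "integrable lebesgue ?h"
      by (subst integrable_cong_AE[symmetric]) (auto simp: measurable_completion)
    then have hi: "integrable lborel ?h" by (simp add: integrable_completion)
    have "AE x in lborel. x \<in> box c d \<longrightarrow> ?h x \<bullet> i = 0" for i
    proof (rule AE_eq_0_on_box_if_test_integrals_eq_0[OF _ cd(2)])
      show "integrable lborel (\<lambda>x. ?h x \<bullet> i)" by (intro integrable_inner_left hi)
      fix \<phi> :: "'a \<Rightarrow> real" assume \<phi>: "\<phi> \<in> test_functions U" and out: "\<And>x. x \<notin> box c d \<Longrightarrow> \<phi> x = 0"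
      have \<phi>f: "integrable (lebesgue_on U) (\<lambda>x. \<phi> x *\<^sub>R f x)"
        by (rule test_function_times_locally_integrable[OF U f \<phi>])
      have rep: "representative U (\<lambda>x. \<phi> x *\<^sub>R f x) (\<lambda>x. \<phi> x *\<^sub>R f' x)"
        using r test_functions_measurable[OF \<phi>] unfolding representative_def
        by (auto elim!: eventually_mono)
      have "(\<integral>x. \<phi> x *\<^sub>R f' x \<partial>lborel) = 0" "integrable lborel (\<lambda>x. \<phi> x *\<^sub>R f' x)"
        using representative_integral[OF U rep] \<phi>f test0[OF \<phi>] by auto
      then have "(\<integral>x. (\<phi> x *\<^sub>R f' x) \<bullet> i \<partial>lborel) = 0"
        by (subst integral_inner_left) auto
      also have "(\<lambda>x. (\<phi> x *\<^sub>R f' x) \<bullet> i) = (\<lambda>x. \<phi> x * (?h x \<bullet> i))"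
        using out box_subset_cbox[of c d] by (auto simp: indicator_def fun_eq_iff)
      finally show "(\<integral>x. \<phi> x * (?h x \<bullet> i) \<partial>lborel) = 0" .
    qed
    then have "AE x in lborel. \<forall>i\<in>Basis. x \<in> box c d \<longrightarrow> ?h x \<bullet> i = 0"
      by (intro AE_finite_allI) auto
    then show ?thesis
    proof eventually_elim
      case (elim x)
      show ?case
      proof
        assume "x \<in> X"
        then have "x \<in> box c d" "x \<in> cbox c d" using cd(1) box_subset_cbox[of c d] by auto
        with elim have "\<forall>i\<in>Basis. f' x \<bullet> i = 0" by (simp add: indicator_def)
        then show "f' x = 0" by (simp only: euclidean_all_zero_iff)
      qed
    qed
  qed
  then have "AE x in lborel. \<forall>X\<in>D. x \<in> X \<longrightarrow> f' x = 0"
    by (subst AE_ball_countable[OF D(1)]) auto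
  with representative_AE[OF r] show ?thesis
  proof eventually_elim
    case (elim x)
    then show ?case unfolding D(4)[symmetric] by force
  qed
qed

subsection \<open>Weak derivatives and translations\<close>

lemma lborel_integral_translate:
  fixes f :: "'a::euclidean_space \<Rightarrow> 'b::{banach, second_countable_topology}"
  assumes [measurable]: "f \<in> borel_measurable borel"
  shows "(\<integral>x. f (x + c) \<partial>lborel) = (\<integral>x. f x \<partial>lborel)"
    and "integrable lborel (\<lambda>x. f (x + c)) \<longleftrightarrow> integrable lborel f"
proof -
  have "(\<integral>x. f x \<partial>distr lborel borel ((+) c)) = (\<integral>x. f (c + x) \<partial>lborel)"
    by (rule integral_distr) auto
  then show "(\<integral>x. f (x + c) \<partial>lborel) = (\<integral>x. f x \<partial>lborel)"
    by (simp add: lborel_distr_plus add.commute)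
  have "integrable (distr lborel borel ((+) c)) f \<longleftrightarrow> integrable lborel (\<lambda>x. f (c + x))"
    by (rule integrable_distr_eq) auto
  then show "integrable lborel (\<lambda>x. f (x + c)) \<longleftrightarrow> integrable lborel f"
    by (simp add: lborel_distr_plus add.commute)
qed

lemma AE_lborel_translate:
  fixes c :: "'a::euclidean_space"
  assumes "AE x in lborel. P x"
  shows "AE x in lborel. P (x + c)"
proof -
  have "AE x in distr lborel borel ((+) c). P x"
    by (subst lborel_distr_plus) (rule assms)
  then have "AE x in lborel. P (c + x)"
    by (rule AE_distrD[rotated]) auto
  then show ?thesis by (simp add: add.commute)
qed

text \<open>In the applications F s is a translated test function times f, or a translate of g, cut
  off to 0 \<le> s \<le> h. Its norm has a bound independent of s, which makes Fubini's theorem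
  available for integrals along segments.\<close>

lemma integrable_lborel_pairI:
  fixes F :: "real \<Rightarrow> 'a::euclidean_space \<Rightarrow> 'b::{banach, second_countable_topology}"
  assumes m: "(\<lambda>z. F (fst z) (snd z)) \<in> borel_measurable (borel \<Otimes>\<^sub>M borel)"
    and i: "\<And>s. integrable lborel (F s)"
    and b: "\<And>s. (\<integral>x. norm (F s x) \<partial>lborel) \<le> C * indicator {0..h} s"
  shows "integrable (lborel \<Otimes>\<^sub>M lborel) (\<lambda>(s, x). F s x)"
proof (rule lborel_pair.Fubini_integrable)
  show m': "(\<lambda>(s, x). F s x) \<in> borel_measurable (lborel \<Otimes>\<^sub>M lborel)"
    using m by (simp add: split_beta' cong: measurable_cong_sets)
  show "AE s in lborel. integrable lborel (\<lambda>x. (\<lambda>(s, x). F s x) (s, x))"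
    using i by simp
  have m'': "(\<lambda>s. \<integral>x. norm (F s x) \<partial>lborel) \<in> borel_measurable lborel"
    using m' by measurable
  have "integrable lborel (\<lambda>s::real. C * indicator {0..h} s)"
    by (intro integrable_mult_right integrable_real_indicator) (use emeasure_bounded_finite[of "{0..h}"] in auto)
  then show "integrable lborel (\<lambda>s. \<integral>x. norm ((\<lambda>(s, x). F s x) (s, x)) \<partial>lborel)"
    by (rule Bochner_Integration.integrable_bound)
       (use b m'' in \<open>auto intro!: AE_I2 simp: abs_of_nonneg integral_nonneg_AE intro: order_trans[OF _ abs_ge_self]\<close>)
qed

text \<open>All functions live on the whole space, extended by 0, so that translations and Fubini's
  theorem need no domain. The tests stay in U, so nothing is claimed about a jump across the
  boundary of U.\<close>

definition L1_weak_deriv :: "'a::euclidean_space set \<Rightarrow> 'a \<Rightarrow> ('a \<Rightarrow> 'b::euclidean_space) \<Rightarrow> ('a \<Rightarrow> 'b) \<Rightarrow> bool" where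
  "L1_weak_deriv U v f g \<longleftrightarrow> integrable lborel f \<and> integrable lborel g \<and> (\<forall>x. x \<notin> U \<longrightarrow> f x = 0 \<and> g x = 0) \<and>
     (\<forall>\<phi>\<in>test_functions U. (\<integral>x. frechet_derivative \<phi> (at x) v *\<^sub>R f x \<partial>lborel) =
        - (\<integral>x. (\<phi> x :: real) *\<^sub>R g x \<partial>lborel))"

lemma fundamental_lemma_lborel:
  fixes f :: "'a::euclidean_space \<Rightarrow> 'b::euclidean_space"
  assumes U: "open U" and f: "integrable lborel f"
    and test0: "\<And>\<phi>::'a \<Rightarrow> real. \<phi> \<in> test_functions U \<Longrightarrow> (\<integral>x. \<phi> x *\<^sub>R f x \<partial>lborel) = 0"
  shows "AE x in lborel. x \<in> U \<longrightarrow> f x = 0"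
proof (rule fundamental_lemma[OF U])
  have fl: "integrable lebesgue f" using f by (simp add: integrable_completion)
  show "locally_integrable U f"
    unfolding locally_integrable_def
  proof (intro allI impI)
    fix K assume "compact K \<and> K \<subseteq> U"
    then have "K \<in> sets lebesgue" by (simp add: lmeasurable_compact fmeasurableD)
    then show "integrable (lebesgue_on K) f"
      using fl by (simp add: integrable_restrict_space integrable_mult_indicator)
  qed
  fix \<phi> :: "'a \<Rightarrow> real" assume \<phi>: "\<phi> \<in> test_functions U"
  have "(\<lambda>x. indicator U x *\<^sub>R (\<phi> x *\<^sub>R f x)) = (\<lambda>x. \<phi> x *\<^sub>R f x)"
    using test_functions_zero_outside[OF \<phi>] by (auto simp: indicator_def fun_eq_iff)
  then show "integral\<^sup>L (lebesgue_on U) (\<lambda>x. \<phi> x *\<^sub>R f x) = 0"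
    using test0[OF \<phi>] U f test_functions_measurable[OF \<phi>]
    by (simp add: integral_restrict_space integral_completion)
qed

lemma test_times_integrable:
  fixes f :: "'a::euclidean_space \<Rightarrow> 'b::euclidean_space" and \<phi> :: "'a \<Rightarrow> real"
  assumes f: "integrable lborel f" and \<phi>: "\<phi> \<in> test_functions U"
  shows "integrable lborel (\<lambda>x. \<phi> x *\<^sub>R f x)"
proof -
  obtain B where B: "0 < B" "\<And>x. norm (\<phi> x) \<le> B" using test_functions_bounded[OF \<phi>] by metis
  have "integrable lborel (\<lambda>x. B *\<^sub>R f x)" using f by simp
  then show ?thesis
  proof (rule Bochner_Integration.integrable_bound)
    show "(\<lambda>x. \<phi> x *\<^sub>R f x) \<in> borel_measurable lborel"
      using f test_functions_measurable[OF \<phi>] by measurable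
    show "AE x in lborel. norm (\<phi> x *\<^sub>R f x) \<le> norm (B *\<^sub>R f x)"
      using B by (auto intro!: AE_I2 mult_right_mono)
  qed
qed

section \<open>Increments and integrals along segments\<close>

lemma norm_integral_test_le:
  fixes f :: "'a::euclidean_space \<Rightarrow> 'b::euclidean_space" and \<phi> :: "'a \<Rightarrow> real"
  assumes f: "integrable lborel f" and \<phi>: "\<phi> \<in> test_functions U" and B: "\<And>x. \<bar>\<phi> x\<bar> \<le> B"
  shows "(\<integral>x. norm (\<phi> x *\<^sub>R f x) \<partial>lborel) \<le> B * (\<integral>x. norm (f x) \<partial>lborel)"
proof -
  have "(\<integral>x. norm (\<phi> x *\<^sub>R f x) \<partial>lborel) \<le> (\<integral>x. B * norm (f x) \<partial>lborel)"
    by (intro integral_mono integrable_norm test_times_integrable[OF f \<phi>])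
       (use f B in \<open>auto intro!: mult_right_mono\<close>)
  then show ?thesis by simp
qed

lemma line_integral_test_function:
  fixes f :: "'a::euclidean_space \<Rightarrow> 'b::euclidean_space" and \<phi> :: "'a \<Rightarrow> real"
  assumes f: "integrable lborel f" and \<phi>: "\<phi> \<in> test_functions V"
  shows "integrable (lborel \<Otimes>\<^sub>M lborel) (\<lambda>(s::real, x). indicator {0..h} s *\<^sub>R (\<phi> (x - s *\<^sub>R v) *\<^sub>R f x))"
proof -
  note [measurable] = test_functions_measurable[OF \<phi>] borel_measurable_integrable[OF f]
  obtain B where B: "\<And>x. norm (\<phi> x) \<le> B" using test_functions_bounded[OF \<phi>] by metis
  have tr: "(\<lambda>x. \<phi> (x - s *\<^sub>R v)) \<in> test_functions UNIV" for s
    by (rule test_functions_translate[OF \<phi>]) simp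
  show ?thesis
  proof (rule integrable_lborel_pairI)
    show "(\<lambda>z. indicator {0..h} (fst z :: real) *\<^sub>R (\<phi> (snd z - fst z *\<^sub>R v) *\<^sub>R f (snd z))) \<in> borel_measurable (borel \<Otimes>\<^sub>M borel)"
      by measurable
    show "integrable lborel (\<lambda>x. indicator {0..h} s *\<^sub>R (\<phi> (x - s *\<^sub>R v) *\<^sub>R f x))" for s
      by (intro integrable_scaleR_right test_times_integrable[OF f tr])
    show "(\<integral>x. norm (indicator {0..h} s *\<^sub>R (\<phi> (x - s *\<^sub>R v) *\<^sub>R f x)) \<partial>lborel) \<le> (B * (\<integral>x. norm (f x) \<partial>lborel)) * indicator {0..h} s" for s
      using norm_integral_test_le[OF f tr, of s B] B by (auto simp: indicator_def)
  qed
qed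

text \<open>The fundamental theorem of calculus along the segment from x to x - h v, followed by
  Fubini's theorem.\<close>

lemma integral_test_increment:
  fixes f :: "'a::euclidean_space \<Rightarrow> 'b::euclidean_space" and \<phi> :: "'a \<Rightarrow> real"
  assumes f: "integrable lborel f" and \<phi>: "\<phi> \<in> test_functions V" and h: "0 \<le> h"
  shows "(\<integral>x. (\<phi> (x - h *\<^sub>R v) - \<phi> x) *\<^sub>R f x \<partial>lborel) =
     - (LINT s:{0..h}|lborel. \<integral>x. frechet_derivative \<phi> (at (x - s *\<^sub>R v)) v *\<^sub>R f x \<partial>lborel)"
proof -
  let ?d = "\<lambda>x. frechet_derivative \<phi> (at x) v"
  have d: "?d \<in> test_functions V" by (rule test_functions_deriv[OF \<phi>])
  have lin: "linear (frechet_derivative \<phi> (at x))" for x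
    using test_functions_has_derivative[OF \<phi>] has_derivative_linear by blast
  have ftc: "\<phi> (x - h *\<^sub>R v) - \<phi> x = - (\<integral>s. indicator {0..h} s *\<^sub>R ?d (x - s *\<^sub>R v) \<partial>lborel)" for x
  proof -
    have "(\<integral>s. indicator {0..h} s *\<^sub>R (- ?d (x - s *\<^sub>R v)) \<partial>lborel) = \<phi> (x - h *\<^sub>R v) - \<phi> (x - 0 *\<^sub>R v)"
    proof (rule integral_FTC_Icc[OF h])
      fix s :: real
      have "((\<lambda>s. x - s *\<^sub>R v) has_derivative (\<lambda>r. - (r *\<^sub>R v))) (at s within {0..h})"
        by (auto intro!: derivative_eq_intros)
      from has_derivative_compose[OF this test_functions_has_derivative[OF \<phi>]]
      show "((\<lambda>s. \<phi> (x - s *\<^sub>R v)) has_vector_derivative - ?d (x - s *\<^sub>R v)) (at s within {0..h})"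
        by (simp add: has_vector_derivative_def linear_neg[OF lin] linear_scale[OF lin])
    next
      show "continuous_on {0..h} (\<lambda>s. - ?d (x - s *\<^sub>R v))"
        by (intro continuous_intros continuous_on_compose2[OF test_functions_continuous[OF d, of UNIV]]) auto
    qed
    then show ?thesis by simp
  qed
  have "(\<integral>x. (\<phi> (x - h *\<^sub>R v) - \<phi> x) *\<^sub>R f x \<partial>lborel) =
      (\<integral>x. - (\<integral>s. indicator {0..h} s *\<^sub>R (?d (x - s *\<^sub>R v) *\<^sub>R f x) \<partial>lborel) \<partial>lborel)"
  proof (rule Bochner_Integration.integral_cong[OF refl])
    fix x
    have "integrable lborel (\<lambda>s. indicator {0..h} s *\<^sub>R ?d (x - s *\<^sub>R v))"
      by (rule borel_integrable_compact)
         (auto intro!: continuous_intros continuous_on_compose2[OF test_functions_continuous[OF d, of UNIV]])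
    then have "(\<integral>s. (indicator {0..h} s *\<^sub>R ?d (x - s *\<^sub>R v)) *\<^sub>R f x \<partial>lborel) =
        (\<integral>s. indicator {0..h} s *\<^sub>R ?d (x - s *\<^sub>R v) \<partial>lborel) *\<^sub>R f x"
      by (intro integral_scaleR_left)
    then show "(\<phi> (x - h *\<^sub>R v) - \<phi> x) *\<^sub>R f x = - (\<integral>s. indicator {0..h} s *\<^sub>R (?d (x - s *\<^sub>R v) *\<^sub>R f x) \<partial>lborel)"
      unfolding ftc by simp
  qed
  also have "\<dots> = - (\<integral>x. \<integral>s. indicator {0..h} s *\<^sub>R (?d (x - s *\<^sub>R v) *\<^sub>R f x) \<partial>lborel \<partial>lborel)"
    by simp
  also have "(\<integral>x. \<integral>s. indicator {0..h} s *\<^sub>R (?d (x - s *\<^sub>R v) *\<^sub>R f x) \<partial>lborel \<partial>lborel) =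
      (\<integral>s. \<integral>x. indicator {0..h} s *\<^sub>R (?d (x - s *\<^sub>R v) *\<^sub>R f x) \<partial>lborel \<partial>lborel)"
    by (rule lborel_pair.Fubini_integral[OF line_integral_test_function[OF f d, of h v]])
  also have "\<dots> = (LINT s:{0..h}|lborel. \<integral>x. ?d (x - s *\<^sub>R v) *\<^sub>R f x \<partial>lborel)"
    by (simp only: set_lebesgue_integral_def integral_scaleR_right)
  finally show ?thesis .
qed

text \<open>Translation invariance moves the increment from f to the smooth factor: a discrete
  integration by parts.\<close>

lemma integral_increment_test:
  fixes f :: "'a::euclidean_space \<Rightarrow> 'b::euclidean_space" and \<phi> :: "'a \<Rightarrow> real"
  assumes f: "integrable lborel f" and \<phi>: "\<phi> \<in> test_functions V"
  shows "(\<integral>x. \<phi> x *\<^sub>R (f (x + c) - f x) \<partial>lborel) = (\<integral>x. (\<phi> (x - c) - \<phi> x) *\<^sub>R f x \<partial>lborel)"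
proof -
  note [measurable] = test_functions_measurable[OF \<phi>] borel_measurable_integrable[OF f]
  have tr: "(\<lambda>x. \<phi> (x - c)) \<in> test_functions UNIV"
    by (rule test_functions_translate[OF \<phi>]) simp
  have i: "integrable lborel (\<lambda>x. \<phi> (x - c) *\<^sub>R f x)" by (rule test_times_integrable[OF f tr])
  have eq: "(\<lambda>x. \<phi> x *\<^sub>R f (x + c)) = (\<lambda>x. (\<lambda>y. \<phi> (y - c) *\<^sub>R f y) (x + c))" by simp
  have i': "integrable lborel (\<lambda>x. \<phi> x *\<^sub>R f (x + c))"
    unfolding eq by (subst lborel_integral_translate(2)) (use i in auto)
  have "(\<integral>x. \<phi> x *\<^sub>R f (x + c) \<partial>lborel) = (\<integral>x. \<phi> (x - c) *\<^sub>R f x \<partial>lborel)"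
    unfolding eq by (rule lborel_integral_translate(1)) measurable
  then show ?thesis
    using i i' test_times_integrable[OF f \<phi>] by (simp add: scaleR_diff_right scaleR_diff_left)
qed

lemma line_integrable_pair:
  fixes g :: "'a::euclidean_space \<Rightarrow> 'b::euclidean_space"
  assumes g: "integrable lborel g"
  shows "integrable (lborel \<Otimes>\<^sub>M lborel) (\<lambda>(s::real, x). indicator {0..h} s *\<^sub>R g (x + s *\<^sub>R v))"
proof (rule integrable_lborel_pairI)
  note [measurable] = borel_measurable_integrable[OF g]
  show "(\<lambda>z. indicator {0..h} (fst z :: real) *\<^sub>R g (snd z + fst z *\<^sub>R v)) \<in> borel_measurable (borel \<Otimes>\<^sub>M borel)"
    by measurable
  have "integrable lborel (\<lambda>x. g (x + c))" for c
    using g by (subst lborel_integral_translate) auto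
  then show "integrable lborel (\<lambda>x. indicator {0..h} s *\<^sub>R g (x + s *\<^sub>R v))" for s
    by simp
  have "(\<integral>x. norm (g (x + c)) \<partial>lborel) = (\<integral>x. norm (g x) \<partial>lborel)" for c
    by (rule lborel_integral_translate) measurable
  then show "(\<integral>x. norm (indicator {0..h} s *\<^sub>R g (x + s *\<^sub>R v)) \<partial>lborel) \<le> (\<integral>x. norm (g x) \<partial>lborel) * indicator {0..h} s" for s
    by (simp add: indicator_def)
qed

text \<open>On a line where this fails the segment integral would be the default value 0 and say
  nothing about g.\<close>

lemma AE_line_integrable:
  fixes g :: "'a::euclidean_space \<Rightarrow> 'b::euclidean_space"
  assumes g: "integrable lborel g"
  shows "AE x in lborel. integrable lborel (\<lambda>s::real. indicator {0..h} s *\<^sub>R g (x + s *\<^sub>R v))"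
  using lborel_pair.AE_integrable_snd[OF line_integrable_pair[OF g]] by simp

lemma line_integral_integrable:
  fixes g :: "'a::euclidean_space \<Rightarrow> 'b::euclidean_space"
  assumes g: "integrable lborel g"
  shows "integrable lborel (\<lambda>x. LINT s:{0..h}|lborel. g (x + s *\<^sub>R v))"
  using lborel_pair.integrable_snd[OF line_integrable_pair[OF g]] by (simp add: set_lebesgue_integral_def)

text \<open>Fubini's theorem and, for each s, translation invariance of the inner integral.\<close>

lemma integral_line_integral_test:
  fixes g :: "'a::euclidean_space \<Rightarrow> 'b::euclidean_space" and \<phi> :: "'a \<Rightarrow> real"
  assumes g: "integrable lborel g" and \<phi>: "\<phi> \<in> test_functions V"
  shows "(\<integral>x. \<phi> x *\<^sub>R (LINT s:{0..h}|lborel. g (x + s *\<^sub>R v)) \<partial>lborel) =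
     (LINT s:{0..h}|lborel. \<integral>x. \<phi> (x - s *\<^sub>R v) *\<^sub>R g x \<partial>lborel)"
proof -
  note [measurable] = test_functions_measurable[OF \<phi>] borel_measurable_integrable[OF g]
  have "integrable (lborel \<Otimes>\<^sub>M lborel) (\<lambda>(s::real, x). indicator {0..h} s *\<^sub>R (\<phi> x *\<^sub>R g (x + s *\<^sub>R v)))"
  proof -
    obtain B where B: "0 < B" "\<And>x. norm (\<phi> x) \<le> B" using test_functions_bounded[OF \<phi>] by metis
    from line_integrable_pair[OF g, of h v]
    have "integrable (lborel \<Otimes>\<^sub>M lborel) (\<lambda>z. B *\<^sub>R (\<lambda>(s::real, x). indicator {0..h} s *\<^sub>R g (x + s *\<^sub>R v)) z)"
      by (rule integrable_scaleR_right)
    then show ?thesis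
    proof (rule Bochner_Integration.integrable_bound)
      show "AE z in lborel \<Otimes>\<^sub>M lborel. norm ((\<lambda>(s::real, x). indicator {0..h} s *\<^sub>R (\<phi> x *\<^sub>R g (x + s *\<^sub>R v))) z)
          \<le> norm (B *\<^sub>R (\<lambda>(s::real, x). indicator {0..h} s *\<^sub>R g (x + s *\<^sub>R v)) z)"
        using B by (auto intro!: AE_I2 mult_right_mono simp: indicator_def split: prod.split)
    qed (simp add: split_beta', measurable)
  qed
  then have "(\<integral>x. \<integral>s. indicator {0..h} s *\<^sub>R (\<phi> x *\<^sub>R g (x + s *\<^sub>R v)) \<partial>lborel \<partial>lborel) =
     (\<integral>s. \<integral>x. indicator {0..h} s *\<^sub>R (\<phi> x *\<^sub>R g (x + s *\<^sub>R v)) \<partial>lborel \<partial>lborel)"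
    by (rule lborel_pair.Fubini_integral)
  moreover have "(\<integral>x. indicator {0..h} s *\<^sub>R (\<phi> x *\<^sub>R g (x + c)) \<partial>lborel) = indicator {0..h} s *\<^sub>R (\<integral>x. \<phi> (x - c) *\<^sub>R g x \<partial>lborel)" for s c
    unfolding integral_scaleR_right using lborel_integral_translate(1)[of "\<lambda>y. \<phi> (y - c) *\<^sub>R g y" c] by simp
  moreover have "(\<integral>s. indicator {0..h} s *\<^sub>R (\<phi> x *\<^sub>R g (x + s *\<^sub>R v)) \<partial>lborel) =
      \<phi> x *\<^sub>R (\<integral>s. indicator {0..h} s *\<^sub>R g (x + s *\<^sub>R v) \<partial>lborel)" for x
    by (subst integral_scaleR_right[symmetric]) (simp add: ac_simps)
  ultimately show ?thesis
    by (simp only: set_lebesgue_integral_def)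
qed

text \<open>The complement consists of the points y - s v with y outside U and 0 \<le> s \<le> h:
  the sum of a closed set and a compact one, hence closed.\<close>

lemma open_segment_inside:
  fixes U :: "'a::euclidean_space set"
  assumes U: "open U"
  shows "open {x. \<forall>s\<in>{0..h}. x + s *\<^sub>R v \<in> U}"
proof -
  have "compact ((\<lambda>s. - (s *\<^sub>R v)) ` {0..h})"
    by (intro compact_continuous_image continuous_intros) auto
  then have "closed (\<Union>x\<in>- U. \<Union>y\<in>(\<lambda>s. - (s *\<^sub>R v)) ` {0..h}. {x + y})"
    using U by (intro closed_compact_sums) auto
  also have "(\<Union>x\<in>- U. \<Union>y\<in>(\<lambda>s. - (s *\<^sub>R v)) ` {0..h}. {x + y}) = - {x. \<forall>s\<in>{0..h}. x + s *\<^sub>R v \<in> U}"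
  proof (intro set_eqI iffI)
    fix y assume "y \<in> - {x. \<forall>s\<in>{0..h}. x + s *\<^sub>R v \<in> U}"
    then obtain s where "s \<in> {0..h}" "y + s *\<^sub>R v \<in> - U" by auto
    then show "y \<in> (\<Union>x\<in>- U. \<Union>y\<in>(\<lambda>s. - (s *\<^sub>R v)) ` {0..h}. {x + y})"
      by (intro UN_I[of "y + s *\<^sub>R v"] UN_I[of "- (s *\<^sub>R v)"]) auto
  next
    fix y assume "y \<in> (\<Union>x\<in>- U. \<Union>y\<in>(\<lambda>s. - (s *\<^sub>R v)) ` {0..h}. {x + y})"
    then obtain x s where "x \<notin> U" "s \<in> {0..h}" "y = x - s *\<^sub>R v" by auto
    then show "y \<in> - {x. \<forall>s\<in>{0..h}. x + s *\<^sub>R v \<in> U}"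
      by (auto intro!: bexI[of _ s])
  qed
  finally show ?thesis by (simp add: open_closed)
qed

text \<open>A test function supported in the set of admissible x can be translated by s v, 0 \<le> s
  \<le> h, without leaving U. So the increment is moved to the test function, written there as an
  integral of derivatives, and exchanged for g by the weak derivative identity at every s. The
  exceptional null set depends on h.\<close>

lemma L1_weak_deriv_translate:
  fixes f :: "'a::euclidean_space \<Rightarrow> 'b::euclidean_space"
  assumes U: "open U" and wd: "L1_weak_deriv U v f g" and h: "0 \<le> h"
  shows "AE x in lborel. (\<forall>s\<in>{0..h}. x + s *\<^sub>R v \<in> U) \<longrightarrow>
    f (x + h *\<^sub>R v) - f x = (LINT s:{0..h}|lborel. g (x + s *\<^sub>R v))"
proof -
  let ?V = "{x. \<forall>s\<in>{0..h}. x + s *\<^sub>R v \<in> U}"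
  have f: "integrable lborel f" and g: "integrable lborel g"
    and w: "\<And>\<phi>. \<phi> \<in> test_functions U \<Longrightarrow> (\<integral>x. frechet_derivative \<phi> (at x) v *\<^sub>R f x \<partial>lborel) =
        - (\<integral>x. (\<phi> x :: real) *\<^sub>R g x \<partial>lborel)"
    using wd by (auto simp: L1_weak_deriv_def)
  have ft: "integrable lborel (\<lambda>x. f (x + c))" for c
    using f by (subst lborel_integral_translate) auto
  have "AE x in lborel. x \<in> ?V \<longrightarrow> f (x + h *\<^sub>R v) - f x - (LINT s:{0..h}|lborel. g (x + s *\<^sub>R v)) = 0"
  proof (rule fundamental_lemma_lborel[OF open_segment_inside[OF U]])
    show "integrable lborel (\<lambda>x. f (x + h *\<^sub>R v) - f x - (LINT s:{0..h}|lborel. g (x + s *\<^sub>R v)))"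
      by (intro Bochner_Integration.integrable_diff ft f line_integral_integrable[OF g])
    fix \<phi> :: "'a \<Rightarrow> real" assume \<phi>: "\<phi> \<in> test_functions ?V"
    have "(\<integral>x. \<phi> x *\<^sub>R (f (x + h *\<^sub>R v) - f x) \<partial>lborel) =
       - (LINT s:{0..h}|lborel. \<integral>x. frechet_derivative \<phi> (at (x - s *\<^sub>R v)) v *\<^sub>R f x \<partial>lborel)"
      by (simp add: integral_increment_test[OF f \<phi>] integral_test_increment[OF f \<phi> h])
    also have "\<dots> = (LINT s:{0..h}|lborel. \<integral>x. \<phi> (x - s *\<^sub>R v) *\<^sub>R g x \<partial>lborel)"
    proof -
      have "(\<integral>x. frechet_derivative \<phi> (at (x - s *\<^sub>R v)) v *\<^sub>R f x \<partial>lborel) = - (\<integral>x. \<phi> (x - s *\<^sub>R v) *\<^sub>R g x \<partial>lborel)"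
        if "s \<in> {0..h}" for s
      proof -
        have "(\<lambda>x. \<phi> (x - s *\<^sub>R v)) \<in> test_functions U"
          by (rule test_functions_translate[OF \<phi>]) (use that in auto)
        from w[OF this] show ?thesis by (simp add: frechet_derivative_translate[OF \<phi>])
      qed
      then have "(LINT s:{0..h}|lborel. \<integral>x. frechet_derivative \<phi> (at (x - s *\<^sub>R v)) v *\<^sub>R f x \<partial>lborel)
         = (LINT s:{0..h}|lborel. - (\<integral>x. \<phi> (x - s *\<^sub>R v) *\<^sub>R g x \<partial>lborel))"
        by (intro set_lebesgue_integral_cong) auto
      then show ?thesis by (simp add: set_lebesgue_integral_def)
    qed
    also have "\<dots> = (\<integral>x. \<phi> x *\<^sub>R (LINT s:{0..h}|lborel. g (x + s *\<^sub>R v)) \<partial>lborel)"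
      by (rule integral_line_integral_test[OF g \<phi>, symmetric])
    finally have eq: "(\<integral>x. \<phi> x *\<^sub>R (f (x + h *\<^sub>R v) - f x) \<partial>lborel) = (\<integral>x. \<phi> x *\<^sub>R (LINT s:{0..h}|lborel. g (x + s *\<^sub>R v)) \<partial>lborel)" .
    have "integrable lborel (\<lambda>x. \<phi> x *\<^sub>R (f (x + h *\<^sub>R v) - f x))"
      "integrable lborel (\<lambda>x. \<phi> x *\<^sub>R (LINT s:{0..h}|lborel. g (x + s *\<^sub>R v)))"
      by (intro test_times_integrable[OF _ \<phi>] Bochner_Integration.integrable_diff ft f line_integral_integrable[OF g])+
    then show "(\<integral>x. \<phi> x *\<^sub>R (f (x + h *\<^sub>R v) - f x - (LINT s:{0..h}|lborel. g (x + s *\<^sub>R v))) \<partial>lborel) = 0"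
      using eq by (subst scaleR_diff_right) simp
  qed
  then show ?thesis by eventually_elim auto
qed

text \<open>The square of the integral is a double integral over the plane, to which the triangles r
  \<le> s and s < r contribute equally by Fubini's theorem. This is the product rule for the square
  of the primitive of a merely integrable function.\<close>

lemma integral_times_primitive:
  fixes \<gamma> :: "real \<Rightarrow> real"
  assumes \<gamma>: "integrable lborel \<gamma>"
  shows "integrable lborel (\<lambda>s. \<gamma> s * (\<integral>r. indicator {..s} r * \<gamma> r \<partial>lborel))"
    and "2 * (\<integral>s. \<gamma> s * (\<integral>r. indicator {..s} r * \<gamma> r \<partial>lborel) \<partial>lborel) = (\<integral>s. \<gamma> s \<partial>lborel)\<^sup>2"
proof -
  note [measurable] = borel_measurable_integrable[OF \<gamma>]
  have full: "integrable (lborel \<Otimes>\<^sub>M lborel) (\<lambda>(s, r). \<gamma> s * \<gamma> r)"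
  proof (rule lborel_pair.Fubini_integrable)
    show "(\<lambda>(s, r). \<gamma> s * \<gamma> r) \<in> borel_measurable (lborel \<Otimes>\<^sub>M lborel)" by measurable
    show "integrable lborel (\<lambda>s. \<integral>r. norm ((\<lambda>(s, r). \<gamma> s * \<gamma> r) (s, r)) \<partial>lborel)"
      using \<gamma> by (simp add: abs_mult)
    show "AE s in lborel. integrable lborel (\<lambda>r. (\<lambda>(s, r). \<gamma> s * \<gamma> r) (s, r))"
      using \<gamma> by simp
  qed
  have half: "integrable (lborel \<Otimes>\<^sub>M lborel) (\<lambda>(s, r). \<gamma> s * (indicator {..s} r * \<gamma> r))"
    by (rule Bochner_Integration.integrable_bound[OF full])
       (auto simp: indicator_def split_beta', measurable)
  have half': "integrable (lborel \<Otimes>\<^sub>M lborel) (\<lambda>(s, r). \<gamma> s * (indicator {s<..} r * \<gamma> r))"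
    by (rule Bochner_Integration.integrable_bound[OF full])
       (auto simp: indicator_def split_beta', measurable)
  have i1: "integrable lborel (\<lambda>r. indicator A r * \<gamma> r)" if "A \<in> sets borel" for A
    using integrable_mult_indicator[of A lborel \<gamma>] that \<gamma> by simp
  show "integrable lborel (\<lambda>s. \<gamma> s * (\<integral>r. indicator {..s} r * \<gamma> r \<partial>lborel))"
    using lborel_pair.integrable_fst[OF half] by simp
  have i2: "integrable lborel (\<lambda>s. \<gamma> s * (\<integral>r. indicator {s<..} r * \<gamma> r \<partial>lborel))"
    using lborel_pair.integrable_fst[OF half'] by simp
  have "(\<integral>s. \<gamma> s * (\<integral>r. indicator {s<..} r * \<gamma> r \<partial>lborel) \<partial>lborel)
      = (\<integral>s. \<integral>r. \<gamma> s * (indicator {s<..} r * \<gamma> r) \<partial>lborel \<partial>lborel)" by simp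
  also have "\<dots> = (\<integral>r. \<integral>s. \<gamma> s * (indicator {s<..} r * \<gamma> r) \<partial>lborel \<partial>lborel)"
    by (rule lborel_pair.Fubini_integral[OF half', symmetric])
  also have "\<dots> = (\<integral>r. \<gamma> r * (\<integral>s. indicator {..<r} s * \<gamma> s \<partial>lborel) \<partial>lborel)"
  proof (rule Bochner_Integration.integral_cong[OF refl])
    fix r :: real
    have "(\<integral>s. \<gamma> s * (indicator {s<..} r * \<gamma> r) \<partial>lborel) = (\<integral>s. \<gamma> r * (indicator {..<r} s * \<gamma> s) \<partial>lborel)"
      by (rule Bochner_Integration.integral_cong) (auto simp: indicator_def)
    then show "(\<integral>s. \<gamma> s * (indicator {s<..} r * \<gamma> r) \<partial>lborel) = \<gamma> r * (\<integral>s. indicator {..<r} s * \<gamma> s \<partial>lborel)"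
      by simp
  qed
  also have "\<dots> = (\<integral>r. \<gamma> r * (\<integral>s. indicator {..r} s * \<gamma> s \<partial>lborel) \<partial>lborel)"
  proof (rule Bochner_Integration.integral_cong[OF refl])
    fix r :: real
    have "AE s in lborel. s \<noteq> r" by (rule AE_lborel_singleton)
    then have "(\<integral>s. indicator {..<r} s * \<gamma> s \<partial>lborel) = (\<integral>s. indicator {..r} s * \<gamma> s \<partial>lborel)"
      by (intro integral_cong_AE) (auto elim!: eventually_mono simp: indicator_def)
    then show "\<gamma> r * (\<integral>s. indicator {..<r} s * \<gamma> s \<partial>lborel) = \<gamma> r * (\<integral>s. indicator {..r} s * \<gamma> s \<partial>lborel)"
      by simp
  qed
  finally have sym: "(\<integral>s. \<gamma> s * (\<integral>r. indicator {s<..} r * \<gamma> r \<partial>lborel) \<partial>lborel) =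
    (\<integral>s. \<gamma> s * (\<integral>r. indicator {..s} r * \<gamma> r \<partial>lborel) \<partial>lborel)" .
  have "(\<integral>s. \<gamma> s \<partial>lborel)\<^sup>2 = (\<integral>s. \<gamma> s * (\<integral>r. \<gamma> r \<partial>lborel) \<partial>lborel)"
    by (simp add: power2_eq_square)
  also have "\<dots> = (\<integral>s. \<gamma> s * (\<integral>r. indicator {..s} r * \<gamma> r \<partial>lborel) + \<gamma> s * (\<integral>r. indicator {s<..} r * \<gamma> r \<partial>lborel) \<partial>lborel)"
  proof (rule Bochner_Integration.integral_cong[OF refl])
    fix s
    have "(\<integral>r. \<gamma> r \<partial>lborel) = (\<integral>r. indicator {..s} r * \<gamma> r + indicator {s<..} r * \<gamma> r \<partial>lborel)"
      by (rule Bochner_Integration.integral_cong) (auto simp: indicator_def)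
    then show "\<gamma> s * (\<integral>r. \<gamma> r \<partial>lborel) = \<gamma> s * (\<integral>r. indicator {..s} r * \<gamma> r \<partial>lborel) + \<gamma> s * (\<integral>r. indicator {s<..} r * \<gamma> r \<partial>lborel)"
      using i1 by (simp add: distrib_left)
  qed
  also have "\<dots> = 2 * (\<integral>s. \<gamma> s * (\<integral>r. indicator {..s} r * \<gamma> r \<partial>lborel) \<partial>lborel)"
    using lborel_pair.integrable_fst[OF half] i2 by (simp add: sym)
  finally show "2 * (\<integral>s. \<gamma> s * (\<integral>r. indicator {..s} r * \<gamma> r \<partial>lborel) \<partial>lborel) = (\<integral>s. \<gamma> s \<partial>lborel)\<^sup>2" by simp
qed

text \<open>If C 0 were nonzero, C would have constant sign just to the right of 0, and its integral
  over a short interval could not vanish.\<close>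

lemma eq_0_if_initial_averages_eq_0:
  fixes C :: "real \<Rightarrow> real"
  assumes C: "continuous (at_right 0) C" and i: "\<And>h. 0 < h \<Longrightarrow> set_integrable lborel {0..h} C"
    and h: "0 < h0" and z: "\<And>h. 0 < h \<Longrightarrow> h \<le> h0 \<Longrightarrow> (LINT s:{0..h}|lborel. C s) = 0"
  shows "C 0 = 0"
proof (rule ccontr)
  assume "C 0 \<noteq> 0"
  then have "\<forall>\<^sub>F s in at_right 0. dist (C s) (C 0) < \<bar>C 0\<bar>"
    using C by (intro tendstoD) (auto simp: continuous_within)
  then obtain d where d: "d > 0" "\<And>s. 0 < s \<Longrightarrow> s < d \<Longrightarrow> \<bar>C s - C 0\<bar> < \<bar>C 0\<bar>"
    unfolding eventually_at_right_field dist_real_def by (metis diff_0_right)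
  define h where "h = min h0 (d / 2)"
  have hh: "0 < h" "h \<le> h0" "h < d" using h d(1) by (auto simp: h_def)
  define e where "e = sgn (C 0)"
  have pos: "0 < e * C s" if "0 < s" "s < d" for s
    using d(2)[OF that] \<open>C 0 \<noteq> 0\<close> by (auto simp: e_def sgn_if abs_if split: if_splits)
  have i': "integrable lborel (\<lambda>s. indicator {0<..h} s * (e * C s))"
  proof -
    have "integrable lborel (\<lambda>s. indicator {0<..h} s *\<^sub>R (indicator {0..h} s *\<^sub>R C s))"
      using i[OF hh(1)] unfolding set_integrable_def by (rule integrable_mult_indicator[rotated]) auto
    then have "integrable lborel (\<lambda>s. e * (indicator {0<..h} s *\<^sub>R (indicator {0..h} s *\<^sub>R C s)))"
      by (rule integrable_mult_right)
    also have "(\<lambda>s. e * (indicator {0<..h} s *\<^sub>R (indicator {0..h} s *\<^sub>R C s))) = (\<lambda>s. indicator {0<..h} s * (e * C s))"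
      by (auto simp: indicator_def)
    finally show ?thesis .
  qed
  have "(\<integral>s. indicator {0<..h} s * (e * C s) \<partial>lborel) = (\<integral>s. e * (indicator {0..h} s *\<^sub>R C s) \<partial>lborel)"
  proof (rule integral_cong_AE)
    show "AE s in lborel. indicator {0<..h} s * (e * C s) = e * (indicator {0..h} s *\<^sub>R C s)"
      using AE_lborel_singleton[of 0] by eventually_elim (auto simp: indicator_def)
    have "integrable lborel (\<lambda>s. e * (indicator {0..h} s *\<^sub>R C s))"
      using i[OF hh(1)] unfolding set_integrable_def by (rule integrable_mult_right)
    then show "(\<lambda>s. e * (indicator {0..h} s *\<^sub>R C s)) \<in> borel_measurable lborel"
      by (rule borel_measurable_integrable)
  qed (use i' in auto)
  also have "\<dots> = 0" using z[OF hh(1,2)] by (simp add: set_lebesgue_integral_def)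
  finally have "AE s in lborel. indicator {0<..h} s * (e * C s) = 0"
  proof (rule iffD1[OF integral_nonneg_eq_0_iff_AE[OF i'], rotated])
    show "AE s in lborel. 0 \<le> indicator {0<..h} s * (e * C s)"
    proof (rule AE_I2)
      fix s show "0 \<le> indicator {0<..h} s * (e * C s)"
        using pos[of s] hh by (cases "s \<in> {0<..h}") auto
    qed
  qed
  then have "AE s in lborel. s \<notin> {0<..h}"
    by eventually_elim (use pos hh in \<open>force simp: indicator_def\<close>)
  then have "emeasure lborel {0<..h} = 0"
    by (subst (asm) AE_iff_measurable[of "{0<..h}"]) auto
  then show False using hh by simp
qed

text \<open>Converse of \<open>L1_weak_deriv_translate\<close>. Let C s be the defect of the weak
  derivative identity for the test function translated by s v. The increment formula says that C has
  integral 0 over every short interval {0..h}; C is continuous from the right at 0, and C 0 = 0 is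
  the identity wanted.\<close>

lemma L1_weak_derivI:
  fixes f g :: "'a::euclidean_space \<Rightarrow> real"
  assumes U: "open U" and f: "integrable lborel f" and g: "integrable lborel g"
    and out: "\<And>x. x \<notin> U \<Longrightarrow> f x = 0 \<and> g x = 0"
    and tr: "\<And>h. 0 < h \<Longrightarrow> h \<le> 1 \<Longrightarrow> AE x in lborel. (\<forall>s\<in>{0..h}. x + s *\<^sub>R v \<in> U) \<longrightarrow>
      f (x + h *\<^sub>R v) - f x = (LINT s:{0..h}|lborel. g (x + s *\<^sub>R v))"
  shows "L1_weak_deriv U v f g"
  unfolding L1_weak_deriv_def
proof (intro conjI ballI allI impI)
  fix \<phi> :: "'a \<Rightarrow> real" assume \<phi>: "\<phi> \<in> test_functions U"
  let ?d = "\<lambda>x. frechet_derivative \<phi> (at x) v"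
  have d: "?d \<in> test_functions U" by (rule test_functions_deriv[OF \<phi>])
  note [measurable] = borel_measurable_integrable[OF f] borel_measurable_integrable[OF g]
  define C where "C s = (\<integral>x. ?d (x - s *\<^sub>R v) *\<^sub>R f x \<partial>lborel) + (\<integral>x. \<phi> (x - s *\<^sub>R v) *\<^sub>R g x \<partial>lborel)" for s
  have cont: "((\<lambda>s. \<integral>x. \<psi> (x - s *\<^sub>R v) *\<^sub>R k x \<partial>lborel) \<longlongrightarrow> (\<integral>x. \<psi> (x - 0 *\<^sub>R v) *\<^sub>R k x \<partial>lborel)) (at_right 0)"
    if \<psi>: "\<psi> \<in> test_functions U" and k: "integrable lborel k" for \<psi> k :: "'a \<Rightarrow> real"
  proof -
    obtain B where B: "0 < B" "\<And>x. norm (\<psi> x) \<le> B" using test_functions_bounded[OF \<psi>] by metis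
    note [measurable] = test_functions_measurable[OF \<psi>] borel_measurable_integrable[OF k]
    show ?thesis
      unfolding tendsto_at_iff_sequentially comp_def
    proof (intro allI impI)
      fix X :: "nat \<Rightarrow> real" assume X: "X \<longlonglongrightarrow> 0"
      show "(\<lambda>n. \<integral>x. \<psi> (x - X n *\<^sub>R v) *\<^sub>R k x \<partial>lborel) \<longlonglongrightarrow> (\<integral>x. \<psi> (x - 0 *\<^sub>R v) *\<^sub>R k x \<partial>lborel)"
      proof (rule integral_dominated_convergence[where w="\<lambda>x. B * norm (k x)"])
        show "integrable lborel (\<lambda>x. B * norm (k x))" using k by simp
        show "AE x in lborel. norm (\<psi> (x - X n *\<^sub>R v) *\<^sub>R k x) \<le> B * norm (k x)" for n
          using B by (auto intro!: AE_I2 mult_right_mono simp: abs_mult)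
        have "isCont \<psi> y" for y
          using test_functions_continuous[OF \<psi>, of UNIV] by (simp add: continuous_on_eq_continuous_at)
        then show "AE x in lborel. (\<lambda>n. \<psi> (x - X n *\<^sub>R v) *\<^sub>R k x) \<longlonglongrightarrow> \<psi> (x - 0 *\<^sub>R v) *\<^sub>R k x"
          by (intro AE_I2 tendsto_intros isCont_tendsto_compose[where g=\<psi>] X)
      qed measurable
    qed
  qed
  obtain K where K: "compact K" "K \<subseteq> U" "\<And>x. x \<notin> K \<Longrightarrow> \<phi> x = 0"
    using \<phi> test_functions_iff by metis
  obtain e where e: "e > 0" "(\<Union>x\<in>K. ball x e) \<subseteq> U"
    using compact_subset_open_imp_ball_epsilon_subset[OF K(1) U K(2)] by blast
  \<comment> \<open>Points of the support moved by at most \<open>h0 * norm v < e\<close> stay in U;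
    the summand 1 in the denominator covers v = 0.\<close>
  define h0 where "h0 = min 1 (e / (norm v + 1))"
  have h0: "0 < h0" "h0 \<le> 1" using e(1) by (auto simp: h0_def add_nonneg_pos)
  have inU: "x + s *\<^sub>R v \<in> U" if "x \<in> K" "0 \<le> s" "s \<le> h0" for x s
  proof -
    have "norm (s *\<^sub>R v) \<le> h0 * norm v" using that by (simp add: mult_right_mono)
    also have "\<dots> \<le> e / (norm v + 1) * norm v" by (intro mult_right_mono) (auto simp: h0_def)
    also have "\<dots> < e" using e(1) by (simp add: pos_divide_less_eq add_nonneg_pos distrib_left)
    finally have "x + s *\<^sub>R v \<in> ball x e" by (simp add: dist_norm)
    then show ?thesis using e(2) that(1) by blast
  qed
  have i1: "set_integrable lborel {0..h} (\<lambda>s. \<integral>x. ?d (x - s *\<^sub>R v) *\<^sub>R f x \<partial>lborel)" for h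
    using lborel_pair.integrable_fst[OF line_integral_test_function[OF f d, of h v]]
    by (simp add: set_integrable_def)
  have i2: "set_integrable lborel {0..h} (\<lambda>s. \<integral>x. \<phi> (x - s *\<^sub>R v) *\<^sub>R g x \<partial>lborel)" for h
    using lborel_pair.integrable_fst[OF line_integral_test_function[OF g \<phi>, of h v]]
    by (simp add: set_integrable_def)
  have "C 0 = 0"
  proof (rule eq_0_if_initial_averages_eq_0[OF _ _ h0(1)])
    show "continuous (at_right 0) C"
      unfolding continuous_within C_def by (intro tendsto_add cont d \<phi> f g)
    show "set_integrable lborel {0..h} C" for h
      unfolding C_def[abs_def] by (intro set_integral_add i1 i2)
    fix h :: real assume h: "0 < h" "h \<le> h0"
    have "(\<integral>x. \<phi> x *\<^sub>R (f (x + h *\<^sub>R v) - f x) \<partial>lborel) = (\<integral>x. \<phi> x *\<^sub>R (LINT s:{0..h}|lborel. g (x + s *\<^sub>R v)) \<partial>lborel)"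
    proof (rule integral_cong_AE)
      show "AE x in lborel. \<phi> x *\<^sub>R (f (x + h *\<^sub>R v) - f x) = \<phi> x *\<^sub>R (LINT s:{0..h}|lborel. g (x + s *\<^sub>R v))"
      proof -
        have "h \<le> 1" using h h0 by linarith
        from tr[OF h(1) this] show ?thesis
        proof eventually_elim
          case (elim x)
          show ?case
          proof (cases "x \<in> K")
            case True
            then have "\<forall>s\<in>{0..h}. x + s *\<^sub>R v \<in> U" using inU h by auto
            then show ?thesis using elim by auto
          qed (use K(3) in auto)
        qed
      qed
      show "(\<lambda>x. \<phi> x *\<^sub>R (LINT s:{0..h}|lborel. g (x + s *\<^sub>R v))) \<in> borel_measurable lborel"
        using line_integral_integrable[OF g] test_functions_measurable[OF \<phi>] by measurable
    qed (use test_functions_measurable[OF \<phi>] in measurable)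
    then have "- (LINT s:{0..h}|lborel. \<integral>x. ?d (x - s *\<^sub>R v) *\<^sub>R f x \<partial>lborel) =
        (LINT s:{0..h}|lborel. \<integral>x. \<phi> (x - s *\<^sub>R v) *\<^sub>R g x \<partial>lborel)"
      using h(1) by (simp only: integral_increment_test[OF f \<phi>] integral_test_increment[OF f \<phi> less_imp_le] integral_line_integral_test[OF g \<phi>])
    then show "(LINT s:{0..h}|lborel. C s) = 0"
      unfolding C_def by (subst set_integral_add(2)[OF i1 i2]) simp
  qed
  then show "(\<integral>x. ?d x *\<^sub>R f x \<partial>lborel) = - (\<integral>x. \<phi> x *\<^sub>R g x \<partial>lborel)"
    by (simp add: C_def)
qed (use f g out in auto)

text \<open>No mollification is needed: by \<open>L1_weak_deriv_translate\<close>, on almost every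
  line \<open>f\<close> is a primitive of \<open>g\<close>, and then \<open>f\<^sup>2\<close> is a
  primitive of \<open>2 f g\<close> by \<open>integral_times_primitive\<close>.\<close>

lemma L1_weak_deriv_square:
  fixes f g :: "'a::euclidean_space \<Rightarrow> real"
  assumes U: "open U" and wd: "L1_weak_deriv U v f g" and K: "\<And>x. \<bar>f x\<bar> \<le> K"
  shows "L1_weak_deriv U v (\<lambda>x. (f x)\<^sup>2) (\<lambda>x. 2 * f x * g x)"
proof (rule L1_weak_derivI[OF U])
  have f: "integrable lborel f" and g: "integrable lborel g" and out: "\<And>x. x \<notin> U \<Longrightarrow> f x = 0 \<and> g x = 0"
    using wd by (auto simp: L1_weak_deriv_def)
  note [measurable] = borel_measurable_integrable[OF f] borel_measurable_integrable[OF g]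
  have K0: "0 \<le> K" using K[of undefined] by linarith
  show "integrable lborel (\<lambda>x. (f x)\<^sup>2)"
  proof (rule Bochner_Integration.integrable_bound[of _ "\<lambda>x. K * f x"])
    have "\<bar>f x\<bar> * \<bar>f x\<bar> \<le> K * \<bar>f x\<bar>" for x by (intro mult_right_mono K) auto
    then show "AE x in lborel. norm ((f x)\<^sup>2) \<le> norm (K * f x)"
      using K0 by (auto simp: power2_eq_square abs_mult)
  qed (use f in auto)
  show "integrable lborel (\<lambda>x. 2 * f x * g x)"
  proof (rule Bochner_Integration.integrable_bound[of _ "\<lambda>x. 2 * K * g x"])
    have "\<bar>f x\<bar> * \<bar>g x\<bar> \<le> K * \<bar>g x\<bar>" for x by (intro mult_right_mono K) auto
    then show "AE x in lborel. norm (2 * f x * g x) \<le> norm (2 * K * g x)"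
      using K0 by (auto simp: abs_mult)
  qed (use g in auto)
  show "(f x)\<^sup>2 = 0 \<and> 2 * f x * g x = 0" if "x \<notin> U" for x using out[OF that] by simp
  fix H :: real assume H: "0 < H" "H \<le> 1"
  define V where "V = {x. \<forall>s\<in>{0..H}. x + s *\<^sub>R v \<in> U}"
  have ind: "(\<integral>s. indicator {0..h} s *\<^sub>R F s \<partial>lborel) = (\<integral>s. (if 0 \<le> s \<and> s \<le> h then F s else 0) \<partial>lborel)"
    for h :: real and F :: "real \<Rightarrow> real"
    by (intro Bochner_Integration.integral_cong) (auto simp: indicator_def)
  have [measurable]: "V \<in> sets borel" unfolding V_def using open_segment_inside[OF U] by (rule borel_open)
  define P where "P h x \<longleftrightarrow> (h \<in> {0..H} \<and> x \<in> V \<longrightarrow>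
      f (x + h *\<^sub>R v) - f x = (\<integral>s. (if 0 \<le> s \<and> s \<le> h then g (x + s *\<^sub>R v) else 0) \<partial>lborel))" for h x
  have AEP: "AE x in lborel. P h x" for h
  proof (cases "h \<in> {0..H}")
    case True
    then have "0 \<le> h" by simp
    from L1_weak_deriv_translate[OF U wd this] show ?thesis
      by eventually_elim (use True in \<open>auto simp: P_def V_def set_lebesgue_integral_def ind simp flip: real_scaleR_def\<close>)
  qed (intro AE_I2, unfold P_def, blast)
  \<comment> \<open>Each h comes with its own null set of x. Fubini's theorem reverses the order, so
    that almost every line carries the increment formula for almost every h.\<close>
  have "AE x in lborel. AE h in lborel. P h x"
  proof (subst lborel_pair.AE_commute[symmetric])
    have "Measurable.pred (borel \<Otimes>\<^sub>M borel) (\<lambda>z. P (fst z) (snd z))"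
      unfolding P_def by measurable
    then show "{z \<in> space (lborel \<Otimes>\<^sub>M lborel). P (fst z) (snd z)} \<in> sets (lborel \<Otimes>\<^sub>M lborel)"
      by (simp add: pred_def space_pair_measure cong: sets_pair_measure_cong)
  qed (use AEP in auto)
  \<comment> \<open>The endpoint H is a single value of h and may be lost in the exchange, so it is
    added separately.\<close>
  with AEP[of H] AE_line_integrable[OF g, of H v]
  show "AE x in lborel. (\<forall>s\<in>{0..H}. x + s *\<^sub>R v \<in> U) \<longrightarrow>
      (f (x + H *\<^sub>R v))\<^sup>2 - (f x)\<^sup>2 = (LINT s:{0..H}|lborel. 2 * f (x + s *\<^sub>R v) * g (x + s *\<^sub>R v))"
  proof eventually_elim
    case (elim x)
    show ?case
    proof
      assume "\<forall>s\<in>{0..H}. x + s *\<^sub>R v \<in> U"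
      then have x: "x \<in> V" by (simp add: V_def)
      define \<gamma> where "\<gamma> s = indicator {0..H} s * g (x + s *\<^sub>R v)" for s
      have \<gamma>: "integrable lborel \<gamma>" using elim(2) by (simp add: \<gamma>_def[abs_def])
      have eH: "f (x + H *\<^sub>R v) = f x + (\<integral>s. \<gamma> s \<partial>lborel)"
        using elim(1) x H by (simp add: P_def \<gamma>_def ind[symmetric])
      \<comment> \<open>On the line f is f x plus the primitive of \<gamma>, hence 2 f g splits into
        a multiple of \<gamma> and twice \<gamma> times its own primitive.\<close>
      have "AE s in lborel. indicator {0..H} s * (2 * f (x + s *\<^sub>R v) * g (x + s *\<^sub>R v)) =
         2 * f x * \<gamma> s + 2 * (\<gamma> s * (\<integral>r. indicator {..s} r * \<gamma> r \<partial>lborel))"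
        using elim(3)
      proof eventually_elim
        case (elim s)
        show ?case
        proof (cases "s \<in> {0..H}")
          case True
          have "(\<integral>r. indicator {..s} r * \<gamma> r \<partial>lborel) = (\<integral>r. indicator {0..s} r *\<^sub>R g (x + r *\<^sub>R v) \<partial>lborel)"
            by (rule Bochner_Integration.integral_cong) (use True in \<open>auto simp: \<gamma>_def indicator_def\<close>)
          also have "\<dots> = f (x + s *\<^sub>R v) - f x" using elim True x unfolding P_def ind by simp
          finally have G: "(\<integral>r. indicator {..s} r * \<gamma> r \<partial>lborel) = f (x + s *\<^sub>R v) - f x" .
          show ?thesis unfolding G using True by (simp add: \<gamma>_def algebra_simps)
        qed (simp add: \<gamma>_def)
      qed
      then have "(LINT s:{0..H}|lborel. 2 * f (x + s *\<^sub>R v) * g (x + s *\<^sub>R v)) =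
         (\<integral>s. 2 * f x * \<gamma> s + 2 * (\<gamma> s * (\<integral>r. indicator {..s} r * \<gamma> r \<partial>lborel)) \<partial>lborel)"
        unfolding set_lebesgue_integral_def real_scaleR_def
        using integral_times_primitive(1)[OF \<gamma>] \<gamma>
        by (intro integral_cong_AE) auto
      also have "\<dots> = 2 * f x * (\<integral>s. \<gamma> s \<partial>lborel) + (\<integral>s. \<gamma> s \<partial>lborel)\<^sup>2"
        using integral_times_primitive[OF \<gamma>] \<gamma> by (subst Bochner_Integration.integral_add) auto
      also have "\<dots> = (f (x + H *\<^sub>R v))\<^sup>2 - (f x)\<^sup>2"
        unfolding eH by (simp add: power2_eq_square algebra_simps)
      finally show "(f (x + H *\<^sub>R v))\<^sup>2 - (f x)\<^sup>2 = (LINT s:{0..H}|lborel. 2 * f (x + s *\<^sub>R v) * g (x + s *\<^sub>R v))"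
        by simp
    qed
  qed
qed

subsection \<open>Square integrable functions\<close>

lemma Lp_space_2_iff:
  "f \<in> Lp_space 2 M \<longleftrightarrow> f \<in> borel_measurable M \<and> integrable M (\<lambda>x. (norm (f x))\<^sup>2)"
proof -
  have "norm (f x) powr 2 = (norm (f x))\<^sup>2" for x
    by (simp add: powr_numeral)
  then show ?thesis by (simp add: Lp_space_def)
qed

lemma Lp_norm_2_eq: "Lp_norm 2 M f = sqrt (\<integral>x. (norm (f x))\<^sup>2 \<partial>M)"
proof -
  have "norm (f x) powr 2 = (norm (f x))\<^sup>2" for x
    by (simp add: powr_numeral)
  then show ?thesis by (simp add: Lp_norm_def powr_half_sqrt integral_nonneg_AE)
qed

lemma Lp_norm_2_squared: "(Lp_norm 2 M f)\<^sup>2 = (\<integral>x. (norm (f x))\<^sup>2 \<partial>M)"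
  by (simp add: Lp_norm_2_eq integral_nonneg_AE)

lemma Lp_norm_2_nonneg: "0 \<le> Lp_norm 2 M f"
  by (simp add: Lp_norm_2_eq integral_nonneg_AE)

lemma Lp_space_2_measurable: "f \<in> Lp_space 2 M \<Longrightarrow> f \<in> borel_measurable M"
  by (simp add: Lp_space_2_iff)

lemma Lp_space_2_norm_iff:
  "f \<in> borel_measurable M \<Longrightarrow> (\<lambda>x. norm (f x)) \<in> Lp_space 2 M \<longleftrightarrow> f \<in> Lp_space 2 M"
  by (auto simp: Lp_space_2_iff)

lemma Lp_norm_2_norm: "Lp_norm 2 M (\<lambda>x. norm (f x)) = Lp_norm 2 M f"
  by (simp add: Lp_norm_2_eq)

lemma Lp_space_2_bound:
  fixes f :: "'a \<Rightarrow> 'b::euclidean_space" and g :: "'a \<Rightarrow> 'c::euclidean_space"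
  assumes g: "g \<in> Lp_space 2 M" and f: "f \<in> borel_measurable M" and le: "AE x in M. norm (f x) \<le> norm (g x)"
  shows "f \<in> Lp_space 2 M" and "Lp_norm 2 M f \<le> Lp_norm 2 M g"
proof -
  have i: "integrable M (\<lambda>x. (norm (f x))\<^sup>2)"
  proof (rule Bochner_Integration.integrable_bound)
    show "integrable M (\<lambda>x. (norm (g x))\<^sup>2)" using g by (simp add: Lp_space_2_iff)
    show "AE x in M. norm ((norm (f x))\<^sup>2) \<le> norm ((norm (g x))\<^sup>2)"
      using le by eventually_elim (simp add: power_mono)
  qed (use f in measurable)
  then show "f \<in> Lp_space 2 M" using f by (simp add: Lp_space_2_iff)
  show "Lp_norm 2 M f \<le> Lp_norm 2 M g"
    unfolding Lp_norm_2_eq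
  proof (intro real_sqrt_le_mono integral_mono_AE i)
    show "integrable M (\<lambda>x. (norm (g x))\<^sup>2)" using g by (simp add: Lp_space_2_iff)
    show "AE x in M. (norm (f x))\<^sup>2 \<le> (norm (g x))\<^sup>2"
      using le by eventually_elim (simp add: power_mono)
  qed
qed

lemma Lp_space_2_prod_integrable:
  fixes f :: "'a \<Rightarrow> 'b::euclidean_space" and g :: "'a \<Rightarrow> 'c::euclidean_space"
  assumes f: "f \<in> Lp_space 2 M" and g: "g \<in> Lp_space 2 M"
  shows "integrable M (\<lambda>x. norm (f x) * norm (g x))"
proof (rule Bochner_Integration.integrable_bound)
  note [measurable] = Lp_space_2_measurable[OF f] Lp_space_2_measurable[OF g]
  show "integrable M (\<lambda>x. (norm (f x))\<^sup>2 + (norm (g x))\<^sup>2)"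
    using f g by (simp add: Lp_space_2_iff)
  show "AE x in M. norm (norm (f x) * norm (g x)) \<le> norm ((norm (f x))\<^sup>2 + (norm (g x))\<^sup>2)"
  proof (rule AE_I2)
    fix x
    have "0 \<le> (norm (f x) - norm (g x))\<^sup>2" by simp
    then have "2 * (norm (f x) * norm (g x)) \<le> (norm (f x))\<^sup>2 + (norm (g x))\<^sup>2"
      unfolding power2_diff by linarith
    moreover have "0 \<le> norm (f x) * norm (g x)" by simp
    ultimately show "norm (norm (f x) * norm (g x)) \<le> norm ((norm (f x))\<^sup>2 + (norm (g x))\<^sup>2)"
      unfolding real_norm_def by linarith
  qed
  show "(\<lambda>x. norm (f x) * norm (g x)) \<in> borel_measurable M" by measurable
qed

lemma Lp_space_2_bounded_prod_integrable:
  fixes f :: "'a \<Rightarrow> 'b::euclidean_space" and g :: "'a \<Rightarrow> 'c::euclidean_space" and h :: "'a \<Rightarrow> 'd::euclidean_space"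
  assumes "f \<in> Lp_space 2 M" "g \<in> Lp_space 2 M" "h \<in> borel_measurable M"
    "\<And>x. norm (h x) \<le> norm (f x) * norm (g x)"
  shows "integrable M h"
  by (rule Bochner_Integration.integrable_bound[OF Lp_space_2_prod_integrable[OF assms(1,2)]])
     (use assms in auto)

lemma Lp_space_2_inner_integrable:
  fixes f g :: "'a \<Rightarrow> 'b::euclidean_space"
  assumes "f \<in> Lp_space 2 M" "g \<in> Lp_space 2 M"
  shows "integrable M (\<lambda>x. f x \<bullet> g x)"
  by (rule Lp_space_2_bounded_prod_integrable[OF assms])
     (use assms[THEN Lp_space_2_measurable] Cauchy_Schwarz_ineq2 in auto)

lemma Lp_norm_2_Cauchy_Schwarz:
  fixes f :: "'a \<Rightarrow> 'b::euclidean_space" and g :: "'a \<Rightarrow> 'c::euclidean_space"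
  assumes f: "f \<in> Lp_space 2 M" and g: "g \<in> Lp_space 2 M"
  shows "(\<integral>x. norm (f x) * norm (g x) \<partial>M) \<le> Lp_norm 2 M f * Lp_norm 2 M g"
proof -
  note [measurable] = Lp_space_2_measurable[OF f] Lp_space_2_measurable[OF g]
  let ?I = "\<integral>x. norm (f x) * norm (g x) \<partial>M"
  have I0: "0 \<le> ?I" by (simp add: integral_nonneg_AE)
  have "(\<integral>\<^sup>+x. ennreal (norm (f x)) * ennreal (norm (g x)) \<partial>M)\<^sup>2 \<le>
      (\<integral>\<^sup>+x. (ennreal (norm (f x)))\<^sup>2 \<partial>M) * (\<integral>\<^sup>+x. (ennreal (norm (g x)))\<^sup>2 \<partial>M)"
    by (rule Cauchy_Schwarz_nn_integral) measurable
  moreover have "(\<integral>\<^sup>+x. ennreal (norm (f x)) * ennreal (norm (g x)) \<partial>M) = ennreal ?I"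
    by (simp add: ennreal_mult[symmetric] nn_integral_eq_integral Lp_space_2_prod_integrable[OF f g])
  moreover have "(\<integral>\<^sup>+x. (ennreal (norm (f x)))\<^sup>2 \<partial>M) = ennreal ((Lp_norm 2 M f)\<^sup>2)"
    using f by (simp add: ennreal_power nn_integral_eq_integral Lp_space_2_iff Lp_norm_2_squared)
  moreover have "(\<integral>\<^sup>+x. (ennreal (norm (g x)))\<^sup>2 \<partial>M) = ennreal ((Lp_norm 2 M g)\<^sup>2)"
    using g by (simp add: ennreal_power nn_integral_eq_integral Lp_space_2_iff Lp_norm_2_squared)
  ultimately have "ennreal (?I\<^sup>2) \<le> ennreal ((Lp_norm 2 M f * Lp_norm 2 M g)\<^sup>2)"
    using I0 by (simp add: ennreal_power ennreal_mult[symmetric] power_mult_distrib)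
  then have "?I\<^sup>2 \<le> (Lp_norm 2 M f * Lp_norm 2 M g)\<^sup>2"
    by (simp add: ennreal_le_iff)
  then show ?thesis
    by (rule power2_le_imp_le) (simp add: Lp_norm_2_nonneg)
qed

lemma Lp_norm_2_inner_bound:
  fixes f g :: "'a \<Rightarrow> 'b::euclidean_space"
  assumes f: "f \<in> Lp_space 2 M" and g: "g \<in> Lp_space 2 M"
  shows "\<bar>\<integral>x. f x \<bullet> g x \<partial>M\<bar> \<le> Lp_norm 2 M f * Lp_norm 2 M g"
proof -
  have "\<bar>\<integral>x. f x \<bullet> g x \<partial>M\<bar> \<le> (\<integral>x. \<bar>f x \<bullet> g x\<bar> \<partial>M)"
    by (rule integral_abs_bound)
  also have "\<dots> \<le> (\<integral>x. norm (f x) * norm (g x) \<partial>M)"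
    by (intro integral_mono integrable_abs Lp_space_2_inner_integrable Lp_space_2_prod_integrable f g Cauchy_Schwarz_ineq2)
  also have "\<dots> \<le> Lp_norm 2 M f * Lp_norm 2 M g" by (rule Lp_norm_2_Cauchy_Schwarz[OF f g])
  finally show ?thesis .
qed

lemma Lp_norm_2_add:
  fixes f g :: "'a \<Rightarrow> 'b::euclidean_space"
  assumes f: "f \<in> Lp_space 2 M" and g: "g \<in> Lp_space 2 M"
  shows "(\<lambda>x. f x + g x) \<in> Lp_space 2 M" and "Lp_norm 2 M (\<lambda>x. f x + g x) \<le> Lp_norm 2 M f + Lp_norm 2 M g"
proof -
  note [measurable] = Lp_space_2_measurable[OF f] Lp_space_2_measurable[OF g]
  let ?S = "\<lambda>x. (norm (f x))\<^sup>2 + 2 * (norm (f x) * norm (g x)) + (norm (g x))\<^sup>2"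
  have iS: "integrable M ?S"
    using f g Lp_space_2_prod_integrable[OF f g] by (simp add: Lp_space_2_iff)
  have le: "(norm (f x + g x))\<^sup>2 \<le> ?S x" for x
  proof -
    have "(norm (f x + g x))\<^sup>2 \<le> (norm (f x) + norm (g x))\<^sup>2"
      by (intro power_mono norm_triangle_ineq) auto
    then show ?thesis by (simp add: power2_sum algebra_simps)
  qed
  have i: "integrable M (\<lambda>x. (norm (f x + g x))\<^sup>2)"
    by (rule Bochner_Integration.integrable_bound[OF iS]) (use le in \<open>auto intro: order_trans[OF _ abs_ge_self]\<close>)
  then show "(\<lambda>x. f x + g x) \<in> Lp_space 2 M" by (simp add: Lp_space_2_iff)
  have "(Lp_norm 2 M (\<lambda>x. f x + g x))\<^sup>2 \<le> (\<integral>x. ?S x \<partial>M)"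
    unfolding Lp_norm_2_squared by (intro integral_mono i iS le)
  also have "\<dots> = (Lp_norm 2 M f)\<^sup>2 + 2 * (\<integral>x. norm (f x) * norm (g x) \<partial>M) + (Lp_norm 2 M g)\<^sup>2"
    using f g Lp_space_2_prod_integrable[OF f g] by (simp add: Lp_space_2_iff Lp_norm_2_squared)
  also have "\<dots> \<le> (Lp_norm 2 M f + Lp_norm 2 M g)\<^sup>2"
    using Lp_norm_2_Cauchy_Schwarz[OF f g] by (simp add: power2_sum)
  finally show "Lp_norm 2 M (\<lambda>x. f x + g x) \<le> Lp_norm 2 M f + Lp_norm 2 M g"
    by (rule power2_le_imp_le) (simp add: Lp_norm_2_nonneg)
qed

lemma Lp_norm_2_scaleR:
  fixes f :: "'a \<Rightarrow> 'b::euclidean_space"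
  assumes "f \<in> Lp_space 2 M"
  shows "(\<lambda>x. c *\<^sub>R f x) \<in> Lp_space 2 M" and "Lp_norm 2 M (\<lambda>x. c *\<^sub>R f x) = \<bar>c\<bar> * Lp_norm 2 M f"
  using assms by (auto simp: Lp_space_2_iff Lp_norm_2_eq power_mult_distrib real_sqrt_mult)

lemma Lp_norm_2_cmult:
  fixes f :: "'a \<Rightarrow> real"
  assumes "f \<in> Lp_space 2 M"
  shows "(\<lambda>x. c * f x) \<in> Lp_space 2 M" and "Lp_norm 2 M (\<lambda>x. c * f x) = \<bar>c\<bar> * Lp_norm 2 M f"
  using Lp_norm_2_scaleR[OF assms] by simp_all

lemma Lp_norm_2_diff:
  fixes f g :: "'a \<Rightarrow> 'b::euclidean_space"
  assumes f: "f \<in> Lp_space 2 M" and g: "g \<in> Lp_space 2 M"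
  shows "(\<lambda>x. f x - g x) \<in> Lp_space 2 M" and "Lp_norm 2 M (\<lambda>x. f x - g x) \<le> Lp_norm 2 M f + Lp_norm 2 M g"
  using Lp_norm_2_add[OF f Lp_norm_2_scaleR(1)[OF g, of "-1"]] Lp_norm_2_scaleR(2)[OF g, of "-1"] by simp_all

text \<open>It makes the convective term square integrable although the velocity is only in L2: the
  gradient of the comparison function is bounded.\<close>

lemma Lp_space_2_inner_const:
  fixes f :: "'a \<Rightarrow> 'b::euclidean_space"
  assumes f: "f \<in> Lp_space 2 M" and g: "g \<in> borel_measurable M" and le: "AE x in M. norm (g x) \<le> K"
  shows "(\<lambda>x. f x \<bullet> g x) \<in> Lp_space 2 M"
proof (rule Lp_space_2_bound(1))
  show "(\<lambda>x. K *\<^sub>R f x) \<in> Lp_space 2 M" by (rule Lp_norm_2_scaleR[OF f])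
  show "(\<lambda>x. f x \<bullet> g x) \<in> borel_measurable M" using Lp_space_2_measurable[OF f] g by measurable
  show "AE x in M. norm (f x \<bullet> g x) \<le> norm (K *\<^sub>R f x)"
    using le
  proof eventually_elim
    case (elim x)
    have "\<bar>f x \<bullet> g x\<bar> \<le> norm (f x) * norm (g x)" by (rule Cauchy_Schwarz_ineq2)
    also have "\<dots> \<le> norm (f x) * \<bar>K\<bar>" using elim by (intro mult_left_mono) auto
    finally show ?case by (simp add: mult.commute)
  qed
qed

lemma (in finite_measure) Lp_space_infinity_imp_2:
  fixes f :: "'a \<Rightarrow> 'b::euclidean_space"
  assumes "f \<in> Lp_space \<infinity> M" shows "f \<in> Lp_space 2 M"
proof -
  obtain C where f: "f \<in> borel_measurable M" and C: "AE x in M. norm (f x) \<le> C"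
    using assms by (auto simp: Lp_space_def)
  have "(\<lambda>x. C) \<in> Lp_space 2 M" by (simp add: Lp_space_2_iff)
  then show ?thesis
    by (rule Lp_space_2_bound) (use f C in \<open>auto elim!: eventually_mono\<close>)
qed

lemma (in finite_measure) Lp_space_2_integrable:
  fixes f :: "'a \<Rightarrow> 'b::euclidean_space"
  assumes "f \<in> Lp_space 2 M" shows "integrable M f"
proof (rule Lp_space_2_bounded_prod_integrable[OF assms])
  show "(\<lambda>x. 1::real) \<in> Lp_space 2 M" by (simp add: Lp_space_2_iff)
qed (use assms in \<open>auto simp: Lp_space_2_measurable\<close>)

lemma Lp_space_infinity_diff:
  fixes f g :: "'a \<Rightarrow> 'b::euclidean_space"
  assumes "f \<in> Lp_space \<infinity> M" "g \<in> Lp_space \<infinity> M" shows "(\<lambda>x. f x - g x) \<in> Lp_space \<infinity> M"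
proof -
  obtain C D where f: "f \<in> borel_measurable M" "AE x in M. norm (f x) \<le> C"
    and g: "g \<in> borel_measurable M" "AE x in M. norm (g x) \<le> D"
    using assms by (auto simp: Lp_space_def)
  have "AE x in M. norm (f x - g x) \<le> C + D"
    using f(2) g(2) by eventually_elim (metis add_mono norm_triangle_ineq4 order_trans)
  then show ?thesis using f g by (auto simp: Lp_space_def)
qed

lemma finite_measure_lebesgue_on:
  assumes "open U" "bounded U" shows "finite_measure (lebesgue_on U)"
proof
  have "emeasure lborel U < \<infinity>" using assms by (intro emeasure_bounded_finite)
  then show "emeasure (lebesgue_on U) (space (lebesgue_on U)) \<noteq> \<infinity>"
    using assms by (simp add: emeasure_restrict_space)
qed

subsection \<open>Stability of one transport step\<close>

text \<open>Lebesgue measure is complete, so equality almost everywhere with a Borel function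
  already forces measurability.\<close>

lemma representative_source_measurable:
  fixes f :: "'a::euclidean_space \<Rightarrow> 'b::euclidean_space"
  assumes U: "open U" and r: "representative U f f'"
  shows "f \<in> borel_measurable (lebesgue_on U)"
proof (rule borel_measurable_if_D)
  note [measurable] = representative_measurable[OF r]
  have "AE x in lebesgue. f' x = (if x \<in> U then f x else 0)"
    using representative_AE[OF r] unfolding AE_completion_iff
    by eventually_elim (use r in \<open>auto simp: representative_def\<close>)
  moreover have "f' \<in> borel_measurable lebesgue" by (rule measurable_completion) simp
  ultimately show "(\<lambda>x. if x \<in> U then f x else 0) \<in> borel_measurable lebesgue"
    by (rule borel_measurable_AE[rotated])
qed

section \<open>Weak derivatives and H1 on open sets\<close>

lemma integrable_imp_locally_integrable:
  fixes f :: "'a::euclidean_space \<Rightarrow> 'b::euclidean_space"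
  assumes U: "open U" and f: "integrable (lebesgue_on U) f"
  shows "locally_integrable U f"
  unfolding locally_integrable_def
proof (intro allI impI)
  fix K assume K: "compact K \<and> K \<subseteq> U"
  then have Km: "K \<in> sets lebesgue" by (simp add: lmeasurable_compact fmeasurableD)
  have "integrable lebesgue (\<lambda>x. indicator U x *\<^sub>R f x)"
    using U f by (simp add: integrable_restrict_space)
  then have "integrable lebesgue (\<lambda>x. indicator K x *\<^sub>R (indicator U x *\<^sub>R f x))"
    by (rule integrable_mult_indicator[OF Km])
  also have "(\<lambda>x. indicator K x *\<^sub>R (indicator U x *\<^sub>R f x)) = (\<lambda>x. indicator K x *\<^sub>R f x)"
    using K by (auto simp: indicator_def fun_eq_iff)
  finally show "integrable (lebesgue_on K) f" using Km by (simp add: integrable_restrict_space)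
qed

lemma representative_scaleR_test:
  fixes f :: "'a::euclidean_space \<Rightarrow> 'b::euclidean_space" and \<phi> :: "'a \<Rightarrow> real"
  assumes r: "representative U f f'" and \<phi>: "\<phi> \<in> test_functions V"
  shows "representative U (\<lambda>x. \<phi> x *\<^sub>R f x) (\<lambda>x. \<phi> x *\<^sub>R f' x)"
  using r test_functions_measurable[OF \<phi>] unfolding representative_def
  by (auto elim!: eventually_mono)

text \<open>Bridge between the definition on \<open>lebesgue_on U\<close> and its Borel form on the
  whole space: derivatives are given and wanted in the former, but computed in the latter.\<close>

lemma has_weak_deriv_iff_L1:
  fixes f g :: "'a::euclidean_space \<Rightarrow> 'b::euclidean_space"
  assumes U: "open U" and rf: "representative U f f'" and rg: "representative U g g'"
    and f': "integrable lborel f'" and g': "integrable lborel g'"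
  shows "has_weak_deriv U v f g \<longleftrightarrow> L1_weak_deriv U v f' g'"
proof -
  note fm = representative_source_measurable[OF U rf] and gm = representative_source_measurable[OF U rg]
  have li: "locally_integrable U f" "locally_integrable U g"
    using representative_integral(2)[OF U rf fm] representative_integral(2)[OF U rg gm] f' g'
    by (auto intro: integrable_imp_locally_integrable[OF U])
  have eq: "integral\<^sup>L (lebesgue_on U) (\<lambda>x. \<phi> x *\<^sub>R f x) = (\<integral>x. \<phi> x *\<^sub>R f' x \<partial>lborel)"
    "integral\<^sup>L (lebesgue_on U) (\<lambda>x. \<phi> x *\<^sub>R g x) = (\<integral>x. \<phi> x *\<^sub>R g' x \<partial>lborel)"
    if "\<phi> \<in> test_functions U" for \<phi> :: "'a \<Rightarrow> real"
    using that
    by (auto intro!: representative_integral(1)[OF U] representative_scaleR_test[OF rf] representative_scaleR_test[OF rg]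
        borel_measurable_integrable[OF test_function_times_locally_integrable[OF U]] li)
  show ?thesis
    using f' g' li rf rg
    by (auto simp: has_weak_deriv_def L1_weak_deriv_def eq test_functions_deriv representative_def)
qed

lemma has_weak_deriv_diff:
  fixes f g :: "'a::euclidean_space \<Rightarrow> 'b::euclidean_space"
  assumes U: "open U" and "has_weak_deriv U v f f'" "has_weak_deriv U v g g'"
  shows "has_weak_deriv U v (\<lambda>x. f x - g x) (\<lambda>x. f' x - g' x)"
  using assms(2,3) unfolding has_weak_deriv_def
  by (auto simp: locally_integrable_diff scaleR_diff_right test_functions_deriv
      test_function_times_locally_integrable[OF U])

text \<open>The difference of two candidates is annihilated by all tests. This gives the chosen
  representative \<open>weak_deriv\<close> a meaning almost everywhere.\<close>

lemma has_weak_deriv_unique: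
  fixes f g :: "'a::euclidean_space \<Rightarrow> 'b::euclidean_space"
  assumes U: "open U" and f: "has_weak_deriv U v f f1" "has_weak_deriv U v f f2"
  shows "AE x in lborel. x \<in> U \<longrightarrow> f1 x = f2 x"
proof -
  have li: "locally_integrable U f1" "locally_integrable U f2" using f by (auto simp: has_weak_deriv_def)
  have "AE x in lborel. x \<in> U \<longrightarrow> f1 x - f2 x = 0"
  proof (rule fundamental_lemma[OF U locally_integrable_diff[OF li]])
    fix \<phi> :: "'a \<Rightarrow> real" assume \<phi>: "\<phi> \<in> test_functions U"
    show "integral\<^sup>L (lebesgue_on U) (\<lambda>x. \<phi> x *\<^sub>R (f1 x - f2 x)) = 0"
      using f \<phi> by (simp add: has_weak_deriv_def scaleR_diff_right
          test_function_times_locally_integrable[OF U li(1) \<phi>] test_function_times_locally_integrable[OF U li(2) \<phi>])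
  qed
  then show ?thesis by eventually_elim auto
qed

lemma weakly_differentiable_has_weak_deriv:
  "weakly_differentiable U v f \<Longrightarrow> has_weak_deriv U v f (weak_deriv U v f)"
  unfolding weakly_differentiable_def weak_deriv_def by (metis someI_ex)

lemma Basis_real3: "Basis = range (\<lambda>j. axis j 1 :: real^3)"
  by (auto simp: Basis_vec_def)

lemma H1_has_weak_deriv:
  "f \<in> H1 \<Omega> \<Longrightarrow> b \<in> Basis \<Longrightarrow> has_weak_deriv \<Omega> b f (weak_deriv \<Omega> b f)"
  by (auto simp: H1_def intro: weakly_differentiable_has_weak_deriv)

lemma axis_Basis_real3: "axis j 1 \<in> (Basis :: (real^3) set)"
  by (auto simp: Basis_real3)

lemma vec3_measurable:
  fixes G :: "'a \<Rightarrow> real^3"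
  shows "(\<And>j. (\<lambda>x. G x $ j) \<in> borel_measurable M) \<Longrightarrow> G \<in> borel_measurable M"
  by (rule borel_measurable_euclidean_space[THEN iffD2]) (auto simp: Basis_real3 cart_eq_inner_axis)

lemma norm_vec3_squared: "(norm (y::real^3))\<^sup>2 = (\<Sum>j\<in>UNIV. (y $ j)\<^sup>2)"
  by (simp add: norm_vec_def L2_set_def sum_nonneg)

lemma Lp_space_2_vec3_iff:
  fixes G :: "'a \<Rightarrow> real^3"
  shows "G \<in> Lp_space 2 M \<longleftrightarrow> (\<forall>j. (\<lambda>x. G x $ j) \<in> Lp_space 2 M)"
proof
  assume G: "G \<in> Lp_space 2 M"
  show "\<forall>j. (\<lambda>x. G x $ j) \<in> Lp_space 2 M"
  proof
    fix j
    have "(\<lambda>x. G x \<bullet> axis j 1) \<in> borel_measurable M"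
      using Lp_space_2_measurable[OF G] by measurable
    then have "(\<lambda>x. G x $ j) \<in> borel_measurable M" by (simp add: cart_eq_inner_axis)
    then show "(\<lambda>x. G x $ j) \<in> Lp_space 2 M"
      by (rule Lp_space_2_bound(1)[OF G]) (auto intro: component_le_norm_cart)
  qed
next
  assume G: "\<forall>j. (\<lambda>x. G x $ j) \<in> Lp_space 2 M"
  then show "G \<in> Lp_space 2 M"
    by (auto simp: Lp_space_2_iff norm_vec3_squared intro: vec3_measurable)
qed

lemma H1_weak_grad:
  assumes "f \<in> H1 \<Omega>"
  shows "has_weak_deriv \<Omega> (axis j 1) f (\<lambda>x. weak_grad \<Omega> f x $ j)" and "weak_grad \<Omega> f \<in> Lp_space 2 (lebesgue_on \<Omega>)"
    and "f \<in> Lp_space 2 (lebesgue_on \<Omega>)"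
  using H1_has_weak_deriv[OF assms axis_Basis_real3] assms axis_Basis_real3
  by (auto simp: weak_grad_def H1_def Lp_space_2_vec3_iff)

text \<open>\<open>weak_grad\<close> rests on a choice, so a function with a known candidate
  gradient G enters H1 through uniqueness; square integrability passes from G to the chosen
  representative.\<close>

lemma H1_I:
  fixes G :: "real^3 \<Rightarrow> real^3"
  assumes U: "open \<Omega>" and f: "f \<in> Lp_space 2 (lebesgue_on \<Omega>)" and G: "G \<in> Lp_space 2 (lebesgue_on \<Omega>)"
    and wd: "\<And>j. has_weak_deriv \<Omega> (axis j 1) f (\<lambda>x. G x $ j)"
  shows "f \<in> H1 \<Omega>" and "AE x in lebesgue_on \<Omega>. weak_grad \<Omega> f x = G x"
proof -
  have h: "has_weak_deriv \<Omega> (axis j 1) f (weak_deriv \<Omega> (axis j 1) f)" for j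
    using wd[of j] by (intro weakly_differentiable_has_weak_deriv) (auto simp: weakly_differentiable_def)
  have ae: "AE x in lebesgue_on \<Omega>. weak_deriv \<Omega> (axis j 1) f x = G x $ j" for j
    using has_weak_deriv_unique[OF U h wd] by (simp add: AE_lebesgue_on_open_iff[OF U])
  have "weak_deriv \<Omega> (axis j 1) f \<in> Lp_space 2 (lebesgue_on \<Omega>)" for j
  proof (rule Lp_space_2_bound(1))
    show "(\<lambda>x. G x $ j) \<in> Lp_space 2 (lebesgue_on \<Omega>)" using G Lp_space_2_vec3_iff by blast
    show "weak_deriv \<Omega> (axis j 1) f \<in> borel_measurable (lebesgue_on \<Omega>)"
      using h[of j] by (intro locally_integrable_measurable[OF U]) (simp add: has_weak_deriv_def)
    show "AE x in lebesgue_on \<Omega>. norm (weak_deriv \<Omega> (axis j 1) f x) \<le> norm (G x $ j)"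
      using ae[of j] by eventually_elim simp
  qed
  then show "f \<in> H1 \<Omega>"
    using f h by (auto simp: H1_def Basis_real3 weakly_differentiable_def)
  have "AE x in lebesgue_on \<Omega>. \<forall>j\<in>UNIV. weak_deriv \<Omega> (axis j 1) f x = G x $ j"
    by (rule AE_finite_allI) (use ae in auto)
  then show "AE x in lebesgue_on \<Omega>. weak_grad \<Omega> f x = G x"
    by eventually_elim (simp add: weak_grad_def vec_eq_iff)
qed

lemma H1_diff:
  fixes f g :: "real^3 \<Rightarrow> real"
  assumes U: "open \<Omega>" and f: "f \<in> H1 \<Omega>" and g: "g \<in> H1 \<Omega>"
  shows "(\<lambda>x. f x - g x) \<in> H1 \<Omega>"
    and "AE x in lebesgue_on \<Omega>. weak_grad \<Omega> (\<lambda>x. f x - g x) x = weak_grad \<Omega> f x - weak_grad \<Omega> g x"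
proof -
  have wd: "has_weak_deriv \<Omega> (axis j 1) (\<lambda>x. f x - g x) (\<lambda>x. (weak_grad \<Omega> f x - weak_grad \<Omega> g x) $ j)" for j
    using has_weak_deriv_diff[OF U H1_weak_grad(1)[OF f] H1_weak_grad(1)[OF g]] by simp
  note * = Lp_norm_2_diff(1)[OF H1_weak_grad(3)[OF f] H1_weak_grad(3)[OF g]]
     Lp_norm_2_diff(1)[OF H1_weak_grad(2)[OF f] H1_weak_grad(2)[OF g]]
  show "(\<lambda>x. f x - g x) \<in> H1 \<Omega>"
    "AE x in lebesgue_on \<Omega>. weak_grad \<Omega> (\<lambda>x. f x - g x) x = weak_grad \<Omega> f x - weak_grad \<Omega> g x"
    by (rule H1_I[OF U * wd])+
qed

lemma has_weak_deriv_square: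
  fixes f g :: "'a::euclidean_space \<Rightarrow> real"
  assumes U: "open U" and f: "integrable (lebesgue_on U) f" and g: "integrable (lebesgue_on U) g"
    and wd: "has_weak_deriv U v f g" and K: "AE x in lebesgue_on U. \<bar>f x\<bar> \<le> K"
  shows "has_weak_deriv U v (\<lambda>x. (f x)\<^sup>2) (\<lambda>x. 2 * f x * g x)"
proof -
  obtain f0 where f0: "representative U f f0"
    using representative_exists[OF U borel_measurable_integrable[OF f]] .
  obtain g' where g': "representative U g g'"
    using representative_exists[OF U borel_measurable_integrable[OF g]] .
  \<comment> \<open>\<open>L1_weak_deriv_square\<close> asks for a bound at every point, whereas K
    is one almost everywhere; the truncation changes the representative on a null set only.\<close>
  define f' where "f' x = max (- \<bar>K\<bar>) (min \<bar>K\<bar> (f0 x))" for x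
  note [measurable] = representative_measurable[OF f0] representative_measurable[OF g']
  have f'm[measurable]: "f' \<in> borel_measurable borel" unfolding f'_def by measurable
  have f': "representative U f f'"
    unfolding representative_def
  proof (intro conjI allI impI)
    show "AE x in lborel. x \<in> U \<longrightarrow> f' x = f x"
      using representative_AE[OF f0] K[unfolded AE_lebesgue_on_open_iff[OF U]]
      by eventually_elim (auto simp: f'_def)
    show "f' x = 0" if "x \<notin> U" for x using f0 that by (simp add: f'_def representative_def)
  qed simp
  have i: "integrable lborel f'" "integrable lborel g'"
    using representative_integral(2)[OF U f' borel_measurable_integrable[OF f]]
      representative_integral(2)[OF U g' borel_measurable_integrable[OF g]] f g by auto
  have "L1_weak_deriv U v f' g'"
    using has_weak_deriv_iff_L1[OF U f' g' i] wd by blast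
  then have sq: "L1_weak_deriv U v (\<lambda>x. (f' x)\<^sup>2) (\<lambda>x. 2 * f' x * g' x)"
    by (rule L1_weak_deriv_square[OF U, where K="\<bar>K\<bar>"]) (auto simp: f'_def)
  have r: "representative U (\<lambda>x. (f x)\<^sup>2) (\<lambda>x. (f' x)\<^sup>2)"
    unfolding representative_def
  proof (intro conjI)
    show "AE x in lborel. x \<in> U \<longrightarrow> (f' x)\<^sup>2 = (f x)\<^sup>2"
      using representative_AE[OF f'] by eventually_elim simp
  qed (use f' in \<open>auto simp: representative_def\<close>)
  have r2: "representative U (\<lambda>x. 2 * f x * g x) (\<lambda>x. 2 * f' x * g' x)"
    unfolding representative_def
  proof (intro conjI)
    show "AE x in lborel. x \<in> U \<longrightarrow> 2 * f' x * g' x = 2 * f x * g x"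
      using representative_AE[OF f'] representative_AE[OF g'] by eventually_elim simp
  qed (use f' in \<open>auto simp: representative_def\<close>)
  show ?thesis
    using has_weak_deriv_iff_L1[OF U r r2] sq by (auto simp: L1_weak_deriv_def)
qed

text \<open>The bound on f keeps both the square and 2 f times the gradient square integrable. The
  square serves as potential when the velocity is orthogonal to gradients.\<close>

lemma H1_square:
  fixes f :: "real^3 \<Rightarrow> real"
  assumes U: "open \<Omega>" "bounded \<Omega>" and f: "f \<in> H1 \<Omega>" and K: "AE x in lebesgue_on \<Omega>. \<bar>f x\<bar> \<le> K"
  shows "(\<lambda>x. (f x)\<^sup>2) \<in> H1 \<Omega>"
    and "AE x in lebesgue_on \<Omega>. weak_grad \<Omega> (\<lambda>x. (f x)\<^sup>2) x = (2 * f x) *\<^sub>R weak_grad \<Omega> f x"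
proof -
  interpret finite_measure "lebesgue_on \<Omega>" by (rule finite_measure_lebesgue_on[OF U])
  note fL = H1_weak_grad(3)[OF f] and gL = H1_weak_grad(2)[OF f]
  note [measurable] = Lp_space_2_measurable[OF fL] Lp_space_2_measurable[OF gL]
  have "(\<lambda>x. weak_grad \<Omega> f x $ j) \<in> Lp_space 2 (lebesgue_on \<Omega>)" for j
    using gL Lp_space_2_vec3_iff by blast
  then have wd: "has_weak_deriv \<Omega> (axis j 1) (\<lambda>x. (f x)\<^sup>2) (\<lambda>x. ((2 * f x) *\<^sub>R weak_grad \<Omega> f x) $ j)" for j
    using has_weak_deriv_square[OF U(1) Lp_space_2_integrable[OF fL] Lp_space_2_integrable H1_weak_grad(1)[OF f] K, of j] by simp
  have 1: "(\<lambda>x. (f x)\<^sup>2) \<in> Lp_space 2 (lebesgue_on \<Omega>)"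
  proof (rule Lp_space_2_bound(1)[OF Lp_norm_2_cmult(1)[OF fL]])
    show "AE x in lebesgue_on \<Omega>. norm ((f x)\<^sup>2) \<le> norm (K * f x)"
      using K
    proof eventually_elim
      case (elim x)
      then have "\<bar>f x\<bar> * \<bar>f x\<bar> \<le> \<bar>K\<bar> * \<bar>f x\<bar>" by (intro mult_right_mono) auto
      then show ?case by (simp add: power2_eq_square abs_mult)
    qed
  qed simp
  have 2: "(\<lambda>x. (2 * f x) *\<^sub>R weak_grad \<Omega> f x) \<in> Lp_space 2 (lebesgue_on \<Omega>)"
  proof (rule Lp_space_2_bound(1)[OF Lp_norm_2_scaleR(1)[OF gL]])
    show "AE x in lebesgue_on \<Omega>. norm ((2 * f x) *\<^sub>R weak_grad \<Omega> f x) \<le> norm ((2 * K) *\<^sub>R weak_grad \<Omega> f x)"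
      using K by eventually_elim (auto intro!: mult_right_mono)
  qed simp
  show "(\<lambda>x. (f x)\<^sup>2) \<in> H1 \<Omega>"
    "AE x in lebesgue_on \<Omega>. weak_grad \<Omega> (\<lambda>x. (f x)\<^sup>2) x = (2 * f x) *\<^sub>R weak_grad \<Omega> f x"
    by (rule H1_I[OF U(1) 1 2 wd])+
qed

text \<open>The test function of the energy estimate is \<open>w = B - R\<close>; the convective
  term \<open>(wh \<cdot> \<nabla>w) w = 1/2 wh \<cdot> \<nabla>(w\<^sup>2)\<close> integrates to zero.\<close>

lemma regularized_step_stability:
  fixes B \<rho> R :: "real^3 \<Rightarrow> real" and wh :: "real^3 \<Rightarrow> real^3"
  assumes U: "open \<Omega>" "bounded \<Omega>" and \<delta>: "0 < \<delta>" and \<epsilon>: "0 < \<epsilon>"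
    and wh: "wh \<in> Lp_space 2 (lebesgue_on \<Omega>)"
    and orth: "\<And>\<phi>. \<phi> \<in> H1 \<Omega> \<Longrightarrow> (\<integral>x. wh x \<bullet> weak_grad \<Omega> \<phi> x \<partial>lebesgue_on \<Omega>) = 0"
    and R: "regularized_transport \<Omega> \<delta> \<epsilon> wh \<rho> R" "R \<in> Lp_space \<infinity> (lebesgue_on \<Omega>)"
    and \<rho>: "\<rho> \<in> Lp_space \<infinity> (lebesgue_on \<Omega>)"
    and B: "B \<in> H1 \<Omega>" "B \<in> Lp_space \<infinity> (lebesgue_on \<Omega>)"
    and gB: "AE x in lebesgue_on \<Omega>. norm (weak_grad \<Omega> B x) \<le> K"
  shows "(\<integral>x. (B x - R x)\<^sup>2 \<partial>lebesgue_on \<Omega>) \<le>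
      (\<integral>x. (B x - \<rho> x + \<delta> * (wh x \<bullet> weak_grad \<Omega> B x))\<^sup>2 \<partial>lebesgue_on \<Omega>)
      + \<epsilon> * (\<delta> / 2 * (\<integral>x. (norm (weak_grad \<Omega> B x))\<^sup>2 \<partial>lebesgue_on \<Omega>))"
proof -
  let ?M = "lebesgue_on \<Omega>"
  interpret finite_measure ?M by (rule finite_measure_lebesgue_on[OF U])
  let ?w = "\<lambda>x. B x - R x"
  let ?Z = "\<lambda>x. B x - \<rho> x + \<delta> * (wh x \<bullet> weak_grad \<Omega> B x)"
  have RH: "R \<in> H1 \<Omega>" using R(1) by (simp add: regularized_transport_def)
  have wH: "?w \<in> H1 \<Omega>" and wi: "?w \<in> Lp_space \<infinity> ?M"
    and gw: "AE x in ?M. weak_grad \<Omega> ?w x = weak_grad \<Omega> B x - weak_grad \<Omega> R x"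
    using H1_diff[OF U(1) B(1) RH] Lp_space_infinity_diff[OF B(2) R(2)] by auto
  obtain K' where K': "AE x in ?M. \<bar>?w x\<bar> \<le> K'"
    using wi by (auto simp: Lp_space_def)
  note L2 = Lp_space_infinity_imp_2[OF \<rho>] H1_weak_grad(2,3)[OF B(1)] H1_weak_grad(2,3)[OF RH] H1_weak_grad(2,3)[OF wH] wh
  note [measurable] = L2[THEN Lp_space_2_measurable]
  have ZL: "?Z \<in> Lp_space 2 ?M"
    by (intro Lp_norm_2_add(1) Lp_norm_2_diff(1) Lp_norm_2_cmult(1) Lp_space_2_inner_const[OF wh _ gB] L2) measurable
  \<comment> \<open>Velocity times gradient is a product of two L2 functions, hence only integrable;
    the third factor has to be bounded.\<close>
  have bw: "integrable ?M (\<lambda>x. F x * ?w x)" if "integrable ?M F" for F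
  proof (rule Bochner_Integration.integrable_bound)
    show "integrable ?M (\<lambda>x. K' * F x)" using that by simp
    show "AE x in ?M. norm (F x * ?w x) \<le> norm (K' * F x)"
      using K'
    proof eventually_elim
      case (elim x)
      then have "\<bar>F x\<bar> * \<bar>B x - R x\<bar> \<le> \<bar>F x\<bar> * \<bar>K'\<bar>" by (intro mult_left_mono) auto
      then show ?case by (simp add: abs_mult mult.commute)
    qed
    show "(\<lambda>x. F x * ?w x) \<in> borel_measurable ?M"
      using borel_measurable_integrable[OF that] by measurable
  qed
  have conv0: "(\<integral>x. (wh x \<bullet> weak_grad \<Omega> ?w x) * ?w x \<partial>?M) = 0"
  proof -
    have "(\<integral>x. wh x \<bullet> weak_grad \<Omega> (\<lambda>x. (?w x)\<^sup>2) x \<partial>?M) = (\<integral>x. 2 * ((wh x \<bullet> weak_grad \<Omega> ?w x) * ?w x) \<partial>?M)"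
    proof (rule integral_cong_AE)
      show "(\<lambda>x. wh x \<bullet> weak_grad \<Omega> (\<lambda>x. (?w x)\<^sup>2) x) \<in> borel_measurable ?M"
        using Lp_space_2_measurable[OF H1_weak_grad(2)[OF H1_square(1)[OF U wH K']]] by measurable
      show "AE x in ?M. wh x \<bullet> weak_grad \<Omega> (\<lambda>x. (?w x)\<^sup>2) x = 2 * ((wh x \<bullet> weak_grad \<Omega> ?w x) * ?w x)"
        using H1_square(2)[OF U wH K'] by eventually_elim simp
    qed measurable
    with orth[OF H1_square(1)[OF U wH K']] show ?thesis by simp
  qed
  let ?E = "\<lambda>x. (R x - \<rho> x) / \<delta> * ?w x + (wh x \<bullet> weak_grad \<Omega> R x) * ?w x + \<epsilon> * (weak_grad \<Omega> R x \<bullet> weak_grad \<Omega> ?w x)"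
  have E0: "(\<integral>x. ?E x \<partial>?M) = 0"
    using R(1) wH wi by (simp add: regularized_transport_def)
  have iE: "integrable ?M ?E"
    by (intro Bochner_Integration.integrable_add bw integrable_divide_zero Bochner_Integration.integrable_diff
        integrable_mult_right Lp_space_2_inner_integrable Lp_space_2_integrable L2) 
  have iconv: "integrable ?M (\<lambda>x. (wh x \<bullet> weak_grad \<Omega> ?w x) * ?w x)"
    by (intro bw Lp_space_2_inner_integrable L2)
  have isq: "integrable ?M (\<lambda>x. (?w x)\<^sup>2)" "integrable ?M (\<lambda>x. (?Z x)\<^sup>2)" "integrable ?M (\<lambda>x. (norm (weak_grad \<Omega> B x))\<^sup>2)"
    using L2 ZL by (auto simp: Lp_space_2_iff)
  \<comment> \<open>The integrals of E and of the convective term vanish; they are subtracted so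
    that the inequality becomes pointwise. With a and b the gradients of B and w, \<delta> times the
    sum of the two integrands is Z w - w^2 + \<epsilon> \<delta> (a.b - b.b). Then Z w \<le> (w^2 +
    Z^2)/2, and a.b - b.b \<le> |a|^2/4 because |a/2 - b|^2 \<ge> 0.\<close>
  have "(\<integral>x. (?w x)\<^sup>2 \<partial>?M) \<le> (\<integral>x. (1/2 * (?w x)\<^sup>2 + 1/2 * (?Z x)\<^sup>2) + \<epsilon> * \<delta> / 4 * (norm (weak_grad \<Omega> B x))\<^sup>2
      - \<delta> * ?E x - \<delta> * ((wh x \<bullet> weak_grad \<Omega> ?w x) * ?w x) \<partial>?M)"
  proof (rule integral_mono_AE)
    show "AE x in ?M. (?w x)\<^sup>2 \<le> (1/2 * (?w x)\<^sup>2 + 1/2 * (?Z x)\<^sup>2) + \<epsilon> * \<delta> / 4 * (norm (weak_grad \<Omega> B x))\<^sup>2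
      - \<delta> * ?E x - \<delta> * ((wh x \<bullet> weak_grad \<Omega> ?w x) * ?w x)"
      using gw
    proof eventually_elim
      case (elim x)
      define a b g where "a = weak_grad \<Omega> B x" and "b = weak_grad \<Omega> ?w x" and "g = wh x"
      have r: "weak_grad \<Omega> R x = a - b" using elim by (simp add: a_def b_def)
      have "0 \<le> \<epsilon> * \<delta> * (norm ((1/2) *\<^sub>R a - b))\<^sup>2" using \<epsilon> \<delta> by simp
      then have 1: "\<epsilon> * \<delta> * (a \<bullet> b - b \<bullet> b) \<le> \<epsilon> * \<delta> / 4 * (norm a)\<^sup>2"
        by (simp add: power2_norm_eq_inner inner_diff inner_commute algebra_simps)
      have 2: "?Z x * ?w x \<le> 1/2 * (?w x)\<^sup>2 + 1/2 * (?Z x)\<^sup>2"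
        using sum_squares_bound[of "?Z x" "?w x"] unfolding mult.assoc by linarith
      have "\<delta> * ?E x + \<delta> * ((g \<bullet> b) * ?w x) = ?Z x * ?w x - (?w x)\<^sup>2 + \<epsilon> * \<delta> * (a \<bullet> b - b \<bullet> b)"
        unfolding r a_def[symmetric] b_def[symmetric] g_def[symmetric] using \<delta>
        by (simp add: inner_diff_left inner_diff_right power2_eq_square field_simps)
      with 1 2 show ?case unfolding a_def b_def g_def by linarith
    qed
  qed (intro Bochner_Integration.integrable_add Bochner_Integration.integrable_diff integrable_mult_right isq iE iconv)+
  also have "\<dots> = 1/2 * (\<integral>x. (?w x)\<^sup>2 \<partial>?M) + 1/2 * (\<integral>x. (?Z x)\<^sup>2 \<partial>?M) + \<epsilon> * \<delta> / 4 * (\<integral>x. (norm (weak_grad \<Omega> B x))\<^sup>2 \<partial>?M)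
      - \<delta> * (\<integral>x. ?E x \<partial>?M) - \<delta> * (\<integral>x. (wh x \<bullet> weak_grad \<Omega> ?w x) * ?w x \<partial>?M)"
    using isq iE iconv by (simp only: Bochner_Integration.integral_add Bochner_Integration.integral_diff
       integral_mult_right_zero Bochner_Integration.integrable_add Bochner_Integration.integrable_diff integrable_mult_right)
  finally show ?thesis unfolding E0 conv0 by simp
qed

text \<open>The \<open>L\<^sup>2\<close> norm is lower semicontinuous under the weak-* limit
  \<open>\<epsilon> \<rightarrow> 0\<close>; no Gronwall factor appears.\<close>

lemma viscosity_step_stability:
  fixes B \<rho> \<rho>' :: "real^3 \<Rightarrow> real" and wh :: "real^3 \<Rightarrow> real^3"
  assumes U: "open \<Omega>" "bounded \<Omega>" and \<delta>: "0 < \<delta>"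
    and wh: "wh \<in> Lp_space 2 (lebesgue_on \<Omega>)"
    and orth: "\<And>\<phi>. \<phi> \<in> H1 \<Omega> \<Longrightarrow> (\<integral>x. wh x \<bullet> weak_grad \<Omega> \<phi> x \<partial>lebesgue_on \<Omega>) = 0"
    and vs: "viscosity_solution \<Omega> \<delta> wh \<rho> \<rho>'"
    and \<rho>: "\<rho> \<in> Lp_space \<infinity> (lebesgue_on \<Omega>)"
    and B: "B \<in> H1 \<Omega>" "B \<in> Lp_space \<infinity> (lebesgue_on \<Omega>)"
    and gB: "AE x in lebesgue_on \<Omega>. norm (weak_grad \<Omega> B x) \<le> K"
  shows "L2_norm \<Omega> (\<lambda>x. B x - \<rho>' x) \<le> L2_norm \<Omega> (\<lambda>x. B x - \<rho> x + \<delta> * (wh x \<bullet> weak_grad \<Omega> B x))"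
proof -
  let ?M = "lebesgue_on \<Omega>"
  interpret finite_measure ?M by (rule finite_measure_lebesgue_on[OF U])
  obtain R where R: "\<And>\<epsilon>. \<epsilon> > 0 \<Longrightarrow> regularized_transport \<Omega> \<delta> \<epsilon> wh \<rho> (R \<epsilon>)"
    and ws: "weakstar_Linf ?M R \<rho>' (at_right 0)"
    using vs by (auto simp: viscosity_solution_def)
  have Ri: "\<forall>\<^sub>F \<epsilon> in at_right 0. R \<epsilon> \<in> Lp_space \<infinity> ?M" and \<rho>'i: "\<rho>' \<in> Lp_space \<infinity> ?M"
    and lim: "\<And>g. g \<in> Lp_space 1 ?M \<Longrightarrow> ((\<lambda>\<epsilon>. \<integral>x. R \<epsilon> x * g x \<partial>?M) \<longlongrightarrow> (\<integral>x. \<rho>' x * g x \<partial>?M)) (at_right 0)"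
    using ws by (auto simp: weakstar_Linf_def)
  let ?e = "\<lambda>x. B x - \<rho>' x"
  let ?Z2 = "\<integral>x. (B x - \<rho> x + \<delta> * (wh x \<bullet> weak_grad \<Omega> B x))\<^sup>2 \<partial>?M"
  let ?c = "\<delta> / 2 * (\<integral>x. (norm (weak_grad \<Omega> B x))\<^sup>2 \<partial>?M)"
  have ei: "?e \<in> Lp_space \<infinity> ?M" by (rule Lp_space_infinity_diff[OF B(2) \<rho>'i])
  note eL = Lp_space_infinity_imp_2[OF ei] and \<rho>L = Lp_space_infinity_imp_2[OF \<rho>'i] and BL = H1_weak_grad(3)[OF B(1)]
  \<comment> \<open>The limit error itself is the test function in the weak-* limit; on a set of
    finite measure it lies in L1.\<close>
  have e1: "?e \<in> Lp_space 1 ?M"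
    using Lp_space_2_integrable[OF eL] by (simp add: Lp_space_def Lp_space_2_measurable[OF eL])
  have prod: "integrable ?M (\<lambda>x. f x * ?e x)" if "f \<in> Lp_space 2 ?M" for f
    using Lp_space_2_inner_integrable[OF that eL] by simp
  have e2: "integrable ?M (\<lambda>x. (?e x)\<^sup>2)" using eL by (simp add: Lp_space_2_iff)
  have "((\<lambda>\<epsilon>. (\<integral>x. B x * ?e x \<partial>?M) - (\<integral>x. R \<epsilon> x * ?e x \<partial>?M)) \<longlongrightarrow> (\<integral>x. B x * ?e x \<partial>?M) - (\<integral>x. \<rho>' x * ?e x \<partial>?M)) (at_right 0)"
    by (intro tendsto_diff tendsto_const lim e1)
  also have "(\<integral>x. B x * ?e x \<partial>?M) - (\<integral>x. \<rho>' x * ?e x \<partial>?M) = (\<integral>x. B x * ?e x - \<rho>' x * ?e x \<partial>?M)"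
    by (rule Bochner_Integration.integral_diff[symmetric]) (intro prod BL \<rho>L)+
  also have "\<dots> = (\<integral>x. (?e x)\<^sup>2 \<partial>?M)"
    by (rule Bochner_Integration.integral_cong) (auto simp: power2_eq_square algebra_simps)
  finally have L: "((\<lambda>\<epsilon>. 2 * ((\<integral>x. B x * ?e x \<partial>?M) - (\<integral>x. R \<epsilon> x * ?e x \<partial>?M))) \<longlongrightarrow> 2 * (\<integral>x. (?e x)\<^sup>2 \<partial>?M)) (at_right 0)"
    by (intro tendsto_mult tendsto_const)
  \<comment> \<open>Lower semicontinuity by Young's inequality: twice the pairing of B - R with e is
    at most the sum of the squared norms of both, and it tends to twice the squared norm of e. One
    of these two copies is cancelled at the end.\<close>
  have "2 * (\<integral>x. (?e x)\<^sup>2 \<partial>?M) \<le> ?Z2 + (\<integral>x. (?e x)\<^sup>2 \<partial>?M)"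
  proof (rule tendsto_le[OF _ _ L])
    have "((\<lambda>\<epsilon>::real. ?Z2 + \<epsilon> * ?c + (\<integral>x. (?e x)\<^sup>2 \<partial>?M)) \<longlongrightarrow> ?Z2 + 0 * ?c + (\<integral>x. (?e x)\<^sup>2 \<partial>?M)) (at_right 0)"
      by (intro tendsto_intros)
    then show "((\<lambda>\<epsilon>::real. ?Z2 + \<epsilon> * ?c + (\<integral>x. (?e x)\<^sup>2 \<partial>?M)) \<longlongrightarrow> ?Z2 + (\<integral>x. (?e x)\<^sup>2 \<partial>?M)) (at_right 0)"
      by simp
    have "\<forall>\<^sub>F \<epsilon>::real in at_right 0. 0 < \<epsilon>" by (simp add: eventually_at_right_less)
    with Ri show "\<forall>\<^sub>F \<epsilon> in at_right 0. 2 * ((\<integral>x. B x * ?e x \<partial>?M) - (\<integral>x. R \<epsilon> x * ?e x \<partial>?M)) \<le> ?Z2 + \<epsilon> * ?c + (\<integral>x. (?e x)\<^sup>2 \<partial>?M)"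
    proof eventually_elim
      case (elim \<epsilon>)
      note st = regularized_step_stability[OF U \<delta> elim(2) wh orth R[OF elim(2)] elim(1) \<rho> B gB]
      note RL = Lp_space_infinity_imp_2[OF elim(1)]
      have w2: "integrable ?M (\<lambda>x. (B x - R \<epsilon> x)\<^sup>2)"
        using Lp_norm_2_diff(1)[OF BL RL] by (simp add: Lp_space_2_iff)
      have "2 * ((\<integral>x. B x * ?e x \<partial>?M) - (\<integral>x. R \<epsilon> x * ?e x \<partial>?M)) = (\<integral>x. 2 * (B x * ?e x - R \<epsilon> x * ?e x) \<partial>?M)"
        using prod[OF BL] prod[OF RL] by simp
      also have "\<dots> \<le> (\<integral>x. (B x - R \<epsilon> x)\<^sup>2 + (?e x)\<^sup>2 \<partial>?M)"
      proof (rule integral_mono)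
        fix x
        have "2 * (B x * ?e x - R \<epsilon> x * ?e x) = 2 * (B x - R \<epsilon> x) * ?e x" by (simp add: algebra_simps)
        also have "\<dots> \<le> (B x - R \<epsilon> x)\<^sup>2 + (?e x)\<^sup>2" by (rule sum_squares_bound)
        finally show "2 * (B x * ?e x - R \<epsilon> x * ?e x) \<le> (B x - R \<epsilon> x)\<^sup>2 + (?e x)\<^sup>2" .
      qed (use prod[OF BL] prod[OF RL] w2 e2 in auto)
      also have "\<dots> = (\<integral>x. (B x - R \<epsilon> x)\<^sup>2 \<partial>?M) + (\<integral>x. (?e x)\<^sup>2 \<partial>?M)" using w2 e2 by simp
      finally show ?case using st by linarith
    qed
  qed simp
  then show ?thesis
    unfolding Lp_norm_2_eq by (intro real_sqrt_le_mono) simp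
qed

subsection \<open>The projected velocity\<close>

text \<open>The scheme fixes the projected velocity only up to null sets, so its measurability has
  to come from the completeness of Lebesgue measure.\<close>

lemma AE_eq_lebesgue_on_measurable:
  fixes f g :: "'a::euclidean_space \<Rightarrow> 'b::euclidean_space"
  assumes U: "open U" and g: "g \<in> borel_measurable (lebesgue_on U)" and ae: "AE x in lebesgue_on U. f x = g x"
  shows "f \<in> borel_measurable (lebesgue_on U)"
proof -
  obtain g' where r: "representative U g g'" using representative_exists[OF U g] .
  have "AE x in lborel. x \<in> U \<longrightarrow> g' x = f x"
    using representative_AE[OF r] ae[unfolded AE_lebesgue_on_open_iff[OF U]] by eventually_elim simp
  then have "representative U f g'" using r by (simp add: representative_def)
  then show ?thesis by (rule representative_source_measurable[OF U])
qed

lemma borel_measurable_lebesgue_onI: "f \<in> borel_measurable borel \<Longrightarrow> f \<in> borel_measurable (lebesgue_on U)"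
  by (rule measurable_restrict_space1, rule measurable_completion) simp

lemma test_functions_Lp_space_2:
  fixes \<phi> :: "'a::euclidean_space \<Rightarrow> 'b::euclidean_space"
  assumes U: "open U" "bounded U" and \<phi>: "\<phi> \<in> test_functions V"
  shows "\<phi> \<in> Lp_space 2 (lebesgue_on U)"
proof -
  interpret finite_measure "lebesgue_on U" by (rule finite_measure_lebesgue_on[OF U])
  obtain B where B: "\<And>x. norm (\<phi> x) \<le> B" using test_functions_bounded[OF \<phi>] by metis
  show ?thesis
  proof (rule Lp_space_infinity_imp_2)
    show "\<phi> \<in> Lp_space \<infinity> (lebesgue_on U)"
      using B test_functions_measurable[OF \<phi>] by (auto simp: Lp_space_def borel_measurable_lebesgue_onI)
  qed
qed

lemma frechet_derivative_component:
  fixes \<psi> :: "'a::euclidean_space \<Rightarrow> real^'n"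
  assumes "\<psi> \<in> test_functions U"
  shows "frechet_derivative (\<lambda>x. \<psi> x $ j) (at x) v = frechet_derivative \<psi> (at x) v $ j"
  using frechet_derivative_at[OF bounded_linear.has_derivative[OF bounded_linear_vec_nth[of j] test_functions_has_derivative[OF assms]]]
  by metis

lemma test_functions_component:
  fixes \<psi> :: "'a::euclidean_space \<Rightarrow> real^'n"
  shows "\<psi> \<in> test_functions U \<Longrightarrow> (\<lambda>x. \<psi> x $ j) \<in> test_functions U"
  by (rule test_functions_bounded_linear_image[OF bounded_linear_vec_nth])

lemma component_test_integral_by_parts:
  fixes \<psi> :: "real^3 \<Rightarrow> real^3" and \<phi> :: "real^3 \<Rightarrow> real"
  assumes \<phi>: "\<phi> \<in> H1 \<Omega>" and \<psi>: "\<psi> \<in> test_functions \<Omega>"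
  shows "(\<integral>x. \<psi> x $ j * weak_grad \<Omega> \<phi> x $ j \<partial>lebesgue_on \<Omega>) =
     - (\<integral>x. frechet_derivative \<psi> (at x) (axis j 1) $ j * \<phi> x \<partial>lebesgue_on \<Omega>)"
  using H1_weak_grad(1)[OF \<phi>, of j] test_functions_component[OF \<psi>, of j]
  by (auto simp: has_weak_deriv_def frechet_derivative_component[OF \<psi>])

lemma Lp_norm_2_component:
  fixes F :: "'a \<Rightarrow> real^3"
  assumes "F \<in> Lp_space 2 M"
  shows "(\<lambda>x. F x $ j) \<in> Lp_space 2 M" and "Lp_norm 2 M (\<lambda>x. F x $ j) \<le> Lp_norm 2 M F"
proof -
  show 1: "(\<lambda>x. F x $ j) \<in> Lp_space 2 M" using assms Lp_space_2_vec3_iff by blast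
  show "Lp_norm 2 M (\<lambda>x. F x $ j) \<le> Lp_norm 2 M F"
    by (rule Lp_space_2_bound(2)[OF assms Lp_space_2_measurable[OF 1]]) (auto intro: component_le_norm_cart)
qed

text \<open>Cauchy-Schwarz: pairing with a fixed L2 function is continuous in the L2 norm.\<close>

lemma tendsto_integral_component_L2:
  fixes F :: "'a \<Rightarrow> real^3" and g :: "'a \<Rightarrow> real"
  assumes F: "F \<in> Lp_space 2 M" and Fm: "\<And>m. Fm m \<in> Lp_space 2 M" and g: "g \<in> Lp_space 2 M"
    and lim: "((\<lambda>m. Lp_norm 2 M (\<lambda>x. F x - Fm m x)) \<longlongrightarrow> 0) A"
  shows "((\<lambda>m. \<integral>x. Fm m x $ j * g x \<partial>M) \<longlongrightarrow> (\<integral>x. F x $ j * g x \<partial>M)) A"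
proof (rule Lim_null[THEN iffD2], rule Lim_null_comparison)
  show "((\<lambda>m. Lp_norm 2 M (\<lambda>x. F x - Fm m x) * Lp_norm 2 M g) \<longlongrightarrow> 0) A"
    using tendsto_mult[OF lim tendsto_const[of "Lp_norm 2 M g"]] by simp
  show "\<forall>\<^sub>F m in A. norm ((\<integral>x. Fm m x $ j * g x \<partial>M) - (\<integral>x. F x $ j * g x \<partial>M)) \<le> Lp_norm 2 M (\<lambda>x. F x - Fm m x) * Lp_norm 2 M g"
  proof (rule always_eventually, rule allI)
    fix m
    note D = Lp_norm_2_diff(1)[OF F Fm[of m]]
    have "(\<integral>x. Fm m x $ j * g x \<partial>M) - (\<integral>x. F x $ j * g x \<partial>M) = - (\<integral>x. (F x - Fm m x) $ j * g x \<partial>M)"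
      using Lp_space_2_inner_integrable[OF Lp_norm_2_component(1)[OF F] g]
        Lp_space_2_inner_integrable[OF Lp_norm_2_component(1)[OF Fm] g]
      by (simp add: left_diff_distrib)
    then have "norm ((\<integral>x. Fm m x $ j * g x \<partial>M) - (\<integral>x. F x $ j * g x \<partial>M)) \<le> Lp_norm 2 M (\<lambda>x. (F x - Fm m x) $ j) * Lp_norm 2 M g"
      using Lp_norm_2_inner_bound[OF Lp_norm_2_component(1)[OF D] g] by simp
    also have "\<dots> \<le> Lp_norm 2 M (\<lambda>x. F x - Fm m x) * Lp_norm 2 M g"
      by (intro mult_right_mono Lp_norm_2_component(2) D Lp_norm_2_nonneg)
    finally show "norm ((\<integral>x. Fm m x $ j * g x \<partial>M) - (\<integral>x. F x $ j * g x \<partial>M)) \<le> Lp_norm 2 M (\<lambda>x. F x - Fm m x) * Lp_norm 2 M g" .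
  qed
qed

text \<open>For a test function in place of u this is, component by component, the definition of the
  weak gradient of \<phi>. Both sides are continuous in the H1 norm, in which test functions
  approximate u. As \<phi> may be nonzero at the boundary, the zero trace is that of u.\<close>

lemma H10_integral_by_parts:
  fixes u :: "real^3 \<Rightarrow> real^3" and \<phi> :: "real^3 \<Rightarrow> real"
  assumes U: "open \<Omega>" "bounded \<Omega>" and u: "u \<in> H10 \<Omega>" and \<phi>: "\<phi> \<in> H1 \<Omega>"
  shows "(\<integral>x. u x \<bullet> weak_grad \<Omega> \<phi> x \<partial>lebesgue_on \<Omega>) = - (\<integral>x. weak_div \<Omega> u x * \<phi> x \<partial>lebesgue_on \<Omega>)"
proof -
  let ?M = "lebesgue_on \<Omega>"
  obtain \<psi> :: "nat \<Rightarrow> real^3 \<Rightarrow> real^3" where \<psi>: "\<And>m. \<psi> m \<in> test_functions \<Omega>"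
    and l1: "(\<lambda>m. Lp_norm 2 ?M (\<lambda>x. u x - \<psi> m x)) \<longlonglongrightarrow> 0"
    and l2: "\<And>j. (\<lambda>m. Lp_norm 2 ?M (\<lambda>x. weak_deriv \<Omega> (axis j 1) u x - frechet_derivative (\<psi> m) (at x) (axis j 1))) \<longlonglongrightarrow> 0"
    using u axis_Basis_real3 unfolding H10_def by blast
  have uL: "u \<in> Lp_space 2 ?M" and duL: "weak_deriv \<Omega> (axis j 1) u \<in> Lp_space 2 ?M" for j
    using u axis_Basis_real3 by (auto simp: H10_def H1_def)
  note \<phi>L = H1_weak_grad(2,3)[OF \<phi>]
  have comp: "(\<integral>x. u x $ j * weak_grad \<Omega> \<phi> x $ j \<partial>?M) = - (\<integral>x. weak_deriv \<Omega> (axis j 1) u x $ j * \<phi> x \<partial>?M)" for j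
  proof (rule LIMSEQ_unique)
    show "(\<lambda>m. \<integral>x. \<psi> m x $ j * weak_grad \<Omega> \<phi> x $ j \<partial>?M) \<longlonglongrightarrow> (\<integral>x. u x $ j * weak_grad \<Omega> \<phi> x $ j \<partial>?M)"
      by (rule tendsto_integral_component_L2[OF uL test_functions_Lp_space_2[OF U \<psi>] Lp_norm_2_component(1)[OF \<phi>L(1)] l1])
    have "(\<lambda>m. - (\<integral>x. frechet_derivative (\<psi> m) (at x) (axis j 1) $ j * \<phi> x \<partial>?M)) \<longlonglongrightarrow> - (\<integral>x. weak_deriv \<Omega> (axis j 1) u x $ j * \<phi> x \<partial>?M)"
      by (intro tendsto_minus tendsto_integral_component_L2[OF duL test_functions_Lp_space_2[OF U test_functions_deriv[OF \<psi>]] \<phi>L(2) l2])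
    then show "(\<lambda>m. \<integral>x. \<psi> m x $ j * weak_grad \<Omega> \<phi> x $ j \<partial>?M) \<longlonglongrightarrow> - (\<integral>x. weak_deriv \<Omega> (axis j 1) u x $ j * \<phi> x \<partial>?M)"
      by (simp add: component_test_integral_by_parts[OF \<phi> \<psi>])
  qed
  have i1: "integrable ?M (\<lambda>x. u x $ j * weak_grad \<Omega> \<phi> x $ j)"
    and i2: "integrable ?M (\<lambda>x. weak_deriv \<Omega> (axis j 1) u x $ j * \<phi> x)" for j
    using Lp_space_2_inner_integrable[OF Lp_norm_2_component(1)[OF uL] Lp_norm_2_component(1)[OF \<phi>L(1)]]
      Lp_space_2_inner_integrable[OF Lp_norm_2_component(1)[OF duL] \<phi>L(2)] by simp_all
  have "(\<integral>x. u x \<bullet> weak_grad \<Omega> \<phi> x \<partial>?M) = (\<Sum>j\<in>UNIV. \<integral>x. u x $ j * weak_grad \<Omega> \<phi> x $ j \<partial>?M)"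
    by (simp add: inner_vec_def i1)
  also have "\<dots> = - (\<Sum>j\<in>UNIV. \<integral>x. weak_deriv \<Omega> (axis j 1) u x $ j * \<phi> x \<partial>?M)"
    by (simp add: comp sum_negf)
  also have "(\<Sum>j\<in>UNIV. \<integral>x. weak_deriv \<Omega> (axis j 1) u x $ j * \<phi> x \<partial>?M) = (\<integral>x. weak_div \<Omega> u x * \<phi> x \<partial>?M)"
    by (simp add: weak_div_def weak_jac_def trace_def sum_distrib_right i2)
  finally show ?thesis .
qed

lemma H10_Lp_space_2:
  assumes "u \<in> H10 \<Omega>" shows "u \<in> Lp_space 2 (lebesgue_on \<Omega>)"
  using assms by (auto simp: H10_def H1_def)

text \<open>Helmholtz decomposition: c times the gradient of q is the gradient part of u', so wh is
  orthogonal to gradients. If v is so too, Pythagoras for v - u' = (v - wh) - c grad q gives the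
  last claim.\<close>

lemma projected_velocity:
  fixes u' wh :: "real^3 \<Rightarrow> real^3" and q :: "real^3 \<Rightarrow> real"
  assumes U: "open \<Omega>" "bounded \<Omega>" and u': "u' \<in> H10 \<Omega>" and c: "0 < c"
    and np: "neumann_poisson \<Omega> (1 / c) u' q"
    and wh: "AE x in lebesgue_on \<Omega>. wh x = u' x - c *\<^sub>R weak_grad \<Omega> q x"
  shows "wh \<in> Lp_space 2 (lebesgue_on \<Omega>)"
    and "\<And>\<phi>. \<phi> \<in> H1 \<Omega> \<Longrightarrow> (\<integral>x. wh x \<bullet> weak_grad \<Omega> \<phi> x \<partial>lebesgue_on \<Omega>) = 0"
    and "\<And>v. v \<in> Lp_space 2 (lebesgue_on \<Omega>) \<Longrightarrow>
       (\<And>\<phi>. \<phi> \<in> H1 \<Omega> \<Longrightarrow> (\<integral>x. v x \<bullet> weak_grad \<Omega> \<phi> x \<partial>lebesgue_on \<Omega>) = 0) \<Longrightarrow>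
       L2_norm \<Omega> (\<lambda>x. v x - wh x) \<le> L2_norm \<Omega> (\<lambda>x. v x - u' x)"
proof -
  let ?M = "lebesgue_on \<Omega>"
  have q: "q \<in> H1 \<Omega>" and poisson: "\<And>\<phi>. \<phi> \<in> H1 \<Omega> \<Longrightarrow>
      - (\<integral>x. weak_grad \<Omega> q x \<bullet> weak_grad \<Omega> \<phi> x \<partial>?M) = 1 / c * (\<integral>x. weak_div \<Omega> u' x * \<phi> x \<partial>?M)"
    using np by (auto simp: neumann_poisson_def)
  note uL = H10_Lp_space_2[OF u'] and gL = H1_weak_grad(2)[OF q]
  note rhsL = Lp_norm_2_diff(1)[OF uL Lp_norm_2_scaleR(1)[OF gL, of c]]
  have whm: "wh \<in> borel_measurable ?M"
    by (rule AE_eq_lebesgue_on_measurable[OF U(1) Lp_space_2_measurable[OF rhsL] wh])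
  show whL: "wh \<in> Lp_space 2 ?M"
    by (rule Lp_space_2_bound(1)[OF rhsL whm]) (use wh in \<open>auto elim!: eventually_mono\<close>)
  show orth: "(\<integral>x. wh x \<bullet> weak_grad \<Omega> \<phi> x \<partial>?M) = 0" if \<phi>: "\<phi> \<in> H1 \<Omega>" for \<phi>
  proof -
    note pL = H1_weak_grad(2)[OF \<phi>]
    note [measurable] = whm Lp_space_2_measurable[OF pL] Lp_space_2_measurable[OF uL] Lp_space_2_measurable[OF gL]
    have "(\<integral>x. wh x \<bullet> weak_grad \<Omega> \<phi> x \<partial>?M) = (\<integral>x. u' x \<bullet> weak_grad \<Omega> \<phi> x - c * (weak_grad \<Omega> q x \<bullet> weak_grad \<Omega> \<phi> x) \<partial>?M)"
      by (rule integral_cong_AE) (use wh in \<open>auto elim!: eventually_mono simp: inner_diff_left\<close>)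
    also have "\<dots> = (\<integral>x. u' x \<bullet> weak_grad \<Omega> \<phi> x \<partial>?M) - c * (\<integral>x. weak_grad \<Omega> q x \<bullet> weak_grad \<Omega> \<phi> x \<partial>?M)"
      using Lp_space_2_inner_integrable[OF uL pL] Lp_space_2_inner_integrable[OF gL pL] by simp
    also have "\<dots> = 0"
      using poisson[OF \<phi>] c by (simp add: H10_integral_by_parts[OF U u' \<phi>] field_simps)
    finally show ?thesis .
  qed
  fix v assume v: "v \<in> Lp_space 2 ?M" and vorth: "\<And>\<phi>. \<phi> \<in> H1 \<Omega> \<Longrightarrow> (\<integral>x. v x \<bullet> weak_grad \<Omega> \<phi> x \<partial>?M) = 0"
  note eL = Lp_norm_2_diff(1)[OF v whL] and dL = Lp_norm_2_diff(1)[OF v uL]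
  note [measurable] = whm Lp_space_2_measurable[OF v] Lp_space_2_measurable[OF uL] Lp_space_2_measurable[OF gL]
  have "(\<integral>x. (v x - wh x) \<bullet> weak_grad \<Omega> q x \<partial>?M) = 0"
    using orth[OF q] vorth[OF q] Lp_space_2_inner_integrable[OF v gL] Lp_space_2_inner_integrable[OF whL gL]
    by (simp add: inner_diff_left)
  \<comment> \<open>The cross term has integral 0; subtracting it reduces the claim to a pointwise
    inequality of integrands.\<close>
  then have "(\<integral>x. (norm (v x - wh x))\<^sup>2 \<partial>?M) = (\<integral>x. (norm (v x - wh x))\<^sup>2 - 2 * c * ((v x - wh x) \<bullet> weak_grad \<Omega> q x) \<partial>?M)"
    using eL Lp_space_2_inner_integrable[OF eL gL] by (simp add: Lp_space_2_iff)
  also have "\<dots> \<le> (\<integral>x. (norm (v x - u' x))\<^sup>2 \<partial>?M)"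
  proof (rule integral_mono_AE)
    show "AE x in ?M. (norm (v x - wh x))\<^sup>2 - 2 * c * ((v x - wh x) \<bullet> weak_grad \<Omega> q x) \<le> (norm (v x - u' x))\<^sup>2"
      using wh
    proof eventually_elim
      case (elim x)
      define e g where "e = v x - wh x" and "g = weak_grad \<Omega> q x"
      have eq: "v x - u' x = e - c *\<^sub>R g" using elim by (simp add: e_def g_def)
      have "(norm (e - c *\<^sub>R g))\<^sup>2 = (norm e)\<^sup>2 - 2 * c * (e \<bullet> g) + (norm (c *\<^sub>R g))\<^sup>2"
        by (simp add: power2_norm_eq_inner inner_diff inner_commute del: norm_scaleR)
      then show ?case unfolding eq e_def[symmetric] g_def[symmetric] by simp
    qed
  qed (use eL dL Lp_space_2_inner_integrable[OF eL gL] in \<open>auto simp: Lp_space_2_iff\<close>)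
  finally show "Lp_norm 2 ?M (\<lambda>x. v x - wh x) \<le> Lp_norm 2 ?M (\<lambda>x. v x - u' x)"
    unfolding Lp_norm_2_eq by (rule real_sqrt_le_mono)
qed

subsection \<open>Weak derivatives on the cylinder\<close>

lemma open_cyl: "open \<Omega> \<Longrightarrow> open (cyl T \<Omega>)"
  by (simp add: cyl_def open_Times)

lemma bounded_cyl: "bounded \<Omega> \<Longrightarrow> bounded (cyl T \<Omega>)"
  by (simp add: cyl_def bounded_Times)

text \<open>Tests with separated variables serve to pass from the cylinder to its time
  slices.\<close>

lemma test_functions_product:
  fixes a :: "'a::euclidean_space \<Rightarrow> real" and \<phi> :: "'b::euclidean_space \<Rightarrow> real"
  assumes a: "a \<in> test_functions I" and \<phi>: "\<phi> \<in> test_functions V"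
  shows "(\<lambda>z. a (fst z) * \<phi> (snd z)) \<in> test_functions (I \<times> V)"
    and "frechet_derivative (\<lambda>z. a (fst z) * \<phi> (snd z)) (at z) (v, w) =
      frechet_derivative a (at (fst z)) v * \<phi> (snd z) + a (fst z) * frechet_derivative \<phi> (at (snd z)) w"
proof -
  have "Ck k (\<lambda>z. a (fst z) * \<phi> (snd z))" for k
    using Ck_mult[OF Ck_compose_affine[OF bounded_linear_fst test_functions_Ck[OF a], of _ 0]
        Ck_compose_affine[OF bounded_linear_snd test_functions_Ck[OF \<phi>], of _ 0]] by simp
  moreover obtain K where "compact K" "K \<subseteq> I" "\<And>x. x \<notin> K \<Longrightarrow> a x = 0"
    using a test_functions_iff by metis
  moreover obtain L where "compact L" "L \<subseteq> V" "\<And>x. x \<notin> L \<Longrightarrow> \<phi> x = 0"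
    using \<phi> test_functions_iff by metis
  ultimately have Ck: "\<And>k. Ck k (\<lambda>z. a (fst z) * \<phi> (snd z))" and "compact (K \<times> L) \<and> K \<times> L \<subseteq> I \<times> V \<and> (\<forall>z. z \<notin> K \<times> L \<longrightarrow> a (fst z) * \<phi> (snd z) = 0)"
    by (auto simp: compact_Times)
  then show "(\<lambda>z. a (fst z) * \<phi> (snd z)) \<in> test_functions (I \<times> V)"
    unfolding test_functions_iff using Ck by blast
  have "((\<lambda>z. a (fst z) * \<phi> (snd z)) has_derivative
     (\<lambda>h. a (fst z) * frechet_derivative \<phi> (at (snd z)) (snd h) + frechet_derivative a (at (fst z)) (fst h) * \<phi> (snd z))) (at z)"
    by (intro has_derivative_mult has_derivative_compose[OF has_derivative_fst[OF has_derivative_ident] test_functions_has_derivative[OF a]]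
      has_derivative_compose[OF has_derivative_snd[OF has_derivative_ident] test_functions_has_derivative[OF \<phi>]])
  note der = frechet_derivative_at[OF this, symmetric]
  show "frechet_derivative (\<lambda>z. a (fst z) * \<phi> (snd z)) (at z) (v, w) =
      frechet_derivative a (at (fst z)) v * \<phi> (snd z) + a (fst z) * frechet_derivative \<phi> (at (snd z)) w"
    unfolding der by simp
qed

lemma frechet_derivative_0: "\<phi> \<in> test_functions U \<Longrightarrow> frechet_derivative \<phi> (at x) 0 = 0"
  using test_functions_has_derivative has_derivative_linear linear_0 by blast

lemma test_times_slice_integrable:
  fixes f :: "real \<times> 'a::euclidean_space \<Rightarrow> 'b::euclidean_space" and \<phi> :: "'a \<Rightarrow> real"
  assumes f: "integrable lborel f" and \<phi>: "\<phi> \<in> test_functions V"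
  shows "integrable (lborel \<Otimes>\<^sub>M lborel) (\<lambda>(t, x). \<phi> x *\<^sub>R f (t, x))"
proof -
  obtain B where B: "0 < B" "\<And>x. norm (\<phi> x) \<le> B" using test_functions_bounded[OF \<phi>] by metis
  have f': "integrable (lborel \<Otimes>\<^sub>M lborel) f" using f by (simp add: lborel_prod)
  then have "integrable (lborel \<Otimes>\<^sub>M lborel) (\<lambda>z. B *\<^sub>R f z)" by simp
  then show ?thesis
  proof (rule Bochner_Integration.integrable_bound)
    note [measurable] = test_functions_measurable[OF \<phi>] borel_measurable_integrable[OF f']
    show "(\<lambda>(t, x). \<phi> x *\<^sub>R f (t, x)) \<in> borel_measurable (lborel \<Otimes>\<^sub>M lborel)"
      by measurable
  qed (use B in \<open>auto intro!: AE_I2 mult_right_mono\<close>)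
qed

text \<open>On a product a(t) \<phi>(x) a derivative in a spatial direction acts on \<phi> alone.
  Integrating in x first leaves an identity tested with every a, and the fundamental lemma in one
  variable gives it for almost every t. The null set of times depends on \<phi>.\<close>

lemma L1_weak_deriv_slice:
  fixes f g :: "real \<times> (real^3) \<Rightarrow> 'b::euclidean_space" and \<phi> :: "real^3 \<Rightarrow> real"
  assumes wd: "L1_weak_deriv (cyl T \<Omega>) (0, v) f g" and \<phi>: "\<phi> \<in> test_functions \<Omega>"
  shows "AE t in lborel. t \<in> {0<..<T} \<longrightarrow>
    (\<integral>x. frechet_derivative \<phi> (at x) v *\<^sub>R f (t, x) \<partial>lborel) = - (\<integral>x. \<phi> x *\<^sub>R g (t, x) \<partial>lborel)"
proof -
  have f: "integrable lborel f" and g: "integrable lborel g" using wd by (auto simp: L1_weak_deriv_def)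
  note i1 = test_times_slice_integrable[OF f test_functions_deriv[OF \<phi>, of v]]
  note i2 = test_times_slice_integrable[OF g \<phi>]
  let ?F = "\<lambda>t. \<integral>x. frechet_derivative \<phi> (at x) v *\<^sub>R f (t, x) \<partial>lborel"
  let ?G = "\<lambda>t. \<integral>x. \<phi> x *\<^sub>R g (t, x) \<partial>lborel"
  have FI: "integrable lborel ?F" and GI: "integrable lborel ?G"
    using lborel_pair.integrable_fst[OF i1] lborel_pair.integrable_fst[OF i2] by simp_all
  have "AE t in lborel. t \<in> {0<..<T} \<longrightarrow> ?F t + ?G t = 0"
  proof (rule fundamental_lemma_lborel)
    fix a :: "real \<Rightarrow> real" assume a: "a \<in> test_functions {0<..<T}"
    note test = test_functions_product[OF a \<phi>]
    have red: "(\<integral>z. (a (fst z) * \<psi> (snd z)) *\<^sub>R h z \<partial>lborel) = (\<integral>t. a t *\<^sub>R (\<integral>x. \<psi> x *\<^sub>R h (t, x) \<partial>lborel) \<partial>lborel)"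
      if \<psi>: "\<psi> \<in> test_functions \<Omega>" and h: "integrable lborel h" for \<psi> and h :: "real \<times> (real^3) \<Rightarrow> 'b"
    proof -
      have "integrable lborel (\<lambda>z. (a (fst z) * \<psi> (snd z)) *\<^sub>R h z)"
        by (rule test_times_integrable[OF h test_functions_product(1)[OF a \<psi>]])
      then have "integrable (lborel \<Otimes>\<^sub>M lborel) (\<lambda>(t, x). (a t * \<psi> x) *\<^sub>R h (t, x))"
        by (simp add: lborel_prod split_beta')
      from lborel_pair.integral_fst[OF this]
      have "(\<integral>z. (a (fst z) * \<psi> (snd z)) *\<^sub>R h z \<partial>lborel) = (\<integral>t. \<integral>x. a t *\<^sub>R (\<psi> x *\<^sub>R h (t, x)) \<partial>lborel \<partial>lborel)"
        by (simp add: lborel_prod split_beta')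
      then show ?thesis by (simp only: integral_scaleR_right)
    qed
    have "(\<integral>z. frechet_derivative (\<lambda>z. a (fst z) * \<phi> (snd z)) (at z) (0, v) *\<^sub>R f z \<partial>lborel) =
        - (\<integral>z. (a (fst z) * \<phi> (snd z)) *\<^sub>R g z \<partial>lborel)"
      using wd test(1) by (auto simp: L1_weak_deriv_def cyl_def)
    then have "(\<integral>t. a t *\<^sub>R ?F t \<partial>lborel) = - (\<integral>t. a t *\<^sub>R ?G t \<partial>lborel)"
      by (simp add: test(2) frechet_derivative_0[OF a] red[OF \<phi> g] red[OF test_functions_deriv[OF \<phi>] f])
    then show "(\<integral>t. a t *\<^sub>R (?F t + ?G t) \<partial>lborel) = 0"
      using test_times_integrable[OF FI a] test_times_integrable[OF GI a] by (simp add: scaleR_add_right)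
  qed (use FI GI in auto)
  then show ?thesis by eventually_elim (auto simp: add_eq_0_iff2)
qed

section \<open>Null sets in product spaces\<close>

lemma AE_lborel_snd:
  fixes P :: "'b::euclidean_space \<Rightarrow> bool"
  assumes "AE x in lborel. P x"
  shows "AE z in (lborel :: ('a::euclidean_space \<times> 'b) measure). P (snd z)"
proof -
  obtain N where N: "N \<in> null_sets lborel" "{x. \<not> P x} \<subseteq> N"
    using assms by (auto simp: eventually_ae_filter)
  have [measurable]: "N \<in> sets borel" using N(1) by (auto simp: null_sets_def)
  have "AE z in (lborel \<Otimes>\<^sub>M lborel :: ('a \<times> 'b) measure). snd z \<notin> N"
  proof (rule lborel_pair.AE_pair_measure)
    show "AE t in lborel. AE x in lborel. snd (t, x) \<notin> N"
      using AE_not_in[OF N(1)] by simp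
  qed measurable
  then show ?thesis
    unfolding lborel_prod by eventually_elim (use N(2) in auto)
qed

lemma AE_slices:
  assumes "AE z in (lborel :: ('a::euclidean_space \<times> 'b::euclidean_space) measure). P z"
  shows "AE t in lborel. AE x in lborel. P (t, x)"
  by (rule lborel_pair.AE_pair) (subst lborel_prod, rule assms)

lemma AE_lborel_commute:
  fixes P :: "'a::euclidean_space \<Rightarrow> 'b::euclidean_space \<Rightarrow> bool"
  assumes "Measurable.pred (borel \<Otimes>\<^sub>M borel) (\<lambda>z. P (fst z) (snd z))"
  shows "(AE x in lborel. AE y in lborel. P x y) \<longleftrightarrow> (AE y in lborel. AE x in lborel. P x y)"
  by (rule lborel_pair.AE_commute)
     (use assms in \<open>simp add: pred_def space_pair_measure cong: sets_pair_measure_cong\<close>)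

section \<open>Primitives in time\<close>

definition time_integral :: "(real \<times> 'a \<Rightarrow> 'b::euclidean_space) \<Rightarrow> real \<Rightarrow> 'a \<Rightarrow> 'b" where
  "time_integral g t x = (\<integral>r. (if 0 \<le> r \<and> r \<le> t then g (r, x) else 0) \<partial>lborel)"

lemma time_integral_measurable [measurable]:
  fixes g :: "real \<times> 'a::euclidean_space \<Rightarrow> 'b::euclidean_space"
  assumes [measurable]: "g \<in> borel_measurable borel"
  shows "(\<lambda>z. time_integral g (fst z) (snd z)) \<in> borel_measurable borel"
  unfolding time_integral_def[abs_def] borel_prod[symmetric] using assms[folded borel_prod] by measurable

lemma integrable_slice_interval:
  fixes \<gamma> :: "real \<Rightarrow> 'b::euclidean_space"
  assumes "integrable lborel \<gamma>"
  shows "integrable lborel (\<lambda>r. if a \<le> r \<and> r \<le> b then \<gamma> r else 0)"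
proof -
  have "integrable lborel (\<lambda>r. indicator {a..b} r *\<^sub>R \<gamma> r)"
    by (rule integrable_mult_indicator) (use assms in auto)
  also have "(\<lambda>r. indicator {a..b} r *\<^sub>R \<gamma> r) = (\<lambda>r. if a \<le> r \<and> r \<le> b then \<gamma> r else 0)"
    by (auto simp: indicator_def)
  finally show ?thesis .
qed

lemma time_integral_diff:
  fixes g :: "real \<times> 'a::euclidean_space \<Rightarrow> 'b::euclidean_space"
  assumes i: "integrable lborel (\<lambda>r. g (r, x))" and s: "0 \<le> s" "s \<le> t"
  shows "time_integral g t x - time_integral g s x = (\<integral>r. (if s \<le> r \<and> r \<le> t then g (r, x) else 0) \<partial>lborel)"
proof -
  have "time_integral g t x - time_integral g s x =
     (\<integral>r. (if 0 \<le> r \<and> r \<le> t then g (r, x) else 0) - (if 0 \<le> r \<and> r \<le> s then g (r, x) else 0) \<partial>lborel)"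
    unfolding time_integral_def
    by (rule Bochner_Integration.integral_diff[symmetric]) (intro integrable_slice_interval i)+
  also have "\<dots> = (\<integral>r. (if s \<le> r \<and> r \<le> t then g (r, x) else 0) \<partial>lborel)"
  proof (rule integral_cong_AE)
    show "AE r in lborel. (if 0 \<le> r \<and> r \<le> t then g (r, x) else 0) - (if 0 \<le> r \<and> r \<le> s then g (r, x) else 0) =
       (if s \<le> r \<and> r \<le> t then g (r, x) else 0)"
      using AE_lborel_singleton[of s] by eventually_elim (use s in auto)
  qed (use integrable_slice_interval[OF i] in \<open>auto intro!: borel_measurable_diff borel_measurable_integrable\<close>)
  finally show ?thesis .
qed

lemma integrable_pair_slices:
  fixes g :: "real \<times> 'a::euclidean_space \<Rightarrow> 'b::euclidean_space"
  assumes "integrable lborel g"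
  shows "AE x in lborel. integrable lborel (\<lambda>r. g (r, x))"
  using lborel_pair.AE_integrable_snd[of "\<lambda>t x. g (t, x)"] assms by (simp add: lborel_prod)

text \<open>\<open>f - \<integral> g\<close> is invariant under almost all time shifts, hence for
  almost every \<open>t\<close> equal to its time average \<open>c\<close>.\<close>

lemma L1_weak_deriv_time_primitive:
  fixes f g :: "real \<times> (real^3) \<Rightarrow> 'b::euclidean_space"
  assumes U: "open \<Omega>" and T: "0 < T" and wd: "L1_weak_deriv (cyl T \<Omega>) (1, 0) f g"
  obtains c where "c \<in> borel_measurable borel"
    "AE t in lborel. AE x in lborel. t \<in> {0<..<T} \<longrightarrow> x \<in> \<Omega> \<longrightarrow> f (t, x) = c x + time_integral g t x"
proof -
  have f: "integrable lborel f" and g: "integrable lborel g" using wd by (auto simp: L1_weak_deriv_def)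
  note gs = integrable_pair_slices[OF g]
  have fm[measurable]: "f \<in> borel_measurable borel" and gm[measurable]: "g \<in> borel_measurable borel"
    using f g by auto
  have [measurable]: "\<Omega> \<in> sets borel" using U by simp
  define k where "k z = f z - time_integral g (fst z) (snd z)" for z
  have "k \<in> borel_measurable borel" unfolding k_def by measurable
  then have [measurable]: "k \<in> borel_measurable (borel \<Otimes>\<^sub>M borel)" by (simp add: borel_prod)
  define P where "P h z \<longleftrightarrow> (fst z \<in> {0<..<T} \<and> fst z + h \<in> {0<..<T} \<and> snd z \<in> \<Omega> \<longrightarrow> k (fst z + h, snd z) = k z)" for h z
  have pos: "AE z in lborel. P h z" if h: "0 \<le> h" for h
    using L1_weak_deriv_translate[OF open_cyl[OF U] wd h] AE_lborel_snd[OF gs]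
  proof eventually_elim
    case (elim z)
    obtain t x where z: "z = (t, x)" by (cases z)
    show ?case
      unfolding P_def
    proof
      assume *: "fst z \<in> {0<..<T} \<and> fst z + h \<in> {0<..<T} \<and> snd z \<in> \<Omega>"
      then have "\<forall>s\<in>{0..h}. z + s *\<^sub>R (1, 0) \<in> cyl T \<Omega>" by (auto simp: z cyl_def)
      then have "f (t + h, x) - f (t, x) = (LINT s:{0..h}|lborel. g (t + s, x))"
        using elim(1) by (simp add: z)
      also have "\<dots> = (\<integral>s. (\<lambda>r. if t \<le> r \<and> r \<le> t + h then g (r, x) else 0) (s + t) \<partial>lborel)"
        unfolding set_lebesgue_integral_def
        by (rule Bochner_Integration.integral_cong) (auto simp: indicator_def add.commute)
      also have "\<dots> = (\<integral>r. (if t \<le> r \<and> r \<le> t + h then g (r, x) else 0) \<partial>lborel)"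
      proof (rule lborel_integral_translate(1))
        have "(\<lambda>r. g (r, x)) \<in> borel_measurable borel" using elim(2) by (auto simp: z)
        then show "(\<lambda>r. if t \<le> r \<and> r \<le> t + h then g (r, x) else 0) \<in> borel_measurable borel" by measurable
      qed
      also have "\<dots> = time_integral g (t + h) x - time_integral g t x"
        by (rule time_integral_diff[symmetric]) (use elim(2) h * in \<open>auto simp: z\<close>)
      finally show "k (fst z + h, snd z) = k z" by (simp add: k_def z algebra_simps)
    qed
  qed
  have all: "AE z in lborel. P h z" for h
  proof (cases "0 \<le> h")
    case False
    \<comment> \<open>A negative shift undoes a positive one, seen from the translated
      point.\<close>
    then have "AE z in lborel. P (- h) z" by (intro pos) simp
    from AE_lborel_translate[OF this, of "(h, 0)"] show ?thesis
      by eventually_elim (auto simp: P_def)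
  qed (rule pos)
  \<comment> \<open>Each shift has its own null set of points; reversing the order gives, at almost
    every point, invariance under almost every shift.\<close>
  have "AE z in lborel. AE h in lborel. P h z"
  proof (subst AE_lborel_commute[symmetric])
    show "Measurable.pred (borel \<Otimes>\<^sub>M borel) (\<lambda>z. P (fst z) (snd z))"
      unfolding P_def borel_prod[symmetric] by measurable
  qed (use all in simp)
  then have AEP: "AE t in lborel. AE x in lborel. AE h in lborel. P h (t, x)"
    by (rule AE_slices)
  define c where "c x = (1 / T) *\<^sub>R (\<integral>s. (if 0 < s \<and> s < T then k (s, x) else 0) \<partial>lborel)" for x
  have "c \<in> borel_measurable borel" unfolding c_def borel_prod[symmetric] by measurable
  moreover have "AE t in lborel. AE x in lborel. t \<in> {0<..<T} \<longrightarrow> x \<in> \<Omega> \<longrightarrow> f (t, x) = c x + time_integral g t x"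
    using AEP
  proof eventually_elim
    case (elim t)
    then show ?case
    proof eventually_elim
      case (elim x)
      show ?case
      proof (intro impI)
        assume t: "t \<in> {0<..<T}" and x: "x \<in> \<Omega>"
        have km: "(\<lambda>s. k (s, x)) \<in> borel_measurable borel"
          unfolding borel_prod[symmetric] by measurable
        \<comment> \<open>The shifts h = s - t reach all times s.\<close>
        from AE_lborel_translate[OF elim, of "- t"]
        have "AE s in lborel. (if 0 < s \<and> s < T then k (s, x) else 0) = (if 0 < s \<and> s < T then k (t, x) else 0)"
          by eventually_elim (use t x in \<open>auto simp: P_def\<close>)
        then have "(\<integral>s. (if 0 < s \<and> s < T then k (s, x) else 0) \<partial>lborel) = (\<integral>s. (if 0 < s \<and> s < T then k (t, x) else 0) \<partial>lborel)"
          by (intro integral_cong_AE) (use km in \<open>auto\<close>)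
        also have "\<dots> = (\<integral>s. indicator {0<..<T} s *\<^sub>R k (t, x) \<partial>lborel)"
          by (rule Bochner_Integration.integral_cong) (auto simp: indicator_def)
        also have "\<dots> = T *\<^sub>R k (t, x)" using T by simp
        finally have "c x = k (t, x)" using T by (simp add: c_def)
        then show "f (t, x) = c x + time_integral g t x" by (simp add: k_def)
      qed
    qed
  qed
  ultimately show thesis by (rule that)
qed

lemma AE_interval_exists:
  assumes "AE s in lborel. P s" and "(a::real) < b"
  shows "\<exists>s. a < s \<and> s < b \<and> P s"
proof (rule ccontr)
  assume *: "\<not> ?thesis"
  have "AE s in lborel. s \<notin> {a<..<b}"
    using assms(1) by eventually_elim (use * in auto)
  then have "emeasure lborel {a<..<b} = 0"
    by (subst (asm) AE_iff_measurable[of "{a<..<b}"]) auto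
  with assms(2) show False by simp
qed

text \<open>Null sets contain no interval. The times avoid t itself because the limit in
  \<open>C_L2\<close> is punctured, and 0 and T because the statements known almost everywhere
  concern the open interval.\<close>

lemma good_times:
  assumes ae: "AE s in lborel. P s" and t: "0 \<le> t" "t \<le> T" and T: "0 < T"
  obtains X :: "nat \<Rightarrow> real" where "X \<longlonglongrightarrow> t" "\<And>i. 0 < X i \<and> X i < T \<and> X i \<noteq> t \<and> P (X i)"
proof -
  have "\<exists>s. 0 < s \<and> s < T \<and> s \<noteq> t \<and> P s \<and> \<bar>s - t\<bar> < 1 / real (Suc i)" for i
  proof (cases "t < T")
    case True
    then have "t < min T (t + 1 / real (Suc i))" by simp
    from AE_interval_exists[OF ae this] obtain s where "t < s" "s < min T (t + 1 / real (Suc i))" "P s" by blast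
    then show ?thesis using t by (intro exI[of _ s]) auto
  next
    case False
    then have "max 0 (t - 1 / real (Suc i)) < t" using t T by simp
    from AE_interval_exists[OF ae this] obtain s where "max 0 (t - 1 / real (Suc i)) < s" "s < t" "P s" by blast
    then show ?thesis using t by (intro exI[of _ s]) auto
  qed
  then obtain X where X: "\<And>i. 0 < X i \<and> X i < T \<and> X i \<noteq> t \<and> P (X i) \<and> \<bar>X i - t\<bar> < 1 / real (Suc i)" by metis
  have "(\<lambda>i. X i - t) \<longlonglongrightarrow> 0"
  proof (rule Lim_null_comparison[OF _ LIMSEQ_inverse_real_of_nat])
    show "\<forall>\<^sub>F i in sequentially. norm (X i - t) \<le> inverse (real (Suc i))"
      using X by (intro always_eventually allI) (simp add: inverse_eq_divide less_imp_le)
  qed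
  then have "X \<longlonglongrightarrow> t" by (simp add: LIM_zero_iff)
  then show thesis using that X by blast
qed

lemma (in finite_measure) tendsto_L2_imp_L1:
  fixes F :: "'i \<Rightarrow> 'a \<Rightarrow> 'b::euclidean_space"
  assumes F: "\<And>i. F i \<in> Lp_space 2 M" and lim: "((\<lambda>i. Lp_norm 2 M (F i)) \<longlongrightarrow> 0) A"
  shows "((\<lambda>i. \<integral>x. norm (F i x) \<partial>M) \<longlongrightarrow> 0) A"
proof (rule Lim_null_comparison)
  have one: "(\<lambda>x. 1::real) \<in> Lp_space 2 M" by (simp add: Lp_space_2_iff)
  show "((\<lambda>i. Lp_norm 2 M (F i) * Lp_norm 2 M (\<lambda>x. 1::real)) \<longlongrightarrow> 0) A"
    using tendsto_mult[OF lim tendsto_const] by simp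
  show "\<forall>\<^sub>F i in A. norm (\<integral>x. norm (F i x) \<partial>M) \<le> Lp_norm 2 M (F i) * Lp_norm 2 M (\<lambda>x. 1::real)"
    using Lp_norm_2_Cauchy_Schwarz[OF F one] by (intro always_eventually allI) (simp add: integral_nonneg_AE)
qed

text \<open>Along good times tending to t the values of f converge in L2, thus almost everywhere for
  a subsequence, while the time integral is continuous in its upper limit by dominated convergence.
  This carries a formula known for almost every time to every single time, including 0 and
  T.\<close>

lemma C_L2_eq_time_primitive:
  fixes f :: "real \<times> (real^3) \<Rightarrow> 'b::euclidean_space"
  assumes U: "open \<Omega>" "bounded \<Omega>" and T: "0 < T" and f: "f \<in> C_L2 T \<Omega>"
    and g: "integrable lborel g"
    and ae: "AE t in lborel. AE x in lborel. t \<in> {0<..<T} \<longrightarrow> x \<in> \<Omega> \<longrightarrow> f (t, x) = c x + time_integral g t x"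
    and t: "0 \<le> t" "t \<le> T"
  shows "AE x in lborel. x \<in> \<Omega> \<longrightarrow> f (t, x) = c x + time_integral g t x"
proof -
  let ?M = "lebesgue_on \<Omega>"
  interpret finite_measure ?M by (rule finite_measure_lebesgue_on[OF U])
  obtain X where X: "X \<longlonglongrightarrow> t" "\<And>i. 0 < X i \<and> X i < T \<and> X i \<noteq> t \<and>
      (AE x in lborel. X i \<in> {0<..<T} \<longrightarrow> x \<in> \<Omega> \<longrightarrow> f (X i, x) = c x + time_integral g (X i) x)"
    using good_times[OF ae t T] by blast
  have fL: "(\<lambda>x. f (s, x)) \<in> Lp_space 2 ?M" if "0 \<le> s" "s \<le> T" for s
    using f that by (auto simp: C_L2_def curry_def)
  have XT: "0 \<le> X i" "X i \<le> T" for i using X(2)[of i] by auto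
  have "((\<lambda>s. L2_norm \<Omega> (\<lambda>x. f (s, x) - f (t, x))) \<longlongrightarrow> 0) (at t within {0..T})"
    using f t by (auto simp: C_L2_def)
  then have "(\<lambda>i. L2_norm \<Omega> (\<lambda>x. f (X i, x) - f (t, x))) \<longlonglongrightarrow> 0"
    using X by (auto simp: tendsto_at_iff_sequentially comp_def less_imp_le)
  then have L1: "(\<lambda>i. \<integral>x. norm (f (X i, x) - f (t, x)) \<partial>?M) \<longlonglongrightarrow> 0"
    by (intro tendsto_L2_imp_L1 Lp_norm_2_diff(1) fL XT t)
  have "\<exists>r. strict_mono r \<and> (AE x in ?M. (\<lambda>i. f (X (r i), x) - f (t, x)) \<longlonglongrightarrow> 0)"
    by (rule tendsto_L1_AE_subseq[OF _ L1])
       (intro Lp_space_2_integrable Lp_norm_2_diff(1) fL XT t)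
  then obtain r where r: "strict_mono r" "AE x in ?M. (\<lambda>i. f (X (r i), x) - f (t, x)) \<longlonglongrightarrow> 0" by blast
  have "AE x in lborel. \<forall>i. x \<in> \<Omega> \<longrightarrow> f (X i, x) = c x + time_integral g (X i) x"
    unfolding AE_all_countable
  proof
    fix i
    have "X i \<in> {0<..<T}" using X(2)[of i] by auto
    with X(2)[of i] show "AE x in lborel. x \<in> \<Omega> \<longrightarrow> f (X i, x) = c x + time_integral g (X i) x" by auto
  qed
  with r(2)[unfolded AE_lebesgue_on_open_iff[OF U(1)]] integrable_pair_slices[OF g]
  show ?thesis
  proof eventually_elim
    case (elim x)
    show ?case
    proof
      assume x: "x \<in> \<Omega>"
      have "(\<lambda>i. time_integral g (X (r i)) x) \<longlonglongrightarrow> time_integral g t x"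
        unfolding time_integral_def
      proof (rule integral_dominated_convergence[where w="\<lambda>s. norm (g (s, x))"])
        show "(\<lambda>s. if 0 \<le> s \<and> s \<le> t then g (s, x) else 0) \<in> borel_measurable lborel"
          "\<And>i. (\<lambda>s. if 0 \<le> s \<and> s \<le> X (r i) then g (s, x) else 0) \<in> borel_measurable lborel"
          by (intro borel_measurable_integrable integrable_slice_interval elim(2))+
        \<comment> \<open>Convergence of the integrands can fail only at s = t.\<close>
        show "AE s in lborel. (\<lambda>i. if 0 \<le> s \<and> s \<le> X (r i) then g (s, x) else 0) \<longlonglongrightarrow> (if 0 \<le> s \<and> s \<le> t then g (s, x) else 0)"
          using AE_lborel_singleton[of t]
        proof eventually_elim
          case (elim s)
          have Xr: "(\<lambda>i. X (r i)) \<longlonglongrightarrow> t"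
            using LIMSEQ_subseq_LIMSEQ[OF X(1) r(1)] by (simp add: comp_def)
          have "\<forall>\<^sub>F i in sequentially. (s \<le> X (r i)) = (s \<le> t)"
          proof (cases "s < t")
            case True
            with order_tendstoD(1)[OF Xr this] show ?thesis by (auto elim!: eventually_mono)
          next
            case False
            with elim have "t < s" by simp
            with order_tendstoD(2)[OF Xr this] show ?thesis by (auto elim!: eventually_mono)
          qed
          then have "\<forall>\<^sub>F i in sequentially. (if 0 \<le> s \<and> s \<le> X (r i) then g (s, x) else 0) = (if 0 \<le> s \<and> s \<le> t then g (s, x) else 0)"
            by eventually_elim simp
          then show ?case by (rule tendsto_eventually)
        qed
      qed (use elim(2) in auto)
      then have "(\<lambda>i. f (X (r i), x)) \<longlonglongrightarrow> c x + time_integral g t x"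
        using elim(3) x by (auto intro: tendsto_add)
      moreover have "(\<lambda>i. f (X (r i), x)) \<longlonglongrightarrow> f (t, x)"
        using elim(1) x by (simp add: LIM_zero_iff)
      ultimately show "f (t, x) = c x + time_integral g t x" using LIMSEQ_unique by blast
    qed
  qed
qed

text \<open>The infimum is attained: it is a bound after adding 1 / (n + 1), for every n, and
  countably many null sets are negligible.\<close>

lemma Lp_norm_infinity_AE:
  fixes f :: "'a \<Rightarrow> 'b::euclidean_space"
  assumes "f \<in> Lp_space \<infinity> M"
  shows "AE x in M. norm (f x) \<le> Lp_norm \<infinity> M f"
proof -
  let ?S = "{C. 0 \<le> C \<and> (AE x in M. norm (f x) \<le> C)}"
  obtain C where C: "AE x in M. norm (f x) \<le> C" using assms by (auto simp: Lp_space_def)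
  then have "AE x in M. norm (f x) \<le> \<bar>C\<bar>" by eventually_elim simp
  then have "\<bar>C\<bar> \<in> ?S" by simp
  then have ne: "?S \<noteq> {}" by blast
  have "AE x in M. norm (f x) \<le> Inf ?S + 1 / real (Suc n)" for n
  proof -
    have "Inf ?S < Inf ?S + 1 / real (Suc n)" by simp
    then obtain D where "D \<in> ?S" "D < Inf ?S + 1 / real (Suc n)"
      using cInf_lessD[OF ne] by blast
    then show ?thesis by (auto elim!: eventually_mono)
  qed
  then have "AE x in M. \<forall>n. norm (f x) \<le> Inf ?S + 1 / real (Suc n)"
    by (simp add: AE_all_countable)
  then have "AE x in M. norm (f x) \<le> Inf ?S"
  proof eventually_elim
    case (elim x)
    show ?case
    proof (rule field_le_epsilon)
      fix e :: real assume "0 < e"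
      then obtain n where "inverse (real (Suc n)) < e" using reals_Archimedean by blast
      then show "norm (f x) \<le> Inf ?S + e"
        using elim[THEN spec, of n] unfolding inverse_eq_divide by linarith
    qed
  qed
  then show ?thesis by (simp add: Lp_norm_def)
qed

section \<open>Mixed norms on the cylinder\<close>

lemma representative_bounded:
  fixes f :: "'a::euclidean_space \<Rightarrow> 'b::euclidean_space"
  assumes U: "open U" and f: "f \<in> borel_measurable (lebesgue_on U)"
    and K: "AE x in lebesgue_on U. norm (f x) \<le> K" and K0: "0 \<le> K"
  obtains f' where "representative U f f'" "\<And>x. norm (f' x) \<le> K"
proof -
  obtain f0 where r: "representative U f f0" using representative_exists[OF U f] .
  note [measurable] = representative_measurable[OF r]
  let ?f = "\<lambda>x. if norm (f0 x) \<le> K then f0 x else 0"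
  have "representative U f ?f"
    unfolding representative_def
  proof (intro conjI allI impI)
    show "AE x in lborel. x \<in> U \<longrightarrow> ?f x = f x"
      using representative_AE[OF r] K[unfolded AE_lebesgue_on_open_iff[OF U]] by eventually_elim auto
  qed (use r in \<open>auto simp: representative_def\<close>)
  then show thesis by (rule that) (use K0 in auto)
qed

lemma bounded_representative_integrable:
  fixes f' :: "'a::euclidean_space \<Rightarrow> 'b::euclidean_space"
  assumes U: "bounded U" "open U" and r: "representative U f f'" and K: "\<And>x. norm (f' x) \<le> K"
  shows "integrable lborel f'"
proof (rule Bochner_Integration.integrable_bound)
  have "emeasure lborel U < \<infinity>" by (rule emeasure_bounded_finite[OF U(1)])
  then show "integrable lborel (\<lambda>x. K * indicator U x)"
    using U by (intro integrable_mult_right integrable_real_indicator) auto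
  show "AE x in lborel. norm (f' x) \<le> norm (K * indicator U x)"
  proof (rule AE_I2)
    fix x show "norm (f' x) \<le> norm (K * indicator U x)"
      using r K[of x] by (cases "x \<in> U") (auto simp: representative_def)
  qed
qed (use r in \<open>simp add: representative_def\<close>)

text \<open>This direction of Fubini's theorem for null sets requires a measurable exceptional set;
  hence the Borel version of f and a Borel condition Q.\<close>

lemma AE_cylI:
  fixes f :: "real \<times> (real^3) \<Rightarrow> 'b::euclidean_space"
  assumes U: "open \<Omega>" and f: "f \<in> borel_measurable (lebesgue_on (cyl T \<Omega>))"
    and Q: "{y. Q y} \<in> sets borel"
    and ae: "AE t in lborel. t \<in> {0<..<T} \<longrightarrow> (AE x in lborel. x \<in> \<Omega> \<longrightarrow> Q (f (t, x)))"
  shows "AE z in lebesgue_on (cyl T \<Omega>). Q (f z)"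
proof -
  obtain f' where r: "representative (cyl T \<Omega>) f f'" using representative_exists[OF open_cyl[OF U] f] .
  have "f' \<in> borel_measurable (borel \<Otimes>\<^sub>M borel)" using representative_measurable[OF r] by (simp add: borel_prod)
  note [measurable] = this
  have [measurable]: "\<Omega> \<in> sets borel" "Measurable.pred borel Q" using U Q by (auto simp: pred_def)
  have "AE z in lborel \<Otimes>\<^sub>M lborel. z \<in> cyl T \<Omega> \<longrightarrow> Q (f' z)"
  proof (rule lborel_pair.AE_pair_measure)
    have "Measurable.pred (borel \<Otimes>\<^sub>M borel) (\<lambda>z. fst z \<in> {0<..<T} \<and> snd z \<in> \<Omega> \<longrightarrow> Q (f' z))"
      by measurable
    then show "{z \<in> space (lborel \<Otimes>\<^sub>M lborel). z \<in> cyl T \<Omega> \<longrightarrow> Q (f' z)} \<in> sets (lborel \<Otimes>\<^sub>M lborel)"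
      by (simp add: pred_def space_pair_measure cyl_def mem_Times_iff cong: sets_pair_measure_cong)
    show "AE t in lborel. AE x in lborel. (t, x) \<in> cyl T \<Omega> \<longrightarrow> Q (f' (t, x))"
      using ae AE_slices[OF representative_AE[OF r]]
    proof eventually_elim
      case (elim t)
      show ?case
      proof (cases "t \<in> {0<..<T}")
        case True
        with elim(1) have "AE x in lborel. x \<in> \<Omega> \<longrightarrow> Q (f (t, x))" by simp
        with elim(2) show ?thesis by eventually_elim (auto simp: cyl_def)
      qed (auto simp: cyl_def)
    qed
  qed
  then have "AE z in lborel. z \<in> cyl T \<Omega> \<longrightarrow> Q (f' z)" by (simp only: lborel_prod)
  with representative_AE[OF r] show ?thesis
    unfolding AE_lebesgue_on_open_iff[OF open_cyl[OF U]] by eventually_elim auto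
qed

lemma Lp_Lq_infinity_bound:
  fixes f :: "real \<times> (real^3) \<Rightarrow> 'b::euclidean_space"
  assumes U: "open \<Omega>" and f: "f \<in> Lp_Lq \<infinity> \<infinity> T \<Omega>"
  obtains K where "0 \<le> K" "AE z in lebesgue_on (cyl T \<Omega>). norm (f z) \<le> K"
proof -
  obtain C where C: "AE t in lebesgue_on {0<..<T}. norm (Lp_norm \<infinity> (lebesgue_on \<Omega>) (curry f t)) \<le> C"
    using f by (auto simp: Lp_Lq_def Lp_space_def)
  have ae: "AE t in lebesgue_on {0<..<T}. curry f t \<in> Lp_space \<infinity> (lebesgue_on \<Omega>)"
    and fm: "f \<in> borel_measurable (lebesgue_on (cyl T \<Omega>))"
    using f by (auto simp: Lp_Lq_def)
  have "AE z in lebesgue_on (cyl T \<Omega>). norm (f z) \<le> \<bar>C\<bar>"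
  proof (rule AE_cylI[OF U fm])
    show "AE t in lborel. t \<in> {0<..<T} \<longrightarrow> (AE x in lborel. x \<in> \<Omega> \<longrightarrow> norm (f (t, x)) \<le> \<bar>C\<bar>)"
      using C ae unfolding AE_lebesgue_on_open_iff[OF open_greaterThanLessThan]
    proof eventually_elim
      case (elim t)
      show ?case
      proof
        assume "t \<in> {0<..<T}"
        then have 1: "Lp_norm \<infinity> (lebesgue_on \<Omega>) (curry f t) \<le> \<bar>C\<bar>" "curry f t \<in> Lp_space \<infinity> (lebesgue_on \<Omega>)"
          using elim by auto
        from Lp_norm_infinity_AE[OF 1(2)] show "AE x in lborel. x \<in> \<Omega> \<longrightarrow> norm (f (t, x)) \<le> \<bar>C\<bar>"
          unfolding AE_lebesgue_on_open_iff[OF U] by eventually_elim (use 1(1) in auto)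
      qed
    qed
    have "closed {y::'b. norm y \<le> \<bar>C\<bar>}" by (intro closed_Collect_le continuous_intros)
    then show "{y::'b. norm y \<le> \<bar>C\<bar>} \<in> sets borel" by simp
  qed
  then show thesis by (rule that[rotated]) simp
qed

text \<open>Tonelli's theorem for the Borel version. The majorant h will be the squared slice norm
  for data in L2 in time, and a constant for data bounded in time, be it by an L3 bound or by
  continuity.\<close>

lemma Lp_space_2_cylI:
  fixes f :: "real \<times> (real^3) \<Rightarrow> 'b::euclidean_space"
  assumes U: "open \<Omega>" and fm: "f \<in> borel_measurable (lebesgue_on (cyl T \<Omega>))"
    and ae: "AE t in lebesgue_on {0<..<T}. (\<integral>\<^sup>+x. ennreal ((norm (f (t, x)))\<^sup>2) \<partial>lebesgue_on \<Omega>) \<le> h t"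
    and h: "(\<integral>\<^sup>+t. h t \<partial>lebesgue_on {0<..<T}) < \<infinity>"
  shows "f \<in> Lp_space 2 (lebesgue_on (cyl T \<Omega>))"
proof -
  obtain f' where r: "representative (cyl T \<Omega>) f f'" using representative_exists[OF open_cyl[OF U] fm] .
  have [measurable]: "f' \<in> borel_measurable (borel \<Otimes>\<^sub>M borel)"
    using representative_measurable[OF r] by (simp add: borel_prod)
  have f'm: "f' \<in> borel_measurable lborel" using representative_measurable[OF r] by simp
  have "(\<integral>\<^sup>+z. ennreal ((norm (f' z))\<^sup>2) \<partial>lborel) = (\<integral>\<^sup>+t. \<integral>\<^sup>+x. ennreal ((norm (f' (t, x)))\<^sup>2) \<partial>lborel \<partial>lborel)"
    unfolding lborel_prod[symmetric] by (rule lborel.nn_integral_fst[symmetric]) measurable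
  also have "\<dots> \<le> (\<integral>\<^sup>+t. h t * indicator {0<..<T} t \<partial>lborel)"
  proof (rule nn_integral_mono_AE)
    show "AE t in lborel. (\<integral>\<^sup>+x. ennreal ((norm (f' (t, x)))\<^sup>2) \<partial>lborel) \<le> h t * indicator {0<..<T} t"
      using ae[unfolded AE_lebesgue_on_open_iff[OF open_greaterThanLessThan]] AE_slices[OF representative_AE[OF r]]
    proof eventually_elim
      case (elim t)
      show ?case
      proof (cases "t \<in> {0<..<T}")
        case True
        have "(\<integral>\<^sup>+x. ennreal ((norm (f' (t, x)))\<^sup>2) \<partial>lborel) = (\<integral>\<^sup>+x. ennreal ((norm (f (t, x)))\<^sup>2) * indicator \<Omega> x \<partial>lborel)"
        proof (rule nn_integral_cong_AE)
          show "AE x in lborel. ennreal ((norm (f' (t, x)))\<^sup>2) = ennreal ((norm (f (t, x)))\<^sup>2) * indicator \<Omega> x"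
            using elim(2)
          proof eventually_elim
            case (elim x)
            show ?case
              using elim True r by (cases "x \<in> \<Omega>") (auto simp: cyl_def representative_def)
          qed
        qed
        also have "\<dots> = (\<integral>\<^sup>+x. ennreal ((norm (f (t, x)))\<^sup>2) \<partial>lebesgue_on \<Omega>)"
          using U by (simp add: nn_integral_restrict_space nn_integral_completion)
        finally show ?thesis using elim(1) True by simp
      next
        case False
        then have "f' (t, x) = 0" for x using r by (auto simp: representative_def cyl_def)
        then show ?thesis by simp
      qed
    qed
  qed
  also have "\<dots> = (\<integral>\<^sup>+t. h t \<partial>lebesgue_on {0<..<T})"
    by (simp add: nn_integral_restrict_space nn_integral_completion)
  finally have fin: "(\<integral>\<^sup>+z. ennreal ((norm (f' z))\<^sup>2) \<partial>lborel) < \<infinity>" using h by simp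
  have i: "integrable lborel (\<lambda>z. (norm (f' z))\<^sup>2)"
    using f'm fin by (intro integrableI_bounded) auto
  have "representative (cyl T \<Omega>) (\<lambda>z. (norm (f z))\<^sup>2) (\<lambda>z. (norm (f' z))\<^sup>2)"
    unfolding representative_def
  proof (intro conjI)
    show "AE x in lborel. x \<in> cyl T \<Omega> \<longrightarrow> (norm (f' x))\<^sup>2 = (norm (f x))\<^sup>2"
      using representative_AE[OF r] by eventually_elim simp
  qed (use r in \<open>auto simp: representative_def\<close>)
  from representative_integral(2)[OF open_cyl[OF U] this] fm i
  show ?thesis by (simp add: Lp_space_2_iff)
qed

lemma Lp_Lq_2_2_imp_Lp_space_2:
  fixes f :: "real \<times> (real^3) \<Rightarrow> 'b::euclidean_space"
  assumes U: "open \<Omega>" and f: "f \<in> Lp_Lq 2 2 T \<Omega>"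
  shows "f \<in> Lp_space 2 (lebesgue_on (cyl T \<Omega>))"
proof (rule Lp_space_2_cylI[OF U])
  show "f \<in> borel_measurable (lebesgue_on (cyl T \<Omega>))" using f by (simp add: Lp_Lq_def)
  have "AE t in lebesgue_on {0<..<T}. curry f t \<in> Lp_space 2 (lebesgue_on \<Omega>)"
    using f by (simp add: Lp_Lq_def)
  then show "AE t in lebesgue_on {0<..<T}. (\<integral>\<^sup>+x. ennreal ((norm (f (t, x)))\<^sup>2) \<partial>lebesgue_on \<Omega>)
      \<le> ennreal ((norm (Lp_norm 2 (lebesgue_on \<Omega>) (curry f t)))\<^sup>2)"
    by eventually_elim (simp add: Lp_norm_2_squared Lp_space_2_iff nn_integral_eq_integral)
  have "(\<lambda>t. Lp_norm 2 (lebesgue_on \<Omega>) (curry f t)) \<in> Lp_space 2 (lebesgue_on {0<..<T})"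
    using f by (simp add: Lp_Lq_def)
  then have "integrable (lebesgue_on {0<..<T}) (\<lambda>t. (norm (Lp_norm 2 (lebesgue_on \<Omega>) (curry f t)))\<^sup>2)"
    by (simp only: Lp_space_2_iff)
  then show "(\<integral>\<^sup>+t. ennreal ((norm (Lp_norm 2 (lebesgue_on \<Omega>) (curry f t)))\<^sup>2) \<partial>lebesgue_on {0<..<T}) < \<infinity>"
    by (simp add: nn_integral_eq_integral)
qed

text \<open>On a set of finite measure a bound in L3 gives one in L2, here through y^2 \<le> 1 +
  y^3.\<close>

lemma Lp_Lq_infinity_3_imp_Lp_space_2:
  fixes f :: "real \<times> (real^3) \<Rightarrow> 'b::euclidean_space"
  assumes U: "open \<Omega>" "bounded \<Omega>" and f: "f \<in> Lp_Lq \<infinity> 3 T \<Omega>"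
  shows "f \<in> Lp_space 2 (lebesgue_on (cyl T \<Omega>))"
proof -
  let ?M = "lebesgue_on \<Omega>"
  interpret finite_measure ?M by (rule finite_measure_lebesgue_on[OF U])
  obtain C where C: "AE t in lebesgue_on {0<..<T}. norm (Lp_norm 3 ?M (curry f t)) \<le> C"
    using f by (auto simp: Lp_Lq_def Lp_space_def)
  have ae: "AE t in lebesgue_on {0<..<T}. curry f t \<in> Lp_space 3 ?M"
    and fm: "f \<in> borel_measurable (lebesgue_on (cyl T \<Omega>))"
    using f by (auto simp: Lp_Lq_def)
  define K where "K = measure ?M (space ?M) + \<bar>C\<bar> ^ 3"
  show ?thesis
  proof (rule Lp_space_2_cylI[OF U(1) fm])
    show "AE t in lebesgue_on {0<..<T}. (\<integral>\<^sup>+x. ennreal ((norm (f (t, x)))\<^sup>2) \<partial>?M) \<le> ennreal K"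
      using C ae
    proof eventually_elim
      case (elim t)
      have i: "integrable ?M (\<lambda>x. norm (f (t, x)) ^ 3)" and m: "(\<lambda>x. f (t, x)) \<in> borel_measurable ?M"
        using elim(2) by (auto simp: Lp_space_def curry_def)
      let ?J = "\<integral>x. norm (f (t, x)) ^ 3 \<partial>?M"
      have J0: "0 \<le> ?J" by (simp add: integral_nonneg_AE)
      have N: "Lp_norm 3 ?M (curry f t) = ?J powr (1/3)" by (simp add: Lp_norm_def curry_def)
      have "?J = (?J powr (1/3)) powr 3"
        using J0 by (simp only: powr_powr) simp
      also have "\<dots> = (?J powr (1/3)) ^ 3"
        by (rule powr_numeral) simp
      also have "\<dots> \<le> \<bar>C\<bar> ^ 3"
        using elim(1) unfolding N by (intro power_mono) auto
      finally have J: "?J \<le> \<bar>C\<bar> ^ 3" .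
      have "(\<integral>\<^sup>+x. ennreal ((norm (f (t, x)))\<^sup>2) \<partial>?M) \<le> (\<integral>\<^sup>+x. ennreal (1 + norm (f (t, x)) ^ 3) \<partial>?M)"
      proof (intro nn_integral_mono ennreal_leI)
        fix x
        define y where "y = norm (f (t, x))"
        have y0: "0 \<le> y" by (simp add: y_def)
        have "y\<^sup>2 \<le> 1 + y ^ 3"
        proof (cases "y \<le> 1")
          case True
          then have "y\<^sup>2 \<le> 1" using y0 by (simp add: power_le_one)
          moreover have "0 \<le> y ^ 3" using y0 by simp
          ultimately show ?thesis by linarith
        next
          case False
          then have "y\<^sup>2 \<le> y ^ 3" by (intro power_increasing) auto
          then show ?thesis by simp
        qed
        then show "(norm (f (t, x)))\<^sup>2 \<le> 1 + norm (f (t, x)) ^ 3" by (simp add: y_def)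
      qed
      also have "\<dots> = ennreal (\<integral>x. 1 + norm (f (t, x)) ^ 3 \<partial>?M)"
        by (rule nn_integral_eq_integral) (use i in auto)
      also have "(\<integral>x. 1 + norm (f (t, x)) ^ 3 \<partial>?M) \<le> K"
        using i J by (simp add: K_def)
      finally show ?case by (simp add: ennreal_leI)
    qed
    have "emeasure (lebesgue_on {0<..<T}) (space (lebesgue_on {0<..<T})) < \<infinity>"
      using finite_measure.emeasure_finite[OF finite_measure_lebesgue_on[of "{0<..<T}"]]
      by (simp add: less_top)
    then show "(\<integral>\<^sup>+t. ennreal K \<partial>lebesgue_on {0<..<T}) < \<infinity>"
      by (simp add: ennreal_mult_less_top)
  qed
qed

text \<open>The L2 norm is continuous in t, and {0..T} is compact.\<close>

lemma C_L2_bounded: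
  fixes f :: "real \<times> (real^3) \<Rightarrow> 'b::euclidean_space"
  assumes T: "0 < T" and f: "f \<in> C_L2 T \<Omega>"
  obtains K where "\<And>t. 0 \<le> t \<Longrightarrow> t \<le> T \<Longrightarrow> L2_norm \<Omega> (\<lambda>x. f (t, x)) \<le> K"
proof -
  have fL: "(\<lambda>x. f (s, x)) \<in> Lp_space 2 (lebesgue_on \<Omega>)" if "s \<in> {0..T}" for s
    using f that by (auto simp: C_L2_def curry_def)
  have "continuous_on {0..T} (\<lambda>t. L2_norm \<Omega> (\<lambda>x. f (t, x)))"
    unfolding continuous_on_def
  proof
    fix t assume t: "t \<in> {0..T}"
    show "((\<lambda>t. L2_norm \<Omega> (\<lambda>x. f (t, x))) \<longlongrightarrow> L2_norm \<Omega> (\<lambda>x. f (t, x))) (at t within {0..T})"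
    proof (rule Lim_null[THEN iffD2], rule Lim_null_comparison)
      show "((\<lambda>s. L2_norm \<Omega> (\<lambda>x. f (s, x) - f (t, x))) \<longlongrightarrow> 0) (at t within {0..T})"
        using f t by (auto simp: C_L2_def)
      have "norm (L2_norm \<Omega> (\<lambda>x. f (s, x)) - L2_norm \<Omega> (\<lambda>x. f (t, x))) \<le> L2_norm \<Omega> (\<lambda>x. f (s, x) - f (t, x))"
        if s: "s \<in> {0..T}" for s
      proof -
        have "L2_norm \<Omega> (\<lambda>x. f (s, x)) \<le> L2_norm \<Omega> (\<lambda>x. f (s, x) - f (t, x)) + L2_norm \<Omega> (\<lambda>x. f (t, x))"
          using Lp_norm_2_add(2)[OF Lp_norm_2_diff(1)[OF fL[OF s] fL[OF t]] fL[OF t]] by simp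
        moreover have "L2_norm \<Omega> (\<lambda>x. f (t, x)) \<le> L2_norm \<Omega> (\<lambda>x. f (s, x)) + L2_norm \<Omega> (\<lambda>x. f (s, x) - f (t, x))"
          using Lp_norm_2_diff(2)[OF fL[OF s] Lp_norm_2_diff(1)[OF fL[OF s] fL[OF t]]] by simp
        ultimately show ?thesis by (simp add: abs_le_iff)
      qed
      then show "\<forall>\<^sub>F s in at t within {0..T}. norm (L2_norm \<Omega> (\<lambda>x. f (s, x)) - L2_norm \<Omega> (\<lambda>x. f (t, x))) \<le> L2_norm \<Omega> (\<lambda>x. f (s, x) - f (t, x))"
        by (auto simp: eventually_at_filter)
    qed
  qed
  then have "compact ((\<lambda>t. L2_norm \<Omega> (\<lambda>x. f (t, x))) ` {0..T})"
    by (rule compact_continuous_image) simp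
  then obtain K where "\<forall>y\<in>(\<lambda>t. L2_norm \<Omega> (\<lambda>x. f (t, x))) ` {0..T}. norm y \<le> K"
    using compact_imp_bounded bounded_iff by metis
  then show thesis by (intro that[of K]) (auto simp: abs_le_iff)
qed

lemma C_L2_imp_Lp_space_2:
  fixes f :: "real \<times> (real^3) \<Rightarrow> 'b::euclidean_space"
  assumes U: "open \<Omega>" and T: "0 < T" and f: "f \<in> C_L2 T \<Omega>" and fm: "f \<in> borel_measurable (lebesgue_on (cyl T \<Omega>))"
  shows "f \<in> Lp_space 2 (lebesgue_on (cyl T \<Omega>))"
proof -
  obtain K where K: "\<And>t. 0 \<le> t \<Longrightarrow> t \<le> T \<Longrightarrow> L2_norm \<Omega> (\<lambda>x. f (t, x)) \<le> K"
    using C_L2_bounded[OF T f] by blast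
  show ?thesis
  proof (rule Lp_space_2_cylI[OF U fm])
    show "AE t in lebesgue_on {0<..<T}. (\<integral>\<^sup>+x. ennreal ((norm (f (t, x)))\<^sup>2) \<partial>lebesgue_on \<Omega>) \<le> ennreal (K\<^sup>2)"
    proof (rule AE_I2)
      fix t assume "t \<in> space (lebesgue_on {0<..<T})"
      then have t: "0 \<le> t" "t \<le> T" by auto
      then have i: "integrable (lebesgue_on \<Omega>) (\<lambda>x. (norm (f (t, x)))\<^sup>2)"
        using f by (auto simp: C_L2_def curry_def Lp_space_2_iff)
      then have "(\<integral>\<^sup>+x. ennreal ((norm (f (t, x)))\<^sup>2) \<partial>lebesgue_on \<Omega>) = ennreal ((L2_norm \<Omega> (\<lambda>x. f (t, x)))\<^sup>2)"
        by (simp add: Lp_norm_2_squared nn_integral_eq_integral)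
      also have "\<dots> \<le> ennreal (K\<^sup>2)"
        by (intro ennreal_leI power_mono K t Lp_norm_2_nonneg)
      finally show "(\<integral>\<^sup>+x. ennreal ((norm (f (t, x)))\<^sup>2) \<partial>lebesgue_on \<Omega>) \<le> ennreal (K\<^sup>2)" .
    qed
    have "emeasure (lebesgue_on {0<..<T}) (space (lebesgue_on {0<..<T})) < \<infinity>"
      using finite_measure.emeasure_finite[OF finite_measure_lebesgue_on[of "{0<..<T}"]]
      by (simp add: less_top)
    then show "(\<integral>\<^sup>+t. ennreal (K\<^sup>2) \<partial>lebesgue_on {0<..<T}) < \<infinity>"
      by (simp add: ennreal_mult_less_top)
  qed
qed

text \<open>The pairing with F is continuous in t, so its vanishing at good times is inherited by
  their limit. It is applied first to gradients of test functions and then to gradients in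
  H1.\<close>

lemma C_L2_inner_eq_0:
  fixes f :: "real \<times> (real^3) \<Rightarrow> 'b::euclidean_space"
  assumes T: "0 < T" and f: "f \<in> C_L2 T \<Omega>" and F: "F \<in> Lp_space 2 (lebesgue_on \<Omega>)"
    and ae: "AE t in lborel. t \<in> {0<..<T} \<longrightarrow> (\<integral>x. f (t, x) \<bullet> F x \<partial>lebesgue_on \<Omega>) = 0"
    and t: "0 \<le> t" "t \<le> T"
  shows "(\<integral>x. f (t, x) \<bullet> F x \<partial>lebesgue_on \<Omega>) = 0"
proof -
  let ?M = "lebesgue_on \<Omega>"
  obtain X where X: "X \<longlonglongrightarrow> t" "\<And>i. 0 < X i \<and> X i < T \<and> X i \<noteq> t \<and>
      (X i \<in> {0<..<T} \<longrightarrow> (\<integral>x. f (X i, x) \<bullet> F x \<partial>?M) = 0)"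
    using good_times[OF ae t T] by blast
  have fL: "(\<lambda>x. f (s, x)) \<in> Lp_space 2 ?M" if "0 \<le> s" "s \<le> T" for s
    using f that by (auto simp: C_L2_def curry_def)
  have XT: "0 \<le> X i" "X i \<le> T" for i using X(2)[of i] by auto
  have "((\<lambda>s. L2_norm \<Omega> (\<lambda>x. f (s, x) - f (t, x))) \<longlongrightarrow> 0) (at t within {0..T})"
    using f t by (auto simp: C_L2_def)
  then have lim: "(\<lambda>i. L2_norm \<Omega> (\<lambda>x. f (X i, x) - f (t, x))) \<longlonglongrightarrow> 0"
    using X by (auto simp: tendsto_at_iff_sequentially comp_def less_imp_le)
  have bound: "\<bar>\<integral>x. f (t, x) \<bullet> F x \<partial>?M\<bar> \<le> L2_norm \<Omega> (\<lambda>x. f (X i, x) - f (t, x)) * Lp_norm 2 ?M F" for i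
  proof -
    have "(\<integral>x. f (X i, x) \<bullet> F x \<partial>?M) = 0" using X(2)[of i] by auto
    then have "(\<integral>x. (f (X i, x) - f (t, x)) \<bullet> F x \<partial>?M) = - (\<integral>x. f (t, x) \<bullet> F x \<partial>?M)"
      using Lp_space_2_inner_integrable[OF fL[OF XT] F] Lp_space_2_inner_integrable[OF fL[OF t] F]
      by (simp add: inner_diff_left)
    then show ?thesis
      using Lp_norm_2_inner_bound[OF Lp_norm_2_diff(1)[OF fL[OF XT, of i] fL[OF t]] F] by simp
  qed
  have "(\<lambda>i. L2_norm \<Omega> (\<lambda>x. f (X i, x) - f (t, x)) * Lp_norm 2 ?M F) \<longlonglongrightarrow> 0"
    using tendsto_mult[OF lim tendsto_const[of "Lp_norm 2 ?M F"]] by simp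
  then have "\<bar>\<integral>x. f (t, x) \<bullet> F x \<partial>?M\<bar> \<le> 0"
    by (rule tendsto_lowerbound) (use bound in auto)
  then show ?thesis by simp
qed

subsection \<open>The velocity is orthogonal to gradients at all times\<close>

lemma locally_integrable_component:
  fixes f :: "'a::euclidean_space \<Rightarrow> real^3"
  shows "locally_integrable U f \<Longrightarrow> locally_integrable U (\<lambda>x. f x $ j)"
  unfolding locally_integrable_def by (auto intro: integrable_bounded_linear[OF bounded_linear_vec_nth])

lemma has_weak_deriv_component:
  fixes f g :: "'a::euclidean_space \<Rightarrow> real^3"
  assumes U: "open U" and wd: "has_weak_deriv U v f g"
  shows "has_weak_deriv U v (\<lambda>x. f x $ j) (\<lambda>x. g x $ j)"
proof -
  have li: "locally_integrable U f" "locally_integrable U g" using wd by (auto simp: has_weak_deriv_def)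
  have eq: "integral\<^sup>L (lebesgue_on U) (\<lambda>x. \<phi> x *\<^sub>R h x $ j) = integral\<^sup>L (lebesgue_on U) (\<lambda>x. \<phi> x *\<^sub>R h x) $ j"
    if "\<phi> \<in> test_functions U" "locally_integrable U h" for \<phi> :: "'a \<Rightarrow> real" and h :: "'a \<Rightarrow> real^3"
    using integral_bounded_linear[OF bounded_linear_vec_nth[of j] test_function_times_locally_integrable[OF U that(2,1)]]
    by simp
  show ?thesis
    unfolding has_weak_deriv_def
  proof (intro conjI ballI locally_integrable_component li)
    fix \<phi> :: "'a \<Rightarrow> real" assume \<phi>: "\<phi> \<in> test_functions U"
    have "integral\<^sup>L (lebesgue_on U) (\<lambda>x. frechet_derivative \<phi> (at x) v *\<^sub>R f x) $ j
        = (- integral\<^sup>L (lebesgue_on U) (\<lambda>x. \<phi> x *\<^sub>R g x)) $ j"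
      using wd \<phi> by (simp add: has_weak_deriv_def)
    then show "integral\<^sup>L (lebesgue_on U) (\<lambda>x. frechet_derivative \<phi> (at x) v *\<^sub>R f x $ j)
        = - integral\<^sup>L (lebesgue_on U) (\<lambda>x. \<phi> x *\<^sub>R g x $ j)"
      by (simp only: eq[OF test_functions_deriv[OF \<phi>] li(1)] eq[OF \<phi> li(2)] vector_uminus_component)
  qed
qed

definition test_grad :: "(real^3 \<Rightarrow> real) \<Rightarrow> real^3 \<Rightarrow> real^3" where
  "test_grad \<psi> x = (\<chi> j. frechet_derivative \<psi> (at x) (axis j 1))"

lemma test_grad_Lp_space_2:
  "open \<Omega> \<Longrightarrow> bounded \<Omega> \<Longrightarrow> \<psi> \<in> test_functions V \<Longrightarrow> test_grad \<psi> \<in> Lp_space 2 (lebesgue_on \<Omega>)"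
  unfolding Lp_space_2_vec3_iff test_grad_def
  by (auto intro!: test_functions_Lp_space_2 intro: test_functions_deriv)

text \<open>For one fixed function the fundamental lemma yields a single null set serving all tests
  at once, which slices of an identity on the cylinder do not give directly.\<close>

lemma weak_div_eq_0_if_test:
  fixes u :: "real^3 \<Rightarrow> real^3"
  assumes U: "open \<Omega>" "bounded \<Omega>" and u: "u \<in> H1 \<Omega>"
    and test0: "\<And>\<psi>. \<psi> \<in> test_functions \<Omega> \<Longrightarrow> (\<integral>x. u x \<bullet> test_grad \<psi> x \<partial>lebesgue_on \<Omega>) = 0"
  shows "AE x in lebesgue_on \<Omega>. weak_div \<Omega> u x = 0"
  unfolding AE_lebesgue_on_open_iff[OF U(1)]
proof (rule fundamental_lemma[OF U(1)])
  let ?M = "lebesgue_on \<Omega>"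
  interpret finite_measure ?M by (rule finite_measure_lebesgue_on[OF U])
  have uL: "u \<in> Lp_space 2 ?M" and duL: "weak_deriv \<Omega> (axis j 1) u \<in> Lp_space 2 ?M" for j
    using u axis_Basis_real3 by (auto simp: H1_def)
  have di: "integrable ?M (\<lambda>x. weak_deriv \<Omega> (axis j 1) u x $ j)" for j
    by (intro Lp_space_2_integrable Lp_norm_2_component duL)
  have wdiv: "weak_div \<Omega> u = (\<lambda>x. \<Sum>j\<in>UNIV. weak_deriv \<Omega> (axis j 1) u x $ j)"
    by (simp add: fun_eq_iff weak_div_def weak_jac_def trace_def)
  show "locally_integrable \<Omega> (weak_div \<Omega> u)"
    unfolding wdiv by (intro integrable_imp_locally_integrable[OF U(1)] Bochner_Integration.integrable_sum di)
  fix \<psi> :: "real^3 \<Rightarrow> real" assume \<psi>: "\<psi> \<in> test_functions \<Omega>"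
  have i1: "integrable ?M (\<lambda>x. \<psi> x * weak_deriv \<Omega> (axis j 1) u x $ j)" for j
    using Lp_space_2_inner_integrable[OF test_functions_Lp_space_2[OF U \<psi>] Lp_norm_2_component(1)[OF duL, of j]] by simp
  have i2: "integrable ?M (\<lambda>x. frechet_derivative \<psi> (at x) (axis j 1) * u x $ j)" for j
    using Lp_space_2_inner_integrable[OF test_functions_Lp_space_2[OF U test_functions_deriv[OF \<psi>]] Lp_norm_2_component(1)[OF uL, of j]] by simp
  have c: "(\<integral>x. frechet_derivative \<psi> (at x) (axis j 1) * u x $ j \<partial>?M) = - (\<integral>x. \<psi> x * weak_deriv \<Omega> (axis j 1) u x $ j \<partial>?M)" for j
    using has_weak_deriv_component[OF U(1) H1_has_weak_deriv[OF u axis_Basis_real3], of j j] \<psi>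
    by (simp add: has_weak_deriv_def)
  have "integral\<^sup>L ?M (\<lambda>x. \<psi> x *\<^sub>R weak_div \<Omega> u x) = (\<Sum>j\<in>UNIV. \<integral>x. \<psi> x * weak_deriv \<Omega> (axis j 1) u x $ j \<partial>?M)"
    by (simp add: wdiv sum_distrib_left i1)
  also have "\<dots> = - (\<integral>x. (\<Sum>j\<in>UNIV. frechet_derivative \<psi> (at x) (axis j 1) * u x $ j) \<partial>?M)"
    by (simp add: i2 c sum_negf)
  also have "(\<integral>x. (\<Sum>j\<in>UNIV. frechet_derivative \<psi> (at x) (axis j 1) * u x $ j) \<partial>?M) = (\<integral>x. u x \<bullet> test_grad \<psi> x \<partial>?M)"
    by (simp add: inner_vec_def test_grad_def mult.commute)
  finally show "integral\<^sup>L ?M (\<lambda>x. \<psi> x *\<^sub>R weak_div \<Omega> u x) = 0" by (simp add: test0[OF \<psi>])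
qed

lemma representative_slice:
  fixes f :: "real \<times> (real^3) \<Rightarrow> 'b::euclidean_space"
  assumes r: "representative (cyl T \<Omega>) f f'"
  shows "AE t in lborel. t \<in> {0<..<T} \<longrightarrow> representative \<Omega> (\<lambda>x. f (t, x)) (\<lambda>x. f' (t, x))"
  using AE_slices[OF representative_AE[OF r]]
proof eventually_elim
  case (elim t)
  have [measurable]: "f' \<in> borel_measurable (borel \<Otimes>\<^sub>M borel)"
    using representative_measurable[OF r] by (simp add: borel_prod)
  show ?case
  proof
    assume t: "t \<in> {0<..<T}"
    show "representative \<Omega> (\<lambda>x. f (t, x)) (\<lambda>x. f' (t, x))"
      unfolding representative_def
    proof (intro conjI)
      show "AE x in lborel. x \<in> \<Omega> \<longrightarrow> f' (t, x) = f (t, x)"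
        using elim by eventually_elim (use t in \<open>auto simp: cyl_def\<close>)
    qed (use r in \<open>auto simp: representative_def cyl_def\<close>)
  qed
qed

lemma representative_inner:
  assumes r: "representative \<Omega> f f'" and F: "F \<in> borel_measurable borel"
  shows "representative \<Omega> (\<lambda>x. f x \<bullet> F x) (\<lambda>x. f' x \<bullet> F x)"
  unfolding representative_def
proof (intro conjI)
  show "AE x in lborel. x \<in> \<Omega> \<longrightarrow> f' x \<bullet> F x = f x \<bullet> F x"
    using representative_AE[OF r] by eventually_elim simp
qed (use r F in \<open>auto simp: representative_def\<close>)

lemma representative_component:
  fixes f :: "'a::euclidean_space \<Rightarrow> real^3"
  assumes r: "representative U f f'"
  shows "representative U (\<lambda>x. f x $ j) (\<lambda>x. f' x $ j)"
  using representative_inner[OF r, of "\<lambda>x. axis j 1"] by (simp add: cart_eq_inner_axis)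

text \<open>The vanishing of \<open>div u\<close> is known on the cylinder only. For one test
  function it passes to almost every time slice, hence by continuity in \<open>L\<^sup>2\<close> to
  every slice, and so the exceptional null set does not depend on the test function.\<close>

lemma velocity_orthogonal_to_gradients:
  fixes u :: "real \<times> (real^3) \<Rightarrow> real^3"
  assumes U: "open \<Omega>" "bounded \<Omega>" and T: "0 < T" and uC: "u \<in> C_L2 T \<Omega>"
    and xd: "x_differentiable T \<Omega> u" and ub: "u \<in> Lp_Lq \<infinity> \<infinity> T \<Omega>" and jb: "x_jac T \<Omega> u \<in> Lp_Lq \<infinity> \<infinity> T \<Omega>"
    and div0: "AE z in lebesgue_on (cyl T \<Omega>). trace (x_jac T \<Omega> u z) = 0"
    and uH: "AE t in lebesgue_on {0<..<T}. curry u t \<in> H10 \<Omega>"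
    and \<phi>: "\<phi> \<in> H1 \<Omega>" and t: "0 \<le> t" "t \<le> T"
  shows "(\<integral>x. u (t, x) \<bullet> weak_grad \<Omega> \<phi> x \<partial>lebesgue_on \<Omega>) = 0"
proof -
  let ?M = "lebesgue_on \<Omega>"
  note oc = open_cyl[OF U(1), of T] and bc = bounded_cyl[OF U(2), of T]
  obtain Ku where Ku: "0 \<le> Ku" "AE z in lebesgue_on (cyl T \<Omega>). norm (u z) \<le> Ku"
    using Lp_Lq_infinity_bound[OF U(1) ub] .
  obtain u' where u': "representative (cyl T \<Omega>) u u'" "\<And>z. norm (u' z) \<le> Ku"
    using representative_bounded[OF oc _ Ku(2,1)] ub by (auto simp: Lp_Lq_def)
  have u'i: "integrable lborel u'" by (rule bounded_representative_integrable[OF bc oc u'])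
  obtain Kj where Kj: "0 \<le> Kj" "AE z in lebesgue_on (cyl T \<Omega>). norm (x_jac T \<Omega> u z) \<le> Kj"
    using Lp_Lq_infinity_bound[OF U(1) jb] .
  \<comment> \<open>The diagonal entries of the Jacobian, whose sum is the divergence on the
    cylinder.\<close>
  define D where "D j z = weak_deriv (cyl T \<Omega>) (0, axis j 1) u z $ j" for j z
  have wd: "has_weak_deriv (cyl T \<Omega>) (0, axis j 1) (\<lambda>z. u z $ j) (D j)" for j
    unfolding D_def[abs_def]
    by (rule has_weak_deriv_component[OF oc weakly_differentiable_has_weak_deriv])
       (use xd in \<open>simp add: x_differentiable_def\<close>)
  have "\<exists>D'. representative (cyl T \<Omega>) (D j) D' \<and> (\<forall>z. norm (D' z) \<le> Kj)" for j
  proof -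
    have Dm: "D j \<in> borel_measurable (lebesgue_on (cyl T \<Omega>))"
      using wd[of j] by (intro locally_integrable_measurable[OF oc]) (simp add: has_weak_deriv_def)
    have "AE z in lebesgue_on (cyl T \<Omega>). norm (D j z) \<le> Kj"
      using Kj(2)
    proof eventually_elim
      case (elim z)
      have "norm (D j z) = norm (x_jac T \<Omega> u z $ j $ j)" by (simp add: D_def x_jac_def)
      also have "\<dots> \<le> norm (x_jac T \<Omega> u z)"
        by (metis Finite_Cartesian_Product.norm_nth_le order_trans)
      finally show ?case using elim by simp
    qed
    from representative_bounded[OF oc Dm this Kj(1)] show ?thesis by metis
  qed
  then obtain D' where D': "\<And>j. representative (cyl T \<Omega>) (D j) (D' j)" "\<And>j z. norm (D' j z) \<le> Kj" by metis
  have D'i: "integrable lborel (D' j)" for j by (rule bounded_representative_integrable[OF bc oc D'])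
  have u'ji: "integrable lborel (\<lambda>z. u' z $ j)" for j
    by (rule integrable_bounded_linear[OF bounded_linear_vec_nth u'i])
  have w1: "L1_weak_deriv (cyl T \<Omega>) (0, axis j 1) (\<lambda>z. u' z $ j) (D' j)" for j
    using has_weak_deriv_iff_L1[OF oc representative_component[OF u'(1)] D'(1) u'ji D'i] wd by blast
  have tr: "AE z in lborel. (\<Sum>j\<in>UNIV. D' j z) = 0"
  proof -
    have "AE z in lborel. \<forall>j\<in>UNIV. z \<in> cyl T \<Omega> \<longrightarrow> D' j z = D j z"
      by (rule AE_finite_allI) (auto intro: representative_AE[OF D'(1)])
    with div0[unfolded AE_lebesgue_on_open_iff[OF oc]] show ?thesis
    proof eventually_elim
      case (elim z)
      show ?case
      proof (cases "z \<in> cyl T \<Omega>")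
        case True
        with elim show ?thesis by (simp add: D_def x_jac_def trace_def)
      next
        case False
        then have "D' j z = 0" for j using D'(1)[of j] unfolding representative_def by blast
        then show ?thesis by simp
      qed
    qed
  qed
  \<comment> \<open>Almost every time for one \<psi>, then every time by continuity: from here on
    the set of admissible times no longer depends on \<psi>.\<close>
  have test0: "(\<integral>x. u (s, x) \<bullet> test_grad \<psi> x \<partial>?M) = 0" if \<psi>: "\<psi> \<in> test_functions \<Omega>" and s: "0 \<le> s" "s \<le> T" for \<psi> s
  proof (rule C_L2_inner_eq_0[OF T uC test_grad_Lp_space_2[OF U \<psi>] _ s])
    have a1: "AE t in lborel. \<forall>j\<in>UNIV. t \<in> {0<..<T} \<longrightarrow>
        (\<integral>x. frechet_derivative \<psi> (at x) (axis j 1) *\<^sub>R (u' (t, x) $ j) \<partial>lborel) = - (\<integral>x. \<psi> x *\<^sub>R D' j (t, x) \<partial>lborel)"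
      by (rule AE_finite_allI) (use L1_weak_deriv_slice[OF w1 \<psi>] in auto)
    have a2: "AE t in lborel. \<forall>j\<in>UNIV. integrable lborel (\<lambda>x. frechet_derivative \<psi> (at x) (axis j 1) *\<^sub>R (u' (t, x) $ j))"
      by (rule AE_finite_allI) (use lborel_pair.AE_integrable_fst[OF test_times_slice_integrable[OF u'ji test_functions_deriv[OF \<psi>]]] in auto)
    have a3: "AE t in lborel. \<forall>j\<in>UNIV. integrable lborel (\<lambda>x. \<psi> x *\<^sub>R D' j (t, x))"
      by (rule AE_finite_allI) (use lborel_pair.AE_integrable_fst[OF test_times_slice_integrable[OF D'i \<psi>]] in auto)
    show "AE t in lborel. t \<in> {0<..<T} \<longrightarrow> (\<integral>x. u (t, x) \<bullet> test_grad \<psi> x \<partial>?M) = 0"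
      using a1 a2 a3 AE_slices[OF tr] representative_slice[OF u'(1)]
    proof eventually_elim
      case (elim t)
      show ?case
      proof
        assume tT: "t \<in> {0<..<T}"
        have gm: "test_grad \<psi> \<in> borel_measurable borel"
          by (rule vec3_measurable) (simp add: test_grad_def test_functions_measurable[OF test_functions_deriv[OF \<psi>]])
        have r: "representative \<Omega> (\<lambda>x. u (t, x) \<bullet> test_grad \<psi> x) (\<lambda>x. u' (t, x) \<bullet> test_grad \<psi> x)"
          using elim(5) tT by (intro representative_inner gm) auto
        have "(\<integral>x. u (t, x) \<bullet> test_grad \<psi> x \<partial>?M) = (\<integral>x. u' (t, x) \<bullet> test_grad \<psi> x \<partial>lborel)"
          by (rule representative_integral(1)[OF U(1) r representative_source_measurable[OF U(1) r]])
        also have "\<dots> = (\<integral>x. (\<Sum>j\<in>UNIV. frechet_derivative \<psi> (at x) (axis j 1) *\<^sub>R (u' (t, x) $ j)) \<partial>lborel)"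
          by (simp add: inner_vec_def test_grad_def mult.commute)
        also have "\<dots> = (\<Sum>j\<in>UNIV. \<integral>x. frechet_derivative \<psi> (at x) (axis j 1) *\<^sub>R (u' (t, x) $ j) \<partial>lborel)"
          by (rule Bochner_Integration.integral_sum) (use elim(2) in auto)
        also have "\<dots> = (\<Sum>j\<in>UNIV. - (\<integral>x. \<psi> x *\<^sub>R D' j (t, x) \<partial>lborel))"
          using elim(1) tT by simp
        also have "\<dots> = - (\<integral>x. (\<Sum>j\<in>UNIV. \<psi> x *\<^sub>R D' j (t, x)) \<partial>lborel)"
          unfolding sum_negf using elim(3) by (subst Bochner_Integration.integral_sum) auto
        also have "(\<integral>x. (\<Sum>j\<in>UNIV. \<psi> x *\<^sub>R D' j (t, x)) \<partial>lborel) = 0"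
        proof (rule integral_eq_zero_AE)
          show "AE x in lborel. (\<Sum>j\<in>UNIV. \<psi> x *\<^sub>R D' j (t, x)) = 0"
            using elim(4) by eventually_elim (simp flip: sum_distrib_left)
        qed
        finally show "(\<integral>x. u (t, x) \<bullet> test_grad \<psi> x \<partial>?M) = 0" by simp
      qed
    qed
  qed
  show ?thesis
  \<comment> \<open>At almost every time the slice is in \<open>H10\<close> and divergence free, so
    integration by parts applies; continuity reaches the remaining times.\<close>
  proof (rule C_L2_inner_eq_0[OF T uC H1_weak_grad(2)[OF \<phi>] _ t])
    show "AE t in lborel. t \<in> {0<..<T} \<longrightarrow> (\<integral>x. u (t, x) \<bullet> weak_grad \<Omega> \<phi> x \<partial>?M) = 0"
      using uH[unfolded AE_lebesgue_on_open_iff[OF open_greaterThanLessThan]]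
    proof eventually_elim
      case (elim t)
      show ?case
      proof
        assume tT: "t \<in> {0<..<T}"
        then have h: "curry u t \<in> H10 \<Omega>" using elim by simp
        then have "curry u t \<in> H1 \<Omega>" by (simp add: H10_def)
        then have "AE x in ?M. weak_div \<Omega> (curry u t) x = 0"
          by (rule weak_div_eq_0_if_test[OF U]) (use test0 tT in auto)
        then have "(\<integral>x. weak_div \<Omega> (curry u t) x * \<phi> x \<partial>?M) = 0"
          by (intro integral_eq_zero_AE) (auto elim!: eventually_mono)
        then show "(\<integral>x. u (t, x) \<bullet> weak_grad \<Omega> \<phi> x \<partial>?M) = 0"
          using H10_integral_by_parts[OF U h \<phi>] by simp
      qed
    qed
  qed
qed

subsection \<open>Consistency of the time averages\<close>

definition primitive :: "(real \<Rightarrow> 'b::euclidean_space) \<Rightarrow> real \<Rightarrow> 'b" where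
  "primitive f s = (\<integral>r. (if 0 \<le> r \<and> r \<le> s then f r else 0) \<partial>lborel)"

lemma time_integral_primitive: "time_integral g t x = primitive (\<lambda>r. g (r, x)) t"
  by (simp add: time_integral_def primitive_def)

lemma primitive_diff:
  fixes f :: "real \<Rightarrow> 'b::euclidean_space"
  assumes "integrable lborel f" "0 \<le> s" "s \<le> t"
  shows "primitive f t - primitive f s = (\<integral>r. (if s \<le> r \<and> r \<le> t then f r else 0) \<partial>lborel)"
  using time_integral_diff[of "\<lambda>z. f (fst z)" "0::real" s t] assms
  by (simp add: time_integral_primitive cong: if_cong)

text \<open>The bound is the same for all s and t in the window {p..q}, so that it can be taken out
  of averages over the window.\<close>

lemma primitive_increment_le:
  fixes f :: "real \<Rightarrow> 'b::euclidean_space"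
  assumes f: "integrable lborel f" and st: "0 \<le> s" "0 \<le> t" "p \<le> s" "s \<le> q" "p \<le> t" "t \<le> q"
  shows "norm (primitive f t - primitive f s) \<le> (\<integral>r. (if p \<le> r \<and> r \<le> q then norm (f r) else 0) \<partial>lborel)"
proof -
  have main: "norm (primitive f b - primitive f a) \<le> (\<integral>r. (if p \<le> r \<and> r \<le> q then norm (f r) else 0) \<partial>lborel)"
    if ab: "0 \<le> a" "a \<le> b" "p \<le> a" "b \<le> q" for a b
  proof -
    have "norm (primitive f b - primitive f a) \<le> (\<integral>r. norm (if a \<le> r \<and> r \<le> b then f r else 0) \<partial>lborel)"
      unfolding primitive_diff[OF f ab(1,2)] by (rule integral_norm_bound)
    also have "\<dots> \<le> (\<integral>r. (if p \<le> r \<and> r \<le> q then norm (f r) else 0) \<partial>lborel)"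
      by (intro integral_mono integrable_norm integrable_slice_interval f) (use ab in auto)
    finally show ?thesis .
  qed
  show ?thesis
    using main[of s t] main[of t s] st by (cases "s \<le> t") (auto simp: norm_minus_commute)
qed

lemma norm_interval_integral_le:
  fixes \<gamma> :: "real \<Rightarrow> 'b::euclidean_space"
  assumes ae: "AE s in lborel. a < s \<and> s < b \<longrightarrow> norm (\<gamma> s) \<le> C" and C: "0 \<le> C" and ab: "a \<le> b"
  shows "norm (\<integral>s. (if a < s \<and> s < b then \<gamma> s else 0) \<partial>lborel) \<le> (b - a) * C"
proof -
  have i: "integrable lborel (\<lambda>s. C * indicator {a<..<b} s)"
    by (intro integrable_mult_right integrable_real_indicator) (use emeasure_bounded_finite[of "{a<..<b}"] in auto)
  have "norm (\<integral>s. (if a < s \<and> s < b then \<gamma> s else 0) \<partial>lborel) \<le> (\<integral>s. C * indicator {a<..<b} s \<partial>lborel)"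
  proof (cases "integrable lborel (\<lambda>s. if a < s \<and> s < b then \<gamma> s else 0)")
    case True
    have "norm (\<integral>s. (if a < s \<and> s < b then \<gamma> s else 0) \<partial>lborel) \<le> (\<integral>s. norm (if a < s \<and> s < b then \<gamma> s else 0) \<partial>lborel)"
      by (rule integral_norm_bound)
    also have "\<dots> \<le> (\<integral>s. C * indicator {a<..<b} s \<partial>lborel)"
      by (rule integral_mono_AE[OF integrable_norm[OF True] i]) (use ae in \<open>auto elim!: eventually_mono simp: indicator_def\<close>)
    finally show ?thesis .
  next
    \<comment> \<open>A function that is not integrable has integral 0 by convention.\<close>
    case False
    then show ?thesis using C by (simp add: not_integrable_integral_eq ab)
  qed
  also have "\<dots> = (b - a) * C" using ab by simp
  finally show ?thesis .
qed

lemma interval_open_closed_integral: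
  fixes \<gamma> :: "real \<Rightarrow> 'b::euclidean_space"
  assumes "integrable lborel \<gamma>"
  shows "(\<integral>s. (if a \<le> s \<and> s \<le> b then \<gamma> s else 0) \<partial>lborel) = (\<integral>s. (if a < s \<and> s < b then \<gamma> s else 0) \<partial>lborel)"
proof (rule integral_cong_AE)
  show "AE s in lborel. (if a \<le> s \<and> s \<le> b then \<gamma> s else 0) = (if a < s \<and> s < b then \<gamma> s else 0)"
    using AE_lborel_singleton[of a] AE_lborel_singleton[of b] by eventually_elim auto
qed (use assms in measurable)

lemma integrable_open_interval:
  fixes \<gamma> :: "real \<Rightarrow> 'b::euclidean_space"
  assumes "integrable lborel \<gamma>"
  shows "integrable lborel (\<lambda>r. if a < r \<and> r < b then \<gamma> r else 0)"
proof -
  have "integrable lborel (\<lambda>r. indicator {a<..<b} r *\<^sub>R \<gamma> r)"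
    by (rule integrable_mult_indicator) (use assms in auto)
  also have "(\<lambda>r. indicator {a<..<b} r *\<^sub>R \<gamma> r) = (\<lambda>r. if a < r \<and> r < b then \<gamma> r else 0)"
    by (auto simp: indicator_def)
  finally show ?thesis .
qed

text \<open>At a fixed point \<open>x\<close>, \<open>R, D, Dtt\<close> stand for
  \<open>\<rho>, \<partial>\<^sub>t\<rho>, \<partial>\<^sub>t\<^sub>t\<rho>\<close>, \<open>V, Vt\<close> for \<open>u, \<partial>\<^sub>tu\<close>, and \<open>G\<close> for \<open>\<nabla>\<rho>\<close>. The difference of
  the averages is the average over \<open>s\<close> of
  \<open>R s - R (s - \<delta>) \<approx> \<delta> D s = - \<delta> (V s \<bullet> G s)\<close>.\<close>

lemma consistency_pointwise:
  fixes R D Dtt :: "real \<Rightarrow> real" and V Vt G :: "real \<Rightarrow> real^3"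
  assumes \<delta>: "0 < \<delta>" "\<delta> \<le> a" and D: "integrable lborel D" and Dtt: "integrable lborel Dtt" and Vt: "integrable lborel Vt"
    and R: "integrable lborel R" and G: "integrable lborel G" and GM: "\<And>s. norm (G s) \<le> M"
    and ae: "AE s in lborel. a - \<delta> < s \<and> s < a + \<delta> \<longrightarrow> R s = c + primitive D s \<and> D s = cD + primitive Dtt s
       \<and> D s = - (V s \<bullet> G s) \<and> V s = cV + primitive Vt s"
  shows "\<bar>(1 / \<delta>) * (\<integral>s. (if a < s \<and> s < a + \<delta> then R s else 0) \<partial>lborel)
      - (1 / \<delta>) * (\<integral>s. (if a - \<delta> < s \<and> s < a then R s else 0) \<partial>lborel)
      + \<delta> * (w \<bullet> ((1 / \<delta>) *\<^sub>R (\<integral>s. (if a < s \<and> s < a + \<delta> then G s else 0) \<partial>lborel)))\<bar>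
    \<le> \<delta> * (M * norm (w - (cV + primitive Vt a)))
      + \<delta> * (\<integral>r. (if a - \<delta> \<le> r \<and> r \<le> a + \<delta> then \<bar>Dtt r\<bar> + M * norm (Vt r) else 0) \<partial>lborel)"
proof -
  define va where "va = cV + primitive Vt a"
  define A1 where "A1 = (\<integral>r. (if a - \<delta> \<le> r \<and> r \<le> a + \<delta> then norm (Dtt r) else 0) \<partial>lborel)"
  define A2 where "A2 = (\<integral>r. (if a - \<delta> \<le> r \<and> r \<le> a + \<delta> then norm (Vt r) else 0) \<partial>lborel)"
  have A0: "0 \<le> A1" "0 \<le> A2" unfolding A1_def A2_def by (auto intro!: integral_nonneg_AE)
  have M0: "0 \<le> M" using GM[of 0] norm_ge_zero order_trans by blast
  have A: "(\<integral>r. (if a - \<delta> \<le> r \<and> r \<le> a + \<delta> then \<bar>Dtt r\<bar> + M * norm (Vt r) else 0) \<partial>lborel) = A1 + M * A2"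
  proof -
    have "(\<integral>r. (if a - \<delta> \<le> r \<and> r \<le> a + \<delta> then \<bar>Dtt r\<bar> + M * norm (Vt r) else 0) \<partial>lborel) =
       (\<integral>r. (if a - \<delta> \<le> r \<and> r \<le> a + \<delta> then norm (Dtt r) else 0) + M * (if a - \<delta> \<le> r \<and> r \<le> a + \<delta> then norm (Vt r) else 0) \<partial>lborel)"
      by (rule Bochner_Integration.integral_cong) auto
    also have "\<dots> = A1 + M * A2"
      unfolding A1_def A2_def
      by (subst Bochner_Integration.integral_add) (auto intro!: integrable_mult_right integrable_slice_interval integrable_norm Dtt Vt)
    finally show ?thesis .
  qed
  define E where "E s = R s - R (s + - \<delta>) + \<delta> * (w \<bullet> G s)" for s
  have Rtr: "integrable lborel (\<lambda>s. R (s + - \<delta>))"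
    using R by (subst lborel_integral_translate(2)) auto
  have i: "integrable lborel (\<lambda>s. if a < s \<and> s < a + \<delta> then R s else 0)"
    "integrable lborel (\<lambda>s. if a < s \<and> s < a + \<delta> then R (s + - \<delta>) else 0)"
    "integrable lborel (\<lambda>s. if a < s \<and> s < a + \<delta> then w \<bullet> G s else 0)"
    by (intro integrable_open_interval R Rtr integrable_inner_right G)+
  \<comment> \<open>Shifting the earlier average by \<delta> brings both averages onto the same
    interval.\<close>
  have "(\<integral>s. (if a - \<delta> < s \<and> s < a then R s else 0) \<partial>lborel) = (\<integral>s. (\<lambda>r. if a - \<delta> < r \<and> r < a then R r else 0) (s + - \<delta>) \<partial>lborel)"
    by (rule lborel_integral_translate(1)[symmetric]) (use integrable_open_interval[OF R] in auto)
  also have "\<dots> = (\<integral>s. (if a < s \<and> s < a + \<delta> then R (s + - \<delta>) else 0) \<partial>lborel)"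
    by (rule Bochner_Integration.integral_cong) auto
  finally have sh: "(\<integral>s. (if a - \<delta> < s \<and> s < a then R s else 0) \<partial>lborel) = (\<integral>s. (if a < s \<and> s < a + \<delta> then R (s + - \<delta>) else 0) \<partial>lborel)" .
  have gi: "w \<bullet> (\<integral>s. (if a < s \<and> s < a + \<delta> then G s else 0) \<partial>lborel) = (\<integral>s. (if a < s \<and> s < a + \<delta> then w \<bullet> G s else 0) \<partial>lborel)"
    by (subst integral_inner_right[symmetric]) (auto intro!: integrable_open_interval G Bochner_Integration.integral_cong)
  have "(\<integral>s. (if a < s \<and> s < a + \<delta> then E s else 0) \<partial>lborel) =
     (\<integral>s. (if a < s \<and> s < a + \<delta> then R s else 0) - (if a < s \<and> s < a + \<delta> then R (s + - \<delta>) else 0)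
        + \<delta> * (if a < s \<and> s < a + \<delta> then w \<bullet> G s else 0) \<partial>lborel)"
    by (rule Bochner_Integration.integral_cong) (auto simp: E_def)
  also have "\<dots> = (\<integral>s. (if a < s \<and> s < a + \<delta> then R s else 0) \<partial>lborel) - (\<integral>s. (if a < s \<and> s < a + \<delta> then R (s + - \<delta>) else 0) \<partial>lborel)
        + \<delta> * (\<integral>s. (if a < s \<and> s < a + \<delta> then w \<bullet> G s else 0) \<partial>lborel)"
    using i by simp
  finally have tot: "(1 / \<delta>) * (\<integral>s. (if a < s \<and> s < a + \<delta> then R s else 0) \<partial>lborel)
      - (1 / \<delta>) * (\<integral>s. (if a - \<delta> < s \<and> s < a then R s else 0) \<partial>lborel)
      + \<delta> * (w \<bullet> ((1 / \<delta>) *\<^sub>R (\<integral>s. (if a < s \<and> s < a + \<delta> then G s else 0) \<partial>lborel)))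
    = (1 / \<delta>) * (\<integral>s. (if a < s \<and> s < a + \<delta> then E s else 0) \<partial>lborel)"
    unfolding inner_scaleR_right gi sh using \<delta> by (simp add: field_simps)
  have "AE s in lborel. a < s \<and> s < a + \<delta> \<longrightarrow> norm (E s) \<le> \<delta> * (M * norm (w - va) + (A1 + M * A2))"
    \<comment> \<open>The increment of R needs the representation at s and at s - \<delta>.\<close>
    using ae AE_lborel_translate[OF ae, of "- \<delta>"]
  proof eventually_elim
    case (elim s)
    show ?case
    proof
      assume s: "a < s \<and> s < a + \<delta>"
      have Rs: "R s = c + primitive D s" "D s = cD + primitive Dtt s" "D s = - (V s \<bullet> G s)" "V s = cV + primitive Vt s"
        using elim(1) s \<delta> by auto
      have Rs': "R (s + - \<delta>) = c + primitive D (s - \<delta>)" using elim(2) s \<delta> by auto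
      have dR: "R s - R (s + - \<delta>) = (\<integral>r. (if s - \<delta> < r \<and> r < s then D r else 0) \<partial>lborel)"
        unfolding Rs Rs' using primitive_diff[OF D, of "s - \<delta>" s] s \<delta>
        by (simp add: interval_open_closed_integral[OF D])
      have const: "(\<integral>r. (if s - \<delta> < r \<and> r < s then D s else 0) \<partial>lborel) = \<delta> * D s"
      proof -
        have "(\<integral>r. (if s - \<delta> < r \<and> r < s then D s else 0) \<partial>lborel) = (\<integral>r. indicator {s - \<delta><..<s} r *\<^sub>R D s \<partial>lborel)"
          by (rule Bochner_Integration.integral_cong) (auto simp: indicator_def)
        then show ?thesis using \<delta> by simp
      qed
      have ic: "integrable lborel (\<lambda>r. if s - \<delta> < r \<and> r < s then D s else 0)"
      proof -
        have "integrable lborel (\<lambda>r. indicator {s - \<delta><..<s} r *\<^sub>R D s)"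
          by (intro integrable_scaleR_left integrable_real_indicator) (use emeasure_bounded_finite[of "{s - \<delta><..<s}"] in auto)
        also have "(\<lambda>r. indicator {s - \<delta><..<s} r *\<^sub>R D s) = (\<lambda>r. if s - \<delta> < r \<and> r < s then D s else 0)"
          by (auto simp: indicator_def)
        finally show ?thesis .
      qed
      \<comment> \<open>Rectangle rule: D s replaces D r under the integral, at the price of one
        integral of Dtt over the window.\<close>
      have "R s - R (s + - \<delta>) - \<delta> * D s = (\<integral>r. (if s - \<delta> < r \<and> r < s then D r else 0) - (if s - \<delta> < r \<and> r < s then D s else 0) \<partial>lborel)"
        unfolding dR const[symmetric]
        by (rule Bochner_Integration.integral_diff[symmetric]) (intro integrable_open_interval D ic)+
      also have "\<dots> = (\<integral>r. (if s - \<delta> < r \<and> r < s then D r - D s else 0) \<partial>lborel)"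
        by (rule Bochner_Integration.integral_cong) auto
      finally have "norm (R s - R (s + - \<delta>) - \<delta> * D s) = norm (\<integral>r. (if s - \<delta> < r \<and> r < s then D r - D s else 0) \<partial>lborel)" by simp
      also have "\<dots> \<le> (s - (s - \<delta>)) * A1"
      proof (rule norm_interval_integral_le[OF _ A0(1)])
        show "AE r in lborel. s - \<delta> < r \<and> r < s \<longrightarrow> norm (D r - D s) \<le> A1"
          using ae
        proof eventually_elim
          case (elim r)
          show ?case
          proof
            assume r: "s - \<delta> < r \<and> r < s"
            then have "D r = cD + primitive Dtt r" using elim s \<delta> by auto
            then have "norm (D r - D s) = norm (primitive Dtt r - primitive Dtt s)" using Rs by simp
            also have "\<dots> \<le> A1"
              unfolding A1_def by (rule primitive_increment_le[OF Dtt]) (use r s \<delta> in auto)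
            finally show "norm (D r - D s) \<le> A1" .
          qed
        qed
      qed (use \<delta> in auto)
      finally have 1: "\<bar>R s - R (s + - \<delta>) - \<delta> * D s\<bar> \<le> \<delta> * A1" by simp
      have "norm (V s - va) = norm (primitive Vt s - primitive Vt a)" by (simp add: Rs va_def)
      also have "\<dots> \<le> A2" unfolding A2_def by (rule primitive_increment_le[OF Vt]) (use s \<delta> in auto)
      finally have 2: "norm (V s - va) \<le> A2" .
      \<comment> \<open>The transport equation turns the sum into the velocity difference w - V s
        paired with G s, which is bounded by M; V s is then compared with the velocity at time
        a.\<close>
      have "\<bar>D s + w \<bullet> G s\<bar> = \<bar>(w - V s) \<bullet> G s\<bar>" by (simp add: Rs(3) inner_diff_left)
      also have "\<dots> \<le> norm (w - V s) * norm (G s)" by (rule Cauchy_Schwarz_ineq2)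
      also have "\<dots> \<le> (norm (w - va) + A2) * M"
      proof (rule mult_mono[OF _ GM])
        show "norm (w - V s) \<le> norm (w - va) + A2"
          using norm_triangle_ineq4[of "w - va" "V s - va"] 2 by (simp add: algebra_simps)
      qed (use A0 in auto)
      finally have 3: "\<bar>D s + w \<bullet> G s\<bar> \<le> M * norm (w - va) + M * A2" by (simp add: algebra_simps)
      have "E s = (R s - R (s + - \<delta>) - \<delta> * D s) + \<delta> * (D s + w \<bullet> G s)" by (simp add: E_def algebra_simps)
      then have "norm (E s) \<le> \<bar>R s - R (s + - \<delta>) - \<delta> * D s\<bar> + \<bar>\<delta> * (D s + w \<bullet> G s)\<bar>" by simp
      also have "\<dots> \<le> \<delta> * A1 + \<delta> * (M * norm (w - va) + M * A2)"
        unfolding abs_mult using 1 3 \<delta> by (intro add_mono mult_mono) auto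
      finally show "norm (E s) \<le> \<delta> * (M * norm (w - va) + (A1 + M * A2))" by (simp add: algebra_simps)
    qed
  qed
  then have "norm (\<integral>s. (if a < s \<and> s < a + \<delta> then E s else 0) \<partial>lborel) \<le> (a + \<delta> - a) * (\<delta> * (M * norm (w - va) + (A1 + M * A2)))"
    by (rule norm_interval_integral_le) (use \<delta> A0 M0 in auto)
  then have "(1 / \<delta>) * norm (\<integral>s. (if a < s \<and> s < a + \<delta> then E s else 0) \<partial>lborel) \<le> (1 / \<delta>) * (\<delta> * (\<delta> * (M * norm (w - va) + (A1 + M * A2))))"
    using \<delta> by (intro mult_left_mono) auto
  then show ?thesis
    unfolding tot A va_def[symmetric] using \<delta> by (simp add: abs_mult algebra_simps)
qed

text \<open>Fubini's theorem in the other order, by way of a Borel null set that covers the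
  exceptional set.\<close>

lemma AE_slices_snd:
  assumes "AE z in (lborel :: ('a::euclidean_space \<times> 'b::euclidean_space) measure). P z"
  shows "AE x in lborel. AE t in lborel. P (t, x)"
proof -
  obtain N where N: "N \<in> null_sets lborel" "{z. \<not> P z} \<subseteq> N"
    using assms by (auto simp: eventually_ae_filter)
  have "N \<in> sets borel" using N(1) by (auto simp: null_sets_def)
  then have [measurable]: "N \<in> sets (borel \<Otimes>\<^sub>M borel)" by (subst borel_prod)
  have "AE t in lborel. AE x in lborel. (t, x) \<notin> N"
    by (rule AE_slices) (rule AE_not_in[OF N(1)])
  then have "AE x in lborel. AE t in lborel. (t, x) \<notin> N"
    by (subst (asm) AE_lborel_commute) auto
  then show ?thesis
    by (elim eventually_mono) (use N(2) in auto)
qed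

lemma AE_pair_eqI:
  fixes f h :: "'a::euclidean_space \<times> 'b::euclidean_space \<Rightarrow> 'c::euclidean_space"
  assumes [measurable]: "f \<in> borel_measurable borel" "h \<in> borel_measurable borel" "A \<in> sets borel"
    and ae: "AE t in lborel. AE x in lborel. (t, x) \<in> A \<longrightarrow> f (t, x) = h (t, x)"
  shows "AE z in lborel. z \<in> A \<longrightarrow> f z = h z"
proof -
  have "AE z in lborel \<Otimes>\<^sub>M lborel. z \<in> A \<longrightarrow> f z = h z"
  proof (rule lborel_pair.AE_pair_measure[OF _ ae])
    have "Measurable.pred borel (\<lambda>z. z \<in> A \<longrightarrow> f z = h z)" by measurable
    then show "{z \<in> space (lborel \<Otimes>\<^sub>M lborel). z \<in> A \<longrightarrow> f z = h z} \<in> sets (lborel \<Otimes>\<^sub>M lborel)"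
      unfolding lborel_prod by (simp add: pred_def)
  qed
  then show ?thesis by (simp only: lborel_prod)
qed

lemma L1_weak_deriv_cmult:
  fixes f g :: "'a::euclidean_space \<Rightarrow> real"
  assumes "L1_weak_deriv U v f g" shows "L1_weak_deriv U v (\<lambda>x. c * f x) (\<lambda>x. c * g x)"
  using assms unfolding L1_weak_deriv_def by (simp add: mult.left_commute[of _ c])

section \<open>Averages in time\<close>

definition slab_integral :: "(real \<times> 'a \<Rightarrow> 'b::euclidean_space) \<Rightarrow> real \<Rightarrow> real \<Rightarrow> 'a \<Rightarrow> 'b" where
  "slab_integral f a b x = (\<integral>s. (if a < s \<and> s < b then f (s, x) else 0) \<partial>lborel)"

lemma slab_integral_measurable:
  fixes f :: "real \<times> 'a::euclidean_space \<Rightarrow> 'b::euclidean_space"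
  assumes "f \<in> borel_measurable borel" shows "slab_integral f a b \<in> borel_measurable borel"
proof -
  have [measurable]: "f \<in> borel_measurable (borel \<Otimes>\<^sub>M borel)" using assms by (simp add: borel_prod)
  show ?thesis unfolding slab_integral_def[abs_def] by measurable
qed

lemma slab_integrable_pair:
  fixes f :: "real \<times> 'a::euclidean_space \<Rightarrow> 'b::euclidean_space"
  assumes f: "integrable lborel f"
  shows "integrable (lborel \<Otimes>\<^sub>M lborel) (\<lambda>(s, x). if a < s \<and> s < b then f (s, x) else 0)"
proof -
  have f': "integrable (lborel \<Otimes>\<^sub>M lborel) f" using f by (simp add: lborel_prod)
  note [measurable] = borel_measurable_integrable[OF f']
  show ?thesis
    by (rule Bochner_Integration.integrable_bound[OF f']) (auto simp: split_beta', measurable)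
qed

lemma slab_integral_integrable:
  fixes f :: "real \<times> 'a::euclidean_space \<Rightarrow> 'b::euclidean_space"
  assumes f: "integrable lborel f"
  shows "integrable lborel (slab_integral f a b)"
  using lborel_pair.integrable_snd[OF slab_integrable_pair[OF f]] by (simp add: slab_integral_def[abs_def])

lemma integral_test_slab_integral:
  fixes f :: "real \<times> 'a::euclidean_space \<Rightarrow> 'b::euclidean_space" and \<phi> :: "'a \<Rightarrow> real"
  assumes f: "integrable lborel f" and \<phi>: "\<phi> \<in> test_functions V"
  shows "(\<integral>x. \<phi> x *\<^sub>R slab_integral f a b x \<partial>lborel) =
    (\<integral>s. (if a < s \<and> s < b then (\<integral>x. \<phi> x *\<^sub>R f (s, x) \<partial>lborel) else 0) \<partial>lborel)"
proof -
  have "integrable lborel (\<lambda>z. \<phi> (snd z) *\<^sub>R f z)"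
    using test_times_slice_integrable[OF f \<phi>] by (simp add: lborel_prod split_beta')
  note i = slab_integrable_pair[OF this, of a b]
  have "(\<integral>x. \<phi> x *\<^sub>R slab_integral f a b x \<partial>lborel) = (\<integral>x. \<integral>s. (if a < s \<and> s < b then \<phi> x *\<^sub>R f (s, x) else 0) \<partial>lborel \<partial>lborel)"
    unfolding slab_integral_def integral_scaleR_right[symmetric]
    by (intro Bochner_Integration.integral_cong) auto
  also have "\<dots> = (\<integral>s. \<integral>x. (if a < s \<and> s < b then \<phi> x *\<^sub>R f (s, x) else 0) \<partial>lborel \<partial>lborel)"
    using lborel_pair.Fubini_integral[of "\<lambda>s x. if a < s \<and> s < b then \<phi> x *\<^sub>R f (s, x) else 0"] i
    by (simp cong: if_cong)
  also have "\<dots> = (\<integral>s. (if a < s \<and> s < b then (\<integral>x. \<phi> x *\<^sub>R f (s, x) \<partial>lborel) else 0) \<partial>lborel)"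
    by (intro Bochner_Integration.integral_cong) auto
  finally show ?thesis .
qed

text \<open>The slice identity holds for almost every time and is integrated in time, one test
  function after the other. This gives the averages the spatial regularity that is not at hand at a
  single time.\<close>

lemma L1_weak_deriv_slab_integral:
  fixes f g :: "real \<times> (real^3) \<Rightarrow> 'b::euclidean_space"
  assumes wd: "L1_weak_deriv (cyl T \<Omega>) (0, v) f g" and ab: "0 \<le> a" "b \<le> T"
  shows "L1_weak_deriv \<Omega> v (slab_integral f a b) (slab_integral g a b)"
  unfolding L1_weak_deriv_def
proof (intro conjI ballI allI impI)
  have f: "integrable lborel f" and g: "integrable lborel g" and out: "\<And>z. z \<notin> cyl T \<Omega> \<Longrightarrow> f z = 0 \<and> g z = 0"
    using wd by (auto simp: L1_weak_deriv_def)
  show "integrable lborel (slab_integral f a b)" "integrable lborel (slab_integral g a b)"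
    by (intro slab_integral_integrable f g)+
  show "slab_integral f a b x = 0" "slab_integral g a b x = 0" if "x \<notin> \<Omega>" for x
    using out that by (simp_all add: slab_integral_def cyl_def cong: if_cong)
  fix \<phi> :: "real^3 \<Rightarrow> real" assume \<phi>: "\<phi> \<in> test_functions \<Omega>"
  have "(\<integral>x. frechet_derivative \<phi> (at x) v *\<^sub>R slab_integral f a b x \<partial>lborel) =
     (\<integral>s. (if a < s \<and> s < b then (\<integral>x. frechet_derivative \<phi> (at x) v *\<^sub>R f (s, x) \<partial>lborel) else 0) \<partial>lborel)"
    by (rule integral_test_slab_integral[OF f test_functions_deriv[OF \<phi>]])
  also have "\<dots> = (\<integral>s. - (if a < s \<and> s < b then (\<integral>x. \<phi> x *\<^sub>R g (s, x) \<partial>lborel) else 0) \<partial>lborel)"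
  proof (rule integral_cong_AE)
    have "integrable lborel (\<lambda>s. \<integral>x. frechet_derivative \<phi> (at x) v *\<^sub>R f (s, x) \<partial>lborel)"
      "integrable lborel (\<lambda>s. \<integral>x. \<phi> x *\<^sub>R g (s, x) \<partial>lborel)"
      using lborel_pair.integrable_fst[OF test_times_slice_integrable[OF f test_functions_deriv[OF \<phi>]]]
        lborel_pair.integrable_fst[OF test_times_slice_integrable[OF g \<phi>]] by simp_all
    then show "(\<lambda>s. if a < s \<and> s < b then (\<integral>x. frechet_derivative \<phi> (at x) v *\<^sub>R f (s, x) \<partial>lborel) else 0) \<in> borel_measurable lborel"
      "(\<lambda>s. - (if a < s \<and> s < b then (\<integral>x. \<phi> x *\<^sub>R g (s, x) \<partial>lborel) else 0)) \<in> borel_measurable lborel"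
      by (auto dest!: borel_measurable_integrable)
    show "AE s in lborel. (if a < s \<and> s < b then (\<integral>x. frechet_derivative \<phi> (at x) v *\<^sub>R f (s, x) \<partial>lborel) else 0) =
        - (if a < s \<and> s < b then (\<integral>x. \<phi> x *\<^sub>R g (s, x) \<partial>lborel) else 0)"
      using L1_weak_deriv_slice[OF wd \<phi>] by eventually_elim (use ab in auto)
  qed
  also have "\<dots> = - (\<integral>x. \<phi> x *\<^sub>R slab_integral g a b x \<partial>lborel)"
    by (simp add: integral_test_slab_integral[OF g \<phi>])
  finally show "(\<integral>x. frechet_derivative \<phi> (at x) v *\<^sub>R slab_integral f a b x \<partial>lborel) = - (\<integral>x. \<phi> x *\<^sub>R slab_integral g a b x \<partial>lborel)" .
qed

lemma primitive_Lipschitz: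
  fixes f :: "real \<Rightarrow> 'b::euclidean_space"
  assumes f: "integrable lborel f" and K: "\<And>r. norm (f r) \<le> K" and st: "0 \<le> s" "s \<le> t"
  shows "norm (primitive f t - primitive f s) \<le> (t - s) * K"
proof -
  have "0 \<le> K" using K[of 0] norm_ge_zero[of "f 0"] by linarith
  then show ?thesis
    unfolding primitive_diff[OF f st] interval_open_closed_integral[OF f]
    by (intro norm_interval_integral_le AE_I2 impI K st)
qed

definition time_average :: "(real \<times> (real^3) \<Rightarrow> 'b::euclidean_space) \<Rightarrow> real \<Rightarrow> real \<Rightarrow> real^3 \<Rightarrow> 'b" where
  "time_average f \<delta> a x = (1 / \<delta>) *\<^sub>R slab_integral f a (a + \<delta>) x"

lemma time_average_close:
  fixes f :: "real \<times> (real^3) \<Rightarrow> 'b::euclidean_space"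
  assumes i: "integrable lborel (\<lambda>s. f (s, x))" and \<delta>: "0 < \<delta>" and C: "0 \<le> C"
    and ae: "AE s in lborel. a < s \<and> s < a + \<delta> \<longrightarrow> norm (f (s, x) - A) \<le> C"
  shows "norm (time_average f \<delta> a x - A) \<le> C"
proof -
  have ic: "integrable lborel (\<lambda>r. indicator {a<..<a + \<delta>} r *\<^sub>R A)"
    by (intro integrable_scaleR_left integrable_real_indicator) (use emeasure_bounded_finite[of "{a<..<a + \<delta>}"] in auto)
  have eq: "(\<lambda>r. indicator {a<..<a + \<delta>} r *\<^sub>R A) = (\<lambda>r. if a < r \<and> r < a + \<delta> then A else 0)"
    by (auto simp: indicator_def)
  have "(\<integral>s. (if a < s \<and> s < a + \<delta> then f (s, x) - A else 0) \<partial>lborel) =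
     (\<integral>s. (if a < s \<and> s < a + \<delta> then f (s, x) else 0) - indicator {a<..<a + \<delta>} s *\<^sub>R A \<partial>lborel)"
    by (rule Bochner_Integration.integral_cong) (auto simp: indicator_def)
  also have "\<dots> = slab_integral f a (a + \<delta>) x - \<delta> *\<^sub>R A"
    unfolding slab_integral_def using integrable_open_interval[OF i, of a "a + \<delta>"] ic \<delta>
    by (subst Bochner_Integration.integral_diff) auto
  finally have "(1 / \<delta>) *\<^sub>R (\<integral>s. (if a < s \<and> s < a + \<delta> then f (s, x) - A else 0) \<partial>lborel) = time_average f \<delta> a x - A"
    using \<delta> by (simp add: time_average_def scaleR_diff_right)
  then have "norm (time_average f \<delta> a x - A) = norm ((1 / \<delta>) *\<^sub>R (\<integral>s. (if a < s \<and> s < a + \<delta> then f (s, x) - A else 0) \<partial>lborel))"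
    by (rule arg_cong[OF sym])
  also have "\<dots> = (1 / \<delta>) * norm (\<integral>s. (if a < s \<and> s < a + \<delta> then f (s, x) - A else 0) \<partial>lborel)"
    unfolding norm_scaleR using \<delta> by simp
  also have "\<dots> \<le> (1 / \<delta>) * ((a + \<delta> - a) * C)"
    by (intro mult_left_mono norm_interval_integral_le[OF ae C]) (use \<delta> in auto)
  finally show ?thesis using \<delta> by simp
qed

lemma representative_integrable:
  fixes f :: "'a::euclidean_space \<Rightarrow> 'b::euclidean_space"
  assumes "open U" "representative U f f'" "integrable (lebesgue_on U) f"
  shows "integrable lborel f'"
  using representative_integral(2)[OF assms(1,2) borel_measurable_integrable[OF assms(3)]] assms(3) by simp

lemma representative_square_integrable:
  fixes f :: "'a::euclidean_space \<Rightarrow> 'b::euclidean_space"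
  assumes U: "open U" and r: "representative U f f'" and f: "f \<in> Lp_space 2 (lebesgue_on U)"
  shows "integrable lborel (\<lambda>x. (norm (f' x))\<^sup>2)"
proof (rule representative_integrable[OF U])
  show "representative U (\<lambda>z. (norm (f z))\<^sup>2) (\<lambda>z. (norm (f' z))\<^sup>2)"
    unfolding representative_def
  proof (intro conjI)
    show "AE x in lborel. x \<in> U \<longrightarrow> (norm (f' x))\<^sup>2 = (norm (f x))\<^sup>2"
      using representative_AE[OF r] by eventually_elim simp
  qed (use r in \<open>auto simp: representative_def\<close>)
qed (use f in \<open>simp add: Lp_space_2_iff\<close>)

text \<open>At a fixed x everything becomes calculus in the one variable s; hence the order of
  quantifiers, opposite to \<open>L1_weak_deriv_time_primitive\<close>. The same c serves the
  representative k that is continuous in time, at every single t.\<close>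

lemma L1_weak_deriv_time_primitive_snd:
  fixes f g :: "real \<times> (real^3) \<Rightarrow> 'b::euclidean_space"
  assumes U: "open \<Omega>" "bounded \<Omega>" and T: "0 < T" and wd: "L1_weak_deriv (cyl T \<Omega>) (1, 0) f g"
  obtains c where
    "AE x in lborel. AE s in lborel. s \<in> {0<..<T} \<longrightarrow> x \<in> \<Omega> \<longrightarrow> f (s, x) = c x + primitive (\<lambda>r. g (r, x)) s"
    "\<And>k t. k \<in> C_L2 T \<Omega> \<Longrightarrow> representative (cyl T \<Omega>) k f \<Longrightarrow> 0 \<le> t \<Longrightarrow> t \<le> T \<Longrightarrow>
       AE x in lborel. x \<in> \<Omega> \<longrightarrow> k (t, x) = c x + primitive (\<lambda>r. g (r, x)) t"
proof -
  obtain c where [measurable]: "c \<in> borel_measurable borel"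
    and ae: "AE t in lborel. AE x in lborel. t \<in> {0<..<T} \<longrightarrow> x \<in> \<Omega> \<longrightarrow> f (t, x) = c x + time_integral g t x"
    using L1_weak_deriv_time_primitive[OF U(1) T wd] by blast
  have f: "integrable lborel f" and g: "integrable lborel g" using wd by (auto simp: L1_weak_deriv_def)
  then have [measurable]: "f \<in> borel_measurable borel" "g \<in> borel_measurable borel" by auto
  have "(\<lambda>z. c (snd z) + time_integral g (fst z) (snd z)) \<in> borel_measurable borel"
  proof -
    have "(\<lambda>z::real \<times> (real^3). c (snd z)) \<in> borel_measurable borel"
      unfolding borel_prod[symmetric] by measurable
    then show ?thesis by measurable
  qed
  then have "AE z in lborel. z \<in> cyl T \<Omega> \<longrightarrow> f z = c (snd z) + time_integral g (fst z) (snd z)"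
  proof (rule AE_pair_eqI[rotated])
    show "AE t in lborel. AE x in lborel. (t, x) \<in> cyl T \<Omega> \<longrightarrow> f (t, x) = c (snd (t, x)) + time_integral g (fst (t, x)) (snd (t, x))"
      using ae by (elim eventually_mono) (auto simp: cyl_def elim!: eventually_mono)
  qed (use open_cyl[OF U(1)] in auto)
  then have 1: "AE x in lborel. AE s in lborel. s \<in> {0<..<T} \<longrightarrow> x \<in> \<Omega> \<longrightarrow> f (s, x) = c x + primitive (\<lambda>r. g (r, x)) s"
    by (drule_tac AE_slices_snd) (elim eventually_mono, auto simp: cyl_def time_integral_primitive)
  have 2: "AE x in lborel. x \<in> \<Omega> \<longrightarrow> k (t, x) = c x + primitive (\<lambda>r. g (r, x)) t"
    if k: "k \<in> C_L2 T \<Omega>" "representative (cyl T \<Omega>) k f" and t: "0 \<le> t" "t \<le> T" for k t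
  proof -
    have "AE t in lborel. AE x in lborel. t \<in> {0<..<T} \<longrightarrow> x \<in> \<Omega> \<longrightarrow> k (t, x) = c x + time_integral g t x"
      using ae AE_slices[OF representative_AE[OF k(2)]]
    proof eventually_elim
      case (elim t)
      then show ?case by eventually_elim (auto simp: cyl_def)
    qed
    from C_L2_eq_time_primitive[OF U T k(1) g this t] show ?thesis
      by (simp add: time_integral_primitive)
  qed
  from 1 2 show thesis by (rule that)
qed

text \<open>The scheme is compared with time averages of \<open>\<rho>\<close> over
  \<open>(a, a + \<delta>)\<close> because \<open>\<nabla>\<rho>\<close> is controlled for almost every time only,
  and not at the times \<open>t\<^sub>n\<close>.\<close>

lemma density_consistency:
  fixes u :: "real \<times> (real^3) \<Rightarrow> real^3" and \<rho> :: "real \<times> (real^3) \<Rightarrow> real"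
  assumes U: "open \<Omega>" "bounded \<Omega>" and T: "0 < T"
    and \<rho>C: "\<rho> \<in> C_L2 T \<Omega>" and uC: "u \<in> C_L2 T \<Omega>"
    and td: "t_differentiable T \<Omega> \<rho>" "t_differentiable T \<Omega> u" "t_differentiable T \<Omega> (dt T \<Omega> \<rho>)"
    and xd: "x_differentiable T \<Omega> \<rho>"
    and transport: "AE z in lebesgue_on (cyl T \<Omega>). dt T \<Omega> \<rho> z + u z \<bullet> x_grad T \<Omega> \<rho> z = 0"
    and ub: "u \<in> Lp_Lq \<infinity> \<infinity> T \<Omega>" and gb: "x_grad T \<Omega> \<rho> \<in> Lp_Lq \<infinity> \<infinity> T \<Omega>"
    and utb: "dt T \<Omega> u \<in> Lp_Lq \<infinity> 3 T \<Omega>" and ttb: "dt T \<Omega> (dt T \<Omega> \<rho>) \<in> Lp_Lq 2 2 T \<Omega>"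
    and ini: "AE x in lebesgue_on \<Omega>. \<bar>\<rho> (0, x)\<bar> \<le> K0"
  obtains M C and H :: "real \<times> (real^3) \<Rightarrow> real" and R :: "real \<times> (real^3) \<Rightarrow> real" where
    "0 \<le> M" "0 \<le> C" "integrable lborel H" "\<And>z. 0 \<le> H z" "integrable lborel (\<lambda>z. (H z)\<^sup>2)"
    "\<And>a \<delta>. 0 < \<delta> \<Longrightarrow> 0 \<le> a \<Longrightarrow> a + \<delta> \<le> T \<Longrightarrow>
       time_average R \<delta> a \<in> H1 \<Omega> \<and> time_average R \<delta> a \<in> Lp_space \<infinity> (lebesgue_on \<Omega>) \<and>
       (AE x in lebesgue_on \<Omega>. norm (weak_grad \<Omega> (time_average R \<delta> a) x) \<le> M) \<and>
       (AE x in lebesgue_on \<Omega>. \<bar>\<rho> (a + \<delta>, x) - time_average R \<delta> a x\<bar> \<le> C * \<delta>) \<and>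
       (AE x in lebesgue_on \<Omega>. \<bar>time_average R \<delta> a x - \<rho> (a, x)\<bar> \<le> C * \<delta>) \<and>
       (\<delta> \<le> a \<longrightarrow> (AE x in lebesgue_on \<Omega>. \<forall>w.
          \<bar>time_average R \<delta> a x - time_average R \<delta> (a - \<delta>) x + \<delta> * (w \<bullet> weak_grad \<Omega> (time_average R \<delta> a) x)\<bar>
          \<le> \<delta> * (M * norm (w - u (a, x))) + \<delta> * (\<integral>r. (if a - \<delta> \<le> r \<and> r \<le> a + \<delta> then H (r, x) else 0) \<partial>lborel)))"
proof -
  let ?Q = "cyl T \<Omega>"
  note oc = open_cyl[OF U(1), of T] and bc = bounded_cyl[OF U(2), of T]
  interpret finite_measure "lebesgue_on ?Q" by (rule finite_measure_lebesgue_on[OF oc bc])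
  have wdt: "has_weak_deriv ?Q (1, 0) \<rho> (dt T \<Omega> \<rho>)" "has_weak_deriv ?Q (1, 0) u (dt T \<Omega> u)"
     "has_weak_deriv ?Q (1, 0) (dt T \<Omega> \<rho>) (dt T \<Omega> (dt T \<Omega> \<rho>))"
    using td[unfolded t_differentiable_def, THEN weakly_differentiable_has_weak_deriv] by (simp_all add: dt_def)
  have wdx: "has_weak_deriv ?Q (0, axis j 1) \<rho> (\<lambda>z. x_grad T \<Omega> \<rho> z $ j)" for j
    using weakly_differentiable_has_weak_deriv[of ?Q "(0, axis j 1)" \<rho>] xd
    by (simp add: x_differentiable_def x_grad_def)
  have meas: "\<rho> \<in> borel_measurable (lebesgue_on ?Q)" "dt T \<Omega> \<rho> \<in> borel_measurable (lebesgue_on ?Q)"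
     "u \<in> borel_measurable (lebesgue_on ?Q)" "x_grad T \<Omega> \<rho> \<in> borel_measurable (lebesgue_on ?Q)"
  proof -
    show "\<rho> \<in> borel_measurable (lebesgue_on ?Q)" "dt T \<Omega> \<rho> \<in> borel_measurable (lebesgue_on ?Q)"
      by (rule locally_integrable_measurable[OF oc], use wdt(1) in \<open>simp add: has_weak_deriv_def\<close>)+
    show "u \<in> borel_measurable (lebesgue_on ?Q)" "x_grad T \<Omega> \<rho> \<in> borel_measurable (lebesgue_on ?Q)"
      using ub gb by (simp_all add: Lp_Lq_def)
  qed
  obtain Ku where Ku: "0 \<le> Ku" "AE z in lebesgue_on ?Q. norm (u z) \<le> Ku"
    using Lp_Lq_infinity_bound[OF U(1) ub] .
  obtain M where M: "0 \<le> M" "AE z in lebesgue_on ?Q. norm (x_grad T \<Omega> \<rho> z) \<le> M"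
    using Lp_Lq_infinity_bound[OF U(1) gb] .
  \<comment> \<open>By the transport equation this bounds the time derivative of the density. It is
    the Lipschitz constant in time and becomes the constant C of the conclusion.\<close>
  define K1 where "K1 = Ku * M"
  have K1: "0 \<le> K1" using Ku M by (simp add: K1_def)
  have Db: "AE z in lebesgue_on ?Q. norm (dt T \<Omega> \<rho> z) \<le> K1"
    using transport Ku(2) M(2)
  proof eventually_elim
    case (elim z)
    then have "norm (dt T \<Omega> \<rho> z) = \<bar>u z \<bullet> x_grad T \<Omega> \<rho> z\<bar>" by (simp add: add_eq_0_iff)
    also have "\<dots> \<le> norm (u z) * norm (x_grad T \<Omega> \<rho> z)" by (rule Cauchy_Schwarz_ineq2)
    also have "\<dots> \<le> K1" unfolding K1_def by (intro mult_mono elim Ku) auto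
    finally show ?case .
  qed
  have \<rho>i: "integrable (lebesgue_on ?Q) \<rho>"
    by (rule Lp_space_2_integrable[OF C_L2_imp_Lp_space_2[OF U(1) T \<rho>C meas(1)]])
  note uttL = Lp_Lq_infinity_3_imp_Lp_space_2[OF U utb] and \<rho>ttL = Lp_Lq_2_2_imp_Lp_space_2[OF U(1) ttb]
  obtain R where R: "representative ?Q \<rho> R" using representative_exists[OF oc meas(1)] .
  obtain D where D: "representative ?Q (dt T \<Omega> \<rho>) D" "\<And>z. norm (D z) \<le> K1"
    using representative_bounded[OF oc meas(2) Db K1] by blast
  obtain V where V: "representative ?Q u V" "\<And>z. norm (V z) \<le> Ku"
    using representative_bounded[OF oc meas(3) Ku(2,1)] by blast
  obtain G where G: "representative ?Q (x_grad T \<Omega> \<rho>) G" "\<And>z. norm (G z) \<le> M"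
    using representative_bounded[OF oc meas(4) M(2,1)] by blast
  obtain Vt where Vt: "representative ?Q (dt T \<Omega> u) Vt"
    using representative_exists[OF oc Lp_space_2_measurable[OF uttL]] .
  obtain Dt where Dt: "representative ?Q (dt T \<Omega> (dt T \<Omega> \<rho>)) Dt"
    using representative_exists[OF oc Lp_space_2_measurable[OF \<rho>ttL]] .
  have i: "integrable lborel R" "integrable lborel D" "integrable lborel V" "integrable lborel G" "integrable lborel Vt" "integrable lborel Dt"
    using representative_integrable[OF oc R \<rho>i] bounded_representative_integrable[OF bc oc D] bounded_representative_integrable[OF bc oc V]
      bounded_representative_integrable[OF bc oc G] representative_integrable[OF oc Vt Lp_space_2_integrable[OF uttL]]
      representative_integrable[OF oc Dt Lp_space_2_integrable[OF \<rho>ttL]] by auto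
  have Gji: "integrable lborel (\<lambda>z. G z $ j)" for j
    by (rule integrable_bounded_linear[OF bounded_linear_vec_nth i(4)])
  have Gjm: "(\<lambda>z. G z $ j) \<in> borel_measurable borel" for j
    using borel_measurable_integrable[OF Gji[of j]] by simp
  have w: "L1_weak_deriv ?Q (1, 0) R D" "L1_weak_deriv ?Q (1, 0) V Vt" "L1_weak_deriv ?Q (1, 0) D Dt" "\<And>j. L1_weak_deriv ?Q (0, axis j 1) R (\<lambda>z. G z $ j)"
    using has_weak_deriv_iff_L1[OF oc R D(1) i(1,2)] has_weak_deriv_iff_L1[OF oc V(1) Vt i(3,5)]
      has_weak_deriv_iff_L1[OF oc D(1) Dt i(2,6)] has_weak_deriv_iff_L1[OF oc R representative_component[OF G(1)] i(1) Gji]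
      wdt wdx by simp_all
  obtain cR where cR1: "AE x in lborel. AE s in lborel. s \<in> {0<..<T} \<longrightarrow> x \<in> \<Omega> \<longrightarrow> R (s, x) = cR x + primitive (\<lambda>r. D (r, x)) s"
    and cR2: "\<And>t. 0 \<le> t \<Longrightarrow> t \<le> T \<Longrightarrow> AE x in lborel. x \<in> \<Omega> \<longrightarrow> \<rho> (t, x) = cR x + primitive (\<lambda>r. D (r, x)) t"
  proof -
    obtain c where c: "AE x in lborel. AE s in lborel. s \<in> {0<..<T} \<longrightarrow> x \<in> \<Omega> \<longrightarrow> R (s, x) = c x + primitive (\<lambda>r. D (r, x)) s"
      "\<And>k t. k \<in> C_L2 T \<Omega> \<Longrightarrow> representative ?Q k R \<Longrightarrow> 0 \<le> t \<Longrightarrow> t \<le> T \<Longrightarrow>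
         AE x in lborel. x \<in> \<Omega> \<longrightarrow> k (t, x) = c x + primitive (\<lambda>r. D (r, x)) t"
      using L1_weak_deriv_time_primitive_snd[OF U T w(1)] by blast
    show thesis by (rule that[OF c(1) c(2)[OF \<rho>C R]])
  qed
  obtain cV where cV1: "AE x in lborel. AE s in lborel. s \<in> {0<..<T} \<longrightarrow> x \<in> \<Omega> \<longrightarrow> V (s, x) = cV x + primitive (\<lambda>r. Vt (r, x)) s"
    and cV2: "\<And>t. 0 \<le> t \<Longrightarrow> t \<le> T \<Longrightarrow> AE x in lborel. x \<in> \<Omega> \<longrightarrow> u (t, x) = cV x + primitive (\<lambda>r. Vt (r, x)) t"
  proof -
    obtain c where c: "AE x in lborel. AE s in lborel. s \<in> {0<..<T} \<longrightarrow> x \<in> \<Omega> \<longrightarrow> V (s, x) = c x + primitive (\<lambda>r. Vt (r, x)) s"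
      "\<And>k t. k \<in> C_L2 T \<Omega> \<Longrightarrow> representative ?Q k V \<Longrightarrow> 0 \<le> t \<Longrightarrow> t \<le> T \<Longrightarrow>
         AE x in lborel. x \<in> \<Omega> \<longrightarrow> k (t, x) = c x + primitive (\<lambda>r. Vt (r, x)) t"
      using L1_weak_deriv_time_primitive_snd[OF U T w(2)] by blast
    show thesis by (rule that[OF c(1) c(2)[OF uC V(1)]])
  qed
  obtain cD where cD1: "AE x in lborel. AE s in lborel. s \<in> {0<..<T} \<longrightarrow> x \<in> \<Omega> \<longrightarrow> D (s, x) = cD x + primitive (\<lambda>r. Dt (r, x)) s"
    using L1_weak_deriv_time_primitive_snd[OF U T w(3)] by blast
  have tr: "AE x in lborel. AE s in lborel. (s, x) \<in> ?Q \<longrightarrow> D (s, x) = - (V (s, x) \<bullet> G (s, x))"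
  proof (rule AE_slices_snd)
    show "AE z in lborel. z \<in> ?Q \<longrightarrow> D z = - (V z \<bullet> G z)"
      using transport[unfolded AE_lebesgue_on_open_iff[OF oc]] representative_AE[OF D(1)] representative_AE[OF V(1)] representative_AE[OF G(1)]
      by eventually_elim (auto simp: eq_neg_iff_add_eq_0)
  qed
  have slices: "AE x in lborel. integrable lborel (\<lambda>r. R (r, x)) \<and> integrable lborel (\<lambda>r. D (r, x)) \<and> integrable lborel (\<lambda>r. G (r, x))
       \<and> integrable lborel (\<lambda>r. Vt (r, x)) \<and> integrable lborel (\<lambda>r. Dt (r, x))"
    using i[THEN integrable_pair_slices] by (auto elim!: eventually_mono)
  \<comment> \<open>What \<open>consistency_pointwise\<close> leaves over: the second time
    derivative of the density from the rectangle rule, and the time derivative of u, weighted with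
    the bound M of the gradient, from freezing u at time a.\<close>
  define H where "H z = \<bar>Dt z\<bar> + M * norm (Vt z)" for z
  have Hi: "integrable lborel H" unfolding H_def by (intro Bochner_Integration.integrable_add integrable_abs integrable_mult_right integrable_norm i)
  have H2: "integrable lborel (\<lambda>z. (H z)\<^sup>2)"
  proof (rule Bochner_Integration.integrable_bound)
    show "integrable lborel (\<lambda>z. 2 * (norm (Dt z))\<^sup>2 + 2 * M\<^sup>2 * (norm (Vt z))\<^sup>2)"
      by (intro Bochner_Integration.integrable_add integrable_mult_right representative_square_integrable[OF oc Dt \<rho>ttL]
          representative_square_integrable[OF oc Vt uttL])
    show "AE z in lborel. norm ((H z)\<^sup>2) \<le> norm (2 * (norm (Dt z))\<^sup>2 + 2 * M\<^sup>2 * (norm (Vt z))\<^sup>2)"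
    proof (rule AE_I2)
      fix z
      define p q where "p = \<bar>Dt z\<bar>" and "q = M * norm (Vt z)"
      have "(p + q)\<^sup>2 \<le> 2 * p\<^sup>2 + 2 * q\<^sup>2"
        using sum_squares_bound[of p q] by (simp add: power2_sum)
      then show "norm ((H z)\<^sup>2) \<le> norm (2 * (norm (Dt z))\<^sup>2 + 2 * M\<^sup>2 * (norm (Vt z))\<^sup>2)"
        by (simp add: H_def p_def q_def power_mult_distrib)
    qed
    show "(\<lambda>z. (H z)\<^sup>2) \<in> borel_measurable lborel" using Hi by measurable
  qed
  have zero_out: "R (s, x) = 0" "G (s, x) = 0" if "x \<notin> \<Omega>" for s x
    using R G(1) that unfolding representative_def cyl_def by blast+
  have main: "time_average R \<delta> a \<in> H1 \<Omega> \<and> time_average R \<delta> a \<in> Lp_space \<infinity> (lebesgue_on \<Omega>) \<and>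
       (AE x in lebesgue_on \<Omega>. norm (weak_grad \<Omega> (time_average R \<delta> a) x) \<le> M) \<and>
       (AE x in lebesgue_on \<Omega>. \<bar>\<rho> (a + \<delta>, x) - time_average R \<delta> a x\<bar> \<le> K1 * \<delta>) \<and>
       (AE x in lebesgue_on \<Omega>. \<bar>time_average R \<delta> a x - \<rho> (a, x)\<bar> \<le> K1 * \<delta>) \<and>
       (\<delta> \<le> a \<longrightarrow> (AE x in lebesgue_on \<Omega>. \<forall>w.
          \<bar>time_average R \<delta> a x - time_average R \<delta> (a - \<delta>) x + \<delta> * (w \<bullet> weak_grad \<Omega> (time_average R \<delta> a) x)\<bar>
          \<le> \<delta> * (M * norm (w - u (a, x))) + \<delta> * (\<integral>r. (if a - \<delta> \<le> r \<and> r \<le> a + \<delta> then H (r, x) else 0) \<partial>lborel)))"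
    if \<delta>: "0 < \<delta>" and a: "0 \<le> a" "a + \<delta> \<le> T" for a \<delta>
  proof -
    let ?M = "lebesgue_on \<Omega>"
    interpret O: finite_measure ?M by (rule finite_measure_lebesgue_on[OF U])
    let ?B = "time_average R \<delta> a" and ?g = "time_average G \<delta> a"
    \<comment> \<open>Both ends of the averaging interval are needed: t = a + \<delta> for the error
      to be estimated, t = a for the first step of the scheme.\<close>
    have close: "AE x in lborel. x \<in> \<Omega> \<longrightarrow> \<bar>?B x - \<rho> (t, x)\<bar> \<le> K1 * \<delta>" if t: "a \<le> t" "t \<le> a + \<delta>" for t
    proof -
      have t': "0 \<le> t" "t \<le> T" using t a by auto
      show ?thesis
        using cR1 cR2[OF t'] slices
      proof eventually_elim
        case (elim x)
        show ?case
        proof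
          assume x: "x \<in> \<Omega>"
          have "norm (?B x - \<rho> (t, x)) \<le> K1 * \<delta>"
          proof (rule time_average_close[OF _ \<delta>])
            show "AE s in lborel. a < s \<and> s < a + \<delta> \<longrightarrow> norm (R (s, x) - \<rho> (t, x)) \<le> K1 * \<delta>"
              using elim(1)
            proof eventually_elim
              case (elim s)
              show ?case
              proof
                assume s: "a < s \<and> s < a + \<delta>"
                then have "R (s, x) = cR x + primitive (\<lambda>r. D (r, x)) s" using elim x a by auto
                moreover have "\<rho> (t, x) = cR x + primitive (\<lambda>r. D (r, x)) t" using \<open>x \<in> \<Omega> \<longrightarrow> _\<close> x by simp
                ultimately have "norm (R (s, x) - \<rho> (t, x)) = norm (primitive (\<lambda>r. D (r, x)) s - primitive (\<lambda>r. D (r, x)) t)" by simp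
                also have "\<dots> \<le> \<bar>s - t\<bar> * K1"
                proof (cases "t \<le> s")
                  case True
                  then show ?thesis
                    using primitive_Lipschitz[of "\<lambda>r. D (r, x)" K1 t s] D(2) \<open>integrable lborel (\<lambda>r. R (r, x)) \<and> _\<close> t' by simp
                next
                  case False
                  then show ?thesis
                    using primitive_Lipschitz[of "\<lambda>r. D (r, x)" K1 s t] D(2) \<open>integrable lborel (\<lambda>r. R (r, x)) \<and> _\<close> s a
                    by (simp add: norm_minus_commute abs_minus_commute)
                qed
                also have "\<dots> \<le> \<delta> * K1" using s t K1 by (intro mult_right_mono) auto
                finally show "norm (R (s, x) - \<rho> (t, x)) \<le> K1 * \<delta>" by (simp add: mult.commute)
              qed
            qed
          qed (use elim(3) K1 \<delta> in auto)
          then show "\<bar>?B x - \<rho> (t, x)\<bar> \<le> K1 * \<delta>" by simp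
        qed
      qed
    qed
    have Bm: "?B \<in> borel_measurable borel" "?g \<in> borel_measurable borel"
    proof -
      have [measurable]: "slab_integral R a (a + \<delta>) \<in> borel_measurable borel" "slab_integral G a (a + \<delta>) \<in> borel_measurable borel"
        using i by (auto intro!: slab_integral_measurable)
      show "?B \<in> borel_measurable borel" "?g \<in> borel_measurable borel"
        unfolding time_average_def[abs_def] by measurable
    qed
    have Binf: "?B \<in> Lp_space \<infinity> ?M"
    proof -
      \<comment> \<open>Lipschitz continuity carries the initial bound K0 to K0 + T K1 at time a,
        and the average is within K1 \<delta> of that.\<close>
      have "AE x in lborel. x \<in> \<Omega> \<longrightarrow> norm (?B x) \<le> K1 * \<delta> + (K0 + T * K1)"
      proof -
        have "0 \<le> a" "a \<le> T" "0 \<le> T" "a \<le> a + \<delta>" using a T \<delta> by auto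
        from close[OF order_refl this(4)] cR2[OF this(1,2)] cR2[OF order_refl this(3)] ini[unfolded AE_lebesgue_on_open_iff[OF U(1)]] slices
        show ?thesis
        proof eventually_elim
          case (elim x)
          show ?case
          proof
            assume x: "x \<in> \<Omega>"
            have "\<bar>\<rho> (a, x) - \<rho> (0, x)\<bar> \<le> (a - 0) * K1"
              using primitive_Lipschitz[of "\<lambda>r. D (r, x)" K1 0 a] D(2) elim x a by simp
            also have "\<dots> \<le> T * K1" using \<open>a \<le> T\<close> K1 by (intro mult_right_mono) auto
            finally show "norm (?B x) \<le> K1 * \<delta> + (K0 + T * K1)"
              using elim(1,4) x by simp
          qed
        qed
      qed
      then show ?thesis
        using Bm(1) by (auto simp: Lp_space_def AE_lebesgue_on_open_iff[OF U(1)] borel_measurable_lebesgue_onI)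
    qed
    have gM: "norm (?g x) \<le> M" for x
    proof -
      have "norm (slab_integral G a (a + \<delta>) x) \<le> (a + \<delta> - a) * M"
        unfolding slab_integral_def by (rule norm_interval_integral_le) (use G(2) M \<delta> in auto)
      then have "(1 / \<delta>) * norm (slab_integral G a (a + \<delta>) x) \<le> (1 / \<delta>) * (\<delta> * M)"
        using \<delta> by (intro mult_left_mono) auto
      then show ?thesis using \<delta> by (simp add: time_average_def)
    qed
    have ginf: "?g \<in> Lp_space \<infinity> ?M"
      using gM Bm(2) by (auto simp: Lp_space_def borel_measurable_lebesgue_onI)
    have hwd: "has_weak_deriv \<Omega> (axis j 1) ?B (\<lambda>x. ?g x $ j)" for j
    proof -
      have "L1_weak_deriv \<Omega> (axis j 1) (slab_integral R a (a + \<delta>)) (slab_integral (\<lambda>z. G z $ j) a (a + \<delta>))"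
        by (rule L1_weak_deriv_slab_integral[OF w(4) a])
      from L1_weak_deriv_cmult[OF this, of "1 / \<delta>"]
      have w1: "L1_weak_deriv \<Omega> (axis j 1) ?B (\<lambda>x. (1 / \<delta>) * slab_integral (\<lambda>z. G z $ j) a (a + \<delta>) x)"
        by (simp add: time_average_def[abs_def])
      have r1: "representative \<Omega> ?B ?B"
        unfolding representative_def
        using Bm(1) by (simp add: zero_out time_average_def slab_integral_def cong: if_cong)
      \<comment> \<open>Taking a component commutes with the integral where the slice of G is
        integrable, which is almost everywhere.\<close>
      have "AE x in lborel. (1 / \<delta>) * slab_integral (\<lambda>z. G z $ j) a (a + \<delta>) x = ?g x $ j"
        using slices
      proof eventually_elim
        case (elim x)
        have "integrable lborel (\<lambda>s. if a < s \<and> s < a + \<delta> then G (s, x) else 0)"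
          using elim by (intro integrable_open_interval) auto
        from integral_bounded_linear[OF bounded_linear_vec_nth[of j] this]
        have "slab_integral (\<lambda>z. G z $ j) a (a + \<delta>) x = slab_integral G a (a + \<delta>) x $ j"
          unfolding slab_integral_def by (simp add: if_distrib[of "\<lambda>y. y $ j"] cong: if_cong)
        then show ?case by (simp add: time_average_def)
      qed
      then have "AE x in lborel. x \<in> \<Omega> \<longrightarrow> (1 / \<delta>) * slab_integral (\<lambda>z. G z $ j) a (a + \<delta>) x = ?g x $ j"
        by (rule eventually_mono) blast
      moreover have z0: "slab_integral (\<lambda>z. G z $ j) a (a + \<delta>) x = 0" if "x \<notin> \<Omega>" for x
        using that by (simp add: slab_integral_def zero_out cong: if_cong)
      ultimately have r2: "representative \<Omega> (\<lambda>x. ?g x $ j) (\<lambda>x. (1 / \<delta>) * slab_integral (\<lambda>z. G z $ j) a (a + \<delta>) x)"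
        unfolding representative_def
        using slab_integral_measurable[OF Gjm[of j], of a "a + \<delta>"] z0 by simp
      show ?thesis
        using has_weak_deriv_iff_L1[OF U(1) r1 r2] w1 by (auto simp: L1_weak_deriv_def)
    qed
    note BH = H1_I[OF U(1) O.Lp_space_infinity_imp_2[OF Binf] O.Lp_space_infinity_imp_2[OF ginf] hwd]
    have g1: "AE x in ?M. norm (weak_grad \<Omega> ?B x) \<le> M"
      using BH(2) by eventually_elim (use gM in simp)
    have c1: "AE x in ?M. \<bar>\<rho> (a + \<delta>, x) - ?B x\<bar> \<le> K1 * \<delta>" "AE x in ?M. \<bar>?B x - \<rho> (a, x)\<bar> \<le> K1 * \<delta>"
      unfolding AE_lebesgue_on_open_iff[OF U(1)]
      using close[of "a + \<delta>"] close[of a] \<delta> by (simp_all add: abs_minus_commute)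
    have main': "AE x in ?M. \<forall>w.
          \<bar>?B x - time_average R \<delta> (a - \<delta>) x + \<delta> * (w \<bullet> weak_grad \<Omega> ?B x)\<bar>
          \<le> \<delta> * (M * norm (w - u (a, x))) + \<delta> * (\<integral>r. (if a - \<delta> \<le> r \<and> r \<le> a + \<delta> then H (r, x) else 0) \<partial>lborel)"
      if da: "\<delta> \<le> a"
      unfolding AE_lebesgue_on_open_iff[OF U(1)]
    proof -
      have "0 \<le> a" "a \<le> T" using a \<delta> by auto
      from BH(2)[unfolded AE_lebesgue_on_open_iff[OF U(1)]] cR1 cV1 cD1 cV2[OF this] tr slices
      show "AE x in lborel. x \<in> \<Omega> \<longrightarrow> (\<forall>w.
          \<bar>?B x - time_average R \<delta> (a - \<delta>) x + \<delta> * (w \<bullet> weak_grad \<Omega> ?B x)\<bar>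
          \<le> \<delta> * (M * norm (w - u (a, x))) + \<delta> * (\<integral>r. (if a - \<delta> \<le> r \<and> r \<le> a + \<delta> then H (r, x) else 0) \<partial>lborel))"
      proof eventually_elim
        case (elim x)
        show ?case
        proof (intro impI allI)
          fix w assume x: "x \<in> \<Omega>"
          have ae: "AE s in lborel. a - \<delta> < s \<and> s < a + \<delta> \<longrightarrow> R (s, x) = cR x + primitive (\<lambda>r. D (r, x)) s \<and>
              D (s, x) = cD x + primitive (\<lambda>r. Dt (r, x)) s \<and> D (s, x) = - (V (s, x) \<bullet> G (s, x)) \<and> V (s, x) = cV x + primitive (\<lambda>r. Vt (r, x)) s"
            using elim(2,3,4,6)
          proof eventually_elim
            case (elim s)
            show ?case using elim x a da by (auto simp: cyl_def)
          qed
          have sl: "integrable lborel (\<lambda>r. D (r, x))" "integrable lborel (\<lambda>r. Dt (r, x))" "integrable lborel (\<lambda>r. Vt (r, x))"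
             "integrable lborel (\<lambda>r. R (r, x))" "integrable lborel (\<lambda>r. G (r, x))" using elim(7) by auto
          from consistency_pointwise[OF \<delta> da sl G(2) ae, of w]
          show "\<bar>?B x - time_average R \<delta> (a - \<delta>) x + \<delta> * (w \<bullet> weak_grad \<Omega> ?B x)\<bar>
            \<le> \<delta> * (M * norm (w - u (a, x))) + \<delta> * (\<integral>r. (if a - \<delta> \<le> r \<and> r \<le> a + \<delta> then H (r, x) else 0) \<partial>lborel)"
            using elim(1,5) x by (simp add: time_average_def slab_integral_def H_def cong: if_cong)
        qed
      qed
    qed
    show ?thesis using BH(1) Binf g1 c1 main' by blast
  qed
  show thesis
    by (rule that[OF M(1) K1 Hi _ H2 main]) (use M in \<open>auto simp: H_def\<close>)
qed

subsection \<open>Summation of the errors\<close>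

text \<open>Cauchy-Schwarz against the indicator of the interval.\<close>

lemma interval_integral_squared_le:
  fixes h :: "real \<Rightarrow> real"
  assumes h: "h \<in> borel_measurable borel" and i: "integrable lborel (\<lambda>r. (h r)\<^sup>2)" and pq: "p \<le> q"
  shows "(\<integral>r. (if p \<le> r \<and> r \<le> q then h r else 0) \<partial>lborel)\<^sup>2 \<le> (q - p) * (\<integral>r. (if p \<le> r \<and> r \<le> q then (h r)\<^sup>2 else 0) \<partial>lborel)"
proof -
  let ?f = "indicator {p..q} :: real \<Rightarrow> real" and ?g = "\<lambda>r. if p \<le> r \<and> r \<le> q then h r else 0"
  have fsq: "(\<lambda>r. (norm (?f r))\<^sup>2) = ?f" by (auto simp: indicator_def fun_eq_iff)
  have gsq: "(\<lambda>r. (norm (?g r))\<^sup>2) = (\<lambda>r. if p \<le> r \<and> r \<le> q then (h r)\<^sup>2 else 0)" by (auto simp: fun_eq_iff)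
  have f: "?f \<in> Lp_space 2 lborel"
    unfolding Lp_space_2_iff fsq using emeasure_bounded_finite[of "{p..q}"] by auto
  have g: "?g \<in> Lp_space 2 lborel"
    unfolding Lp_space_2_iff gsq using h integrable_slice_interval[OF i] by auto
  have "(\<integral>r. ?f r \<bullet> ?g r \<partial>lborel) = (\<integral>r. ?g r \<partial>lborel)"
    by (rule Bochner_Integration.integral_cong) (auto simp: indicator_def)
  then have "\<bar>\<integral>r. ?g r \<partial>lborel\<bar> \<le> Lp_norm 2 lborel ?f * Lp_norm 2 lborel ?g"
    using Lp_norm_2_inner_bound[OF f g] by simp
  then have "(\<integral>r. ?g r \<partial>lborel)\<^sup>2 \<le> (Lp_norm 2 lborel ?f * Lp_norm 2 lborel ?g)\<^sup>2"
    using power_mono[OF _ abs_ge_zero, of "\<integral>r. ?g r \<partial>lborel" _ 2] by (simp only: power2_abs)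
  also have "\<dots> = (q - p) * (\<integral>r. (if p \<le> r \<and> r \<le> q then (h r)\<^sup>2 else 0) \<partial>lborel)"
    unfolding power_mult_distrib Lp_norm_2_squared fsq gsq using pq by simp
  finally show ?thesis .
qed

text \<open>Cauchy-Schwarz in time for each x, then Fubini's theorem. The mass of the squared H in
  the window is written as an increment of a primitive, a form in which overlapping windows can be
  summed by telescoping.\<close>

lemma time_window_L2_norm:
  fixes H :: "real \<times> (real^3) \<Rightarrow> real"
  assumes U: "open \<Omega>" and H: "integrable lborel H" and H2: "integrable lborel (\<lambda>z. (H z)\<^sup>2)" and pq: "0 \<le> p" "p \<le> q"
  defines "F \<equiv> \<lambda>x. \<integral>r. (if p \<le> r \<and> r \<le> q then H (r, x) else 0) \<partial>lborel"
    and "\<theta> \<equiv> \<lambda>r. \<integral>x. (H (r, x))\<^sup>2 \<partial>lborel"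
  shows "F \<in> Lp_space 2 (lebesgue_on \<Omega>)"
    and "(L2_norm \<Omega> F)\<^sup>2 \<le> (q - p) * (primitive \<theta> q - primitive \<theta> p)"
    and "integrable lborel \<theta>"
proof -
  have [measurable]: "H \<in> borel_measurable (borel \<Otimes>\<^sub>M borel)" using H by (simp add: borel_prod)
  have Fm[measurable]: "F \<in> borel_measurable borel" unfolding F_def by measurable
  have H2': "integrable (lborel \<Otimes>\<^sub>M lborel) (\<lambda>(r, x). (H (r, x))\<^sup>2)"
    using H2 by (simp add: lborel_prod split_beta')
  show \<theta>: "integrable lborel \<theta>"
    unfolding \<theta>_def using lborel_pair.integrable_fst[OF H2'] by simp
  define S where "S x = (\<integral>r. (if p \<le> r \<and> r \<le> q then (H (r, x))\<^sup>2 else 0) \<partial>lborel)" for x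
  have pair: "integrable (lborel \<Otimes>\<^sub>M lborel) (\<lambda>(r, x). if p \<le> r \<and> r \<le> q then (H (r, x))\<^sup>2 else 0)"
    by (rule Bochner_Integration.integrable_bound[OF H2']) (auto simp: split_beta', measurable)
  have Si: "integrable lborel S"
    unfolding S_def using lborel_pair.integrable_snd[OF pair] by simp
  have Sint: "(\<integral>x. S x \<partial>lborel) = primitive \<theta> q - primitive \<theta> p"
  proof -
    have "(\<integral>x. S x \<partial>lborel) = (\<integral>r. \<integral>x. (if p \<le> r \<and> r \<le> q then (H (r, x))\<^sup>2 else 0) \<partial>lborel \<partial>lborel)"
      unfolding S_def by (rule lborel_pair.Fubini_integral[OF pair])
    also have "\<dots> = (\<integral>r. (if p \<le> r \<and> r \<le> q then \<theta> r else 0) \<partial>lborel)"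
      by (rule Bochner_Integration.integral_cong) (auto simp: \<theta>_def)
    also have "\<dots> = primitive \<theta> q - primitive \<theta> p" by (rule primitive_diff[OF \<theta> pq, symmetric])
    finally show ?thesis .
  qed
  have le: "AE x in lborel. (F x)\<^sup>2 \<le> (q - p) * S x"
    using integrable_pair_slices[OF H2]
  proof eventually_elim
    case (elim x)
    have "(\<lambda>r. H (r, x)) \<in> borel_measurable borel" by measurable
    from interval_integral_squared_le[OF this elim pq(2)] show ?case by (simp add: F_def S_def)
  qed
  have S0: "0 \<le> S x" for x unfolding S_def by (rule integral_nonneg_AE) auto
  have F2: "integrable lborel (\<lambda>x. (F x)\<^sup>2)"
  proof (rule Bochner_Integration.integrable_bound)
    show "integrable lborel (\<lambda>x. (q - p) * S x)" using Si by simp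
    show "AE x in lborel. norm ((F x)\<^sup>2) \<le> norm ((q - p) * S x)"
      using le by eventually_elim simp
  qed measurable
  have eqi: "integrable lborel (\<lambda>x. indicator \<Omega> x *\<^sub>R (F x)\<^sup>2)"
    by (rule integrable_mult_indicator) (use U F2 in auto)
  have om: "\<Omega> \<in> sets borel" using U by simp
  have im: "(\<lambda>x. indicator \<Omega> x *\<^sub>R (F x)\<^sup>2) \<in> borel_measurable lborel"
    using eqi by (rule borel_measurable_integrable)
  have "integrable (lebesgue_on \<Omega>) (\<lambda>x. (F x)\<^sup>2)"
    using U eqi im by (simp add: integrable_restrict_space integrable_completion)
  then show "F \<in> Lp_space 2 (lebesgue_on \<Omega>)"
    by (simp add: Lp_space_2_iff borel_measurable_lebesgue_onI)
  have "(L2_norm \<Omega> F)\<^sup>2 = (\<integral>x. indicator \<Omega> x *\<^sub>R (F x)\<^sup>2 \<partial>lborel)"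
    unfolding Lp_norm_2_squared using U im by (simp add: integral_restrict_space integral_completion)
  also have "\<dots> \<le> (\<integral>x. (q - p) * S x \<partial>lborel)"
  proof (rule integral_mono_AE[OF eqi])
    show "AE x in lborel. indicator \<Omega> x *\<^sub>R (F x)\<^sup>2 \<le> (q - p) * S x"
      using le by eventually_elim (use S0 pq in \<open>auto simp: indicator_def\<close>)
  qed (use Si in simp)
  also have "\<dots> = (q - p) * (primitive \<theta> q - primitive \<theta> p)" by (simp add: Sint)
  finally show "(L2_norm \<Omega> F)\<^sup>2 \<le> (q - p) * (primitive \<theta> q - primitive \<theta> p)" .
qed

lemma primitive_nonneg_le:
  fixes \<theta> :: "real \<Rightarrow> real"
  assumes \<theta>: "integrable lborel \<theta>" and pos: "\<And>r. 0 \<le> \<theta> r"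
  shows "0 \<le> primitive \<theta> s" and "primitive \<theta> s \<le> (\<integral>r. \<theta> r \<partial>lborel)"
proof -
  show "0 \<le> primitive \<theta> s"
    unfolding primitive_def by (rule integral_nonneg_AE) (use pos in simp)
  show "primitive \<theta> s \<le> (\<integral>r. \<theta> r \<partial>lborel)"
    unfolding primitive_def by (intro integral_mono integrable_slice_interval \<theta>) (use pos in auto)
qed

text \<open>The windows from (k - 1) \<delta> to (k + 1) \<delta> overlap at most twice, so their
  masses add up to at most 2 I, with I the integral of \<theta>. Cauchy-Schwarz over n terms then
  bounds the square of the sum by 4 n \<delta> I \<le> 4 T I, whatever \<delta> is.\<close>

lemma window_sum_le:
  fixes \<phi> :: "nat \<Rightarrow> real"
  assumes \<theta>: "integrable lborel \<theta>" and pos: "\<And>r. 0 \<le> \<theta> r" and \<delta>: "0 < \<delta>" and n: "real n * \<delta> \<le> T"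
    and \<phi>: "\<And>k. 1 \<le> k \<Longrightarrow> k \<le> n \<Longrightarrow> (\<phi> k)\<^sup>2 \<le> 2 * \<delta> * (primitive \<theta> (real (Suc k) * \<delta>) - primitive \<theta> (real (k - 1) * \<delta>))"
  shows "(\<Sum>k=1..n. \<phi> k) \<le> 2 * sqrt (T * (\<integral>r. \<theta> r \<partial>lborel))"
proof -
  let ?P = "\<lambda>k. primitive \<theta> (real k * \<delta>)"
  define I where "I = (\<integral>r. \<theta> r \<partial>lborel)"
  note P = primitive_nonneg_le[OF \<theta> pos, folded I_def]
  have tel: "(\<Sum>k=1..m. ?P (Suc k) - ?P (k - 1)) = ?P (Suc m) + ?P m - ?P 1 - ?P 0" for m
    by (induction m) auto
  have I0: "0 \<le> I" using P[of 0] by linarith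
  have "0 \<le> real n * \<delta>" using \<delta> by simp
  then have T: "0 \<le> T" using n by linarith
  have sum2: "(\<Sum>k=1..n. ?P (Suc k) - ?P (k - 1)) \<le> 2 * I"
    unfolding tel using P[of "real (Suc n) * \<delta>"] P[of "real n * \<delta>"] P[of "real 1 * \<delta>"] P[of "real 0 * \<delta>"] by linarith
  have "(\<Sum>k=1..n. \<phi> k)\<^sup>2 \<le> (\<Sum>k=1..n. (\<phi> k)\<^sup>2) * real (card {1..n})"
    by (rule sum_squared_le_sum_of_squares)
  also have "\<dots> \<le> (\<Sum>k=1..n. 2 * \<delta> * (?P (Suc k) - ?P (k - 1))) * real n"
    using \<phi> by (simp, intro mult_right_mono sum_mono) auto
  also have "\<dots> = 2 * (real n * \<delta>) * (\<Sum>k=1..n. ?P (Suc k) - ?P (k - 1))"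
    unfolding sum_distrib_left[symmetric] by (simp only: mult_ac)
  also have "\<dots> \<le> 2 * (real n * \<delta>) * (2 * I)"
    using sum2 \<delta> by (intro mult_left_mono) auto
  also have "\<dots> \<le> 2 * T * (2 * I)"
    using n I0 by (intro mult_right_mono) auto
  also have "\<dots> = (2 * sqrt (T * I))\<^sup>2"
    using I0 T by (simp add: power_mult_distrib)
  finally have sq: "(\<Sum>k=1..n. \<phi> k)\<^sup>2 \<le> (2 * sqrt (T * I))\<^sup>2" .
  show ?thesis
    unfolding I_def[symmetric] by (rule power2_le_imp_le[OF sq]) (use I0 T in simp)
qed

text \<open>Squaring the hypothesis gives two terms. In the one with the velocity errors
  Cauchy-Schwarz costs a factor k, absorbed by k \<delta> \<le> T; the outer sum costs (n + 1)
  \<delta> \<le> T for both. This explains T and the square of T in K, whose summand 1 makes it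
  positive.\<close>

lemma error_summation:
  fixes err e :: "nat \<Rightarrow> real"
  assumes \<delta>: "0 < \<delta>" and n: "real (Suc n) * \<delta> \<le> T" and pos: "0 \<le> c" "0 \<le> M" "\<And>k. 0 \<le> err k" "\<And>k. 0 \<le> e k"
    and err: "\<And>k. k \<le> n \<Longrightarrow> err k \<le> \<delta> * c + \<delta> * M * (\<Sum>j=1..k. e j)"
  defines "K \<equiv> 2 * T * c\<^sup>2 + 2 * M\<^sup>2 * T\<^sup>2 + 1"
  shows "\<delta> * (\<Sum>k=0..n. (err k)\<^sup>2) \<le> K * \<delta>\<^sup>2 + K * \<delta> * (\<Sum>k=0..n. (e (Suc k))\<^sup>2)"
proof -
  define E where "E = (\<Sum>k=0..n. (e (Suc k))\<^sup>2)"
  have E0: "0 \<le> E" by (simp add: E_def sum_nonneg)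
  have "0 < real (Suc n) * \<delta>" using \<delta> by simp
  then have T: "0 < T" using n by linarith
  have one: "(err k)\<^sup>2 \<le> 2 * \<delta>\<^sup>2 * c\<^sup>2 + 2 * \<delta> * M\<^sup>2 * T * E" if k: "k \<le> n" for k
  proof -
    let ?S = "\<Sum>j=1..k. e j"
    have S0: "0 \<le> ?S" by (intro sum_nonneg pos)
    have "?S\<^sup>2 \<le> (\<Sum>j=1..k. (e j)\<^sup>2) * real (card {1..k})" by (rule sum_squared_le_sum_of_squares)
    also have "\<dots> = real k * (\<Sum>j=1..k. (e j)\<^sup>2)" by simp
    also have "(\<Sum>j=1..k. (e j)\<^sup>2) \<le> (\<Sum>j=1..Suc n. (e j)\<^sup>2)" using k by (intro sum_mono2) auto
    also have "(\<Sum>j=1..Suc n. (e j)\<^sup>2) = E"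
      unfolding E_def by (subst sum.shift_bounds_cl_Suc_ivl[symmetric]) simp
    finally have S2: "?S\<^sup>2 \<le> real k * E" by (simp add: mult_left_mono)
    have kT: "\<delta> * real k \<le> T"
    proof -
      have "\<delta> * real k \<le> \<delta> * real (Suc n)" using k \<delta> by (intro mult_left_mono) auto
      then show ?thesis using n by (simp add: mult.commute)
    qed
    have "(err k)\<^sup>2 \<le> (\<delta> * c + \<delta> * M * ?S)\<^sup>2" using err[OF k] pos by (intro power_mono) auto
    also have "\<dots> \<le> 2 * (\<delta> * c)\<^sup>2 + 2 * (\<delta> * M * ?S)\<^sup>2"
      using sum_squares_bound[of "\<delta> * c" "\<delta> * M * ?S"] by (simp add: power2_sum)
    also have "\<dots> = 2 * \<delta>\<^sup>2 * c\<^sup>2 + 2 * \<delta>\<^sup>2 * M\<^sup>2 * ?S\<^sup>2" by (simp add: power_mult_distrib)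
    also have "\<dots> \<le> 2 * \<delta>\<^sup>2 * c\<^sup>2 + 2 * \<delta>\<^sup>2 * M\<^sup>2 * (real k * E)" using S2 by (intro add_left_mono mult_left_mono) auto
    also have "2 * \<delta>\<^sup>2 * M\<^sup>2 * (real k * E) = (\<delta> * real k) * (2 * \<delta> * M\<^sup>2 * E)" by (simp add: power2_eq_square)
    also have "\<dots> \<le> T * (2 * \<delta> * M\<^sup>2 * E)" using kT E0 \<delta> by (intro mult_right_mono) auto
    finally show ?thesis by (simp add: mult_ac)
  qed
  have "\<delta> * (\<Sum>k=0..n. (err k)\<^sup>2) \<le> \<delta> * (\<Sum>k=0..n. 2 * \<delta>\<^sup>2 * c\<^sup>2 + 2 * \<delta> * M\<^sup>2 * T * E)"
    using one \<delta> by (intro mult_left_mono sum_mono) auto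
  also have "\<dots> = (real (Suc n) * \<delta>) * (2 * \<delta>\<^sup>2 * c\<^sup>2 + 2 * \<delta> * M\<^sup>2 * T * E)" by simp
  also have "\<dots> \<le> T * (2 * \<delta>\<^sup>2 * c\<^sup>2 + 2 * \<delta> * M\<^sup>2 * T * E)"
    using n E0 \<delta> T by (intro mult_right_mono) auto
  also have "\<dots> = (2 * T * c\<^sup>2) * \<delta>\<^sup>2 + (2 * M\<^sup>2 * T\<^sup>2) * (\<delta> * E)" by (simp add: power2_eq_square algebra_simps)
  also have "\<dots> \<le> K * \<delta>\<^sup>2 + K * (\<delta> * E)"
    using T E0 \<delta> by (intro add_mono mult_right_mono) (auto simp: K_def)
  finally show ?thesis by (simp add: E_def mult.assoc)
qed

lemma viscosity_solution_Lp_infinity: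
  "viscosity_solution \<Omega> \<delta> w \<rho> \<rho>' \<Longrightarrow> \<rho>' \<in> Lp_space \<infinity> (lebesgue_on \<Omega>)"
  by (auto simp: viscosity_solution_def weakstar_Linf_def)

theorem theorem4:
  fixes T r \<theta> \<rho>1 \<rho>2 \<mu>1 \<mu>2 \<alpha>1 \<alpha>2 :: real
    and \<Omega> :: "(real^3) set"
    and \<mu> \<alpha> :: "real \<Rightarrow> real"
    and \<rho>0 :: "real^3 \<Rightarrow> real" and u0 :: "real^3 \<Rightarrow> real^3"
    and u :: "real \<times> (real^3) \<Rightarrow> real^3" and \<rho> p :: "real \<times> (real^3) \<Rightarrow> real"
    and S :: "real \<times> (real^3) \<Rightarrow> real^3^3"
  assumes "T > 0" and "r > 0" and "\<theta> > 0"
    and "open \<Omega>" and "connected \<Omega>" and "bounded \<Omega>" and "\<Omega> \<noteq> {}"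
    and "\<mu> C1_differentiable_on {\<rho>1..\<rho>2}" and "\<alpha> C1_differentiable_on {\<rho>1..\<rho>2}"
    and "\<mu>1 > 0" and "\<mu>2 > 0" and "\<alpha>1 \<ge> 0" and "\<alpha>2 \<ge> 0"
    and "\<And>s. s \<in> {\<rho>1..\<rho>2} \<Longrightarrow> \<mu>1 \<le> \<mu> s \<and> \<mu> s \<le> \<mu>2"
    and "\<And>s. s \<in> {\<rho>1..\<rho>2} \<Longrightarrow> \<alpha>1 \<le> \<alpha> s \<and> \<alpha> s \<le> \<alpha>2"
    and "\<rho>1 > 0" and "\<rho>0 \<in> borel_measurable (lebesgue_on \<Omega>)"
    and "AE x in lebesgue_on \<Omega>. \<rho>1 \<le> \<rho>0 x \<and> \<rho>0 x \<le> \<rho>2"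
    and "u0 \<in> H10 \<Omega>" and "AE x in lebesgue_on \<Omega>. weak_div \<Omega> u0 x = 0"
    and "bingham_solution T \<Omega> \<mu> \<alpha> \<rho>0 u0 u \<rho> p S"
    and "bingham_regular T \<Omega> u \<rho> p S"
  shows "\<exists>C>0. \<forall>N>0. T / real N < 1/6 \<longrightarrow>
    (\<forall>\<rho>h uh uhat qh ph Sh.
       bi_projection_scheme \<Omega> \<mu> \<alpha> \<rho>1 r \<theta> \<rho>0 u0 N (T / real N) \<rho>h uh uhat qh ph Sh \<longrightarrow>
       (\<forall>n\<le>N - 1.
          (T / real N) * (\<Sum>k=0..n. (L2_norm \<Omega>
             (\<lambda>x. \<rho> (real (Suc k) * (T / real N), x) - \<rho>h (Suc k) x))\<^sup>2)
          \<le> C * (T / real N)\<^sup>2 + C * (T / real N) * (\<Sum>k=0..n. (L2_norm \<Omega>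
             (\<lambda>x. u (real (Suc k) * (T / real N), x) - uh (Suc k) x))\<^sup>2)))"
proof -
  let ?M = "lebesgue_on \<Omega>"
  note T = assms(1) and U = assms(4,6) and \<rho>1 = assms(16) and \<rho>0m = assms(17) and \<rho>0b = assms(18)
    and u0H = assms(19) and u0div = assms(20) and sol = assms(21) and reg = assms(22)
  interpret finite_measure ?M by (rule finite_measure_lebesgue_on[OF U])
  have \<rho>C: "\<rho> \<in> C_L2 T \<Omega>" and uC: "u \<in> C_L2 T \<Omega>"
    and transport: "AE z in lebesgue_on (cyl T \<Omega>). dt T \<Omega> \<rho> z + u z \<bullet> x_grad T \<Omega> \<rho> z = 0"
    and div0: "AE z in lebesgue_on (cyl T \<Omega>). trace (x_jac T \<Omega> u z) = 0"
    and i\<rho>: "AE x in ?M. \<rho> (0, x) = \<rho>0 x" and iu: "AE x in ?M. u (0, x) = u0 x"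
    and uH: "AE t in lebesgue_on {0<..<T}. curry u t \<in> H10 \<Omega>"
    using sol by (simp_all add: bingham_solution_def)
  have regs: "u \<in> Lp_Lq \<infinity> \<infinity> T \<Omega>" "x_differentiable T \<Omega> u" "x_jac T \<Omega> u \<in> Lp_Lq \<infinity> \<infinity> T \<Omega>" "t_differentiable T \<Omega> u"
    "dt T \<Omega> u \<in> Lp_Lq \<infinity> 3 T \<Omega>" "x_differentiable T \<Omega> \<rho>" "x_grad T \<Omega> \<rho> \<in> Lp_Lq \<infinity> \<infinity> T \<Omega>" "t_differentiable T \<Omega> \<rho>"
    "t_differentiable T \<Omega> (dt T \<Omega> \<rho>)" "dt T \<Omega> (dt T \<Omega> \<rho>) \<in> Lp_Lq 2 2 T \<Omega>"
    using reg by (simp_all add: bingham_regular_def)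
  have ini: "AE x in ?M. \<bar>\<rho> (0, x)\<bar> \<le> \<rho>2"
    using i\<rho> \<rho>0b by eventually_elim (use \<rho>1 in auto)
  obtain M C and H R :: "real \<times> (real^3) \<Rightarrow> real" where M: "0 \<le> M" and C: "0 \<le> C" and H: "integrable lborel H"
    and H0: "\<And>z. 0 \<le> H z" and H2: "integrable lborel (\<lambda>z. (H z)\<^sup>2)"
    and cons: "\<And>a \<delta>. 0 < \<delta> \<Longrightarrow> 0 \<le> a \<Longrightarrow> a + \<delta> \<le> T \<Longrightarrow>
       time_average R \<delta> a \<in> H1 \<Omega> \<and> time_average R \<delta> a \<in> Lp_space \<infinity> ?M \<and>
       (AE x in ?M. norm (weak_grad \<Omega> (time_average R \<delta> a) x) \<le> M) \<and>
       (AE x in ?M. \<bar>\<rho> (a + \<delta>, x) - time_average R \<delta> a x\<bar> \<le> C * \<delta>) \<and>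
       (AE x in ?M. \<bar>time_average R \<delta> a x - \<rho> (a, x)\<bar> \<le> C * \<delta>) \<and>
       (\<delta> \<le> a \<longrightarrow> (AE x in ?M. \<forall>w.
          \<bar>time_average R \<delta> a x - time_average R \<delta> (a - \<delta>) x + \<delta> * (w \<bullet> weak_grad \<Omega> (time_average R \<delta> a) x)\<bar>
          \<le> \<delta> * (M * norm (w - u (a, x))) + \<delta> * (\<integral>r. (if a - \<delta> \<le> r \<and> r \<le> a + \<delta> then H (r, x) else 0) \<partial>lborel)))"
    apply (rule density_consistency[OF U T \<rho>C uC regs(8,4,9,6) transport regs(1,7,5,10) ini])
    subgoal premises p for M C H R by (rule p(1)[OF p(2-7)])
    done
  have uorth: "(\<integral>x. u (t, x) \<bullet> weak_grad \<Omega> \<phi> x \<partial>?M) = 0" if "\<phi> \<in> H1 \<Omega>" "0 \<le> t" "t \<le> T" for \<phi> t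
    by (rule velocity_orthogonal_to_gradients[OF U T uC regs(2,1,3) div0 uH that])
  have uL: "(\<lambda>x. u (t, x)) \<in> Lp_space 2 ?M" "(\<lambda>x. \<rho> (t, x)) \<in> Lp_space 2 ?M" if "0 \<le> t" "t \<le> T" for t
    using uC \<rho>C that by (auto simp: C_L2_def curry_def)
  have u0L: "u0 \<in> Lp_space 2 ?M" by (rule H10_Lp_space_2[OF u0H])
  \<comment> \<open>At step 0 the scheme transports with \<open>u0\<close>, which is no output of
    the projection; its orthogonality comes from the vanishing divergence.\<close>
  have u0orth: "(\<integral>x. u0 x \<bullet> weak_grad \<Omega> \<phi> x \<partial>?M) = 0" if "\<phi> \<in> H1 \<Omega>" for \<phi>
  proof -
    have "(\<integral>x. weak_div \<Omega> u0 x * \<phi> x \<partial>?M) = 0"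
      by (rule integral_eq_zero_AE) (use u0div in \<open>auto elim!: eventually_mono\<close>)
    then show ?thesis by (simp add: H10_integral_by_parts[OF U u0H that])
  qed
  have \<rho>0i: "\<rho>0 \<in> Lp_space \<infinity> ?M"
  proof -
    have "AE x in ?M. norm (\<rho>0 x) \<le> \<rho>2"
      using \<rho>0b by eventually_elim (use \<rho>1 in auto)
    then show ?thesis using \<rho>0m by (auto simp: Lp_space_def)
  qed
  \<comment> \<open>The square root of the measure of \<Omega>, which turns pointwise bounds into
    bounds in L2.\<close>
  define vol where "vol = Lp_norm 2 ?M (\<lambda>x. 1::real)"
  have one: "(\<lambda>x. 1::real) \<in> Lp_space 2 ?M" by (simp add: Lp_space_2_iff)
  have const: "(\<lambda>x. c::real) \<in> Lp_space 2 ?M" "Lp_norm 2 ?M (\<lambda>x. c::real) = \<bar>c\<bar> * vol" for c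
    using Lp_norm_2_cmult[OF one, of c] by (simp_all add: vol_def)
  have vol0: "0 \<le> vol" by (simp add: vol_def Lp_norm_2_nonneg)
  define \<theta>' where "\<theta>' r = (\<integral>x. (H (r, x))\<^sup>2 \<partial>lborel)" for r
  have \<theta>'i: "integrable lborel \<theta>'" and \<theta>'0: "\<And>r. 0 \<le> \<theta>' r"
    unfolding \<theta>'_def using time_window_L2_norm(3)[OF U(1) H H2, of 0 0] by (simp_all add: integral_nonneg_AE)
  define Q where "Q = 2 * sqrt (T * (\<integral>r. \<theta>' r \<partial>lborel))"
  have Q0: "0 \<le> Q" using T by (simp add: Q_def integral_nonneg_AE \<theta>'0)
  \<comment> \<open>Cost of the first step per unit of \<delta>: the distance of B 0 from the
    initial density, and transport of B 0 by the initial velocity.\<close>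
  define c0 where "c0 = C * vol + M * Lp_norm 2 ?M u0"
  \<comment> \<open>Per unit of \<delta>: passing from the average to the value of \<rho> at the end
    of the step, the first step, and the sum of all consistency windows.\<close>
  define c where "c = C * vol + c0 + Q"
  have c0: "0 \<le> c0" "0 \<le> c" using C M vol0 Q0 by (simp_all add: c0_def c_def Lp_norm_2_nonneg)
  define K where "K = 2 * T * c\<^sup>2 + 2 * M\<^sup>2 * T\<^sup>2 + 1"
  have K: "0 < K" using T by (simp add: K_def add_nonneg_pos)
  show ?thesis
  \<comment> \<open>K is fixed before N and the output of the scheme, hence independent of the time
    step.\<close>
  proof (rule exI[of _ K], intro conjI K allI impI)
    fix N :: nat and \<rho>h uh uhat qh ph Sh n
    assume N: "0 < N" and sch: "bi_projection_scheme \<Omega> \<mu> \<alpha> \<rho>1 r \<theta> \<rho>0 u0 N (T / real N) \<rho>h uh uhat qh ph Sh"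
      and n: "n \<le> N - 1"
    define \<delta> where "\<delta> = T / real N"
    have \<delta>: "0 < \<delta>" using T N by (simp add: \<delta>_def)
    have tk: "real k * \<delta> \<le> T" if "k \<le> N" for k
      using that T N by (simp add: \<delta>_def field_simps mult_right_mono)
    have sch0: "\<rho>h 0 = \<rho>0" "uh 0 = u0" "uhat 0 = u0"
      and schS: "\<And>k. k < N \<Longrightarrow> viscosity_solution \<Omega> \<delta> (uhat k) (\<rho>h k) (\<rho>h (Suc k))"
        "\<And>k. k < N \<Longrightarrow> uh (Suc k) \<in> H10 \<Omega>"
        "\<And>k. k < N \<Longrightarrow> neumann_poisson \<Omega> (\<rho>1 / \<delta>) (uh (Suc k)) (qh (Suc k))"
        "\<And>k. k < N \<Longrightarrow> AE x in ?M. uhat (Suc k) x = uh (Suc k) x - (\<delta> / \<rho>1) *\<^sub>R weak_grad \<Omega> (qh (Suc k)) x"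
      using sch unfolding bi_projection_scheme_def momentum_step_def \<delta>_def by auto
    \<comment> \<open>For k > 0 boundedness is part of the weak-* convergence that defines the
      density.\<close>
    have \<rho>hi: "\<rho>h k \<in> Lp_space \<infinity> ?M" if "k \<le> N" for k
    proof (cases k)
      case 0
      then show ?thesis using \<rho>0i sch0 by simp
    next
      case (Suc m)
      then have "m < N" using that by simp
      from viscosity_solution_Lp_infinity[OF schS(1)[OF this]] show ?thesis using Suc by simp
    qed
    define e where "e k = L2_norm \<Omega> (\<lambda>x. u (real k * \<delta>, x) - uh k x)" for k
    have hat: "uhat k \<in> Lp_space 2 ?M" "\<And>\<phi>. \<phi> \<in> H1 \<Omega> \<Longrightarrow> (\<integral>x. uhat k x \<bullet> weak_grad \<Omega> \<phi> x \<partial>?M) = 0"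
      "L2_norm \<Omega> (\<lambda>x. u (real k * \<delta>, x) - uhat k x) \<le> e k" if k: "k \<le> N" for k
    proof -
      have "uhat k \<in> Lp_space 2 ?M \<and> (\<forall>\<phi>. \<phi> \<in> H1 \<Omega> \<longrightarrow> (\<integral>x. uhat k x \<bullet> weak_grad \<Omega> \<phi> x \<partial>?M) = 0) \<and>
         L2_norm \<Omega> (\<lambda>x. u (real k * \<delta>, x) - uhat k x) \<le> e k"
      proof (cases k)
        \<comment> \<open>Here \<open>uhat\<close> and \<open>uh\<close> coincide, so the bound by e
          is an equality.\<close>
        case 0
        then show ?thesis using u0L u0orth by (simp add: sch0 e_def)
      next
        case (Suc m)
        then have m: "m < N" using k by simp
        have c': "0 < \<delta> / \<rho>1" using \<delta> \<rho>1 by simp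
        have np: "neumann_poisson \<Omega> (1 / (\<delta> / \<rho>1)) (uh (Suc m)) (qh (Suc m))" using schS(3)[OF m] by simp
        note pv = projected_velocity[OF U schS(2)[OF m] c' np schS(4)[OF m]]
        have "0 \<le> real k * \<delta>" using \<delta> by simp
        note pv3 = pv(3)[OF uL(1)[OF this tk[OF k]] uorth[OF _ this tk[OF k]]]
        show ?thesis using pv(1,2) pv3 Suc by (simp add: e_def)
      qed
      then show "uhat k \<in> Lp_space 2 ?M" "\<And>\<phi>. \<phi> \<in> H1 \<Omega> \<Longrightarrow> (\<integral>x. uhat k x \<bullet> weak_grad \<Omega> \<phi> x \<partial>?M) = 0"
        "L2_norm \<Omega> (\<lambda>x. u (real k * \<delta>, x) - uhat k x) \<le> e k" by auto
    qed
    define B where "B k = time_average R \<delta> (real k * \<delta>)" for k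
    have tS: "real (Suc k) * \<delta> = real k * \<delta> + \<delta>" for k by (simp add: algebra_simps)
    have consk: "B k \<in> H1 \<Omega>" "B k \<in> Lp_space \<infinity> ?M" "AE x in ?M. norm (weak_grad \<Omega> (B k) x) \<le> M"
       "AE x in ?M. \<bar>\<rho> (real (Suc k) * \<delta>, x) - B k x\<bar> \<le> C * \<delta>" "AE x in ?M. \<bar>B k x - \<rho> (real k * \<delta>, x)\<bar> \<le> C * \<delta>"
      if k: "k < N" for k
      using cons[OF \<delta>, of "real k * \<delta>"] \<delta> tk[of "Suc k"] k unfolding tS B_def by auto
    \<comment> \<open>The window of two steps around the node k. Sums over F start at 1, so the
      truncated k - 1 at k = 0 has no effect on them.\<close>
    define F where "F k x = (\<integral>r. (if real (k - 1) * \<delta> \<le> r \<and> r \<le> real (Suc k) * \<delta> then H (r, x) else 0) \<partial>lborel)" for k x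
    have incr: "AE x in ?M. \<bar>B (Suc k) x - B k x + \<delta> * (uhat (Suc k) x \<bullet> weak_grad \<Omega> (B (Suc k)) x)\<bar>
        \<le> \<delta> * (M * norm (uhat (Suc k) x - u (real (Suc k) * \<delta>, x))) + \<delta> * F (Suc k) x" if k: "Suc k < N" for k
    proof -
      have sub: "real (Suc k) * \<delta> - \<delta> = real k * \<delta>" by (simp add: algebra_simps)
      have "0 \<le> real (Suc k) * \<delta>" "\<delta> \<le> real (Suc k) * \<delta>" "real (Suc k) * \<delta> + \<delta> \<le> T"
        using \<delta> tk[of "Suc (Suc k)"] k by (auto simp: algebra_simps)
      with cons[OF \<delta>, of "real (Suc k) * \<delta>"] have "AE x in ?M. \<forall>w.
          \<bar>B (Suc k) x - B k x + \<delta> * (w \<bullet> weak_grad \<Omega> (B (Suc k)) x)\<bar>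
          \<le> \<delta> * (M * norm (w - u (real (Suc k) * \<delta>, x))) + \<delta> * F (Suc k) x"
        unfolding B_def F_def sub diff_Suc_1 tS[of "Suc k"] by blast
      \<comment> \<open>The estimate holds for all vectors w outside one null set, so w may be the
        value of \<open>uhat\<close> at x.\<close>
      then show ?thesis by eventually_elim blast
    qed
    have FL: "F k \<in> Lp_space 2 ?M" and F2: "(L2_norm \<Omega> (F k))\<^sup>2 \<le> (real (Suc k) * \<delta> - real (k - 1) * \<delta>) * (primitive \<theta>' (real (Suc k) * \<delta>) - primitive \<theta>' (real (k - 1) * \<delta>))" for k
    proof -
      have "0 \<le> real (k - 1) * \<delta>" "real (k - 1) * \<delta> \<le> real (Suc k) * \<delta>" using \<delta> by (auto intro!: mult_right_mono)
      from time_window_L2_norm(1,2)[OF U(1) H H2 this]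
      show "F k \<in> Lp_space 2 ?M" "(L2_norm \<Omega> (F k))\<^sup>2 \<le> (real (Suc k) * \<delta> - real (k - 1) * \<delta>) * (primitive \<theta>' (real (Suc k) * \<delta>) - primitive \<theta>' (real (k - 1) * \<delta>))"
        by (simp_all add: F_def[abs_def] \<theta>'_def[abs_def])
    qed
    define \<eta> where "\<eta> k = L2_norm \<Omega> (\<lambda>x. B k x - \<rho>h (Suc k) x)" for k
    have step: "\<eta> k \<le> L2_norm \<Omega> (\<lambda>x. B k x - \<rho>h k x + \<delta> * (uhat k x \<bullet> weak_grad \<Omega> (B k) x))" if k: "k < N" for k
      unfolding \<eta>_def using k
      by (intro viscosity_step_stability[OF U \<delta> hat(1) hat(2) schS(1) \<rho>hi consk(1,2,3)]) auto
    have conv: "(\<lambda>x. \<delta> * (uhat k x \<bullet> weak_grad \<Omega> (B k) x)) \<in> Lp_space 2 ?M" if k: "k < N" for k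
      using k by (intro Lp_norm_2_cmult(1) Lp_space_2_inner_const[OF hat(1) Lp_space_2_measurable[OF H1_weak_grad(2)] consk(3)] consk(1)) auto
    note BL = Lp_space_infinity_imp_2[OF consk(2)] and \<rho>hL = Lp_space_infinity_imp_2[OF \<rho>hi]
    have \<eta>0: "\<eta> 0 \<le> \<delta> * c0"
    proof -
      have le0: "AE x in ?M. norm (B 0 x - \<rho>h 0 x + \<delta> * (uhat 0 x \<bullet> weak_grad \<Omega> (B 0) x)) \<le> norm (C * \<delta> + \<delta> * M * norm (u0 x))"
        using consk(5)[OF N] consk(3)[OF N] i\<rho>
      proof eventually_elim
        case (elim x)
        have "\<bar>u0 x \<bullet> weak_grad \<Omega> (B 0) x\<bar> \<le> norm (u0 x) * norm (weak_grad \<Omega> (B 0) x)" by (rule Cauchy_Schwarz_ineq2)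
        also have "\<dots> \<le> norm (u0 x) * M" using elim(2) by (intro mult_left_mono) auto
        finally have "\<bar>\<delta> * (u0 x \<bullet> weak_grad \<Omega> (B 0) x)\<bar> \<le> \<delta> * (norm (u0 x) * M)"
          unfolding abs_mult using \<delta> by (intro mult_mono) auto
        moreover have "\<bar>B 0 x - \<rho>0 x\<bar> \<le> C * \<delta>" using elim(1,3) by simp
        ultimately show ?case by (simp add: sch0 mult_ac)
      qed
      have gL: "(\<lambda>x. C * \<delta> + \<delta> * M * norm (u0 x)) \<in> Lp_space 2 ?M"
        "Lp_norm 2 ?M (\<lambda>x. C * \<delta> + \<delta> * M * norm (u0 x)) \<le> C * \<delta> * vol + \<delta> * M * Lp_norm 2 ?M u0"
      proof -
        have nu: "(\<lambda>x. norm (u0 x)) \<in> Lp_space 2 ?M" using u0L Lp_space_2_norm_iff[OF Lp_space_2_measurable[OF u0L]] by simp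
        note a = Lp_norm_2_add[OF const(1)[of "C * \<delta>"] Lp_norm_2_cmult(1)[OF nu, of "\<delta> * M"]]
        show "(\<lambda>x. C * \<delta> + \<delta> * M * norm (u0 x)) \<in> Lp_space 2 ?M" by (rule a(1))
        show "Lp_norm 2 ?M (\<lambda>x. C * \<delta> + \<delta> * M * norm (u0 x)) \<le> C * \<delta> * vol + \<delta> * M * Lp_norm 2 ?M u0"
          using a(2) C M \<delta> by (simp add: const(2) Lp_norm_2_cmult(2)[OF nu] Lp_norm_2_norm abs_mult)
      qed
      have m0: "(\<lambda>x. B 0 x - \<rho>h 0 x + \<delta> * (uhat 0 x \<bullet> weak_grad \<Omega> (B 0) x)) \<in> borel_measurable ?M"
        using N by (intro Lp_space_2_measurable Lp_norm_2_add(1) Lp_norm_2_diff(1) BL \<rho>hL conv) auto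
      note order_trans[OF Lp_space_2_bound(2)[OF gL(1) m0 le0] gL(2)]
      then show ?thesis using step[OF N] by (simp add: c0_def algebra_simps)
    qed
    have \<eta>S: "\<eta> (Suc k) \<le> \<eta> k + \<delta> * (M * e (Suc k)) + \<delta> * L2_norm \<Omega> (F (Suc k))" if k: "Suc k < N" for k
    proof -
      let ?I = "\<lambda>x. B (Suc k) x - B k x + \<delta> * (uhat (Suc k) x \<bullet> weak_grad \<Omega> (B (Suc k)) x)"
      let ?d = "\<lambda>x. u (real (Suc k) * \<delta>, x) - uhat (Suc k) x"
      have k': "k < N" "k \<le> N" "Suc k \<le> N" using k by auto
      have IL: "?I \<in> Lp_space 2 ?M" by (intro Lp_norm_2_add(1) Lp_norm_2_diff(1) BL conv k k')
      have t0: "0 \<le> real (Suc k) * \<delta>" using \<delta> by simp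
      have dL: "?d \<in> Lp_space 2 ?M" by (intro Lp_norm_2_diff(1) uL hat(1) k' t0 tk)
      then have ndL: "(\<lambda>x. norm (?d x)) \<in> Lp_space 2 ?M"
        using Lp_space_2_norm_iff[OF Lp_space_2_measurable[OF dL]] by simp
      note a = Lp_norm_2_add[OF Lp_norm_2_cmult(1)[OF ndL, of "\<delta> * M"] Lp_norm_2_cmult(1)[OF FL[of "Suc k"], of \<delta>]]
      have F0: "0 \<le> F (Suc k) x" for x unfolding F_def by (rule integral_nonneg_AE) (use H0 in auto)
      have "AE x in ?M. norm (?I x) \<le> norm (\<delta> * M * norm (?d x) + \<delta> * F (Suc k) x)"
        using incr[OF k]
      proof eventually_elim
        case (elim x)
        have "0 \<le> \<delta> * M * norm (?d x) + \<delta> * F (Suc k) x" using \<delta> M F0 by simp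
        then show ?case using elim by (simp add: norm_minus_commute[of "uhat (Suc k) x"] mult.assoc)
      qed
      then have "L2_norm \<Omega> ?I \<le> Lp_norm 2 ?M (\<lambda>x. \<delta> * M * norm (?d x) + \<delta> * F (Suc k) x)"
        by (rule Lp_space_2_bound(2)[OF a(1) Lp_space_2_measurable[OF IL]])
      also have "\<dots> \<le> \<delta> * M * L2_norm \<Omega> ?d + \<delta> * L2_norm \<Omega> (F (Suc k))"
        using a(2)[unfolded Lp_norm_2_cmult(2)[OF ndL] Lp_norm_2_cmult(2)[OF FL] Lp_norm_2_norm] \<delta> M
        by (simp add: abs_mult)
      also have "\<dots> \<le> \<delta> * M * e (Suc k) + \<delta> * L2_norm \<Omega> (F (Suc k))"
        using hat(3)[OF k'(3)] \<delta> M by (intro add_right_mono mult_left_mono) auto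
      finally have 1: "L2_norm \<Omega> ?I \<le> \<delta> * M * e (Suc k) + \<delta> * L2_norm \<Omega> (F (Suc k))" .
      \<comment> \<open>B k is inserted: the bound of the step splits into the increment ?I and the
        error of the previous step.\<close>
      have eqf: "(\<lambda>x. B (Suc k) x - \<rho>h (Suc k) x + \<delta> * (uhat (Suc k) x \<bullet> weak_grad \<Omega> (B (Suc k)) x)) = (\<lambda>x. ?I x + (B k x - \<rho>h (Suc k) x))"
        by (simp add: fun_eq_iff)
      have "\<eta> (Suc k) \<le> L2_norm \<Omega> (\<lambda>x. ?I x + (B k x - \<rho>h (Suc k) x))"
        using step[OF k] unfolding eqf .
      also have "\<dots> \<le> L2_norm \<Omega> ?I + \<eta> k"
        unfolding \<eta>_def by (intro Lp_norm_2_add(2) IL Lp_norm_2_diff(1) BL \<rho>hL k')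
      finally show ?thesis using 1 by (simp add: mult.assoc)
    qed
    \<comment> \<open>The coefficient of the previous error is 1, so the induction merely
      adds.\<close>
    have \<eta>b: "\<eta> k \<le> \<delta> * c0 + \<delta> * M * (\<Sum>j=1..k. e j) + \<delta> * (\<Sum>j=1..k. L2_norm \<Omega> (F j))" if "k < N" for k
      using that
    proof (induction k)
      case 0
      then show ?case using \<eta>0 by simp
    next
      case (Suc k)
      then show ?case using \<eta>S[OF Suc.prems] by (simp add: algebra_simps)
    qed
    have Fsum: "(\<Sum>j=1..k. L2_norm \<Omega> (F j)) \<le> Q" if k: "k < N" for k
      unfolding Q_def
    proof (rule window_sum_le[OF \<theta>'i \<theta>'0 \<delta>])
      show "real k * \<delta> \<le> T" using tk k by simp
      fix j :: nat assume j: "1 \<le> j" "j \<le> k"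
      have "real (Suc j) * \<delta> - real (j - 1) * \<delta> = 2 * \<delta>" using j by (simp add: of_nat_diff algebra_simps)
      then show "(L2_norm \<Omega> (F j))\<^sup>2 \<le> 2 * \<delta> * (primitive \<theta>' (real (Suc j) * \<delta>) - primitive \<theta>' (real (j - 1) * \<delta>))"
        using F2[of j] by simp
    qed
    have err: "L2_norm \<Omega> (\<lambda>x. \<rho> (real (Suc k) * \<delta>, x) - \<rho>h (Suc k) x) \<le> \<delta> * c + \<delta> * M * (\<Sum>j=1..k. e j)" if k: "k < N" for k
    proof -
      have t0: "0 \<le> real (Suc k) * \<delta>" "real (Suc k) * \<delta> \<le> T" using \<delta> tk[of "Suc k"] k by auto
      let ?d = "\<lambda>x. \<rho> (real (Suc k) * \<delta>, x) - B k x"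
      have dL: "?d \<in> Lp_space 2 ?M" by (intro Lp_norm_2_diff(1) uL t0 BL k)
      have "Lp_norm 2 ?M ?d \<le> Lp_norm 2 ?M (\<lambda>x. C * \<delta>)"
        by (rule Lp_space_2_bound(2)[OF const(1) Lp_space_2_measurable[OF dL]])
           (use consk(4)[OF k] in \<open>auto elim!: eventually_mono\<close>)
      then have 1: "Lp_norm 2 ?M ?d \<le> \<delta> * (C * vol)" using C \<delta> by (simp add: const(2) abs_mult mult_ac)
      have "L2_norm \<Omega> (\<lambda>x. ?d x + (B k x - \<rho>h (Suc k) x)) \<le> Lp_norm 2 ?M ?d + \<eta> k"
        unfolding \<eta>_def using k by (intro Lp_norm_2_add(2) dL Lp_norm_2_diff(1) BL \<rho>hL) auto
      also have "\<dots> \<le> \<delta> * (C * vol) + (\<delta> * c0 + \<delta> * M * (\<Sum>j=1..k. e j) + \<delta> * Q)"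
        using 1 \<eta>b[OF k] mult_left_mono[OF Fsum[OF k], of \<delta>] \<delta> by linarith
      finally show ?thesis by (simp add: c_def algebra_simps)
    qed
    have nN: "n < N" using n N by simp
    have "\<delta> * (\<Sum>k=0..n. (L2_norm \<Omega> (\<lambda>x. \<rho> (real (Suc k) * \<delta>, x) - \<rho>h (Suc k) x))\<^sup>2)
          \<le> K * \<delta>\<^sup>2 + K * \<delta> * (\<Sum>k=0..n. (e (Suc k))\<^sup>2)"
      unfolding K_def
    proof (rule error_summation[OF \<delta> _ c0(2) M])
      show "real (Suc n) * \<delta> \<le> T" using tk[of "Suc n"] nN by simp
    qed (use err nN in \<open>auto simp: Lp_norm_2_nonneg e_def\<close>)
    then show "(T / real N) * (\<Sum>k=0..n. (L2_norm \<Omega>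
             (\<lambda>x. \<rho> (real (Suc k) * (T / real N), x) - \<rho>h (Suc k) x))\<^sup>2)
          \<le> K * (T / real N)\<^sup>2 + K * (T / real N) * (\<Sum>k=0..n. (L2_norm \<Omega>
             (\<lambda>x. u (real (Suc k) * (T / real N), x) - uh (Suc k) x))\<^sup>2)"
      by (simp only: \<delta>_def e_def)
  qed
qed

end
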